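(* Consider the white noise model: one observes a sample path $X^{(n)}$ of $X^{(n)}_t=\int_0^tw(s)\,ds+\frac1{\sqrt n}B_t$, $t\in[0,1]$, with $B$ standard Brownian motion. Let $p\in[1,2]$, $q\in[1,2)$, $\beta>\frac1p\vee\frac1q$, and assume $w_0\in B^\beta_q$. Let $\alpha>0$ and let the prior on $w$ be the rescaled $\alpha$-regular $p$-exponential measure in $L_2[0,1]$ with scaling $\lambda_n$. Write $m_n=n^{-\frac{\beta}{1+2\beta}}$ and let $\alpha$, $\lambda_n$ and $\bar r_n$ be as follows: (i) if $q=p$: $\alpha=\beta-\frac1p$, $\lambda_n=n^{-\frac{1}{p(1+2\beta)}}$ and $\bar r_n=m_n$; (ii) if $q>p$: $\alpha=\beta-\frac1p$, $\lambda_n=n^{-\frac{1}{p(1+2\beta)}}\log^{\omega}n$ with $\omega=\left(p-\frac{2}{1+2\beta}\right)\frac{q-p}{p^2q}$ and $\bar r_n=m_n\log^{\frac{q-p}{pq(1+2\beta)}}n$; (iii) if $q<p$: $\alpha=\beta-\frac1q$, $\lambda_n=n^{-\frac{q}{2q+2\beta pq-2p+pq}}$ and $\bar r_n=n^{\frac{(p-q)-\beta pq}{2(q-p)+2\beta pq+pq}}$. Then for $M$ large enough, as $n\to\infty$, $$\Pi_n\left(w\in L_2[0,1]:\|w-w_0\|_{L_2}\le M\bar r_n\mid X^{(n)}\right)\to1\quad\text{in }P^{(n)}_{w_0}\text{-probability}.$$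
   Context: $P^{(n)}_w$ is the law of the path $X^{(n)}$ in $C[0,1]$ when the signal is $w\in L_2[0,1]$, and $\Pi_n(\cdot\mid X^{(n)})$ is the posterior distribution of $w$ given $X^{(n)}$. Fix an orthonormal basis $\{\psi_\ell\}_{\ell\in\mathbb{N}}$ of $L_2[0,1]$. The rescaled $\alpha$-regular $p$-exponential measure in $L_2[0,1]$ with scaling $\lambda>0$ is the law of $\lambda\sum_{\ell\ge1}\ell^{-\frac12-\alpha}\xi_\ell\psi_\ell$, with $\xi_\ell$ i.i.d. with density proportional to $\exp(-|x|^p/p)$ on $\mathbb{R}$. For $\beta>0$, $q\ge1$, a function $w=\sum_\ell w_\ell\psi_\ell$ is said to be in $B^\beta_q$ if $\sum_{\ell\ge1}\ell^{q(\beta+\frac12)-1}|w_\ell|^q<\infty$. $a\vee b=\max\{a,b\}$. *)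

theory Defs
  imports "HOL-Probability.Probability"
begin

section \<open>The Hilbert space of square-integrable functions on the unit interval\<close>

definition square_integrable01 :: "(real \<Rightarrow> real) \<Rightarrow> bool" where
  "square_integrable01 f \<longleftrightarrow>
     f \<in> borel_measurable (lebesgue_on {0..1}) \<and> integrable (lebesgue_on {0..1}) (\<lambda>x. (f x)\<^sup>2)"

definition L2_rel :: "(real \<Rightarrow> real) \<Rightarrow> (real \<Rightarrow> real) \<Rightarrow> bool" where
  "L2_rel f g \<longleftrightarrow> square_integrable01 f \<and> square_integrable01 g \<and>
     (AE x in lebesgue_on {0..1}. f x = g x)"

lemma square_integrable01_mult:
  assumes "square_integrable01 f" "square_integrable01 g"
  shows "integrable (lebesgue_on {0..1}) (\<lambda>x. f x * g x)"
proof (rule Bochner_Integration.integrable_bound)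
  show "integrable (lebesgue_on {0..1}) (\<lambda>x. (f x)\<^sup>2 + (g x)\<^sup>2)"
    using assms by (auto simp: square_integrable01_def)
  show "(\<lambda>x. f x * g x) \<in> borel_measurable (lebesgue_on {0..1})"
    using assms by (auto simp: square_integrable01_def)
  have "\<bar>a * b\<bar> \<le> a\<^sup>2 + b\<^sup>2" for a b :: real
  proof -
    have "2 * \<bar>a\<bar> * \<bar>b\<bar> \<le> a\<^sup>2 + b\<^sup>2"
      using sum_squares_bound[of "\<bar>a\<bar>" "\<bar>b\<bar>"] by simp
    moreover have "0 \<le> \<bar>a\<bar> * \<bar>b\<bar>" by simp
    ultimately show ?thesis unfolding abs_mult by linarith
  qed
  then show "AE x in lebesgue_on {0..1}. norm (f x * g x) \<le> norm ((f x)\<^sup>2 + (g x)\<^sup>2)"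
    by (intro AE_I2) (simp add: abs_of_nonneg)
qed

lemma square_integrable01_zero: "square_integrable01 (\<lambda>_. 0)"
  by (simp add: square_integrable01_def)

lemma square_integrable01_add:
  assumes "square_integrable01 f" "square_integrable01 g"
  shows "square_integrable01 (\<lambda>x. f x + g x)"
proof -
  have "integrable (lebesgue_on {0..1}) (\<lambda>x. (f x)\<^sup>2 + (g x)\<^sup>2 + 2 * (f x * g x))"
    using assms square_integrable01_mult[OF assms] by (auto simp: square_integrable01_def)
  then show ?thesis
    using assms by (auto simp: square_integrable01_def power2_sum mult.assoc)
qed

lemma square_integrable01_scale:
  "square_integrable01 f \<Longrightarrow> square_integrable01 (\<lambda>x. c * f x)"
  by (auto simp: square_integrable01_def power_mult_distrib)

quotient_type L2 = "real \<Rightarrow> real" / partial: L2_rel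
proof (rule part_equivpI)
  show "\<exists>f. L2_rel f f"
    using square_integrable01_zero by (auto simp: L2_rel_def)
  show "symp L2_rel"
    by (auto simp: symp_def L2_rel_def elim: eventually_mono)
  show "transp L2_rel"
    unfolding transp_def L2_rel_def by (auto elim: eventually_elim2)
qed

instantiation L2 :: real_inner
begin

lift_definition zero_L2 :: L2 is "\<lambda>_. 0"
  by (auto simp: L2_rel_def square_integrable01_zero)

lift_definition plus_L2 :: "L2 \<Rightarrow> L2 \<Rightarrow> L2" is "\<lambda>f g x. f x + g x"
  unfolding L2_rel_def by (auto intro: square_integrable01_add elim: eventually_elim2)

lift_definition scaleR_L2 :: "real \<Rightarrow> L2 \<Rightarrow> L2" is "\<lambda>c f x. c * f x"
  unfolding L2_rel_def by (auto intro: square_integrable01_scale elim: eventually_mono)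

lift_definition inner_L2 :: "L2 \<Rightarrow> L2 \<Rightarrow> real"
  is "\<lambda>f g. integral\<^sup>L (lebesgue_on {0..1}) (\<lambda>x. f x * g x)"
proof -
  fix f f' g g' assume a: "L2_rel f f'" "L2_rel g g'"
  have [measurable]: "f \<in> borel_measurable (lebesgue_on {0..1})"
    "f' \<in> borel_measurable (lebesgue_on {0..1})" "g \<in> borel_measurable (lebesgue_on {0..1})"
    "g' \<in> borel_measurable (lebesgue_on {0..1})"
    using a by (auto simp: L2_rel_def square_integrable01_def)
  show "integral\<^sup>L (lebesgue_on {0..1}) (\<lambda>x. f x * g x) =
        integral\<^sup>L (lebesgue_on {0..1}) (\<lambda>x. f' x * g' x)"
    using a by (intro integral_cong_AE) (auto simp: L2_rel_def elim: eventually_elim2)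
qed

definition uminus_L2 :: "L2 \<Rightarrow> L2" where "uminus_L2 w = (- 1) *\<^sub>R w"

definition minus_L2 :: "L2 \<Rightarrow> L2 \<Rightarrow> L2" where "minus_L2 v w = v + (- 1) *\<^sub>R w"

definition norm_L2 :: "L2 \<Rightarrow> real" where "norm_L2 w = sqrt (inner w w)"

definition sgn_L2 :: "L2 \<Rightarrow> L2" where "sgn_L2 w = inverse (norm w) *\<^sub>R w"

definition dist_L2 :: "L2 \<Rightarrow> L2 \<Rightarrow> real" where "dist_L2 v w = norm (v - w)"

definition uniformity_L2 :: "(L2 \<times> L2) filter" where
  "uniformity_L2 = (INF e\<in>{0 <..}. principal {(v, w). dist v w < e})"

definition open_L2 :: "L2 set \<Rightarrow> bool" where
  "open_L2 U \<longleftrightarrow> (\<forall>v\<in>U. \<forall>\<^sub>F (v', w) in uniformity. v' = v \<longrightarrow> w \<in> U)"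

instance
proof
  fix u v w :: L2 and a b :: real
  show "u + v + w = u + (v + w)"
    by transfer (auto simp: L2_rel_def add.assoc intro!: square_integrable01_add)
  show "u + v = v + u"
    by transfer (auto simp: L2_rel_def add.commute intro!: square_integrable01_add)
  show "0 + u = u"
    by transfer (auto simp: L2_rel_def)
  show "- u + u = 0"
    unfolding uminus_L2_def by transfer (auto simp: L2_rel_def square_integrable01_zero)
  show "u - v = u + - v"
    by (simp add: uminus_L2_def minus_L2_def)
  show "a *\<^sub>R (u + v) = a *\<^sub>R u + a *\<^sub>R v"
    by transfer (auto simp: L2_rel_def distrib_left
        intro!: square_integrable01_add square_integrable01_scale)
  show "(a + b) *\<^sub>R u = a *\<^sub>R u + b *\<^sub>R u"
    by transfer (auto simp: L2_rel_def distrib_right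
        intro!: square_integrable01_add square_integrable01_scale)
  show "a *\<^sub>R b *\<^sub>R u = (a * b) *\<^sub>R u"
    by transfer (auto simp: L2_rel_def mult.assoc intro!: square_integrable01_scale)
  show "1 *\<^sub>R u = u"
    by transfer (auto simp: L2_rel_def)
  show "sgn u = inverse (norm u) *\<^sub>R u" by (rule sgn_L2_def)
  show "dist u v = norm (u - v)" by (rule dist_L2_def)
  show "uniformity = (INF e\<in>{0 <..}. principal {(v, w::L2). dist v w < e})"
    by (rule uniformity_L2_def)
  show "open U \<longleftrightarrow> (\<forall>v\<in>U. \<forall>\<^sub>F (v', w) in uniformity. v' = v \<longrightarrow> w \<in> U)" for U :: "L2 set"
    by (rule open_L2_def)
  show "inner u v = inner v u"
    by transfer (simp add: mult.commute)
  show "inner (u + v) w = inner u w + inner v w"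
    by transfer (auto simp: L2_rel_def distrib_right square_integrable01_mult)
  show "inner (a *\<^sub>R u) v = a * inner u v"
    by transfer (auto simp: mult.assoc)
  show "0 \<le> inner u u"
    by transfer auto
  show "inner u u = 0 \<longleftrightarrow> u = 0"
    by transfer (auto simp: L2_rel_def square_integrable01_zero square_integrable01_def
        power2_eq_square integral_nonneg_eq_0_iff_AE)
  show "norm u = sqrt (inner u u)" by (rule norm_L2_def)
qed

end

lift_definition primitive :: "L2 \<Rightarrow> real \<Rightarrow> real"
  is "\<lambda>f t. (\<integral>s\<in>{0..t}. f s \<partial>lebesgue_on {0..1})"
proof -
  fix f g assume a: "L2_rel f g"
  then have [measurable]: "f \<in> borel_measurable (lebesgue_on {0..1})"
    "g \<in> borel_measurable (lebesgue_on {0..1})"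
    by (auto simp: L2_rel_def square_integrable01_def)
  have [measurable]: "indicat_real {0..t} \<in> borel_measurable (lebesgue_on {0..1})" for t :: real
    by (intro measurable_restrict_space1 borel_measurable_indicator) simp
  have "AE x in lebesgue_on {0..1}. f x = g x"
    using a by (simp add: L2_rel_def)
  then show "(\<lambda>t. \<integral>s\<in>{0..t}. f s \<partial>lebesgue_on {0..1}) =
    (\<lambda>t. \<integral>s\<in>{0..t}. g s \<partial>lebesgue_on {0..1})"
    unfolding set_lebesgue_integral_def
    by (intro ext integral_cong_AE) (auto elim: eventually_mono)
qed

text \<open>Only the values \<open>\<psi> l\<close> with \<open>l \<ge> 1\<close> matter.\<close>

definition orthonormal_basis :: "(nat \<Rightarrow> 'a::real_inner) \<Rightarrow> bool" where
  "orthonormal_basis \<psi> \<longleftrightarrow>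
     (\<forall>i\<ge>1. \<forall>j\<ge>1. inner (\<psi> i) (\<psi> j) = (if i = j then 1 else 0)) \<and>
     closure (span (\<psi> ` {1..})) = UNIV"

definition besov :: "(nat \<Rightarrow> L2) \<Rightarrow> real \<Rightarrow> real \<Rightarrow> L2 set" where
  "besov \<psi> \<beta> q =
     {w. (\<lambda>l. real l powr (q * (\<beta> + 1/2) - 1) * \<bar>inner w (\<psi> l)\<bar> powr q) summable_on {1..}}"

section \<open>The p-exponential prior\<close>

definition p_exponential :: "real \<Rightarrow> real measure" where
  "p_exponential p = density lborel
     (\<lambda>x. ennreal (exp (- (\<bar>x\<bar> powr p) / p) / (LBINT y. exp (- (\<bar>y\<bar> powr p) / p))))"

text \<open>
  The coordinates of the product measure are indexed by \<open>l \<ge> 1\<close>; the series runs over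
  \<open>l = Suc k\<close> and converges in norm almost surely, for every \<open>\<alpha> > 0\<close>.
\<close>

definition p_exponential_prior ::
    "(nat \<Rightarrow> L2) \<Rightarrow> real \<Rightarrow> real \<Rightarrow> real \<Rightarrow> L2 measure" where
  "p_exponential_prior \<psi> p \<alpha> lam =
     distr (PiM {1..} (\<lambda>_. p_exponential p)) borel
       (\<lambda>\<xi>. lam *\<^sub>R (\<Sum>k. (real (Suc k) powr (- 1/2 - \<alpha>) * \<xi> (Suc k)) *\<^sub>R \<psi> (Suc k)))"

section \<open>The white noise model\<close>

text \<open>
  The sigma-algebra on \<open>C[0,1]\<close> generated by the evaluations, which is the Borel
  sigma-algebra of the supremum norm.
\<close>

definition C01 :: "(real \<Rightarrow> real) measure" where
  "C01 = restrict_space (PiM {0..1} (\<lambda>_. borel)) {x. continuous_on {0..1} x}"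

locale brownian_motion = prob_space M for M :: "'o measure" +
  fixes B :: "real \<Rightarrow> 'o \<Rightarrow> real"
  assumes measurable_B: "\<And>t. t \<in> {0..1} \<Longrightarrow> B t \<in> borel_measurable M"
    and B_0: "AE \<omega> in M. B 0 \<omega> = 0"
    and continuous_B: "\<And>\<omega>. \<omega> \<in> space M \<Longrightarrow> continuous_on {0..1} (\<lambda>t. B t \<omega>)"
    and normal_increments: "\<And>s t. 0 \<le> s \<Longrightarrow> s < t \<Longrightarrow> t \<le> 1 \<Longrightarrow>
      distributed M lborel (\<lambda>\<omega>. B t \<omega> - B s \<omega>) (normal_density 0 (sqrt (t - s)))"
    and independent_increments: "\<And>(\<tau> :: nat \<Rightarrow> real) k. mono_on {..k} \<tau> \<Longrightarrow> \<tau> ` {..k} \<subseteq> {0..1} \<Longrightarrow>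
      indep_vars (\<lambda>_. borel) (\<lambda>i \<omega>. B (\<tau> (Suc i)) \<omega> - B (\<tau> i) \<omega>) {..<k}"

definition white_noise_path :: "(real \<Rightarrow> 'o \<Rightarrow> real) \<Rightarrow> nat \<Rightarrow> L2 \<Rightarrow> 'o \<Rightarrow> real \<Rightarrow> real" where
  "white_noise_path B n w \<omega> = (\<lambda>t\<in>{0..1}. primitive w t + 1 / sqrt (real n) * B t \<omega>)"

definition white_noise_law ::
    "'o measure \<Rightarrow> (real \<Rightarrow> 'o \<Rightarrow> real) \<Rightarrow> nat \<Rightarrow> L2 \<Rightarrow> (real \<Rightarrow> real) measure" where
  "white_noise_law M B n w = distr M C01 (white_noise_path B n w)"

section \<open>Posterior distributions and convergence in probability\<close>

text \<open>
  A posterior is a Markov kernel that is a regular conditional distribution of the parameter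
  given the observation, when the parameter has law \<open>prior\<close> and the observation has law \<open>P w\<close>
  given the parameter \<open>w\<close>. The marginal law of the observation is \<open>prior \<bind> P\<close>. Such a
  kernel is unique up to a null set of that law.
\<close>

definition is_posterior ::
    "'w measure \<Rightarrow> 'x measure \<Rightarrow> ('w \<Rightarrow> 'x measure) \<Rightarrow> ('x \<Rightarrow> 'w measure) \<Rightarrow> bool" where
  "is_posterior prior S P K \<longleftrightarrow>
     K \<in> measurable S (prob_algebra prior) \<and>
     (\<forall>A\<in>sets prior. \<forall>D\<in>sets S.
        (\<integral>\<^sup>+w\<in>A. emeasure (P w) D \<partial>prior) = (\<integral>\<^sup>+x\<in>D. emeasure (K x) A \<partial>(bind prior P)))"

definition tendsto_in_probability ::
    "(nat \<Rightarrow> 'x measure) \<Rightarrow> (nat \<Rightarrow> 'x \<Rightarrow> real) \<Rightarrow> real \<Rightarrow> bool" where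
  "tendsto_in_probability P Y c \<longleftrightarrow>
     (\<forall>\<epsilon>>0. (\<lambda>n. measure (P n) {x \<in> space (P n). \<bar>Y n x - c\<bar> > \<epsilon>}) \<longlonglongrightarrow> 0)"

end

(*
  Given the prior, the coordinates of the signal are independent, and so is the noise in the
  coordinate observations (Wiener integrals of the path). Hence the expected posterior exponential
  moment of n |w - w0|^2 over the first N coordinates factorises into one-dimensional posterior
  risks; the other coordinates are handled by the Cameron-Martin theorem and disappear as N grows.
  A one-dimensional risk is bounded by dilating the posterior about a point and using convexity of
  |x|^p: the exponent is at most 1 + |w0_j / tau_j|^p in general and of order
  n (tau_j^2 + w0_j^2) when the signal is below the noise level. Summing over j, with the Besov
  condition controlling the terms in w0, gives an exponent of order n r_n^2, and Chernoff's bound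
  concludes.
*)

theory Submission imports Defs begin

section \<open>The Hilbert space of square integrable functions\<close>

text \<open>The posterior is an arbitrary kernel with the defining integral identity, so it can be
  reached only through integrals over the prior mixture. In that mixture the law at
  \<open>w0\<close> can be reproduced by reweighting only in finitely many coordinates; hence the
  argument runs at finite N, with a total variation comparison for the other coordinates. An
  exponential moment is used, and not a variance, because it is multiplicative over coordinates and
  its logarithm only has to be of the order of the effective dimension L = n r^2. The coordinate
  observations must be functions of the path alone, so Wiener integrals are limits along a dyadic
  subsequence. The exponent is divided by 81 because a dilation by 9/8 multiplies squares by 81/64:
  this leaves 1/64, below the gain 1/16 from the quadratic part of the log-likelihood. The logarithm
  in the case q > p comes from a harmonic sum: with \<alpha> = \<beta> - 1/p the p-th powers of w0_j
  / \<tau>_j carry a weight 1/j that the Besov condition does not remove.\<close>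

lemma AE_convergent_of_L2_steps:
  fixes f :: "nat \<Rightarrow> 'a \<Rightarrow> real"
  assumes [measurable]: "\<And>k. f k \<in> borel_measurable M"
    and step: "\<And>k. (\<integral>\<^sup>+x. ennreal ((f (Suc k) x - f k x)\<^sup>2) \<partial>M) \<le> ennreal ((1/8)^k)"
  shows "AE x in M. convergent (\<lambda>k. f k x)"
proof -
  \<comment> \<open>The weight 2^k turns the bounds 8^-k into the still summable 4^-k, so the
    weighted squares have a finite sum almost everywhere. Each step is then of order 2^(-k/2), and
    the steps are absolutely summable.\<close>
  have "(\<integral>\<^sup>+x. (\<Sum>k. ennreal (2^k * (f (Suc k) x - f k x)\<^sup>2)) \<partial>M)
      = (\<Sum>k. \<integral>\<^sup>+x. ennreal (2^k * (f (Suc k) x - f k x)\<^sup>2) \<partial>M)"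
    by (rule nn_integral_suminf) measurable
  also have "\<dots> \<le> (\<Sum>k. ennreal ((1/4)^k))"
  proof (rule suminf_le)
    fix k
    have "(\<integral>\<^sup>+x. ennreal (2^k * (f (Suc k) x - f k x)\<^sup>2) \<partial>M)
        = ennreal (2^k) * (\<integral>\<^sup>+x. ennreal ((f (Suc k) x - f k x)\<^sup>2) \<partial>M)"
      by (subst nn_integral_cmult[symmetric]) (auto simp: ennreal_mult)
    also have "\<dots> \<le> ennreal (2^k) * ennreal ((1/8)^k)"
      by (intro mult_left_mono step) auto
    also have "\<dots> = ennreal ((1/4)^k)"
      by (simp add: ennreal_mult[symmetric] power_mult_distrib[symmetric])
    finally show "(\<integral>\<^sup>+x. ennreal (2^k * (f (Suc k) x - f k x)\<^sup>2) \<partial>M) \<le> ennreal ((1/4)^k)" .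
  qed auto
  also have "\<dots> < \<infinity>"
    by (subst suminf_ennreal2) (auto intro!: summable_geometric)
  finally have "AE x in M. (\<Sum>k. ennreal (2^k * (f (Suc k) x - f k x)\<^sup>2)) \<noteq> \<infinity>"
    by (intro nn_integral_PInf_AE) auto
  then show ?thesis
  proof eventually_elim
    case (elim x)
    define d where "d k = f (Suc k) x - f k x" for k
    have "summable (\<lambda>k. 2^k * (d k)\<^sup>2)"
      using elim by (intro summable_suminf_not_top) (auto simp: d_def)
    then have "(\<lambda>k. 2^k * (d k)\<^sup>2) \<longlonglongrightarrow> 0"
      by (rule summable_LIMSEQ_zero)
    then have "Bseq (\<lambda>k. 2^k * (d k)\<^sup>2)"
      by (intro convergent_imp_Bseq convergentI)
    then obtain C where C: "\<And>k. norm (2^k * (d k)\<^sup>2) \<le> C"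
      by (elim BseqE) blast
    have C0: "0 \<le> C" using order_trans[OF norm_ge_zero C[of 0]] .
    have "norm (d k) \<le> sqrt C * (1 / sqrt 2)^k" for k
    proof -
      have "(d k)\<^sup>2 \<le> C / 2^k" using C[of k] by (simp add: field_simps)
      also have "\<dots> = (sqrt C * (1 / sqrt 2)^k)\<^sup>2"
      proof -
        have "((1 / sqrt 2)^k)\<^sup>2 = ((1 / sqrt 2)\<^sup>2)^k"
          by (simp only: power_mult[symmetric] mult.commute)
        then show ?thesis using C0 by (simp add: power_mult_distrib power_divide)
      qed
      finally show ?thesis
        using C0 by (simp add: abs_le_square_iff[symmetric] abs_mult)
    qed
    moreover have "summable (\<lambda>k. sqrt C * (1 / sqrt 2)^k)"
      by (rule summable_mult) (simp add: summable_geometric)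
    ultimately have "summable d"
      by (rule summable_comparison_test'[rotated])
    then have "(\<lambda>n. \<Sum>k<n. d k) \<longlonglongrightarrow> suminf d" by (rule summable_LIMSEQ)
    then have "(\<lambda>n. f n x - f 0 x) \<longlonglongrightarrow> suminf d"
      unfolding d_def sum_lessThan_telescope[of "\<lambda>k. f k x"] .
    then have "(\<lambda>n. (f n x - f 0 x) + f 0 x) \<longlonglongrightarrow> suminf d + f 0 x"
      by (intro tendsto_intros)
    then show ?case by (auto simp: convergent_def)
  qed
qed

text \<open>The rate 8^-k for squared distances is the one that
  \<open>AE_convergent_of_L2_steps\<close> asks for. Both indices are free beyond
  \<open>r k\<close>, so one of them can later be sent to infinity.\<close>

lemma fast_Cauchy_subseq:
  fixes X :: "nat \<Rightarrow> 'a::metric_space"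
  assumes "Cauchy X"
  obtains r where "strict_mono r" "\<And>k m n. m \<ge> r k \<Longrightarrow> n \<ge> r k \<Longrightarrow> (dist (X m) (X n))\<^sup>2 \<le> (1/8)^k"
proof -
  have "\<exists>N>a. \<forall>m\<ge>N. \<forall>n\<ge>N. (dist (X m) (X n))\<^sup>2 \<le> (1/8)^k" for k a :: nat
  proof -
    have "0 < sqrt ((1/8::real)^k)" by simp
    from metric_CauchyD[OF assms this] obtain N
      where N: "\<And>m n. m \<ge> N \<Longrightarrow> n \<ge> N \<Longrightarrow> dist (X m) (X n) < sqrt ((1/8)^k)" by blast
    have "(dist (X m) (X n))\<^sup>2 \<le> (1/8)^k" if "m \<ge> N" "n \<ge> N" for m n
    proof -
      have "(dist (X m) (X n))\<^sup>2 \<le> (sqrt ((1/8)^k))\<^sup>2"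
        using N[OF that] by (intro power_mono) auto
      then show ?thesis by simp
    qed
    then show ?thesis by (intro exI[of _ "max N (Suc a)"]) auto
  qed
  note ex = this
  define h where "h k a = (SOME N. N > a \<and> (\<forall>m\<ge>N. \<forall>n\<ge>N. (dist (X m) (X n))\<^sup>2 \<le> (1/8)^k))" for k a
  have "h k a > a \<and> (\<forall>m\<ge>h k a. \<forall>n\<ge>h k a. (dist (X m) (X n))\<^sup>2 \<le> (1/8)^k)" for k a
    unfolding h_def by (rule someI_ex) (use ex in blast)
  then have h: "\<And>k a. h k a > a"
    "\<And>k a m n. m \<ge> h k a \<Longrightarrow> n \<ge> h k a \<Longrightarrow> (dist (X m) (X n))\<^sup>2 \<le> (1/8)^k"
    by blast+
  define r where "r = rec_nat (h 0 0) (\<lambda>k a. h (Suc k) a)"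
  have "strict_mono r" by (rule strict_monoI_Suc) (simp add: r_def h)
  moreover have "\<exists>a. r k = h k a" for k by (cases k) (auto simp: r_def)
  ultimately show ?thesis using h(2) by (intro that[of r]) (metis, metis)
qed

section \<open>Representatives of classes and completeness (Riesz-Fischer)\<close>

lemma L2_rel_rep: "L2_rel (rep_L2 w) (rep_L2 w)"
  using Quotient3_rel_rep[OF Quotient3_L2, of w w] by simp

lemma square_integrable01_rep: "square_integrable01 (rep_L2 w)"
  using L2_rel_rep by (auto simp: L2_rel_def)

lemma rep_L2_measurable [measurable]: "rep_L2 w \<in> borel_measurable (lebesgue_on {0..1})"
  using square_integrable01_rep by (auto simp: square_integrable01_def)

lemma L2_rel_abs_rep:
  assumes "square_integrable01 f" shows "L2_rel (rep_L2 (abs_L2 f)) f"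
proof -
  have "L2_rel f f" using assms by (simp add: L2_rel_def)
  then show ?thesis using rep_abs_rsp_left[OF Quotient3_L2] by blast
qed

lemma rep_abs_L2:
  assumes "square_integrable01 f"
  shows "AE x in lebesgue_on {0..1}. rep_L2 (abs_L2 f) x = f x"
  using L2_rel_abs_rep[OF assms] by (simp add: L2_rel_def)

lemma inner_L2_rep: "inner v w = (\<integral>x. rep_L2 v x * rep_L2 w x \<partial>lebesgue_on {0..1})"
  by (rule inner_L2.rep_eq)

lemma rep_L2_plus:
  "AE x in lebesgue_on {0..1}. rep_L2 (v + w) x = rep_L2 v x + rep_L2 w x"
proof -
  have "v + w = abs_L2 (\<lambda>x. rep_L2 v x + rep_L2 w x)"
    using plus_L2.abs_eq[OF L2_rel_rep[of v] L2_rel_rep[of w]]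
    by (simp add: Quotient_abs_rep[OF Quotient_L2])
  then show ?thesis
    using rep_abs_L2[OF square_integrable01_add[OF square_integrable01_rep square_integrable01_rep]]
    by simp
qed

lemma rep_L2_scaleR:
  "AE x in lebesgue_on {0..1}. rep_L2 (c *\<^sub>R w) x = c * rep_L2 w x"
proof -
  have "c *\<^sub>R w = abs_L2 (\<lambda>x. c * rep_L2 w x)"
    using scaleR_L2.abs_eq[OF L2_rel_rep[of w], of c]
    by (simp add: Quotient_abs_rep[OF Quotient_L2])
  then show ?thesis
    using rep_abs_L2[OF square_integrable01_scale[OF square_integrable01_rep]]
    by simp
qed

lemma rep_L2_diff:
  "AE x in lebesgue_on {0..1}. rep_L2 (v - w) x = rep_L2 v x - rep_L2 w x"
  using rep_L2_plus[of v "(-1) *\<^sub>R w"] rep_L2_scaleR[of "-1" w]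
  unfolding minus_L2_def[of v w] by eventually_elim simp

lemma integrable_rep_L2_sq: "integrable (lebesgue_on {0..1}) (\<lambda>x. (rep_L2 w x)\<^sup>2)"
  using square_integrable01_rep by (auto simp: square_integrable01_def)

lemma norm_L2_sq: "(\<integral>\<^sup>+x. ennreal ((rep_L2 w x)\<^sup>2) \<partial>lebesgue_on {0..1}) = ennreal ((norm w)\<^sup>2)"
proof -
  have "(norm w)\<^sup>2 = (\<integral>x. (rep_L2 w x)\<^sup>2 \<partial>lebesgue_on {0..1})"
    by (simp only: power2_norm_eq_inner[of w] inner_L2_rep) (simp only: power2_eq_square)
  then show ?thesis
    by (simp add: nn_integral_eq_integral[OF integrable_rep_L2_sq])
qed

lemma dist_L2_sq:
  "(\<integral>\<^sup>+x. ennreal ((rep_L2 v x - rep_L2 w x)\<^sup>2) \<partial>lebesgue_on {0..1}) = ennreal ((dist v w)\<^sup>2)"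
proof -
  have "(\<integral>\<^sup>+x. ennreal ((rep_L2 v x - rep_L2 w x)\<^sup>2) \<partial>lebesgue_on {0..1})
      = (\<integral>\<^sup>+x. ennreal ((rep_L2 (v - w) x)\<^sup>2) \<partial>lebesgue_on {0..1})"
    using rep_L2_diff[of v w] by (intro nn_integral_cong_AE) (auto elim: eventually_mono)
  then show ?thesis by (simp add: norm_L2_sq dist_norm)
qed

instance L2 :: banach
proof
  fix X :: "nat \<Rightarrow> L2" assume X: "Cauchy X"
  obtain r where r: "strict_mono r"
    "\<And>k m n. m \<ge> r k \<Longrightarrow> n \<ge> r k \<Longrightarrow> (dist (X m) (X n))\<^sup>2 \<le> (1/8)^k"
    by (rule fast_Cauchy_subseq[OF X], rule that)
  let ?M = "lebesgue_on {0..1::real}"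
  define f where "f k = rep_L2 (X (r k))" for k
  have [measurable]: "f k \<in> borel_measurable ?M" for k by (simp add: f_def)
  have rr: "r k \<le> r m" if "k \<le> m" for k m using r(1) that by (simp add: strict_mono_less_eq)
  have d: "(\<integral>\<^sup>+x. ennreal ((f m x - f k x)\<^sup>2) \<partial>?M) \<le> ennreal ((1/8)^k)" if "k \<le> m" for k m
    unfolding f_def dist_L2_sq by (intro ennreal_leI r rr that order_refl)
  have conv: "AE x in ?M. convergent (\<lambda>k. f k x)"
    by (rule AE_convergent_of_L2_steps) (auto intro: d)
  define g where "g x = lim (\<lambda>k. f k x)" for x
  have [measurable]: "g \<in> borel_measurable ?M" unfolding g_def by measurable
  \<comment> \<open>Fatou's lemma carries the bound on \<open>f m - f k\<close> to the limit in m.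
    The case k = 0 gives square integrability of g, and all k together give convergence in
    norm.\<close>
  have lim: "(\<integral>\<^sup>+x. ennreal ((g x - f k x)\<^sup>2) \<partial>?M) \<le> ennreal ((1/8)^k)" for k
  proof -
    have "(\<integral>\<^sup>+x. ennreal ((g x - f k x)\<^sup>2) \<partial>?M)
        = (\<integral>\<^sup>+x. liminf (\<lambda>m. ennreal ((f m x - f k x)\<^sup>2)) \<partial>?M)"
    proof (rule nn_integral_cong_AE)
      show "AE x in ?M. ennreal ((g x - f k x)\<^sup>2) = liminf (\<lambda>m. ennreal ((f m x - f k x)\<^sup>2))"
        using conv
      proof eventually_elim
        case (elim x)
        then have "(\<lambda>m. f m x) \<longlonglongrightarrow> g x" by (simp add: g_def convergent_LIMSEQ_iff)
        then have "(\<lambda>m. ennreal ((f m x - f k x)\<^sup>2)) \<longlonglongrightarrow> ennreal ((g x - f k x)\<^sup>2)"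
          by (intro tendsto_intros)
        then show ?case by (rule lim_imp_Liminf[OF sequentially_bot, symmetric])
      qed
    qed
    also have "\<dots> \<le> liminf (\<lambda>m. \<integral>\<^sup>+x. ennreal ((f m x - f k x)\<^sup>2) \<partial>?M)"
      by (rule nn_integral_liminf) measurable
    also have "\<dots> \<le> limsup (\<lambda>m. \<integral>\<^sup>+x. ennreal ((f m x - f k x)\<^sup>2) \<partial>?M)"
      by (rule Liminf_le_Limsup) simp
    also have "\<dots> \<le> ennreal ((1/8)^k)"
      by (rule Limsup_bounded) (auto simp: eventually_sequentially intro!: exI[of _ k] d)
    finally show ?thesis .
  qed
  have "integrable ?M (\<lambda>x. (g x - f 0 x)\<^sup>2)"
    by (rule integrableI_nonneg) (use lim[of 0] in \<open>auto simp: less_top[symmetric] top_unique\<close>)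
  then have "square_integrable01 (\<lambda>x. g x - f 0 x)" by (simp add: square_integrable01_def)
  from square_integrable01_add[OF this square_integrable01_rep[of "X (r 0)"]]
  have g: "square_integrable01 g" by (simp add: f_def)
  define G where "G = abs_L2 g"
  have "(\<lambda>k. X (r k)) \<longlonglongrightarrow> G"
  proof (rule metric_LIMSEQ_I)
    fix e :: real assume e: "0 < e"
    have bound: "(dist G (X (r k)))\<^sup>2 \<le> (1/8)^k" for k
    proof -
      have "ennreal ((dist G (X (r k)))\<^sup>2) = (\<integral>\<^sup>+x. ennreal ((g x - f k x)\<^sup>2) \<partial>?M)"
        unfolding dist_L2_sq[symmetric] f_def
        using rep_abs_L2[OF g] by (intro nn_integral_cong_AE) (auto simp: G_def elim: eventually_mono)
      also have "\<dots> \<le> ennreal ((1/8)^k)" by (rule lim)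
      finally show ?thesis by (simp add: ennreal_le_iff)
    qed
    have "(\<lambda>k. (1/8::real)^k) \<longlonglongrightarrow> 0" by (rule LIMSEQ_power_zero) simp
    then obtain N where N: "\<And>k. k \<ge> N \<Longrightarrow> norm ((1/8::real)^k - 0) < e\<^sup>2"
      using LIMSEQ_D[of "\<lambda>k. (1/8::real)^k" 0 "e\<^sup>2"] e by auto
    have "dist (X (r k)) G < e" if "k \<ge> N" for k
    proof -
      have "(dist G (X (r k)))\<^sup>2 < e\<^sup>2" using bound[of k] N[OF that] by simp
      then show ?thesis using e by (simp add: power2_less_imp_less dist_commute)
    qed
    then show "\<exists>N. \<forall>k\<ge>N. dist (X (r k)) G < e" by blast
  qed
  then have "X \<longlonglongrightarrow> G"
    by (intro Cauchy_converges_subseq[OF X r(1)]) (simp add: o_def)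
  then show "convergent X" by (rule convergentI)
qed

text \<open>The projection theorem by hand: a minimising sequence for the distance from x to the
  span is Cauchy by the parallelogram law, and the residual of its limit is orthogonal to S, hence
  zero by totality.\<close>

lemma dense_span_if_total:
  fixes S :: "'a::{real_inner,complete_space} set"
  assumes total: "\<And>x. (\<And>s. s \<in> S \<Longrightarrow> inner x s = 0) \<Longrightarrow> x = 0"
  shows "closure (span S) = UNIV"
proof -
  have "x \<in> closure (span S)" for x
  proof -
    define D where "D = (INF y\<in>span S. (norm (x - y))\<^sup>2)"
    have ne: "span S \<noteq> {}" using span_zero by blast
    have bb: "bdd_below ((\<lambda>y. (norm (x - y))\<^sup>2) ` span S)" by (rule bdd_belowI[of _ 0]) auto
    have D: "D \<le> (norm (x - y))\<^sup>2" if "y \<in> span S" for y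
      unfolding D_def by (rule cINF_lower[OF bb that])
    have "\<exists>y\<in>span S. (norm (x - y))\<^sup>2 < D + 1 / real (Suc n)" for n
      using cINF_less_iff[OF ne bb, of "D + 1 / real (Suc n)"] unfolding D_def[symmetric] by auto
    then obtain y where y: "\<And>n. y n \<in> span S" "\<And>n. (norm (x - y n))\<^sup>2 < D + 1 / real (Suc n)"
      by metis
    \<comment> \<open>Parallelogram law centred at x. The midpoint of a and b stays in the span, so
      its squared distance from x is at least D.\<close>
    have par: "(norm (a - b))\<^sup>2 = 2 * (norm (x - a))\<^sup>2 + 2 * (norm (x - b))\<^sup>2
        - 4 * (norm (x - (1/2) *\<^sub>R (a + b)))\<^sup>2" for a b
      unfolding power2_norm_eq_inner
      by (simp add: inner_diff_left inner_diff_right inner_add_left inner_add_right inner_commute algebra_simps)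
    have cau: "(norm (y m - y n))\<^sup>2 \<le> 2 * (1 / real (Suc m)) + 2 * (1 / real (Suc n))" for m n
    proof -
      have "(1/2) *\<^sub>R (y m + y n) \<in> span S" by (intro span_scale span_add y)
      from D[OF this] have "D \<le> (norm (x - (1/2) *\<^sub>R (y m + y n)))\<^sup>2" .
      then show ?thesis using par[of "y m" "y n"] y(2)[of m] y(2)[of n] by linarith
    qed
    have "Cauchy y"
    proof (rule metric_CauchyI)
      fix e :: real assume e: "0 < e"
      obtain N where N: "4 / e\<^sup>2 < real N" using reals_Archimedean2 by blast
      have "dist (y m) (y n) < e" if "m \<ge> N" "n \<ge> N" for m n
      proof -
        have N0: "0 < real N" using N e by (meson less_trans divide_pos_pos zero_less_numeral zero_less_power)
        have "1 / real (Suc m) \<le> 1 / real N" "1 / real (Suc n) \<le> 1 / real N"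
          using that N0 by (auto intro!: divide_left_mono)
        then have "2 * (1 / real (Suc m)) + 2 * (1 / real (Suc n)) \<le> 4 / real N" by simp
        also have "\<dots> < e\<^sup>2"
          using N e N0 by (simp add: divide_less_eq less_divide_eq mult.commute)
        finally have "(norm (y m - y n))\<^sup>2 < e\<^sup>2" using cau[of m n] by simp
        then show ?thesis using e by (simp add: dist_norm power2_less_imp_less)
      qed
      then show "\<exists>N. \<forall>m\<ge>N. \<forall>n\<ge>N. dist (y m) (y n) < e" by blast
    qed
    then obtain z where z: "y \<longlonglongrightarrow> z" using Cauchy_convergent convergent_def by blast
    have "(\<lambda>n. D + 1 / real (Suc n)) \<longlonglongrightarrow> D + 0"
      using LIMSEQ_inverse_real_of_nat by (intro tendsto_intros) (simp add: inverse_eq_divide)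
    moreover have "(\<lambda>n. (norm (x - y n))\<^sup>2) \<longlonglongrightarrow> (norm (x - z))\<^sup>2"
      by (intro tendsto_intros z)
    ultimately have zD: "(norm (x - z))\<^sup>2 \<le> D + 0"
      using y(2) by (intro LIMSEQ_le[of _ _ "\<lambda>n. D + 1 / real (Suc n)"] exI[of _ 0]) (auto intro: less_imp_le)
    have "inner (x - z) s = 0" if s: "s \<in> S" for s
    proof -
      \<comment> \<open>Minimality of z along the line z + t s. The linear term must vanish, as the
        choice t = c / |s|^2 below shows.\<close>
      have "2 * t * inner (x - z) s \<le> t\<^sup>2 * (norm s)\<^sup>2" for t
      proof -
        have "(\<lambda>n. (norm (x - (y n + t *\<^sub>R s)))\<^sup>2) \<longlonglongrightarrow> (norm (x - (z + t *\<^sub>R s)))\<^sup>2"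
          by (intro tendsto_intros z)
        moreover have "D \<le> (norm (x - (y n + t *\<^sub>R s)))\<^sup>2" for n
          by (intro D span_add span_scale span_base s y)
        ultimately have "D \<le> (norm (x - (z + t *\<^sub>R s)))\<^sup>2"
          by (intro LIMSEQ_le_const[of "\<lambda>n. (norm (x - (y n + t *\<^sub>R s)))\<^sup>2" _ D]) auto
        also have "\<dots> = (norm (x - z))\<^sup>2 - 2 * t * inner (x - z) s + t\<^sup>2 * (norm s)\<^sup>2"
          unfolding power2_norm_eq_inner
          by (simp add: inner_diff_left inner_diff_right inner_add_left inner_add_right
            inner_commute algebra_simps power2_eq_square)
        finally show ?thesis using zD by simp
      qed
      note q = this
      show ?thesis
      proof (cases "s = 0")
        case False
        then have ns: "0 < (norm s)\<^sup>2" by simp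
        define c where "c = inner (x - z) s"
        have "2 * (c / (norm s)\<^sup>2) * c \<le> (c / (norm s)\<^sup>2)\<^sup>2 * (norm s)\<^sup>2"
          using q[of "c / (norm s)\<^sup>2"] by (simp add: c_def)
        also have "\<dots> = (c / (norm s)\<^sup>2) * c"
          using ns by (simp add: power2_eq_square)
        finally have "(c / (norm s)\<^sup>2) * c \<le> 0" by simp
        then have "c\<^sup>2 \<le> 0" using ns by (simp add: divide_le_0_iff power2_eq_square)
        then show ?thesis by (simp add: c_def)
      qed simp
    qed
    then have "x - z = 0" by (rule total)
    then have "y \<longlonglongrightarrow> x" using z by simp
    then show ?thesis using y(1) closure_sequential by blast
  qed
  then show ?thesis by blast
qed

text \<open>This element represents evaluation of the primitive (\<open>primitive_eq_inner\<close>).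
  Its Gram matrix \<open>min s t\<close> is the covariance of Brownian motion, so sending
  \<open>ind01 t\<close> to B_t is the start of the Wiener isometry.\<close>

definition ind01 :: "real \<Rightarrow> L2" where "ind01 t = abs_L2 (indicator {0..t})"

lemma indicator_measurable_lebesgue_on [measurable]:
  "indicat_real {a..b} \<in> borel_measurable (lebesgue_on {0..1::real})"
  by (intro measurable_restrict_space1 borel_measurable_indicator) simp

lemma finite_measure_lebesgue_on: "finite_measure (lebesgue_on {0..1::real})"
  by (rule finite_measureI) (simp add: space_restrict_space emeasure_restrict_space)

lemma square_integrable01_indicator: "square_integrable01 (indicator {0..t})"
proof -
  interpret finite_measure "lebesgue_on {0..1::real}" by (rule finite_measure_lebesgue_on)
  have "integrable (lebesgue_on {0..1::real}) (\<lambda>x. (indicator {0..t} x)\<^sup>2 :: real)"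
  proof (rule integrable_const_bound[of _ 1])
    show "AE x in lebesgue_on {0..1}. norm ((indicat_real {0..t} x)\<^sup>2) \<le> 1"
      by (rule AE_I2) (simp add: indicator_def)
  qed measurable
  then show ?thesis by (simp add: square_integrable01_def)
qed

lemma rep_ind01: "AE x in lebesgue_on {0..1}. rep_L2 (ind01 t) x = indicator {0..t} x"
  unfolding ind01_def by (rule rep_abs_L2[OF square_integrable01_indicator])

lemma inner_ind01: "inner w (ind01 t) = (\<integral>x. indicator {0..t} x * rep_L2 w x \<partial>lebesgue_on {0..1})"
  unfolding inner_L2_rep using rep_ind01[of t]
  by (intro integral_cong_AE) (auto elim!: eventually_mono)

lemma primitive_eq_inner: "primitive w t = inner w (ind01 t)"
  unfolding primitive.rep_eq inner_ind01 set_lebesgue_integral_def by simp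

lemma inner_ind01_ind01:
  assumes "s \<in> {0..1}" "t \<in> {0..1}"
  shows "inner (ind01 s) (ind01 t) = min s t"
proof -
  have "inner (ind01 s) (ind01 t) = (\<integral>x. indicator {0..min s t} x \<partial>lebesgue_on {0..1::real})"
    unfolding inner_ind01
  proof (rule integral_cong_AE)
    show "AE x in lebesgue_on {0..1}. indicat_real {0..t} x * rep_L2 (ind01 s) x = indicat_real {0..min s t} x"
      using rep_ind01[of s] by eventually_elim (auto simp: indicator_def)
  qed measurable
  also have "\<dots> = measure (lebesgue_on {0..1}) {0..min s t}"
    by (subst Bochner_Integration.integral_indicator)
      (use assms in \<open>auto simp: space_restrict_space sets_restrict_space_iff intro!: arg_cong2[where f=measure]\<close>)
  also have "\<dots> = min s t"
    using assms by (subst measure_restrict_space) (auto simp: min_def)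
  finally show ?thesis .
qed

lemma norm_ind01_diff:
  assumes "s \<in> {0..1}" "t \<in> {0..1}"
  shows "(norm (ind01 s - ind01 t))\<^sup>2 = \<bar>s - t\<bar>"
  using assms unfolding power2_norm_eq_inner inner_diff_left inner_diff_right
  by (simp add: inner_ind01_ind01 min_def)

lemma ind01_0: "ind01 0 = 0"
  using inner_ind01_ind01[of 0 0] by simp

text \<open>A vanishing primitive means vanishing integrals over all half-lines. These form a
  generator of the Borel sets closed under intersection, so the integral over every Borel set
  vanishes, and with it the function almost everywhere.\<close>

lemma total_ind01:
  assumes 0: "\<And>t. t \<in> {0..1} \<Longrightarrow> inner w (ind01 t) = 0"
  shows "w = 0"
proof -
  let ?M = "lebesgue_on {0..1::real}"
  define f where "f x = indicator {0..1} x * rep_L2 w x" for x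
  have int: "integrable ?M (rep_L2 w)"
  proof -
    have "square_integrable01 (\<lambda>x. 1)"
      using finite_measure.integrable_const[OF finite_measure_lebesgue_on]
      by (simp add: square_integrable01_def)
    from square_integrable01_mult[OF this square_integrable01_rep[of w]] show ?thesis by simp
  qed
  have f: "integrable lebesgue f"
    using int by (subst (asm) integrable_restrict_space) (auto simp: f_def[abs_def])
  have eq: "inner w (ind01 t) = (\<integral>x. indicator {..t} x * f x \<partial>lebesgue)" for t
    unfolding inner_ind01 by (subst integral_restrict_space)
      (auto simp: f_def indicator_def intro!: Bochner_Integration.integral_cong)
  have at: "(\<integral>x. indicator {..t} x * f x \<partial>lebesgue) = 0" for t
  proof -
    consider "t < 0" | "0 \<le> t \<and> t \<le> 1" | "1 < t" by linarith
    then show ?thesis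
    proof cases
      case 1
      then have "(\<lambda>x. indicator {..t} x * f x) = (\<lambda>_. 0)" by (auto simp: f_def indicator_def fun_eq_iff)
      then show ?thesis by simp
    next
      case 2 then show ?thesis using 0[of t] eq[of t] by simp
    next
      case 3
      then have "(\<lambda>x. indicator {..t} x * f x) = (\<lambda>x. indicator {..1} x * f x)"
        by (auto simp: f_def indicator_def fun_eq_iff)
      then show ?thesis using 0[of 1] eq[of 1] by simp
    qed
  qed
  have int_ind: "integrable lebesgue (\<lambda>x. indicator A x * f x)" if "A \<in> sets borel" for A
    using integrable_mult_indicator[OF _ f, of A] that by simp
  have tot: "(\<integral>x. f x \<partial>lebesgue) = 0"
  proof -
    have "(\<lambda>x. indicator {..1} x * f x) = f" by (auto simp: f_def indicator_def fun_eq_iff)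
    then show ?thesis using at[of 1] by simp
  qed
  have bor: "(\<integral>x. indicator A x * f x \<partial>lebesgue) = 0" if A: "A \<in> sets borel" for A
  proof -
    have sb: "sigma_sets UNIV (range (\<lambda>a::real. {..a})) = sets borel"
      by (simp add: borel_eq_atMost)
    have st: "Int_stable (range (\<lambda>a::real. {..a}))"
      by (auto simp: Int_stable_def)
    have "A \<in> sigma_sets UNIV (range (\<lambda>a::real. {..a}))" "range (\<lambda>a::real. {..a}) \<subseteq> Pow UNIV"
      using A sb by auto
    from st this(2,1) show ?thesis
    proof (induction rule: sigma_sets_induct_disjoint)
      case (basic A) then show ?case using at by auto
    next
      case empty then show ?case by simp
    next
      case (compl A)
      then have "A \<in> sets borel" by (simp add: sb)
      then have "(\<integral>x. f x - indicator A x * f x \<partial>lebesgue) = 0"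
        using compl tot int_ind f by (subst Bochner_Integration.integral_diff) auto
      moreover have "(\<lambda>x. f x - indicator A x * f x) = (\<lambda>x. indicator (UNIV - A) x * f x)"
        by (auto simp: indicator_def fun_eq_iff)
      ultimately show ?case by simp
    next
      case (union A)
      have Ai: "A i \<in> sets lebesgue" for i using union(2) sb by auto
      have UA: "(\<Union>i. A i) \<in> sets borel" using union(2) sb by auto
      have "(LINT x:(\<Union>i. A i)|lebesgue. f x) = (\<Sum>i. LINT x:A i|lebesgue. f x)"
        by (rule lebesgue_integral_countable_add)
          (use Ai union(1) int_ind[OF UA] in \<open>auto simp: disjoint_family_on_def set_integrable_def\<close>)
      then show ?case using union(3) by (simp add: set_lebesgue_integral_def)
    qed
  qed
  interpret M: finite_measure ?M by (rule finite_measure_lebesgue_on)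
  have "AE x in ?M. rep_L2 w x = 0"
  proof (rule M.density_zero[OF int])
    fix A assume AM: "A \<in> sets ?M"
    then have AL: "A \<in> sets lebesgue" by (simp add: sets_restrict_space_iff)
    \<comment> \<open>The measure lives on Lebesgue sets while the induction reached only Borel
      sets; A differs from the Borel set S by a null set.\<close>
    then obtain S N N' where A: "A = S \<union> N" "N \<subseteq> N'" "N' \<in> null_sets lborel" "S \<in> sets lborel"
      by (rule sets_completionE)
    have "AE x in lebesgue. x \<notin> N'"
      using A(3) by (intro AE_completion AE_not_in)
    then have "AE x in lebesgue. indicator A x * f x = indicator S x * f x"
      by eventually_elim (use A in \<open>auto simp: indicator_def\<close>)
    moreover have "(\<lambda>x. indicator A x * f x) \<in> borel_measurable lebesgue"
      using AL f by measurable
    moreover have "(\<lambda>x. indicator S x * f x) \<in> borel_measurable lebesgue"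
      using int_ind[of S] A(4) by simp
    ultimately have "(\<integral>x. indicator A x * f x \<partial>lebesgue) = (\<integral>x. indicator S x * f x \<partial>lebesgue)"
      by (intro integral_cong_AE)
    moreover have "set_lebesgue_integral ?M A (rep_L2 w) = (\<integral>x. indicator A x * f x \<partial>lebesgue)"
      unfolding set_lebesgue_integral_def
      by (subst integral_restrict_space) (auto simp: f_def intro!: Bochner_Integration.integral_cong)
    ultimately show "set_lebesgue_integral ?M A (rep_L2 w) = 0"
      using bor[of S] A(4) by simp
  qed
  then have "(\<integral>x. rep_L2 w x * rep_L2 w x \<partial>?M) = (\<integral>x. 0 \<partial>?M)"
    by (intro integral_cong_AE) (auto elim: eventually_mono)
  then have "inner w w = 0" unfolding inner_L2_rep by simp
  then show ?thesis by simp
qed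

section \<open>Density of step functions and separability\<close>

lemma dense_ind01: "closure (span (ind01 ` {0..1})) = UNIV"
  by (rule dense_span_if_total) (auto intro: total_ind01)

lemma closure_seqI:
  fixes f :: "nat \<Rightarrow> 'a::metric_space"
  assumes "\<And>n. f n \<in> S" "f \<longlonglongrightarrow> x" shows "x \<in> closure S"
  unfolding closure_sequential using assms by blast

text \<open>Lists of rational pairs form a countable type, so the range is countable by
  construction, and its density is separability of the space.\<close>

definition rat_step :: "(rat \<times> rat) list \<Rightarrow> L2" where
  "rat_step xs = (\<Sum>(c, t)\<leftarrow>xs. of_rat c *\<^sub>R ind01 (of_rat t))"

lemma dense_rat_step: "closure (range rat_step) = UNIV"
proof -
  let ?D = "range rat_step" and ?W = "closure (range rat_step)"
  have rap: "rat_step xs + rat_step ys = rat_step (xs @ ys)" for xs ys by (simp add: rat_step_def)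
  have add: "x + y \<in> ?W" if xy: "x \<in> ?W" "y \<in> ?W" for x y
  proof -
    obtain f g where fg: "\<And>n. f n \<in> ?D" "f \<longlonglongrightarrow> x" "\<And>n. g n \<in> ?D" "g \<longlonglongrightarrow> y"
      using xy closure_sequential[of x ?D] closure_sequential[of y ?D] by blast
    have "f n + g n \<in> ?D" for n
    proof -
      obtain a b where "f n = rat_step a" "g n = rat_step b" using fg(1)[of n] fg(3)[of n] by auto
      then show ?thesis using rap by simp
    qed
    then show ?thesis
      by (rule closure_seqI) (rule tendsto_add[OF fg(2) fg(4)])
  qed
  have rsc: "of_rat c *\<^sub>R rat_step xs = rat_step (map (\<lambda>(d, t). (c * d, t)) xs)" for c xs
    by (induction xs) (auto simp: rat_step_def of_rat_mult scaleR_right_distrib)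
  have dense: "\<exists>q. q \<longlonglongrightarrow> (c::real) \<and> (\<forall>n. q n \<in> \<rat>)" for c
  proof -
    have "c \<in> closure \<rat>" by (simp add: Rats_closure_real)
    then obtain q where "\<And>n. q n \<in> \<rat>" "q \<longlonglongrightarrow> c"
      using closure_sequential[of c "\<rat>"] by blast
    then show ?thesis by blast
  qed
  have sc0: "c *\<^sub>R x \<in> ?W" if x: "x \<in> ?D" for c x
  proof -
    obtain q where q: "q \<longlonglongrightarrow> c" "\<And>n. q n \<in> \<rat>" using dense by blast
    have "q n *\<^sub>R x \<in> ?D" for n
    proof -
      obtain r where "q n = of_rat r" using q(2)[of n] by (auto elim: Rats_cases)
      moreover obtain xs where "x = rat_step xs" using x by auto
      ultimately show ?thesis using rsc by simp
    qed
    moreover have "(\<lambda>n. q n *\<^sub>R x) \<longlonglongrightarrow> c *\<^sub>R x" by (intro tendsto_intros q)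
    ultimately show ?thesis by (rule closure_seqI)
  qed
  have sc: "c *\<^sub>R x \<in> ?W" if x: "x \<in> ?W" for c x
  proof -
    obtain f where f: "\<And>n. f n \<in> ?D" "f \<longlonglongrightarrow> x" using x closure_sequential[of x ?D] by blast
    have "(\<lambda>n. c *\<^sub>R f n) \<longlonglongrightarrow> c *\<^sub>R x" by (intro tendsto_intros f)
    then have "c *\<^sub>R x \<in> closure ?W"
      by (rule closure_seqI[rotated]) (rule sc0[OF f(1)])
    then show ?thesis by simp
  qed
  have "0 \<in> ?D" by (rule range_eqI[of _ _ "[]"]) (simp add: rat_step_def)
  then have "0 \<in> ?W" by (rule subsetD[OF closure_subset])
  then have sub: "subspace ?W" using add sc by (simp add: subspace_def)
  have "ind01 t \<in> ?W" if t: "t \<in> {0..1}" for t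
  proof -
    \<comment> \<open>The distance of two indicators is the square root of the distance of their
      endpoints, hence the tolerance e^2. The rational is taken below t to stay in the unit
      interval, which leaves t = 0 as a separate case.\<close>
    have "\<exists>r. \<bar>t - of_rat r\<bar> < e\<^sup>2 \<and> of_rat r \<in> {0..1::real}" if e: "0 < e" for e :: real
    proof (cases "t = 0")
      case True then show ?thesis using e by (intro exI[of _ 0]) auto
    next
      case False
      then have "max 0 (t - e\<^sup>2) < t" using t e by auto
      then obtain r where r: "max 0 (t - e\<^sup>2) < real_of_rat r" "real_of_rat r < t"
        using of_rat_dense by blast
      have t1: "t \<le> 1" using t by simp
      have "\<bar>t - of_rat r\<bar> < e\<^sup>2" "0 \<le> real_of_rat r" "real_of_rat r \<le> 1"
        using t1 r by linarith+
      then have "\<bar>t - of_rat r\<bar> < e\<^sup>2" "of_rat r \<in> {0..1::real}"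
        unfolding atLeastAtMost_iff by blast+
      then show ?thesis by blast
    qed
    then have "\<exists>y\<in>?D. dist y (ind01 t) < e" if e: "0 < e" for e
    proof -
      obtain r where r: "\<bar>t - of_rat r\<bar> < e\<^sup>2" "of_rat r \<in> {0..1::real}"
        using e \<open>\<And>e. 0 < e \<Longrightarrow> \<exists>r. \<bar>t - of_rat r\<bar> < e\<^sup>2 \<and> of_rat r \<in> {0..1::real}\<close> by blast
      have "(norm (ind01 t - ind01 (of_rat r)))\<^sup>2 < e\<^sup>2"
        using norm_ind01_diff[OF t r(2)] r(1) by simp
      then have "dist (ind01 (of_rat r)) (ind01 t) < e"
        using e by (simp add: dist_norm norm_minus_commute power2_less_imp_less)
      moreover have "ind01 (of_rat r) = rat_step [(1, r)]" by (simp add: rat_step_def)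
      ultimately show ?thesis by auto
    qed
    then show ?thesis unfolding closure_approachable by blast
  qed
  then have "span (ind01 ` {0..1}) \<subseteq> ?W" by (intro span_minimal sub) auto
  then have "closure (span (ind01 ` {0..1})) \<subseteq> closure ?W" by (rule closure_mono)
  then show ?thesis using dense_ind01 by auto
qed

text \<open>Separability makes the vector operations of the space Borel measurable, as the random
  series that defines the prior demands.\<close>

instance L2 :: second_countable_topology
proof
  define B where "B = (\<lambda>(xs, n). ball (rat_step xs) (1 / real (Suc n))) ` UNIV"
  have "topological_basis B"
  proof (rule topological_basisI)
    show "open b" if "b \<in> B" for b using that by (auto simp: B_def)
    fix U and x :: L2 assume U: "open U" "x \<in> U"
    obtain e where e: "0 < e" "ball x e \<subseteq> U" using U openE by blast
    obtain n where n: "1 / real (Suc n) < e / 2" using nat_approx_posE[of "e/2"] e by auto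
    have "x \<in> closure (range rat_step)" by (simp add: dense_rat_step)
    then obtain xs where xs: "dist (rat_step xs) x < 1 / real (Suc n)"
      unfolding closure_approachable by (auto dest!: spec[of _ "1 / real (Suc n)"])
    have "ball (rat_step xs) (1 / real (Suc n)) \<subseteq> ball x e"
    proof
      fix y assume "y \<in> ball (rat_step xs) (1 / real (Suc n))"
      then have "dist (rat_step xs) y < 1 / real (Suc n)" by simp
      then show "y \<in> ball x e"
        using xs n dist_triangle[of x y "rat_step xs"] by (simp add: dist_commute)
    qed
    then show "\<exists>b\<in>B. x \<in> b \<and> b \<subseteq> U"
      using xs e by (intro bexI[of _ "ball (rat_step xs) (1 / real (Suc n))"]) (auto simp: B_def)
  qed
  then show "\<exists>B :: L2 set set. countable B \<and> open = generate_topology B"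
    by (intro exI[of _ B] conjI topological_basis_imp_subbasis) (auto simp: B_def)
qed

section \<open>Joint normality from characteristic functions\<close>

context prob_space
begin

lemma integrable_bounded:
  fixes f :: "'a \<Rightarrow> 'b::{banach, second_countable_topology}"
  assumes "f \<in> borel_measurable M" "\<And>x. norm (f x) \<le> C"
  shows "integrable M f"
  using assms by (intro integrable_const_bound[of _ C]) auto

text \<open>Both \<open>W = 1 + G / D\<close> and \<open>1\<close> are probability densities under which \<open>X\<close> has the same
  characteristic function, so Levy's uniqueness theorem applies to signed weights.\<close>

lemma char_weight_zero_real:
  fixes X G :: "'a \<Rightarrow> real"
  assumes [measurable]: "X \<in> borel_measurable M" "G \<in> borel_measurable M"
    and C: "\<And>x. \<bar>G x\<bar> \<le> C"
    and zero: "\<And>t. (CLINT x|M. complex_of_real (G x) * iexp (t * X x)) = 0"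
    and A[measurable]: "A \<in> sets borel"
  shows "(\<integral>x. G x * indicator A (X x) \<partial>M) = 0"
proof -
  define D where "D = \<bar>C\<bar> + 1"
  have D: "0 < D" "\<bar>G x\<bar> \<le> D" for x using C[of x] by (auto simp: D_def)
  define W where "W x = 1 + G x / D" for x
  have [measurable]: "W \<in> borel_measurable M" unfolding W_def by measurable
  have W0: "0 \<le> W x" for x
    using D(2)[of x] D(1) by (auto simp: W_def abs_le_iff field_simps)
  have Gi: "integrable M G" by (rule integrable_bounded[where C=C]) (auto simp: C)
  have "(CLINT x|M. complex_of_real (G x)) = 0" using zero[of 0] by simp
  then have EG: "(\<integral>x. G x \<partial>M) = 0" by simp
  have Wi: "integrable M W" unfolding W_def using Gi by auto
  have EW: "(\<integral>x. W x \<partial>M) = 1" unfolding W_def using Gi EG by (simp add: prob_space)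
  define N where "N = density M (\<lambda>x. ennreal (W x))"
  have "prob_space N"
    by (rule prob_spaceI) (simp add: N_def emeasure_density nn_integral_eq_integral[OF Wi] W0 EW
        cong: nn_integral_cong)
  then interpret N: prob_space N .
  have [measurable]: "X \<in> borel_measurable N" by (simp add: N_def)
  have iX: "integrable M (\<lambda>x. iexp (t * X x))" for t
    by (rule integrable_bounded[where C=1]) auto
  have iG: "integrable M (\<lambda>x. complex_of_real (G x) * iexp (t * X x))" for t
    by (rule integrable_bounded[where C=C]) (auto simp: norm_mult C)
  have "distr N borel X = distr M borel X"
  proof (rule Levy_uniqueness)
    show "real_distribution (distr N borel X)" by simp
    show "real_distribution (distr M borel X)" by simp
    show "char (distr N borel X) = char (distr M borel X)"
    proof
      fix t
      have "char (distr N borel X) t = (CLINT x|M. W x *\<^sub>R iexp (t * X x))"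
        by (simp add: char_def integral_distr N_def integral_density W0)
      also have "\<dots> = (CLINT x|M. iexp (t * X x) + (complex_of_real (G x) * iexp (t * X x)) / D)"
        by (intro Bochner_Integration.integral_cong) (auto simp: W_def scaleR_conv_of_real field_simps)
      also have "\<dots> = (CLINT x|M. iexp (t * X x))"
        using zero[of t] iX iG by (subst Bochner_Integration.integral_add) auto
      finally show "char (distr N borel X) t = char (distr M borel X) t"
        by (simp add: char_def integral_distr)
    qed
  qed
  then have "measure N (X -` A \<inter> space N) = measure M (X -` A \<inter> space M)"
    by (metis A \<open>X \<in> borel_measurable N\<close> assms(1) measure_distr)
  moreover have "measure M (X -` A \<inter> space M) = (\<integral>x. indicator A (X x) \<partial>M)"
  proof -
    have "(\<integral>x. indicat_real A (X x) \<partial>M) = (\<integral>x. indicat_real (X -` A \<inter> space M) x \<partial>M)"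
      by (intro Bochner_Integration.integral_cong) (auto simp: indicator_def)
    then show ?thesis by simp
  qed
  moreover have "measure N (X -` A \<inter> space N) = (\<integral>x. W x * indicator A (X x) \<partial>M)"
  proof -
    have "(\<integral>x. indicat_real A (X x) \<partial>N) = (\<integral>x. indicat_real (X -` A \<inter> space N) x \<partial>N)"
      by (intro Bochner_Integration.integral_cong) (auto simp: indicator_def)
    then have "measure N (X -` A \<inter> space N) = (\<integral>x. indicat_real A (X x) \<partial>N)"
      by simp
    then show ?thesis unfolding N_def by (subst (asm) integral_density) (auto simp: W0)
  qed
  moreover have "(\<integral>x. W x * indicator A (X x) \<partial>M)
      = (\<integral>x. indicator A (X x) + (G x * indicator A (X x)) / D \<partial>M)"
    by (intro Bochner_Integration.integral_cong) (auto simp: W_def field_simps)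
  moreover have "integrable M (\<lambda>x. indicat_real A (X x))"
    by (rule integrable_bounded[where C=1]) (auto simp: indicator_def)
  moreover have "integrable M (\<lambda>x. G x * indicat_real A (X x))"
    by (rule integrable_bounded[where C="\<bar>C\<bar>"]) (use C in \<open>auto simp: indicator_def intro: order_trans[OF C abs_ge_self]\<close>)
  ultimately show ?thesis using D(1) by simp
qed

lemma char_weight_zero:
  fixes X :: "'a \<Rightarrow> real" and G :: "'a \<Rightarrow> complex"
  assumes [measurable]: "X \<in> borel_measurable M" "G \<in> borel_measurable M"
    and C: "\<And>x. norm (G x) \<le> C"
    and zero: "\<And>t. (CLINT x|M. G x * iexp (t * X x)) = 0"
    and A[measurable]: "A \<in> sets borel"
  shows "(CLINT x|M. G x * indicator A (X x)) = 0"
proof -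
  have i: "integrable M (\<lambda>x. G x * iexp (t * X x))" for t
    by (rule integrable_bounded[where C=C]) (auto simp: norm_mult C)
  have [measurable]: "(\<lambda>x. cnj (G x)) \<in> borel_measurable M"
    by (rule measurable_compose[OF assms(2) borel_measurable_continuous_onI])
      (intro continuous_on_cnj continuous_on_id)
  have ic: "integrable M (\<lambda>x. cnj (G x) * iexp (t * X x))" for t
    by (rule integrable_bounded[where C=C]) (auto simp: norm_mult C)
  \<comment> \<open>Conjugation turns the frequency t into -t, so the hypothesis passes to the
    conjugate weight and from there to the real and imaginary parts.\<close>
  have zc: "(CLINT x|M. cnj (G x) * iexp (t * X x)) = 0" for t
  proof -
    have "(CLINT x|M. cnj (G x) * iexp (t * X x)) = (CLINT x|M. cnj (G x * iexp ((- t) * X x)))"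
      by (intro Bochner_Integration.integral_cong) (auto simp: exp_cnj)
    also have "\<dots> = cnj (CLINT x|M. G x * iexp ((- t) * X x))" by (rule Bochner_Integration.integral_cnj)
    also have "\<dots> = 0" using zero[of "- t"] by (simp only: complex_cnj_zero)
    finally show ?thesis .
  qed
  have re: "(CLINT x|M. complex_of_real (Re (G x)) * iexp (t * X x)) = 0" for t
  proof -
    have "(CLINT x|M. complex_of_real (Re (G x)) * iexp (t * X x))
        = (CLINT x|M. (G x * iexp (t * X x) + cnj (G x) * iexp (t * X x)) / 2)"
      by (intro Bochner_Integration.integral_cong) (auto simp: complex_eq_iff)
    then show ?thesis using zero[of t] zc[of t] i ic by simp
  qed
  have im: "(CLINT x|M. complex_of_real (Im (G x)) * iexp (t * X x)) = 0" for t
  proof -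
    have "(CLINT x|M. complex_of_real (Im (G x)) * iexp (t * X x))
        = (CLINT x|M. (G x * iexp (t * X x) - cnj (G x) * iexp (t * X x)) / (2 * \<i>))"
      by (intro Bochner_Integration.integral_cong) (auto simp: complex_eq_iff Re_divide Im_divide power2_eq_square field_simps)
    then show ?thesis using zero[of t] zc[of t] i ic by simp
  qed
  have R: "(\<integral>x. Re (G x) * indicator A (X x) \<partial>M) = 0"
    by (rule char_weight_zero_real[where C=C, OF _ _ _ re])
      (auto intro: order_trans[OF abs_Re_le_cmod C])
  have I: "(\<integral>x. Im (G x) * indicator A (X x) \<partial>M) = 0"
    by (rule char_weight_zero_real[where C=C, OF _ _ _ im])
      (auto intro: order_trans[OF abs_Im_le_cmod C])
  have int: "integrable M (\<lambda>x. G x * indicator A (X x))"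
    by (rule integrable_bounded[where C="\<bar>C\<bar>"])
      (use C in \<open>auto simp: indicator_def norm_mult intro: order_trans[OF C abs_ge_self]\<close>)
  have "Re (CLINT x|M. G x * indicator A (X x)) = (\<integral>x. Re (G x) * indicator A (X x) \<partial>M)"
    by (subst integral_Re[OF int, symmetric]) (auto intro!: Bochner_Integration.integral_cong simp: indicator_def)
  moreover have "Im (CLINT x|M. G x * indicator A (X x)) = (\<integral>x. Im (G x) * indicator A (X x) \<partial>M)"
    by (subst integral_Im[OF int, symmetric]) (auto intro!: Bochner_Integration.integral_cong simp: indicator_def)
  ultimately show ?thesis using R I by (simp add: complex_eq_iff)
qed

lemma char_weight_factor:
  fixes X :: "'a \<Rightarrow> real" and G :: "'a \<Rightarrow> complex"
  assumes [measurable]: "X \<in> borel_measurable M" "G \<in> borel_measurable M"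
    and C: "\<And>x. norm (G x) \<le> C"
    and eq: "\<And>t. (CLINT x|M. G x * iexp (t * X x)) = c * (CLINT x|M. iexp (t * X x))"
    and A[measurable]: "A \<in> sets borel"
  shows "(CLINT x|M. G x * indicator A (X x)) = c * (CLINT x|M. indicator A (X x))"
proof -
  have i1: "integrable M (\<lambda>x. G x * iexp (t * X x))" for t
    by (rule integrable_bounded[where C=C]) (auto simp: norm_mult C)
  have i2: "integrable M (\<lambda>x. c * iexp (t * X x))" for t
    by (rule integrable_bounded[where C="norm c"]) (auto simp: norm_mult)
  have j1: "integrable M (\<lambda>x. G x * indicator A (X x))"
    by (rule integrable_bounded[where C="\<bar>C\<bar>"])
      (use C in \<open>auto simp: indicator_def norm_mult intro: order_trans[OF C abs_ge_self]\<close>)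
  have j2: "integrable M (\<lambda>x. c * indicator A (X x))"
    by (rule integrable_bounded[where C="norm c"]) (auto simp: indicator_def norm_mult)
  have "(CLINT x|M. (G x - c) * indicator A (X x)) = 0"
  proof (rule char_weight_zero[where C="C + norm c"])
    show "norm (G x - c) \<le> C + norm c" for x
      using norm_triangle_ineq4[of "G x" c] C[of x] by simp
    fix t
    have "(CLINT x|M. (G x - c) * iexp (t * X x)) = (CLINT x|M. G x * iexp (t * X x) - c * iexp (t * X x))"
      by (simp add: left_diff_distrib)
    also have "\<dots> = 0" using i1 i2 eq[of t] by (subst Bochner_Integration.integral_diff) auto
    finally show "(CLINT x|M. (G x - c) * iexp (t * X x)) = 0" .
  qed measurable
  then have "(CLINT x|M. G x * indicator A (X x) - c * indicator A (X x)) = 0"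
    by (simp add: left_diff_distrib)
  then show ?thesis using j1 j2 by (subst (asm) Bochner_Integration.integral_diff) auto
qed

text \<open>The coordinates are treated one at a time. With the frequency of \<open>X k\<close>
  frozen, the factor \<open>iexp (s * X k x)\<close> joins the bounded weight G and the induction
  hypothesis converts the other coordinates to indicators; one-dimensional uniqueness then converts
  \<open>X k\<close>. This is why G and c are generalised in the induction.\<close>

lemma char_weight_prod:
  fixes X :: "'i \<Rightarrow> 'a \<Rightarrow> real"
  assumes "finite J" "\<And>j. j \<in> J \<Longrightarrow> X j \<in> borel_measurable M"
    and "G \<in> borel_measurable M" "\<And>x. norm (G x :: complex) \<le> C"
    and "\<And>t :: 'i \<Rightarrow> real. (CLINT x|M. G x * (\<Prod>j\<in>J. iexp (t j * X j x)))
      = c * (\<Prod>j\<in>J. CLINT x|M. iexp (t j * X j x))"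
    and "\<And>j. j \<in> J \<Longrightarrow> A j \<in> sets borel"
  shows "(CLINT x|M. G x * (\<Prod>j\<in>J. indicator (A j) (X j x)))
    = c * (\<Prod>j\<in>J. CLINT x|M. indicator (A j) (X j x))"
  using assms
proof (induction J arbitrary: G c rule: finite_induct)
  case empty
  then show ?case by simp
next
  case (insert k J)
  note [measurable] = insert.prems(2)
  have [measurable]: "X k \<in> borel_measurable M" "A k \<in> sets borel" using insert.prems by auto
  have [measurable]: "X j \<in> borel_measurable M" "A j \<in> sets borel" if "j \<in> J" for j
    using insert.prems that by auto
  have C0: "0 \<le> C" using insert.prems(3) norm_ge_zero order_trans by blast
  have step: "(CLINT x|M. (G x * iexp (s * X k x)) * (\<Prod>j\<in>J. indicator (A j) (X j x)))
      = (c * (CLINT x|M. iexp (s * X k x))) * (\<Prod>j\<in>J. CLINT x|M. indicator (A j) (X j x))" for s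
  proof (rule insert.IH)
    show "norm (G x * iexp (s * X k x)) \<le> C" for x
      using insert.prems(3)[of x] by (simp add: norm_mult)
    show "(CLINT x|M. (G x * iexp (s * X k x)) * (\<Prod>j\<in>J. iexp (t j * X j x)))
        = (c * (CLINT x|M. iexp (s * X k x))) * (\<Prod>j\<in>J. CLINT x|M. iexp (t j * X j x))" for t
    proof -
      have "(\<Prod>j\<in>J. iexp ((t(k := s)) j * X j x)) = (\<Prod>j\<in>J. iexp (t j * X j x))" for x
        using insert.hyps by (intro prod.cong) auto
      moreover have "(\<Prod>j\<in>J. CLINT x|M. iexp ((t(k := s)) j * X j x))
          = (\<Prod>j\<in>J. CLINT x|M. iexp (t j * X j x))"
        using insert.hyps by (intro prod.cong) auto
      ultimately show ?thesis
        using insert.prems(4)[of "t(k := s)"] insert.hyps by (simp add: mult.assoc)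
    qed
  qed (use insert.prems in auto)
  define H where "H x = G x * (\<Prod>j\<in>J. indicator (A j) (X j x))" for x
  have [measurable]: "H \<in> borel_measurable M" unfolding H_def by measurable
  have "(CLINT x|M. H x * indicator (A k) (X k x))
      = (c * (\<Prod>j\<in>J. CLINT x|M. indicator (A j) (X j x))) * (CLINT x|M. indicator (A k) (X k x))"
  proof (rule char_weight_factor)
    show "norm (H x) \<le> C" for x
    proof -
      have "norm (\<Prod>j\<in>J. indicator (A j) (X j x) :: complex) \<le> (\<Prod>j\<in>J. 1)"
        unfolding prod_norm[symmetric] by (intro prod_mono) (auto simp: indicator_def)
      then have "norm (H x) \<le> C * 1"
        unfolding H_def norm_mult by (intro mult_mono insert.prems(3) C0) auto
      then show ?thesis by simp
    qed
    show "(CLINT x|M. H x * iexp (t * X k x))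
        = (c * (\<Prod>j\<in>J. CLINT x|M. indicator (A j) (X j x))) * (CLINT x|M. iexp (t * X k x))" for t
      using step[of t] by (simp add: H_def ac_simps)
  qed auto
  then show ?case using insert.hyps by (simp add: H_def ac_simps)
qed

text \<open>Multivariate uniqueness in the only case that occurs: \<open>char_weight_prod\<close>
  with weight 1 turns a factorised joint characteristic function into factorised probabilities of
  rectangles.\<close>

lemma distr_eq_PiM_std_normal:
  fixes X :: "'i \<Rightarrow> 'a \<Rightarrow> real"
  assumes J: "finite J" and X[measurable]: "\<And>j. j \<in> J \<Longrightarrow> X j \<in> borel_measurable M"
    and ch: "\<And>t :: 'i \<Rightarrow> real. (CLINT x|M. iexp (\<Sum>j\<in>J. t j * X j x))
      = complex_of_real (exp (- (\<Sum>j\<in>J. (t j)\<^sup>2) / 2))"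
  shows "distr M (PiM J (\<lambda>_. borel)) (\<lambda>x. \<lambda>j\<in>J. X j x) = PiM J (\<lambda>_. std_normal_distribution)"
proof -
  have prodexp: "(\<Prod>j\<in>J. iexp (t j * X j x)) = iexp (\<Sum>j\<in>J. t j * X j x)" for t x
    using J by (simp add: exp_sum sum_distrib_left)
  have single: "(CLINT x|M. iexp (s * X j x)) = complex_of_real (exp (- s\<^sup>2 / 2))" if j: "j \<in> J" for s j
  proof -
    \<comment> \<open>A frequency vector supported at j isolates the marginal of
      \<open>X j\<close>.\<close>
    define t where "t i = (if i = j then s else 0)" for i
    have "(\<Sum>i\<in>J. t i * X i x) = s * X j x" for x
      using J j by (simp add: t_def if_distrib[of "\<lambda>a. a * _"] sum.delta cong: if_cong)
    moreover have "(\<Sum>i\<in>J. (t i)\<^sup>2) = s\<^sup>2"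
      using J j by (simp add: t_def if_distrib[of "\<lambda>a. a\<^sup>2"] sum.delta cong: if_cong)
    ultimately show ?thesis using ch[of t] by simp
  qed
  have law: "distr M borel (X j) = std_normal_distribution" if j: "j \<in> J" for j
  proof (rule Levy_uniqueness)
    show "real_distribution (distr M borel (X j))" using X[OF j] by simp
    show "real_distribution std_normal_distribution"
      by (simp add: real_distribution_def real_distribution_axioms_def prob_space_normal_density)
    show "char (distr M borel (X j)) = char std_normal_distribution"
      unfolding char_std_normal_distribution char_def using X[OF j] single[OF j]
      by (auto simp: integral_distr fun_eq_iff)
  qed
  interpret P: product_prob_space "\<lambda>_. std_normal_distribution" J
    by (simp add: product_prob_space_def product_prob_space_axioms_def product_sigma_finite_def
      prob_space_imp_sigma_finite prob_space_normal_density)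
  show ?thesis
  proof (rule P.PiM_eqI[OF J])
    show "sets (distr M (PiM J (\<lambda>_. borel)) (\<lambda>x. \<lambda>j\<in>J. X j x)) = sets (PiM J (\<lambda>_. std_normal_distribution))"
      by (simp cong: sets_PiM_cong)
    fix A assume A: "\<And>i. i \<in> J \<Longrightarrow> A i \<in> sets std_normal_distribution"
    then have A': "\<And>i. i \<in> J \<Longrightarrow> A i \<in> sets borel" by simp
    have "emeasure (distr M (PiM J (\<lambda>_. borel)) (\<lambda>x. \<lambda>j\<in>J. X j x)) (Pi\<^sub>E J A)
        = emeasure M {x\<in>space M. \<forall>j\<in>J. X j x \<in> A j}"
      using J A' by (subst emeasure_distr) (auto intro!: arg_cong[where f="emeasure M"] simp: PiE_iff)
    also have "\<dots> = ennreal (measure M {x\<in>space M. \<forall>j\<in>J. X j x \<in> A j})"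
      by (rule emeasure_eq_measure)
    also have "measure M {x\<in>space M. \<forall>j\<in>J. X j x \<in> A j} = (\<Prod>j\<in>J. measure std_normal_distribution (A j))"
    proof -
      have "(CLINT x|M. 1 * (\<Prod>j\<in>J. indicator (A j) (X j x)))
          = 1 * (\<Prod>j\<in>J. CLINT x|M. indicator (A j) (X j x))"
      proof (rule char_weight_prod[OF J])
        show "(CLINT x|M. 1 * (\<Prod>j\<in>J. iexp (t j * X j x))) = 1 * (\<Prod>j\<in>J. CLINT x|M. iexp (t j * X j x))" for t
          unfolding prodexp using ch[of t] J single
          by (simp add: exp_sum sum_negf[symmetric] sum_divide_distrib)
      qed (use X A' in auto)
      moreover have "(\<Prod>j\<in>J. indicator (A j) (X j x) :: complex) = complex_of_real (indicator {x\<in>space M. \<forall>j\<in>J. X j x \<in> A j} x)"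
        if "x \<in> space M" for x
        using J that by (auto simp: indicator_def prod_zero_iff)
      ultimately have "(CLINT x|M. complex_of_real (indicator {x\<in>space M. \<forall>j\<in>J. X j x \<in> A j} x))
          = (\<Prod>j\<in>J. CLINT x|M. indicator (A j) (X j x))"
        by (simp cong: Bochner_Integration.integral_cong)
      moreover have "(CLINT x|M. complex_of_real (indicator {x\<in>space M. \<forall>j\<in>J. X j x \<in> A j} x))
          = complex_of_real (measure M {x\<in>space M. \<forall>j\<in>J. X j x \<in> A j})"
        by (simp add: Int_def conj_commute)
      moreover have "(CLINT x|M. indicator (A j) (X j x)) = complex_of_real (measure std_normal_distribution (A j))"
        if j: "j \<in> J" for j
      proof -
        have "(CLINT x|M. indicator (A j) (X j x)) = (CLINT x|M. complex_of_real (indicator (X j -` A j \<inter> space M) x))"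
          by (intro Bochner_Integration.integral_cong) (auto simp: indicator_def)
        also have "\<dots> = complex_of_real (measure M (X j -` A j \<inter> space M))" by simp
        also have "measure M (X j -` A j \<inter> space M) = measure (distr M borel (X j)) (A j)"
          using X[OF j] A'[OF j] by (simp add: measure_distr)
        finally show ?thesis using law[OF j] by simp
      qed
      ultimately have "complex_of_real (measure M {x\<in>space M. \<forall>j\<in>J. X j x \<in> A j})
          = complex_of_real (\<Prod>j\<in>J. measure std_normal_distribution (A j))"
        by simp
      then show ?thesis unfolding of_real_eq_iff .
    qed
    also have "ennreal \<dots> = (\<Prod>j\<in>J. emeasure std_normal_distribution (A j))"
      by (simp add: prod_ennreal[symmetric] P.M.emeasure_eq_measure)
    finally show "emeasure (distr M (PiM J (\<lambda>_. borel)) (\<lambda>x. \<lambda>j\<in>J. X j x)) (Pi\<^sub>E J A)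
        = (\<Prod>i\<in>J. emeasure std_normal_distribution (A i))" .
  qed
qed

end

section \<open>Wiener integrals\<close>

definition grid :: "nat \<Rightarrow> nat \<Rightarrow> real" where "grid k i = real i / 2^k"

definition ind_cell :: "nat \<Rightarrow> nat \<Rightarrow> L2" where
  "ind_cell k i = ind01 (grid k (Suc i)) - ind01 (grid k i)"

text \<open>The cells of level k are orthogonal with squared norm 2^-k, so the factor 2^k makes this
  the orthogonal projection onto step functions on the grid.\<close>

definition dyadic_proj :: "nat \<Rightarrow> L2 \<Rightarrow> L2" where
  "dyadic_proj k h = (\<Sum>i<2^k. (2^k * inner h (ind_cell k i)) *\<^sub>R ind_cell k i)"

text \<open>A Stieltjes sum with the cell means of h as integrand. It makes sense for every path, so
  it can be evaluated on observations and on Brownian paths alike.\<close>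

definition dyadic_int :: "nat \<Rightarrow> L2 \<Rightarrow> (real \<Rightarrow> real) \<Rightarrow> real" where
  "dyadic_int k h x = (\<Sum>i<2^k. 2^k * inner h (ind_cell k i) * (x (grid k (Suc i)) - x (grid k i)))"

lemma grid_in [simp]: "i \<le> 2^k \<Longrightarrow> grid k i \<in> {0..1}"
proof -
  assume "i \<le> 2^k"
  then have "real i \<le> real (2^k)" by (rule of_nat_mono)
  then show ?thesis by (simp add: grid_def divide_le_eq)
qed

lemma grid_0 [simp]: "grid k 0 = 0" by (simp add: grid_def)

lemma grid_mono: "i \<le> j \<Longrightarrow> grid k i \<le> grid k j"
  by (simp add: grid_def divide_right_mono)

lemma grid_less: "i < j \<Longrightarrow> grid k i < grid k j"
  by (simp add: grid_def divide_strict_right_mono)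

lemma grid_Suc_diff: "grid k (Suc i) - grid k i = 1 / 2^k"
  by (simp add: grid_def diff_divide_distrib[symmetric])

lemma inner_ind_cell:
  assumes "i < 2^k" "j < 2^k"
  shows "inner (ind_cell k i) (ind_cell k j) = (if i = j then 1 / 2^k else 0)"
proof -
  have m: "grid k i \<in> {0..1}" "grid k (Suc i) \<in> {0..1}" "grid k j \<in> {0..1}" "grid k (Suc j) \<in> {0..1}"
    using assms by (auto intro!: grid_in simp del: atLeastAtMost_iff)
  have "inner (ind_cell k i) (ind_cell k j) = min (grid k (Suc i)) (grid k (Suc j)) - min (grid k (Suc i)) (grid k j)
     - (min (grid k i) (grid k (Suc j)) - min (grid k i) (grid k j))"
    unfolding ind_cell_def inner_diff_left inner_diff_right using m by (simp only: inner_ind01_ind01)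
  also have "\<dots> = (if i = j then 1 / 2^k else 0)"
  proof -
    consider "i = j" | "Suc i \<le> j" | "Suc j \<le> i" by linarith
    then show ?thesis
    proof cases
      case 1 then show ?thesis using grid_less[of i "Suc i" k] grid_Suc_diff[of k i] by simp
    next
      case 2
      have "grid k (Suc i) \<le> grid k j" "grid k i < grid k (Suc i)" "grid k j < grid k (Suc j)"
        using 2 by (auto intro: grid_mono grid_less)
      then show ?thesis using 2 by (simp add: min_def)
    next
      case 3
      have "grid k (Suc j) \<le> grid k i" "grid k i < grid k (Suc i)" "grid k j < grid k (Suc j)"
        using 3 by (auto intro: grid_mono grid_less)
      then show ?thesis using 3 by (simp add: min_def)
    qed
  qed
  finally show ?thesis .
qed

lemma inner_dyadic_proj: "inner (dyadic_proj k h) v = (\<Sum>i<2^k. 2^k * inner h (ind_cell k i) * inner v (ind_cell k i))"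
  unfolding dyadic_proj_def inner_sum_left inner_scaleR_left
  by (intro sum.cong refl arg_cong2[where f="(*)"] inner_commute)

lemma inner_dyadic_proj_cell:
  assumes i: "i < 2^k" shows "inner (dyadic_proj k h) (ind_cell k i) = inner h (ind_cell k i)"
proof -
  have "inner (dyadic_proj k h) (ind_cell k i) = (\<Sum>j<2^k. if j = i then inner h (ind_cell k i) else 0)"
    unfolding inner_dyadic_proj using i by (intro sum.cong) (auto simp: inner_ind_cell)
  then show ?thesis using i by simp
qed

lemma inner_dyadic_proj_self: "inner (dyadic_proj k h) (dyadic_proj k h) = inner (dyadic_proj k h) h"
proof -
  have "inner (dyadic_proj k h) (dyadic_proj k h)
      = (\<Sum>i<2^k. 2^k * inner h (ind_cell k i) * inner (dyadic_proj k h) (ind_cell k i))"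
    by (rule inner_dyadic_proj)
  also have "\<dots> = inner (dyadic_proj k h) h"
    unfolding inner_dyadic_proj[of k h h] by (intro sum.cong) (auto simp: inner_dyadic_proj_cell)
  finally show ?thesis .
qed

lemma norm_dyadic_proj_sq: "(norm (dyadic_proj k h))\<^sup>2 = (\<Sum>i<2^k. 2^k * (inner h (ind_cell k i))\<^sup>2)"
proof -
  have "(norm (dyadic_proj k h))\<^sup>2 = inner (dyadic_proj k h) h"
    by (simp only: power2_norm_eq_inner inner_dyadic_proj_self)
  also have "\<dots> = (\<Sum>i<2^k. 2^k * inner h (ind_cell k i) * inner h (ind_cell k i))"
    by (rule inner_dyadic_proj)
  finally show ?thesis by (simp add: power2_eq_square mult.assoc)
qed

lemma norm_dyadic_proj_le: "norm (dyadic_proj k h) \<le> norm h"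
proof -
  have "(norm (dyadic_proj k h))\<^sup>2 \<le> norm (dyadic_proj k h) * norm h"
    unfolding power2_norm_eq_inner inner_dyadic_proj_self by (rule norm_cauchy_schwarz)
  then show ?thesis
    by (cases "norm (dyadic_proj k h) = 0") (auto simp: power2_eq_square)
qed

lemma dyadic_proj_add: "dyadic_proj k (u + v) = dyadic_proj k u + dyadic_proj k v"
  by (simp add: dyadic_proj_def inner_add_left distrib_left scaleR_left_distrib sum.distrib)

lemma dyadic_proj_scaleR: "dyadic_proj k (c *\<^sub>R u) = c *\<^sub>R dyadic_proj k u"
  by (simp add: dyadic_proj_def scaleR_sum_right mult.left_commute)

lemma dyadic_proj_diff: "dyadic_proj k (u - v) = dyadic_proj k u - dyadic_proj k v"
  using dyadic_proj_add[of k u "-1 *\<^sub>R v"] dyadic_proj_scaleR[of k "-1" v] by simp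

lemma dyadic_int_add: "dyadic_int k (u + v) x = dyadic_int k u x + dyadic_int k v x"
  by (simp add: dyadic_int_def inner_add_left distrib_left distrib_right sum.distrib)

lemma dyadic_int_scaleR: "dyadic_int k (c *\<^sub>R u) x = c * dyadic_int k u x"
  by (simp add: dyadic_int_def sum_distrib_left ac_simps)

lemma dyadic_int_0: "dyadic_int k 0 x = 0"
  by (simp add: dyadic_int_def)

lemma dyadic_int_sum: "dyadic_int k (\<Sum>j\<in>J. c j *\<^sub>R u j) x = (\<Sum>j\<in>J. c j * dyadic_int k (u j) x)"
  by (induction J rule: infinite_finite_induct)
    (auto simp: dyadic_int_0 dyadic_int_add dyadic_int_scaleR)

lemma dyadic_int_path:
  assumes "\<And>t. t \<in> {0..1} \<Longrightarrow> x t = primitive w t + c * y t"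
  shows "dyadic_int k h x = inner (dyadic_proj k h) w + c * dyadic_int k h y"
proof -
  have "x (grid k (Suc i)) - x (grid k i) = inner w (ind_cell k i) + c * (y (grid k (Suc i)) - y (grid k i))"
    if "i < 2^k" for i
  proof -
    have "grid k (Suc i) \<in> {0..1}" "grid k i \<in> {0..1}"
      using that by (auto intro!: grid_in simp del: atLeastAtMost_iff)
    then show ?thesis using assms
      by (simp add: primitive_eq_inner ind_cell_def inner_diff_right algebra_simps)
  qed
  then show ?thesis
    unfolding dyadic_int_def inner_dyadic_proj sum_distrib_left sum.distrib[symmetric]
    by (intro sum.cong refl) (simp add: distrib_left)
qed

text \<open>The projection changes the indicator only on the one cell that contains t, which costs
  at most 2^-k in squared norm.\<close>

lemma dyadic_proj_ind01_tendsto: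
  assumes t: "t \<in> {0..1}"
  shows "(\<lambda>k. dyadic_proj k (ind01 t)) \<longlonglongrightarrow> ind01 t"
proof -
  have bound: "(norm (dyadic_proj k (ind01 t) - ind01 t))\<^sup>2 \<le> (1/2)^k" for k
  proof -
    \<comment> \<open>Number of cells that lie entirely to the left of t.\<close>
    define m where "m = nat \<lfloor>t * 2^k\<rfloor>"
    have m1: "real m \<le> t * 2^k" using t by (simp add: m_def)
    have m2: "t * 2^k \<le> real m + 1" using t unfolding m_def by linarith
    have "t * 2^k \<le> 1 * 2^k" using t by (intro mult_right_mono) auto
    then have "real m \<le> real (2^k)" unfolding of_nat_power of_nat_numeral using m1 by linarith
    then have mk: "m \<le> 2^k" by (simp only: of_nat_le_iff)
    have cell: "inner (ind01 t) (ind_cell k i) = 1 / 2^k" if "i < m" for i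
    proof -
      have g: "grid k (Suc i) \<in> {0..1}" "grid k i \<in> {0..1}"
        using that mk by (auto intro!: grid_in simp del: atLeastAtMost_iff)
      have "real (Suc i) \<le> t * 2^k" using that m1 by linarith
      then have le: "grid k (Suc i) \<le> t" by (simp add: grid_def divide_le_eq)
      have "grid k i \<le> t" using le grid_mono[of i "Suc i" k] by simp
      then show ?thesis using le grid_Suc_diff[of k i] unfolding ind_cell_def inner_diff_right
        by (simp only: inner_ind01_ind01[OF t g(1)] inner_ind01_ind01[OF t g(2)] min_absorb2)
    qed
    have "(\<Sum>i<m. 2^k * (inner (ind01 t) (ind_cell k i))\<^sup>2) \<le> (norm (dyadic_proj k (ind01 t)))\<^sup>2"
      unfolding norm_dyadic_proj_sq using mk by (intro sum_mono2) auto
    moreover have "(\<Sum>i<m. 2^k * (inner (ind01 t) (ind_cell k i))\<^sup>2) = real m / 2^k"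
      by (simp add: cell power2_eq_square)
    moreover have "t \<le> real m / 2^k + (1/2)^k"
      using m2 by (simp add: power_divide add_divide_distrib[symmetric] le_divide_eq)
    ultimately have "t - (norm (dyadic_proj k (ind01 t)))\<^sup>2 \<le> (1/2)^k" by linarith
    \<comment> \<open>Pythagoras for an orthogonal projection, with \<open>ind01 t\<close> of
      squared norm t.\<close>
    moreover have "(norm (dyadic_proj k (ind01 t) - ind01 t))\<^sup>2 = t - (norm (dyadic_proj k (ind01 t)))\<^sup>2"
      using inner_dyadic_proj_self[of k "ind01 t"] inner_ind01_ind01[OF t t]
      unfolding power2_norm_eq_inner inner_diff_left inner_diff_right
      by (simp add: inner_commute)
    ultimately show ?thesis by simp
  qed
  have "(\<lambda>k. (norm (dyadic_proj k (ind01 t) - ind01 t))\<^sup>2) \<longlonglongrightarrow> 0"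
  proof (rule tendsto_sandwich[where f="\<lambda>_. 0" and h="\<lambda>k. (1/2)^k"])
    show "\<forall>\<^sub>F k in sequentially. (norm (dyadic_proj k (ind01 t) - ind01 t))\<^sup>2 \<le> (1/2)^k"
      by (intro always_eventually allI bound)
    show "(\<lambda>k. (1/2 :: real)^k) \<longlonglongrightarrow> 0" by (rule LIMSEQ_power_zero) simp
  qed (auto intro: tendsto_const)
  then have "(\<lambda>k. sqrt ((norm (dyadic_proj k (ind01 t) - ind01 t))\<^sup>2)) \<longlonglongrightarrow> sqrt 0"
    by (rule tendsto_real_sqrt)
  then have "(\<lambda>k. norm (dyadic_proj k (ind01 t) - ind01 t)) \<longlonglongrightarrow> 0" by simp
  then show ?thesis by (rule LIM_zero_cancel[OF tendsto_norm_zero_cancel])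
qed

text \<open>Projections are contractions, so convergence on the dense span of indicators extends to
  the whole space by an e/3 argument.\<close>

lemma dyadic_proj_tendsto: "(\<lambda>k. dyadic_proj k h) \<longlonglongrightarrow> h"
proof (rule metric_LIMSEQ_I)
  fix e :: real assume e: "0 < e"
  have span: "(\<lambda>k. dyadic_proj k s) \<longlonglongrightarrow> s" if "s \<in> span (ind01 ` {0..1})" for s
    using that
  proof (induction rule: span_induct_alt)
    case base
    have "dyadic_proj k 0 = 0" for k using dyadic_proj_scaleR[of k 0 0] by simp
    then show ?case by simp
  next
    case (step c x y)
    then show ?case unfolding dyadic_proj_add dyadic_proj_scaleR
      by (intro tendsto_intros) (auto intro: dyadic_proj_ind01_tendsto)
  qed
  have "h \<in> closure (span (ind01 ` {0..1}))" by (simp add: dense_ind01)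
  moreover have "0 < e / 3" using e by simp
  ultimately have "\<exists>s\<in>span (ind01 ` {0..1}). dist s h < e / 3"
    unfolding closure_approachable by blast
  then obtain s where s: "s \<in> span (ind01 ` {0..1})" "dist s h < e / 3" by blast
  obtain N where N: "\<And>k. k \<ge> N \<Longrightarrow> dist (dyadic_proj k s) s < e / 3"
    using metric_LIMSEQ_D[OF span[OF s(1)], of "e/3"] e by auto
  have "dist (dyadic_proj k h) h < e" if "k \<ge> N" for k
  proof -
    have "dist (dyadic_proj k h) (dyadic_proj k s) \<le> dist h s"
      unfolding dist_norm dyadic_proj_diff[symmetric] by (rule norm_dyadic_proj_le)
    then show ?thesis
      using N[OF that] s(2) dist_triangle[of "dyadic_proj k h" h "dyadic_proj k s"]
        dist_triangle[of "dyadic_proj k s" h s] by (simp add: dist_commute)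
  qed
  then show "\<exists>N. \<forall>k\<ge>N. dist (dyadic_proj k h) h < e" by blast
qed

section \<open>Brownian motion on the dyadic grid and the isometry\<close>

context brownian_motion
begin

lemma B_measurable [measurable (raw)]: "0 \<le> t \<Longrightarrow> t \<le> 1 \<Longrightarrow> B t \<in> borel_measurable M"
  by (rule measurable_B) simp

definition cell_incr :: "nat \<Rightarrow> nat \<Rightarrow> 'o \<Rightarrow> real" where
  "cell_incr k i \<omega> = B (grid k (Suc i)) \<omega> - B (grid k i) \<omega>"

lemma grid_meas: "i \<le> 2^k \<Longrightarrow> B (grid k i) \<in> borel_measurable M"
  by (rule measurable_B) (rule grid_in)

lemma cell_incr_measurable: "i < 2^k \<Longrightarrow> cell_incr k i \<in> borel_measurable M"
  unfolding cell_incr_def[abs_def] by (intro borel_measurable_diff grid_meas) auto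

lemma indep_cell_incr: "indep_vars (\<lambda>_. borel) (cell_incr k) {..<2^k}"
  unfolding cell_incr_def[abs_def]
proof (rule independent_increments)
  show "mono_on {..2^k} (grid k)" by (auto intro: mono_onI grid_mono)
  show "grid k ` {..2^k} \<subseteq> {0..1}" by (auto simp del: atLeastAtMost_iff intro!: grid_in)
qed

lemma distributed_cell_incr_scaled:
  assumes i: "i < 2^k"
  shows "distributed M lborel (\<lambda>\<omega>. sqrt (2^k) * cell_incr k i \<omega>) std_normal_density"
proof -
  have g: "0 \<le> grid k i" "grid k (Suc i) \<le> 1"
    using grid_in[of i k] grid_in[of "Suc i" k] i by auto
  have "distributed M lborel (cell_incr k i) (normal_density 0 (sqrt (1 / 2^k)))"
    using normal_increments[OF g(1) grid_less[of i "Suc i" k] g(2)]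
    unfolding cell_incr_def[abs_def] grid_Suc_diff by simp
  then have "distributed M lborel (\<lambda>\<omega>. (cell_incr k i \<omega> - 0) / sqrt (1 / 2^k)) std_normal_density"
    by (subst (asm) normal_standard_normal_convert) auto
  then show ?thesis by (simp add: real_sqrt_divide mult.commute)
qed

lemma distr_cell_incr_scaled:
  assumes "i < 2^k"
  shows "distr M borel (\<lambda>\<omega>. sqrt (2^k) * cell_incr k i \<omega>) = std_normal_distribution"
  using distributed_distr_eq_density[OF distributed_cell_incr_scaled[OF assms]]
  by (metis distr_cong sets_lborel)

lemma indep_cell_incr_scaled: "indep_vars (\<lambda>_. borel) (\<lambda>i \<omega>. sqrt (2^k) * cell_incr k i \<omega>) {..<2^k}"
  by (rule indep_vars_compose2[OF indep_cell_incr]) measurable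

lemma distr_cell_incr_PiM:
  "distr M (PiM {..<2^k} (\<lambda>_. borel)) (\<lambda>\<omega>. \<lambda>i\<in>{..<2^k}. sqrt (2^k) * cell_incr k i \<omega>)
    = PiM {..<2^k} (\<lambda>_. std_normal_distribution)"
proof -
  have "distr M (PiM {..<2^k} (\<lambda>_. borel)) (\<lambda>\<omega>. \<lambda>i\<in>{..<2^k}. sqrt (2^k) * cell_incr k i \<omega>)
    = PiM {..<2^k} (\<lambda>i. distr M borel (\<lambda>\<omega>. sqrt (2^k) * cell_incr k i \<omega>))"
    using indep_cell_incr_scaled[of k]
    by (subst (asm) indep_vars_iff_distr_eq_PiM')
      (auto simp: lessThan_empty_iff intro!: borel_measurable_times cell_incr_measurable)
  also have "\<dots> = PiM {..<2^k} (\<lambda>_. std_normal_distribution)"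
    by (intro PiM_cong) (auto simp: distr_cell_incr_scaled)
  finally show ?thesis .
qed

abbreviation "Bpath \<omega> \<equiv> (\<lambda>t. B t \<omega>)"

lemma dyadic_int_path_eq:
  "dyadic_int k h (Bpath \<omega>) = (\<Sum>i<2^k. sqrt (2^k) * inner h (ind_cell k i) * (sqrt (2^k) * cell_incr k i \<omega>))"
  unfolding dyadic_int_def cell_incr_def by (intro sum.cong refl) (simp add: algebra_simps)

lemma dyadic_int_measurable [measurable]: "(\<lambda>\<omega>. dyadic_int k h (Bpath \<omega>)) \<in> borel_measurable M"
  unfolding dyadic_int_path_eq
  by (intro borel_measurable_sum borel_measurable_times borel_measurable_const cell_incr_measurable) auto

lemma char_dyadic_int:
  "(CLINT \<omega>|M. iexp (dyadic_int k h (Bpath \<omega>))) = complex_of_real (exp (- (norm (dyadic_proj k h))\<^sup>2 / 2))"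
proof -
  define c where "c i = sqrt (2^k) * inner h (ind_cell k i)" for i
  define N where "N i \<omega> = sqrt (2^k) * cell_incr k i \<omega>" for i \<omega>
  have N[measurable]: "N i \<in> borel_measurable M" if "i < 2^k" for i
    unfolding N_def[abs_def] using cell_incr_measurable[OF that] by measurable
  have "(CLINT \<omega>|M. iexp (dyadic_int k h (Bpath \<omega>))) = char (distr M borel (\<lambda>\<omega>. \<Sum>i<2^k. c i * N i \<omega>)) 1"
    unfolding char_def dyadic_int_path_eq c_def N_def
    by (subst integral_distr) (auto intro!: borel_measurable_sum cell_incr_measurable borel_measurable_times)
  also have "\<dots> = (\<Prod>i<2^k. char (distr M borel (\<lambda>\<omega>. c i * N i \<omega>)) 1)"
    unfolding N_def by (rule char_distr_sum) (rule indep_vars_compose2[OF indep_cell_incr], measurable)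
  also have "\<dots> = (\<Prod>i<2^k. complex_of_real (exp (- (c i)\<^sup>2 / 2)))"
  proof (intro prod.cong refl)
    fix i :: nat assume "i \<in> {..<2^k}"
    then have i: "i < 2^k" by simp
    have "char (distr M borel (\<lambda>\<omega>. c i * N i \<omega>)) 1 = char (distr M borel (N i)) (c i)"
      unfolding char_def using N[OF i] by (simp add: integral_distr)
    also have "distr M borel (N i) = std_normal_distribution"
      unfolding N_def[abs_def] by (rule distr_cell_incr_scaled[OF i])
    finally show "char (distr M borel (\<lambda>\<omega>. c i * N i \<omega>)) 1 = complex_of_real (exp (- (c i)\<^sup>2 / 2))"
      by (simp add: char_std_normal_distribution)
  qed
  also have "\<dots> = complex_of_real (exp (\<Sum>i<2^k. - (c i)\<^sup>2 / 2))"
    by (simp add: exp_sum)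
  also have "(\<Sum>i<2^k. - (c i)\<^sup>2 / 2) = - (norm (dyadic_proj k h))\<^sup>2 / 2"
    unfolding norm_dyadic_proj_sq by (simp add: c_def power_mult_distrib sum_negf sum_divide_distrib)
  finally show ?thesis .
qed

lemma second_moment_B:
  assumes "0 \<le> s" "s \<le> t" "t \<le> 1"
  shows "integrable M (\<lambda>\<omega>. (B s \<omega> - B 0 \<omega>) * (B t \<omega> - B 0 \<omega>))" (is ?I)
    and "(\<integral>\<omega>. (B s \<omega> - B 0 \<omega>) * (B t \<omega> - B 0 \<omega>) \<partial>M) = s" (is ?E)
proof -
  have var: "integrable M (\<lambda>\<omega>. (B b \<omega> - B a \<omega>)\<^sup>2) \<and> (\<integral>\<omega>. (B b \<omega> - B a \<omega>)\<^sup>2 \<partial>M) = b - a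
     \<and> integrable M (\<lambda>\<omega>. B b \<omega> - B a \<omega>) \<and> (\<integral>\<omega>. B b \<omega> - B a \<omega> \<partial>M) = 0"
    if ab: "0 \<le> a" "a \<le> b" "b \<le> 1" for a b
  proof (cases "a = b")
    case False
    then have ab': "a < b" using ab by simp
    note d = normal_increments[OF ab(1) ab' ab(3)]
    have sd: "0 < sqrt (b - a)" using ab' by simp
    have i1: "integrable M (\<lambda>\<omega>. B b \<omega> - B a \<omega>)"
      using integrable_normal_moment[OF sd, of 0 1] by (subst distributed_integrable[OF d, of "\<lambda>x. x", symmetric]) (auto simp: mult.commute)
    have i2: "integrable M (\<lambda>\<omega>. (B b \<omega> - B a \<omega>)\<^sup>2)"
      using integrable_normal_moment[OF sd, of 0 2] by (subst distributed_integrable[OF d, of "\<lambda>x. x\<^sup>2", symmetric]) (auto simp: mult.commute)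
    have e: "(\<integral>\<omega>. B b \<omega> - B a \<omega> \<partial>M) = 0"
      by (rule normal_distributed_expectation[OF sd d])
    have "variance (\<lambda>\<omega>. B b \<omega> - B a \<omega>) = (sqrt (b - a))\<^sup>2"
      by (rule normal_distributed_variance[OF sd d])
    then have "(\<integral>\<omega>. (B b \<omega> - B a \<omega>)\<^sup>2 \<partial>M) = b - a" using e ab' by simp
    then show ?thesis using i1 i2 e by blast
  qed simp
  define X Y where "X \<omega> = B s \<omega> - B 0 \<omega>" and "Y \<omega> = B t \<omega> - B s \<omega>" for \<omega>
  \<comment> \<open>The partition 0, s, t, whose two increments are X and Y. Working with B_t - B_0
    keeps the identities exact, since B_0 = 0 holds only almost surely.\<close>
  define \<tau> :: "nat \<Rightarrow> real" where "\<tau> i = (if i = 0 then 0 else if i = 1 then s else t)" for i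
  have "indep_vars (\<lambda>_. borel) (\<lambda>i \<omega>. B (\<tau> (Suc i)) \<omega> - B (\<tau> i) \<omega>) {..<2}"
    by (rule independent_increments) (use assms in \<open>auto simp: \<tau>_def mono_on_def\<close>)
  moreover have "{..<2} = insert 0 {1::nat}" by auto
  ultimately have "indep_var borel (\<lambda>\<omega>. B (\<tau> (Suc 0)) \<omega> - B (\<tau> 0) \<omega>)
      borel (\<lambda>\<omega>. \<Sum>i\<in>{1}. B (\<tau> (Suc i)) \<omega> - B (\<tau> i) \<omega>)"
    by (intro indep_vars_sum) auto
  then have ind: "indep_var borel X borel Y" by (simp add: \<tau>_def X_def[abs_def] Y_def[abs_def])
  have X: "integrable M (\<lambda>\<omega>. (X \<omega>)\<^sup>2)" "(\<integral>\<omega>. (X \<omega>)\<^sup>2 \<partial>M) = s" "integrable M X" "(\<integral>\<omega>. X \<omega> \<partial>M) = 0"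
    using var[of 0 s] assms by (auto simp: X_def[abs_def])
  have Y: "integrable M Y" "(\<integral>\<omega>. Y \<omega> \<partial>M) = 0"
    using var[of s t] assms by (auto simp: Y_def[abs_def])
  have XY: "integrable M (\<lambda>\<omega>. X \<omega> * Y \<omega>)" "(\<integral>\<omega>. X \<omega> * Y \<omega> \<partial>M) = 0"
    using indep_var_integrable[OF ind X(3) Y(1)] indep_var_lebesgue_integral[OF ind X(3) Y(1)] X(4) by auto
  have eq: "(B s \<omega> - B 0 \<omega>) * (B t \<omega> - B 0 \<omega>) = (X \<omega>)\<^sup>2 + X \<omega> * Y \<omega>" for \<omega>
    by (simp add: X_def Y_def power2_eq_square algebra_simps)
  show ?I unfolding eq using X(1) XY(1) by (rule Bochner_Integration.integrable_add)
  show ?E unfolding eq using X XY by simp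
qed

lemma second_moment_B_inner:
  assumes "s \<in> {0..1}" "t \<in> {0..1}"
  shows "integrable M (\<lambda>\<omega>. (B s \<omega> - B 0 \<omega>) * (B t \<omega> - B 0 \<omega>))"
    and "(\<integral>\<omega>. (B s \<omega> - B 0 \<omega>) * (B t \<omega> - B 0 \<omega>) \<partial>M) = inner (ind01 s) (ind01 t)"
proof -
  show "integrable M (\<lambda>\<omega>. (B s \<omega> - B 0 \<omega>) * (B t \<omega> - B 0 \<omega>))"
    using second_moment_B(1)[of s t] second_moment_B(1)[of t s] assms
    by (cases "s \<le> t") (auto simp: mult.commute)
  show "(\<integral>\<omega>. (B s \<omega> - B 0 \<omega>) * (B t \<omega> - B 0 \<omega>) \<partial>M) = inner (ind01 s) (ind01 t)"
    using second_moment_B(2)[of s t] second_moment_B(2)[of t s] assms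
    by (cases "s \<le> t") (auto simp: mult.commute inner_ind01_ind01 min_def)
qed

lemma second_moment_cell_incr:
  assumes "i < 2^k" "j < 2^m"
  shows "integrable M (\<lambda>\<omega>. cell_incr k i \<omega> * cell_incr m j \<omega>)"
    and "(\<integral>\<omega>. cell_incr k i \<omega> * cell_incr m j \<omega> \<partial>M) = inner (ind_cell k i) (ind_cell m j)"
proof -
  have g: "grid k i \<in> {0..1}" "grid k (Suc i) \<in> {0..1}" "grid m j \<in> {0..1}" "grid m (Suc j) \<in> {0..1}"
    using assms by (auto intro!: grid_in simp del: atLeastAtMost_iff)
  define W where "W t \<omega> = B t \<omega> - B 0 \<omega>" for t \<omega>
  have eq: "cell_incr k i \<omega> * cell_incr m j \<omega>
     = W (grid k (Suc i)) \<omega> * W (grid m (Suc j)) \<omega> - W (grid k (Suc i)) \<omega> * W (grid m j) \<omega>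
       - (W (grid k i) \<omega> * W (grid m (Suc j)) \<omega> - W (grid k i) \<omega> * W (grid m j) \<omega>)" for \<omega>
    by (simp add: W_def cell_incr_def algebra_simps)
  note I = second_moment_B_inner(1)[folded W_def] and E = second_moment_B_inner(2)[folded W_def]
  show "integrable M (\<lambda>\<omega>. cell_incr k i \<omega> * cell_incr m j \<omega>)"
    unfolding eq by (intro Bochner_Integration.integrable_diff I g)
  show "(\<integral>\<omega>. cell_incr k i \<omega> * cell_incr m j \<omega> \<partial>M) = inner (ind_cell k i) (ind_cell m j)"
    unfolding eq ind_cell_def inner_diff_left inner_diff_right
    using I[OF g(2) g(4)] I[OF g(2) g(3)] I[OF g(1) g(4)] I[OF g(1) g(3)]
    by (simp add: E[OF g(2) g(4)] E[OF g(2) g(3)] E[OF g(1) g(4)] E[OF g(1) g(3)])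
qed

text \<open>An isometry across two levels, obtained bilinearly from the covariance of B. Mixed
  moments are what makes the difference of two levels computable in
  \<open>dyadic_int_diff_sq\<close>.\<close>

lemma second_moment_dyadic_int:
  shows "integrable M (\<lambda>\<omega>. dyadic_int k h (Bpath \<omega>) * dyadic_int m h (Bpath \<omega>))"
    and "(\<integral>\<omega>. dyadic_int k h (Bpath \<omega>) * dyadic_int m h (Bpath \<omega>) \<partial>M) = inner (dyadic_proj k h) (dyadic_proj m h)"
proof -
  define c where "c k i = 2^k * inner h (ind_cell k i)" for k i
  have eq: "dyadic_int k h (Bpath \<omega>) * dyadic_int m h (Bpath \<omega>)
      = (\<Sum>i<2^k. \<Sum>j<2^m. (c k i * c m j) * (cell_incr k i \<omega> * cell_incr m j \<omega>))" for \<omega>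
    unfolding dyadic_int_def sum_product c_def cell_incr_def by (intro sum.cong refl) (simp add: ac_simps)
  have int: "integrable M (\<lambda>\<omega>. (c k i * c m j) * (cell_incr k i \<omega> * cell_incr m j \<omega>))"
    if "i < 2^k" "j < 2^m" for i j
    by (intro integrable_mult_right second_moment_cell_incr that)
  show "integrable M (\<lambda>\<omega>. dyadic_int k h (Bpath \<omega>) * dyadic_int m h (Bpath \<omega>))"
    unfolding eq by (intro Bochner_Integration.integrable_sum int) auto
  have "(\<integral>\<omega>. dyadic_int k h (Bpath \<omega>) * dyadic_int m h (Bpath \<omega>) \<partial>M)
      = (\<Sum>i<2^k. \<Sum>j<2^m. (c k i * c m j) * inner (ind_cell k i) (ind_cell m j))"
    unfolding eq
    by (subst Bochner_Integration.integral_sum, (intro Bochner_Integration.integrable_sum int; simp),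
        intro sum.cong refl, subst Bochner_Integration.integral_sum, (intro int; simp), intro sum.cong refl)
      (simp add: second_moment_cell_incr)
  also have "\<dots> = inner (dyadic_proj k h) (dyadic_proj m h)"
    unfolding dyadic_proj_def inner_sum_left inner_sum_right c_def
    by (subst sum.swap) (simp add: ac_simps)
  finally show "(\<integral>\<omega>. dyadic_int k h (Bpath \<omega>) * dyadic_int m h (Bpath \<omega>) \<partial>M)
    = inner (dyadic_proj k h) (dyadic_proj m h)" .
qed

lemma dyadic_int_diff_sq:
  "(\<integral>\<^sup>+\<omega>. ennreal ((dyadic_int k h (Bpath \<omega>) - dyadic_int m h (Bpath \<omega>))\<^sup>2) \<partial>M)
    = ennreal ((norm (dyadic_proj k h - dyadic_proj m h))\<^sup>2)"
proof -
  let ?I = "\<lambda>k \<omega>. dyadic_int k h (Bpath \<omega>)"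
  have eq: "(?I k \<omega> - ?I m \<omega>)\<^sup>2 = ?I k \<omega> * ?I k \<omega> - 2 * (?I k \<omega> * ?I m \<omega>) + ?I m \<omega> * ?I m \<omega>" for \<omega>
    by (simp add: power2_eq_square algebra_simps)
  have int: "integrable M (\<lambda>\<omega>. (?I k \<omega> - ?I m \<omega>)\<^sup>2)"
    unfolding eq by (intro Bochner_Integration.integrable_add Bochner_Integration.integrable_diff
      integrable_mult_right second_moment_dyadic_int)
  have "(\<integral>\<omega>. (?I k \<omega> - ?I m \<omega>)\<^sup>2 \<partial>M) = (norm (dyadic_proj k h - dyadic_proj m h))\<^sup>2"
    unfolding eq power2_norm_eq_inner inner_diff_left inner_diff_right
    using second_moment_dyadic_int[of k h k] second_moment_dyadic_int[of k h m] second_moment_dyadic_int[of m h m]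
    by (simp add: inner_commute)
  then show ?thesis using nn_integral_eq_integral[OF int] by simp
qed

text \<open>The dyadic sums converge in mean square; a subsequence \<open>\<kappa>\<close> that works for finitely many
  integrands makes the stochastic integral a measurable function of the path.\<close>

definition admissible :: "(nat \<Rightarrow> nat) \<Rightarrow> L2 \<Rightarrow> bool" where
  "admissible \<kappa> h \<longleftrightarrow> (AE \<omega> in M. convergent (\<lambda>j. dyadic_int (\<kappa> j) h (Bpath \<omega>)))"

lemma ex_admissible:
  assumes F: "finite F"
  shows "\<exists>\<kappa>. filterlim \<kappa> at_top sequentially \<and> (\<forall>h\<in>F. admissible \<kappa> h)"
proof -
  have ev: "\<forall>\<^sub>F N in sequentially. \<forall>k\<ge>N. norm (dyadic_proj k h - h) \<le> e" if e: "0 < e" for e h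
  proof -
    obtain N where "\<And>k. k \<ge> N \<Longrightarrow> dist (dyadic_proj k h) h < e"
      using metric_LIMSEQ_D[OF dyadic_proj_tendsto e] by blast
    then show ?thesis
      by (intro eventually_sequentiallyI[of N]) (auto simp: dist_norm intro!: less_imp_le)
  qed
  have "\<exists>N\<ge>j. \<forall>h\<in>F. \<forall>k\<ge>N. norm (dyadic_proj k h - h) \<le> sqrt ((1/8)^j) / 2" for j
  proof -
    have "\<forall>\<^sub>F N in sequentially. \<forall>h\<in>F. \<forall>k\<ge>N. norm (dyadic_proj k h - h) \<le> sqrt ((1/8)^j) / 2"
      using F by (intro eventually_ball_finite ballI ev) auto
    then have "\<forall>\<^sub>F N in sequentially. N \<ge> j \<and> (\<forall>h\<in>F. \<forall>k\<ge>N. norm (dyadic_proj k h - h) \<le> sqrt ((1/8)^j) / 2)"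
      using eventually_ge_at_top[of j] by eventually_elim blast
    then obtain N where "N \<ge> j \<and> (\<forall>h\<in>F. \<forall>k\<ge>N. norm (dyadic_proj k h - h) \<le> sqrt ((1/8)^j) / 2)"
      using eventually_happens'[OF sequentially_bot] by blast
    then show ?thesis by blast
  qed
  then obtain \<kappa>0 where k0: "\<And>j. \<kappa>0 j \<ge> j" "\<And>j h k. h \<in> F \<Longrightarrow> k \<ge> \<kappa>0 j \<Longrightarrow> norm (dyadic_proj k h - h) \<le> sqrt ((1/8)^j) / 2"
    by metis
  \<comment> \<open>Partial sums dominate every earlier \<open>\<kappa>0 j\<close>, so both
    \<open>\<kappa> j\<close> and \<open>\<kappa> (Suc j)\<close> meet the accuracy of level j. The
    factor 1/2 in that accuracy is for the triangle inequality between the two.\<close>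
  define \<kappa> where "\<kappa> j = (\<Sum>i\<le>j. \<kappa>0 i)" for j
  have ge: "\<kappa> i \<ge> \<kappa>0 j" if "j \<le> i" for i j
    unfolding \<kappa>_def using that by (intro member_le_sum) auto
  have lim: "filterlim \<kappa> at_top sequentially"
    by (rule filterlim_at_top_mono[OF filterlim_ident])
      (auto intro!: always_eventually order_trans[OF k0(1) ge])
  have "admissible \<kappa> h" if h: "h \<in> F" for h
    unfolding admissible_def
  proof (rule AE_convergent_of_L2_steps)
    fix j
    have "norm (dyadic_proj (\<kappa> (Suc j)) h - dyadic_proj (\<kappa> j) h)
        \<le> norm (dyadic_proj (\<kappa> (Suc j)) h - h) + norm (dyadic_proj (\<kappa> j) h - h)"
      using norm_triangle_ineq4[of "dyadic_proj (\<kappa> (Suc j)) h - h" "dyadic_proj (\<kappa> j) h - h"] by simp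
    also have "\<dots> \<le> sqrt ((1/8)^j) / 2 + sqrt ((1/8)^j) / 2"
      by (intro add_mono k0(2) h ge) auto
    finally have "(norm (dyadic_proj (\<kappa> (Suc j)) h - dyadic_proj (\<kappa> j) h))\<^sup>2 \<le> (sqrt ((1/8)^j))\<^sup>2"
      by (intro power_mono) auto
    then show "(\<integral>\<^sup>+\<omega>. ennreal ((dyadic_int (\<kappa> (Suc j)) h (Bpath \<omega>) - dyadic_int (\<kappa> j) h (Bpath \<omega>))\<^sup>2) \<partial>M)
        \<le> ennreal ((1/8)^j)"
      unfolding dyadic_int_diff_sq by (intro ennreal_leI) simp
  qed measurable
  then show ?thesis using lim by blast
qed

lemma admissible_sum:
  assumes J: "finite J" and h: "\<And>j. j \<in> J \<Longrightarrow> admissible \<kappa> (h j)"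
  shows "admissible \<kappa> (\<Sum>j\<in>J. c j *\<^sub>R h j)"
proof -
  have "AE \<omega> in M. \<forall>j\<in>J. convergent (\<lambda>i. dyadic_int (\<kappa> i) (h j) (Bpath \<omega>))"
    using J h by (simp add: AE_finite_all admissible_def)
  then show ?thesis unfolding admissible_def
  proof eventually_elim
    case (elim \<omega>)
    then show ?case unfolding dyadic_int_sum
      by (intro convergent_sum convergent_mult convergent_const) auto
  qed
qed

end

text \<open>A pathwise limit, hence a measurable function of the path with no reference to the
  probability space. Where the sums diverge \<open>lim\<close> has an arbitrary value; for
  admissible h this concerns only a null set of Brownian paths.\<close>

definition wiener_int :: "(nat \<Rightarrow> nat) \<Rightarrow> L2 \<Rightarrow> (real \<Rightarrow> real) \<Rightarrow> real" where
  "wiener_int \<kappa> h x = lim (\<lambda>j. dyadic_int (\<kappa> j) h x)"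

context brownian_motion
begin

lemma wiener_int_tendsto:
  assumes "admissible \<kappa> h"
  shows "AE \<omega> in M. (\<lambda>j. dyadic_int (\<kappa> j) h (Bpath \<omega>)) \<longlonglongrightarrow> wiener_int \<kappa> h (Bpath \<omega>)"
  using assms unfolding admissible_def wiener_int_def by (auto simp: convergent_LIMSEQ_iff)

lemma wiener_int_measurable [measurable]: "(\<lambda>\<omega>. wiener_int \<kappa> h (Bpath \<omega>)) \<in> borel_measurable M"
  unfolding wiener_int_def by measurable

lemma wiener_int_sum:
  assumes J: "finite J" and h: "\<And>j. j \<in> J \<Longrightarrow> admissible \<kappa> (h j)"
  shows "AE \<omega> in M. wiener_int \<kappa> (\<Sum>j\<in>J. c j *\<^sub>R h j) (Bpath \<omega>) = (\<Sum>j\<in>J. c j * wiener_int \<kappa> (h j) (Bpath \<omega>))"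
proof -
  have "AE \<omega> in M. \<forall>j\<in>J. (\<lambda>i. dyadic_int (\<kappa> i) (h j) (Bpath \<omega>)) \<longlonglongrightarrow> wiener_int \<kappa> (h j) (Bpath \<omega>)"
    using J h wiener_int_tendsto by (simp add: AE_finite_all)
  then show ?thesis
  proof eventually_elim
    case (elim \<omega>)
    then have "(\<lambda>i. \<Sum>j\<in>J. c j * dyadic_int (\<kappa> i) (h j) (Bpath \<omega>)) \<longlonglongrightarrow> (\<Sum>j\<in>J. c j * wiener_int \<kappa> (h j) (Bpath \<omega>))"
      by (intro tendsto_intros) auto
    then show ?case unfolding wiener_int_def dyadic_int_sum by (rule limI)
  qed
qed

lemma char_wiener_int:
  assumes \<kappa>: "filterlim \<kappa> at_top sequentially" and h: "admissible \<kappa> h"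
  shows "(CLINT \<omega>|M. iexp (wiener_int \<kappa> h (Bpath \<omega>))) = complex_of_real (exp (- (norm h)\<^sup>2 / 2))"
proof (rule LIMSEQ_unique)
  show "(\<lambda>j. CLINT \<omega>|M. iexp (dyadic_int (\<kappa> j) h (Bpath \<omega>))) \<longlonglongrightarrow> (CLINT \<omega>|M. iexp (wiener_int \<kappa> h (Bpath \<omega>)))"
  proof (rule integral_dominated_convergence[where w="\<lambda>_. 1"])
    show "AE \<omega> in M. (\<lambda>j. iexp (dyadic_int (\<kappa> j) h (Bpath \<omega>))) \<longlonglongrightarrow> iexp (wiener_int \<kappa> h (Bpath \<omega>))"
      using wiener_int_tendsto[OF h] by eventually_elim (intro tendsto_intros)
  qed auto
  have "(\<lambda>j. dyadic_proj (\<kappa> j) h) \<longlonglongrightarrow> h"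
    using dyadic_proj_tendsto \<kappa> by (rule filterlim_compose)
  then show "(\<lambda>j. CLINT \<omega>|M. iexp (dyadic_int (\<kappa> j) h (Bpath \<omega>))) \<longlonglongrightarrow> complex_of_real (exp (- (norm h)\<^sup>2 / 2))"
    unfolding char_dyadic_int by (intro tendsto_intros) auto
qed

text \<open>A linear combination of the integrals is almost surely the integral of the combination,
  so its characteristic function is known from \<open>char_wiener_int\<close>, and orthonormality
  turns the norm into the sum of the squared frequencies.\<close>

lemma distr_wiener_int_PiM:
  fixes \<psi> :: "'i \<Rightarrow> L2"
  assumes \<kappa>: "filterlim \<kappa> at_top sequentially" and J: "finite J"
    and adm: "\<And>j. j \<in> J \<Longrightarrow> admissible \<kappa> (\<psi> j)"
    and ortho: "\<And>i j. i \<in> J \<Longrightarrow> j \<in> J \<Longrightarrow> inner (\<psi> i) (\<psi> j) = (if i = j then 1 else 0)"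
  shows "distr M (PiM J (\<lambda>_. borel)) (\<lambda>\<omega>. \<lambda>j\<in>J. wiener_int \<kappa> (\<psi> j) (Bpath \<omega>)) = PiM J (\<lambda>_. std_normal_distribution)"
proof (rule distr_eq_PiM_std_normal[OF J])
  fix t :: "'i \<Rightarrow> real"
  have "(CLINT \<omega>|M. iexp (\<Sum>j\<in>J. t j * wiener_int \<kappa> (\<psi> j) (Bpath \<omega>)))
      = (CLINT \<omega>|M. iexp (wiener_int \<kappa> (\<Sum>j\<in>J. t j *\<^sub>R \<psi> j) (Bpath \<omega>)))"
  proof (rule integral_cong_AE)
    have "AE \<omega> in M. wiener_int \<kappa> (\<Sum>j\<in>J. t j *\<^sub>R \<psi> j) (Bpath \<omega>) = (\<Sum>j\<in>J. t j * wiener_int \<kappa> (\<psi> j) (Bpath \<omega>))"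
      by (rule wiener_int_sum[OF J adm])
    then show "AE \<omega> in M. iexp (\<Sum>j\<in>J. t j * wiener_int \<kappa> (\<psi> j) (Bpath \<omega>))
        = iexp (wiener_int \<kappa> (\<Sum>j\<in>J. t j *\<^sub>R \<psi> j) (Bpath \<omega>))"
      by eventually_elim simp
  qed measurable
  also have "\<dots> = complex_of_real (exp (- (norm (\<Sum>j\<in>J. t j *\<^sub>R \<psi> j))\<^sup>2 / 2))"
    by (intro char_wiener_int \<kappa> admissible_sum J adm)
  also have "(norm (\<Sum>j\<in>J. t j *\<^sub>R \<psi> j))\<^sup>2 = (\<Sum>j\<in>J. (t j)\<^sup>2)"
    unfolding power2_norm_eq_inner inner_sum_left inner_sum_right
  proof (rule sum.cong[OF refl])
    fix i assume i: "i \<in> J"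
    have "(\<Sum>j\<in>J. inner (t j *\<^sub>R \<psi> j) (t i *\<^sub>R \<psi> i)) = (\<Sum>j\<in>J. if j = i then (t i)\<^sup>2 else 0)"
      using i by (intro sum.cong) (auto simp: ortho power2_eq_square)
    then show "(\<Sum>j\<in>J. inner (t j *\<^sub>R \<psi> j) (t i *\<^sub>R \<psi> i)) = (t i)\<^sup>2" using J i by simp
  qed
  finally show "(CLINT \<omega>|M. iexp (\<Sum>j\<in>J. t j * wiener_int \<kappa> (\<psi> j) (Bpath \<omega>)))
      = complex_of_real (exp (- (\<Sum>j\<in>J. (t j)\<^sup>2) / 2))" .
qed measurable

end

section \<open>Gaussian shifts in finite dimension\<close>

lemma nn_integral_std_normal_shift:
  assumes [measurable]: "f \<in> borel_measurable borel"
  shows "(\<integral>\<^sup>+z. f (z + a) \<partial>std_normal_distribution)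
    = (\<integral>\<^sup>+z. f z * ennreal (exp (a * z - a\<^sup>2 / 2)) \<partial>std_normal_distribution)"
proof -
  have eq: "std_normal_density (z - a) = std_normal_density z * exp (a * z - a\<^sup>2 / 2)" for z
    by (simp add: normal_density_def exp_add[symmetric] power2_diff field_simps)
  have "(\<integral>\<^sup>+z. f (z + a) \<partial>std_normal_distribution) = (\<integral>\<^sup>+z. ennreal (std_normal_density z) * f (z + a) \<partial>lborel)"
    by (subst nn_integral_density) auto
  also have "\<dots> = (\<integral>\<^sup>+z. ennreal (std_normal_density (- a + 1 * z)) * f (- a + 1 * z + a) \<partial>lborel)"
    by (subst nn_integral_real_affine[where c=1 and t="- a"]) auto
  also have "\<dots> = (\<integral>\<^sup>+z. ennreal (std_normal_density z) * (f z * ennreal (exp (a * z - a\<^sup>2 / 2))) \<partial>lborel)"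
    using eq by (intro nn_integral_cong) (simp add: ennreal_mult mult.commute mult.left_commute)
  also have "\<dots> = (\<integral>\<^sup>+z. f z * ennreal (exp (a * z - a\<^sup>2 / 2)) \<partial>std_normal_distribution)"
    by (subst nn_integral_density) auto
  finally show ?thesis .
qed

text \<open>The translated and the exponentially tilted product measure are both identified with
  \<open>PiM J ga\<close> on rectangles, where the one-dimensional shift formula applies factor by
  factor.\<close>

lemma nn_integral_PiM_std_normal_shift:
  fixes a :: "'i \<Rightarrow> real"
  assumes J: "finite J" and F[measurable]: "F \<in> borel_measurable (PiM J (\<lambda>_. borel))"
  shows "(\<integral>\<^sup>+z. F (\<lambda>j\<in>J. z j + a j) \<partial>PiM J (\<lambda>_. std_normal_distribution))
    = (\<integral>\<^sup>+z. F z * ennreal (exp (\<Sum>j\<in>J. a j * z j - (a j)\<^sup>2 / 2)) \<partial>PiM J (\<lambda>_. std_normal_distribution))"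
proof -
  let ?g = "std_normal_distribution" and ?P = "PiM J (\<lambda>_::'i. std_normal_distribution)"
  let ?B = "PiM J (\<lambda>_::'i. borel :: real measure)"
  define ga where "ga j = density ?g (\<lambda>z. ennreal (exp (a j * z - (a j)\<^sup>2 / 2)))" for j
  have sets_ga[simp]: "sets (ga j) = sets borel" for j by (simp add: ga_def)
  have sP[measurable_cong]: "sets ?P = sets ?B" by (intro sets_PiM_cong) auto
  have ga: "emeasure (ga j) A = emeasure ?g {z. z + a j \<in> A}" if [measurable]: "A \<in> sets borel" for A j
  proof -
    have "emeasure ?g {z. z + a j \<in> A} = (\<integral>\<^sup>+z. indicator {z. z + a j \<in> A} z \<partial>?g)"
      by (rule nn_integral_indicator[symmetric]) measurable
    also have "\<dots> = (\<integral>\<^sup>+z. indicator A (z + a j) \<partial>?g)"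
      by (rule nn_integral_cong) (simp add: indicator_def)
    also have "\<dots> = (\<integral>\<^sup>+z. indicator A z * ennreal (exp (a j * z - (a j)\<^sup>2 / 2)) \<partial>?g)"
      by (rule nn_integral_std_normal_shift) measurable
    also have "\<dots> = emeasure (ga j) A"
      unfolding ga_def by (subst emeasure_density) (auto simp: mult.commute)
    finally show ?thesis by simp
  qed
  have pg: "prob_space ?g" by (rule prob_space_normal_density) simp
  have pga: "prob_space (ga j)" for j
  proof
    have "emeasure (ga j) (space (ga j)) = emeasure ?g (space ?g)"
      using ga[of UNIV j] by (simp add: ga_def)
    then show "emeasure (ga j) (space (ga j)) = 1" unfolding prob_space.emeasure_space_1[OF pg] .
  qed
  interpret G: product_prob_space "\<lambda>_::'i. ?g" J
    by (simp add: product_prob_space_def product_prob_space_axioms_def product_sigma_finite_def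
      prob_space_imp_sigma_finite pg)
  interpret A: product_prob_space ga J
    by (simp add: product_prob_space_def product_prob_space_axioms_def product_sigma_finite_def
      prob_space_imp_sigma_finite pga)
  have [measurable]: "(\<lambda>z. \<lambda>j\<in>J. z j + a j) \<in> measurable ?P ?B" by measurable
  have [measurable]: "(\<lambda>z. ennreal (exp (\<Sum>j\<in>J. a j * z j - (a j)\<^sup>2 / 2))) \<in> borel_measurable ?P"
    by measurable
  have 1: "distr ?P ?B (\<lambda>z. \<lambda>j\<in>J. z j + a j) = PiM J ga"
  proof (rule A.PiM_eqI[OF J])
    show "sets (distr ?P ?B (\<lambda>z. \<lambda>j\<in>J. z j + a j)) = sets (PiM J ga)"
      by (simp, intro sets_PiM_cong) auto
    fix A assume "\<And>i. i \<in> J \<Longrightarrow> A i \<in> sets (ga i)"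
    then have A[measurable]: "\<And>i. i \<in> J \<Longrightarrow> A i \<in> sets borel" by simp
    have "emeasure (distr ?P ?B (\<lambda>z. \<lambda>j\<in>J. z j + a j)) (Pi\<^sub>E J A)
        = emeasure ?P (Pi\<^sub>E J (\<lambda>j. {z. z + a j \<in> A j}))"
      using J A by (subst emeasure_distr)
        (auto intro!: arg_cong[where f="emeasure ?P"] sets_PiM_I_finite simp: space_PiM PiE_iff)
    also have "\<dots> = (\<Prod>j\<in>J. emeasure (ga j) (A j))"
      using J by (subst G.emeasure_PiM) (auto intro!: prod.cong simp: ga)
    finally show "emeasure (distr ?P ?B (\<lambda>z. \<lambda>j\<in>J. z j + a j)) (Pi\<^sub>E J A) = (\<Prod>j\<in>J. emeasure (ga j) (A j))" .
  qed
  have 2: "density ?P (\<lambda>z. ennreal (exp (\<Sum>j\<in>J. a j * z j - (a j)\<^sup>2 / 2))) = PiM J ga"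
  proof (rule A.PiM_eqI[OF J])
    show "sets (density ?P (\<lambda>z. ennreal (exp (\<Sum>j\<in>J. a j * z j - (a j)\<^sup>2 / 2)))) = sets (PiM J ga)"
      by (simp, intro sets_PiM_cong) auto
    fix A assume "\<And>i. i \<in> J \<Longrightarrow> A i \<in> sets (ga i)"
    then have A[measurable]: "\<And>i. i \<in> J \<Longrightarrow> A i \<in> sets borel" by simp
    have "emeasure (density ?P (\<lambda>z. ennreal (exp (\<Sum>j\<in>J. a j * z j - (a j)\<^sup>2 / 2)))) (Pi\<^sub>E J A)
        = (\<integral>\<^sup>+z. (\<Prod>j\<in>J. ennreal (exp (a j * z j - (a j)\<^sup>2 / 2)) * indicator (A j) (z j)) \<partial>?P)"
      using J A by (subst emeasure_density)
        (auto intro!: nn_integral_cong sets_PiM_I_finite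
          simp: exp_sum prod_ennreal[symmetric] prod.distrib space_PiM PiE_iff indicator_def prod_zero_iff)
    also have "\<dots> = (\<Prod>j\<in>J. \<integral>\<^sup>+z. ennreal (exp (a j * z - (a j)\<^sup>2 / 2)) * indicator (A j) z \<partial>?g)"
      using J by (subst G.product_nn_integral_prod) auto
    also have "\<dots> = (\<Prod>j\<in>J. emeasure (ga j) (A j))"
      by (intro prod.cong refl) (auto simp: ga_def emeasure_density)
    finally show "emeasure (density ?P (\<lambda>z. ennreal (exp (\<Sum>j\<in>J. a j * z j - (a j)\<^sup>2 / 2)))) (Pi\<^sub>E J A)
        = (\<Prod>j\<in>J. emeasure (ga j) (A j))" .
  qed
  have "(\<integral>\<^sup>+z. F (\<lambda>j\<in>J. z j + a j) \<partial>?P) = (\<integral>\<^sup>+z. F z \<partial>distr ?P ?B (\<lambda>z. \<lambda>j\<in>J. z j + a j))"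
    by (subst nn_integral_distr) auto
  also have "\<dots> = (\<integral>\<^sup>+z. F z \<partial>density ?P (\<lambda>z. ennreal (exp (\<Sum>j\<in>J. a j * z j - (a j)\<^sup>2 / 2))))"
    unfolding 1 2 ..
  also have "\<dots> = (\<integral>\<^sup>+z. F z * ennreal (exp (\<Sum>j\<in>J. a j * z j - (a j)\<^sup>2 / 2)) \<partial>?P)"
    by (subst nn_integral_density) (auto simp: mult.commute)
  finally show ?thesis .
qed

section \<open>Path space and the Cameron-Martin theorem\<close>

lemma primitive_continuous: "continuous_on {0..1} (primitive w)"
proof (rule continuous_onI)
  fix t e :: real assume t: "t \<in> {0..1}" and e: "0 < e"
  \<comment> \<open>Primitives are Hoelder continuous of order 1/2, hence the square. Adding 1 to
    the norm covers w = 0.\<close>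
  define d where "d = (e / (norm w + 1))\<^sup>2"
  have n: "0 < norm w + 1" using norm_ge_zero[of w] by linarith
  have d0: "0 < d" using e n by (simp add: d_def)
  have "dist (primitive w s) (primitive w t) \<le> e" if s: "s \<in> {0..1}" "dist s t < d" for s
  proof -
    have "dist (primitive w s) (primitive w t) = \<bar>inner w (ind01 s - ind01 t)\<bar>"
      by (simp add: dist_real_def primitive_eq_inner inner_diff_right)
    also have "\<dots> \<le> norm w * norm (ind01 s - ind01 t)" by (rule Cauchy_Schwarz_ineq2)
    also have "norm (ind01 s - ind01 t) \<le> e / (norm w + 1)"
    proof (rule power2_le_imp_le)
      show "(norm (ind01 s - ind01 t))\<^sup>2 \<le> (e / (norm w + 1))\<^sup>2"
        unfolding norm_ind01_diff[OF s(1) t] using s(2) by (simp add: d_def dist_real_def)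
    qed (use e n in auto)
    also have "norm w * (e / (norm w + 1)) \<le> e"
      using e n by (simp add: field_simps)
    finally show ?thesis by (simp add: mult_left_mono)
  qed
  then show "\<exists>d>0. \<forall>s\<in>{0..1}. dist s t < d \<longrightarrow> dist (primitive w s) (primitive w t) \<le> e"
    using d0 by blast
qed

section \<open>Path space and its dyadic marginals\<close>

lemma space_C01: "space C01 = {x \<in> extensional {0..1}. continuous_on {0..1} x}"
  by (auto simp: C01_def space_restrict_space space_PiM PiE_def)

lemma C01_eval_measurable: "t \<in> {0..1} \<Longrightarrow> (\<lambda>x. x t) \<in> borel_measurable C01"
  unfolding C01_def by (intro measurable_restrict_space1 measurable_component_singleton)

lemma measurable_C01I:
  assumes "\<And>t. t \<in> {0..1} \<Longrightarrow> (\<lambda>\<omega>. f \<omega> t) \<in> borel_measurable N"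
    and "\<And>\<omega>. \<omega> \<in> space N \<Longrightarrow> continuous_on {0..1} (f \<omega>)"
  shows "(\<lambda>\<omega>. restrict (f \<omega>) {0..1}) \<in> measurable N C01"
  unfolding C01_def
proof (rule measurable_restrict_space2)
  show "(\<lambda>\<omega>. restrict (f \<omega>) {0..1}) \<in> space N \<rightarrow> {x. continuous_on {0..1} x}"
    using assms(2) by (auto cong: continuous_on_cong_simp)
  show "(\<lambda>\<omega>. restrict (f \<omega>) {0..1}) \<in> measurable N (PiM {0..1} (\<lambda>_. borel))"
    using assms(1) by (intro measurable_restrict)
qed

definition dyadics :: "real set" where "dyadics = (\<Union>k. grid k ` {..2^k})"

lemma dyadics_01: "dyadics \<subseteq> {0..1}"
  unfolding dyadics_def by (auto simp del: atLeastAtMost_iff)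

lemma grid_refine: "grid k i = grid (k + m) (i * 2^m)"
  by (simp add: grid_def power_add)

lemma finite_dyadics_level:
  assumes "finite S" "S \<subseteq> dyadics"
  shows "\<exists>k0. \<forall>k\<ge>k0. S \<subseteq> grid k ` {..2^k}"
  using assms
proof (induction S rule: finite_induct)
  case (insert t S)
  then obtain k0 where k0: "\<And>k. k \<ge> k0 \<Longrightarrow> S \<subseteq> grid k ` {..2^k}" by blast
  obtain m i where m: "i \<le> 2^m" "t = grid m i" using insert.prems by (auto simp: dyadics_def)
  have "t \<in> grid k ` {..2^k}" if "k \<ge> m" for k
  proof -
    have "t = grid k (i * 2^(k - m))" using grid_refine[of m i "k - m"] that m by simp
    moreover have "i * 2^(k - m) \<le> 2^m * 2^(k - m)" using m by (intro mult_right_mono) auto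
    then have "i * 2^(k - m) \<le> 2^k" using that by (simp add: power_add[symmetric])
    ultimately show ?thesis by auto
  qed
  then show ?case using k0 by (intro exI[of _ "max k0 m"]) auto
qed auto

lemma ex_dyadic_seq:
  assumes t: "t \<in> {0..1}"
  shows "\<exists>q. (\<forall>n::nat. q n \<in> dyadics) \<and> q \<longlonglongrightarrow> t"
proof -
  define q where "q n = grid n (nat \<lfloor>t * 2^n\<rfloor>)" for n
  have m1: "real (nat \<lfloor>t * 2^n\<rfloor>) \<le> t * 2^n" for n using t by simp
  have m2: "t * 2^n \<le> real (nat \<lfloor>t * 2^n\<rfloor>) + 1" for n using t by linarith
  have le: "nat \<lfloor>t * 2^n\<rfloor> \<le> 2^n" for n
  proof -
    have "t * 2^n \<le> 1 * 2^n" using t by (intro mult_right_mono) auto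
    then have "real (nat \<lfloor>t * 2^n\<rfloor>) \<le> real (2^n)"
      unfolding of_nat_power of_nat_numeral using m1[of n] by linarith
    then show ?thesis by (simp only: of_nat_le_iff)
  qed
  have "\<forall>n. q n \<in> dyadics"
  proof
    fix n
    have "grid n (nat \<lfloor>t * 2^n\<rfloor>) \<in> grid n ` {..2^n}" using le[of n] by (intro imageI) simp
    then show "q n \<in> dyadics" unfolding q_def dyadics_def by blast
  qed
  moreover have "q \<longlonglongrightarrow> t"
  proof (rule tendsto_sandwich[where f="\<lambda>n. t - (1/2)^n" and h="\<lambda>_. t"])
    show "\<forall>\<^sub>F n in sequentially. t - (1/2)^n \<le> q n"
    proof (intro always_eventually allI)
      fix n
      have "t \<le> (real (nat \<lfloor>t * 2^n\<rfloor>) + 1) / 2^n" using m2[of n] by (simp add: le_divide_eq)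
      then show "t - (1/2)^n \<le> q n" by (simp add: q_def grid_def add_divide_distrib power_divide)
    qed
    show "\<forall>\<^sub>F n in sequentially. q n \<le> t"
      using m1 by (intro always_eventually allI) (simp add: q_def grid_def divide_le_eq)
    have "(\<lambda>n. (1/2::real)^n) \<longlonglongrightarrow> 0" by (rule LIMSEQ_power_zero) simp
    then show "(\<lambda>n. t - (1/2)^n) \<longlonglongrightarrow> t" using tendsto_diff[OF tendsto_const, of _ 0 sequentially t] by simp
  qed auto
  ultimately show ?thesis by blast
qed

text \<open>By continuity every evaluation is a limit of evaluations at dyadic times, so those alone
  generate the sigma-algebra. Laws on path space can then be compared at finitely many dyadic times,
  where the grid computation is exact.\<close>

lemma sets_C01_dyadic:
  assumes D: "D \<in> sets C01"
  shows "\<exists>D'\<in>sets (PiM dyadics (\<lambda>_. borel :: real measure)). D = (\<lambda>x. restrict x dyadics) -` D' \<inter> space C01"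
proof -
  let ?V = "vimage_algebra (space C01) (\<lambda>x. restrict x dyadics) (PiM dyadics (\<lambda>_. borel :: real measure))"
  have fn: "(\<lambda>x. restrict x dyadics) \<in> space C01 \<rightarrow> space (PiM dyadics (\<lambda>_. borel :: real measure))"
    by (auto simp: space_PiM)
  have ev: "(\<lambda>x. x q) \<in> borel_measurable ?V" if q: "q \<in> dyadics" for q
  proof -
    have "(\<lambda>x. (restrict x dyadics) q) \<in> borel_measurable ?V"
      by (rule measurable_compose[OF measurable_vimage_algebra1[OF fn]
        measurable_component_singleton[OF q]])
    then show ?thesis using q by simp
  qed
  have "(\<lambda>x. x) \<in> measurable ?V C01"
  proof -
    have *: "(\<lambda>x. x t) \<in> borel_measurable ?V" if t: "t \<in> {0..1}" for t :: real
    proof -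
      obtain q where q: "\<And>n::nat. q n \<in> dyadics" "q \<longlonglongrightarrow> t" using ex_dyadic_seq[OF t] by blast
      show ?thesis
      proof (rule borel_measurable_LIMSEQ_real)
        fix x assume "x \<in> space ?V"
        then have "continuous_on {0..1} x" by (simp add: space_C01)
        then show "(\<lambda>n. x (q n)) \<longlonglongrightarrow> x t"
          by (rule continuous_on_tendsto_compose[OF _ q(2) t])
            (use q(1) dyadics_01 in \<open>blast intro: always_eventually\<close>)
      qed (rule ev[OF q(1)])
    qed
    have "(\<lambda>x. restrict x {0..1}) \<in> measurable ?V C01"
      by (rule measurable_C01I[OF *]) (auto simp: space_C01)
    moreover have "restrict x {0..1} = x" if "x \<in> space ?V" for x
      using that by (auto simp: space_C01 extensional_restrict)
    ultimately show ?thesis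
      by (subst measurable_cong[where g="\<lambda>x. restrict x {0..1}"]) auto
  qed
  from measurable_sets[OF this D] have "D \<inter> space C01 \<in> sets ?V" by simp
  moreover have "D \<inter> space C01 = D" using sets.sets_into_space[OF D] by blast
  ultimately show ?thesis by (auto simp: sets_vimage_algebra2[OF fn])
qed

lemma C01_measure_eqI:
  assumes [simp]: "sets P = sets C01" "sets Q = sets C01" and P: "finite_measure P"
    and eq: "\<And>S A. finite S \<Longrightarrow> S \<subseteq> dyadics \<Longrightarrow> (\<And>t. t \<in> S \<Longrightarrow> A t \<in> sets borel) \<Longrightarrow>
      emeasure P {x \<in> space C01. \<forall>t\<in>S. x t \<in> A t} = emeasure Q {x \<in> space C01. \<forall>t\<in>S. x t \<in> A t}"
  shows "P = Q"
proof (rule measure_eqI)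
  let ?\<Pi> = "PiM dyadics (\<lambda>_. borel :: real measure)" and ?r = "\<lambda>x. restrict x dyadics"
  have sp[simp]: "space P = space C01" "space Q = space C01" 
    using sets_eq_imp_space_eq[OF assms(1)] sets_eq_imp_space_eq[OF assms(2)] by simp_all
  have r: "?r \<in> measurable C01 ?\<Pi>"
    using dyadics_01 by (intro measurable_restrict C01_eval_measurable) auto
  have rP[measurable]: "?r \<in> measurable P ?\<Pi>" and rQ[measurable]: "?r \<in> measurable Q ?\<Pi>"
    using r by (simp_all cong: measurable_cong_sets)
  have "distr P ?\<Pi> ?r = distr Q ?\<Pi> ?r"
  proof (rule measure_eqI_PiM_infinite)
    show "finite_measure (distr P ?\<Pi> ?r)" by (rule finite_measure.finite_measure_distr[OF P rP])
    fix A J assume J: "finite J" "J \<subseteq> dyadics" "\<And>i. i \<in> J \<Longrightarrow> A i \<in> sets (borel :: real measure)"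
    have pe: "prod_emb dyadics (\<lambda>_. borel) J (Pi\<^sub>E J A) \<in> sets ?\<Pi>"
      using J by (intro sets_PiM_I) auto
    have "?r -` prod_emb dyadics (\<lambda>_. borel) J (Pi\<^sub>E J A) \<inter> space C01 = {x \<in> space C01. \<forall>t\<in>J. x t \<in> A t}"
      using J(2) by (auto simp: prod_emb_def PiE_iff space_PiM subset_iff)
    then show "emeasure (distr P ?\<Pi> ?r) (prod_emb dyadics (\<lambda>_. borel) J (Pi\<^sub>E J A))
        = emeasure (distr Q ?\<Pi> ?r) (prod_emb dyadics (\<lambda>_. borel) J (Pi\<^sub>E J A))"
      using eq[OF J] pe by (simp add: emeasure_distr)
  qed auto
  fix D assume "D \<in> sets P"
  then obtain D' where D': "D' \<in> sets ?\<Pi>" "D = ?r -` D' \<inter> space C01"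
    using sets_C01_dyadic by auto
  then have "emeasure P D = emeasure (distr P ?\<Pi> ?r) D'" "emeasure Q D = emeasure (distr Q ?\<Pi> ?r) D'"
    by (auto simp: emeasure_distr)
  then show "emeasure P D = emeasure Q D"
    using \<open>distr P ?\<Pi> ?r = distr Q ?\<Pi> ?r\<close> by simp
qed simp

lemma wiener_int_measurable_C01 [measurable]: "wiener_int \<kappa> h \<in> borel_measurable C01"
  unfolding wiener_int_def[abs_def] dyadic_int_def
  by (intro borel_measurable_lim_metric borel_measurable_sum borel_measurable_times
      borel_measurable_const borel_measurable_diff C01_eval_measurable grid_in) auto

section \<open>The Cameron-Martin theorem and its total variation bound\<close>

context brownian_motion
begin

definition shifted_path :: "L2 \<Rightarrow> 'o \<Rightarrow> real \<Rightarrow> real" where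
  "shifted_path u \<omega> = (\<lambda>t\<in>{0..1}. primitive u t + B t \<omega>)"

lemma shifted_path_measurable [measurable]: "shifted_path u \<in> measurable M C01"
  unfolding shifted_path_def[abs_def]
  by (intro measurable_C01I) (auto intro!: continuous_on_add primitive_continuous continuous_B)

text \<open>On the dyadic grid of level \<open>k\<close> the shift is exactly Gaussian; the limit \<open>k \<rightarrow> \<infinity>\<close> is taken
  with Fatou's lemma, and equality of total masses makes the inequality an equality.\<close>

lemma grid_shift:
  fixes k :: nat
  assumes S: "finite S" "S \<subseteq> grid k ` {..2^k}" and A: "\<And>t. t \<in> S \<Longrightarrow> A t \<in> sets borel"
    and c: "c \<in> {id, Not}"
  shows "emeasure M {\<omega>\<in>space M. c (\<forall>t\<in>S. shifted_path u \<omega> t \<in> A t)}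
    = (\<integral>\<^sup>+\<omega>. indicator {\<omega>\<in>space M. c (\<forall>t\<in>S. shifted_path 0 \<omega> t \<in> A t)} \<omega>
        * ennreal (exp (dyadic_int k u (Bpath \<omega>) - (norm (dyadic_proj k u))\<^sup>2 / 2)) \<partial>M)"
proof -
  let ?J = "{..<2^k :: nat}" and ?g = "std_normal_distribution"
  let ?B = "PiM ?J (\<lambda>_. borel :: real measure)"
  define a where "a i = sqrt (2^k) * inner u (ind_cell k i)" for i
  define N where "N \<omega> = (\<lambda>i\<in>?J. sqrt (2^k) * cell_incr k i \<omega>)" for \<omega>
  define I where "I = {i. i \<le> 2^k \<and> grid k i \<in> S}"
  define C where "C z \<longleftrightarrow> c (\<forall>i\<in>I. (\<Sum>j<i. z j / sqrt (2^k)) \<in> A (grid k i))" for z :: "nat \<Rightarrow> real"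
  have finI: "finite I" unfolding I_def by (rule finite_subset[of _ "{..2^k}"]) auto
  have SI: "S = grid k ` I" using S(2) by (auto simp: I_def)
  have N_meas[measurable]: "N \<in> measurable M ?B"
    unfolding N_def[abs_def] by (intro measurable_restrict borel_measurable_times borel_measurable_const cell_incr_measurable) auto
  have "Measurable.pred ?B (\<lambda>z. (\<Sum>j<i. z j / sqrt (2^k)) \<in> A (grid k i))" if i: "i \<in> I" for i
  proof -
    have "(\<lambda>z. \<Sum>j<i. z j / sqrt (2^k)) \<in> borel_measurable ?B"
      using i by (intro borel_measurable_sum borel_measurable_divide borel_measurable_const measurable_component_singleton)
        (auto simp: I_def)
    moreover have "A (grid k i) \<in> sets borel" using i A by (auto simp: I_def)
    ultimately show ?thesis by (rule pred_sets2[rotated])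
  qed
  then have "Measurable.pred ?B (\<lambda>z. \<forall>i\<in>I. (\<Sum>j<i. z j / sqrt (2^k)) \<in> A (grid k i))"
    using finI by (intro pred_intros_finite) auto
  then have [measurable]: "Measurable.pred ?B C"
    using c by (auto simp: C_def[abs_def])
  \<comment> \<open>On the grid a path that starts at 0 is the partial sum of its increments, and
    the shift adds a constant to each normalised increment. The event thus becomes a condition on a
    vector of independent standard normals.\<close>
  have path: "c (\<forall>t\<in>S. shifted_path v \<omega> t \<in> A t) \<longleftrightarrow> C (\<lambda>i\<in>?J. N \<omega> i + sqrt (2^k) * inner v (ind_cell k i))"
    if B0: "B 0 \<omega> = 0" for v \<omega>
  proof -
    have "shifted_path v \<omega> (grid k i) = (\<Sum>j<i. (\<lambda>i\<in>?J. N \<omega> i + sqrt (2^k) * inner v (ind_cell k i)) j / sqrt (2^k))"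
      if i: "i \<le> 2^k" for i
    proof -
      define f where "f j = shifted_path v \<omega> (grid k j)" for j
      have f: "f (Suc j) - f j = (\<lambda>i\<in>?J. N \<omega> i + sqrt (2^k) * inner v (ind_cell k i)) j / sqrt (2^k)"
        if "j < i" for j
      proof -
        have j: "j < 2^k" using that i by simp
        then have "grid k j \<in> {0..1}" "grid k (Suc j) \<in> {0..1}"
          by (auto intro!: grid_in simp del: atLeastAtMost_iff)
        then have "f (Suc j) - f j = inner v (ind_cell k j) + cell_incr k j \<omega>"
          by (simp add: f_def shifted_path_def primitive_eq_inner ind_cell_def cell_incr_def inner_diff_right)
        then show ?thesis using j by (simp add: N_def add_divide_distrib)
      qed
      have "f 0 = 0" using B0 by (simp add: f_def shifted_path_def primitive_eq_inner ind01_0)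
      then have "f i = (\<Sum>j<i. f (Suc j) - f j)" by (simp add: sum_lessThan_telescope)
      also have "\<dots> = (\<Sum>j<i. (\<lambda>i\<in>?J. N \<omega> i + sqrt (2^k) * inner v (ind_cell k i)) j / sqrt (2^k))"
        by (intro sum.cong refl f) simp
      finally show ?thesis by (simp add: f_def)
    qed
    then show ?thesis unfolding C_def SI by (auto simp: I_def intro!: arg_cong[where f=c])
  qed
  have event: "Measurable.pred M (\<lambda>\<omega>. c (\<forall>t\<in>S. shifted_path v \<omega> t \<in> A t))" for v
  proof -
    have "Measurable.pred M (\<lambda>\<omega>. \<forall>t\<in>S. shifted_path v \<omega> t \<in> A t)"
    proof (rule pred_intros_finite[OF S(1)])
      fix t assume t: "t \<in> S"
      then have t01: "t \<in> {0..1}" using S(2) by (auto simp del: atLeastAtMost_iff)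
      show "Measurable.pred M (\<lambda>\<omega>. shifted_path v \<omega> t \<in> A t)"
        by (rule pred_sets2[OF A[OF t] measurable_compose[OF shifted_path_measurable C01_eval_measurable[OF t01]]])
    qed
    then show ?thesis using c by auto
  qed
  have mev: "{\<omega>\<in>space M. c (\<forall>t\<in>S. shifted_path v \<omega> t \<in> A t)} \<in> sets M" for v
    using event[of v] by (simp add: pred_def)
  have "emeasure M {\<omega>\<in>space M. c (\<forall>t\<in>S. shifted_path u \<omega> t \<in> A t)}
      = (\<integral>\<^sup>+\<omega>. indicator {\<omega>\<in>space M. c (\<forall>t\<in>S. shifted_path u \<omega> t \<in> A t)} \<omega> \<partial>M)"
    using mev by simp
  also have "\<dots> = (\<integral>\<^sup>+\<omega>. indicator {z. C z} (\<lambda>i\<in>?J. N \<omega> i + a i) \<partial>M)"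
    using B_0 by (intro nn_integral_cong_AE) (auto simp: indicator_def path a_def elim!: eventually_mono)
  also have "\<dots> = (\<integral>\<^sup>+z. indicator {z. C z} (\<lambda>i\<in>?J. z i + a i) \<partial>distr M ?B N)"
    by (subst nn_integral_distr) (auto simp: N_meas)
  also have "\<dots> = (\<integral>\<^sup>+z. indicator {z. C z} z * ennreal (exp (\<Sum>i\<in>?J. a i * z i - (a i)\<^sup>2 / 2)) \<partial>distr M ?B N)"
    unfolding N_def[abs_def] distr_cell_incr_PiM by (rule nn_integral_PiM_std_normal_shift) auto
  also have "\<dots> = (\<integral>\<^sup>+\<omega>. indicator {z. C z} (N \<omega>) * ennreal (exp (\<Sum>i\<in>?J. a i * N \<omega> i - (a i)\<^sup>2 / 2)) \<partial>M)"
    by (subst nn_integral_distr) (auto simp: N_meas)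
  also have "\<dots> = (\<integral>\<^sup>+\<omega>. indicator {\<omega>\<in>space M. c (\<forall>t\<in>S. shifted_path 0 \<omega> t \<in> A t)} \<omega>
        * ennreal (exp (dyadic_int k u (Bpath \<omega>) - (norm (dyadic_proj k u))\<^sup>2 / 2)) \<partial>M)"
  proof (rule nn_integral_cong_AE, use B_0 AE_space in eventually_elim)
    fix \<omega> assume B0: "B 0 \<omega> = 0" and sp: "\<omega> \<in> space M"
    have N0: "(\<lambda>i\<in>?J. N \<omega> i + sqrt (2^k) * inner 0 (ind_cell k i)) = N \<omega>"
      by (auto simp: N_def fun_eq_iff)
    have "(\<Sum>i\<in>?J. a i * N \<omega> i - (a i)\<^sup>2 / 2) = dyadic_int k u (Bpath \<omega>) - (norm (dyadic_proj k u))\<^sup>2 / 2"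
      unfolding dyadic_int_path_eq norm_dyadic_proj_sq sum_subtractf sum_divide_distrib
      by (intro arg_cong2[where f="(-)"] sum.cong refl) (auto simp: a_def N_def power_mult_distrib)
    then show "indicator {z. C z} (N \<omega>) * ennreal (exp (\<Sum>i\<in>?J. a i * N \<omega> i - (a i)\<^sup>2 / 2))
      = indicator {\<omega>\<in>space M. c (\<forall>t\<in>S. shifted_path 0 \<omega> t \<in> A t)} \<omega>
        * ennreal (exp (dyadic_int k u (Bpath \<omega>) - (norm (dyadic_proj k u))\<^sup>2 / 2))"
      using path[OF B0, of 0] N0 sp by (simp add: indicator_def)
  qed
  finally show ?thesis .
qed

text \<open>Normalising u reduces the claim to one standard normal coordinate, where it is the shift
  formula applied to the constant 1. The unit mass is what upgrades Fatou's inequality to an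
  equality in \<open>cameron_martin\<close>; u = 0 cannot be normalised and is treated
  apart.\<close>

lemma nn_integral_exp_wiener_int:
  assumes \<kappa>: "filterlim \<kappa> at_top sequentially" and adm: "admissible \<kappa> u"
  shows "(\<integral>\<^sup>+\<omega>. ennreal (exp (wiener_int \<kappa> u (Bpath \<omega>) - (norm u)\<^sup>2 / 2)) \<partial>M) = 1"
proof (cases "u = 0")
  case True
  have "wiener_int \<kappa> 0 x = 0" for x by (simp add: wiener_int_def dyadic_int_0 limI)
  then show ?thesis using True emeasure_space_1 by simp
next
  case False
  define \<psi> :: "nat \<Rightarrow> L2" where "\<psi> j = (1 / norm u) *\<^sub>R u" for j
  have u: "norm u \<noteq> 0" using False by simp
  have adm\<psi>: "admissible \<kappa> (\<psi> j)" for j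
    using admissible_sum[of "{0::nat}" \<kappa> "\<lambda>_. u" "\<lambda>_. 1 / norm u"] adm by (simp add: \<psi>_def)
  have "inner (\<psi> i) (\<psi> j) = 1" for i j
    using u by (simp add: \<psi>_def power2_norm_eq_inner[symmetric] power2_eq_square)
  then have law: "distr M (PiM {0::nat} (\<lambda>_. borel)) (\<lambda>\<omega>. \<lambda>j\<in>{0}. wiener_int \<kappa> (\<psi> j) (Bpath \<omega>))
      = PiM {0} (\<lambda>_. std_normal_distribution)"
    by (intro distr_wiener_int_PiM \<kappa> adm\<psi>) auto
  have [measurable]: "(\<lambda>\<omega>. \<lambda>j\<in>{0::nat}. wiener_int \<kappa> (\<psi> j) (Bpath \<omega>)) \<in> measurable M (PiM {0} (\<lambda>_. borel))"
    by (intro measurable_restrict wiener_int_measurable)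
  have AE_eq: "AE \<omega> in M. wiener_int \<kappa> u (Bpath \<omega>) = norm u * wiener_int \<kappa> (\<psi> 0) (Bpath \<omega>)"
    using wiener_int_sum[of "{0::nat}" \<kappa> \<psi> "\<lambda>_. norm u"] adm\<psi> u by (simp add: \<psi>_def)
  have "(\<integral>\<^sup>+\<omega>. ennreal (exp (wiener_int \<kappa> u (Bpath \<omega>) - (norm u)\<^sup>2 / 2)) \<partial>M)
      = (\<integral>\<^sup>+\<omega>. ennreal (exp (norm u * (\<lambda>j\<in>{0::nat}. wiener_int \<kappa> (\<psi> j) (Bpath \<omega>)) 0 - (norm u)\<^sup>2 / 2)) \<partial>M)"
    using AE_eq by (intro nn_integral_cong_AE) (auto elim!: eventually_mono)
  also have "\<dots> = (\<integral>\<^sup>+z. ennreal (exp (norm u * z 0 - (norm u)\<^sup>2 / 2)) \<partial>PiM {0::nat} (\<lambda>_. std_normal_distribution))"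
    unfolding law[symmetric] by (subst nn_integral_distr) auto
  also have "\<dots> = (\<integral>\<^sup>+z. ennreal (exp (norm u * z - (norm u)\<^sup>2 / 2)) \<partial>std_normal_distribution)"
  proof -
    interpret product_prob_space "\<lambda>_::nat. std_normal_distribution" "{0}"
      by (simp add: product_prob_space_def product_prob_space_axioms_def product_sigma_finite_def
        prob_space_imp_sigma_finite prob_space_normal_density)
    show ?thesis by (rule product_nn_integral_singleton) auto
  qed
  also have "\<dots> = (\<integral>\<^sup>+z. 1 \<partial>std_normal_distribution)"
    using nn_integral_std_normal_shift[of "\<lambda>_. 1" "norm u"] by simp
  also have "\<dots> = 1"
    using prob_space.emeasure_space_1[OF prob_space_normal_density[of 1 0]] by simp
  finally show ?thesis .
qed

text \<open>Both sides are integrals of g against laws on path space, so it is enough that these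
  agree on events at finitely many dyadic times. There the densities of the grid shifts converge
  almost surely along \<open>\<kappa>\<close> to the limiting density.\<close>

lemma cameron_martin:
  assumes \<kappa>: "filterlim \<kappa> at_top sequentially" and adm: "admissible \<kappa> u"
    and g[measurable]: "g \<in> borel_measurable C01"
  shows "(\<integral>\<^sup>+\<omega>. g (shifted_path u \<omega>) \<partial>M)
    = (\<integral>\<^sup>+\<omega>. g (shifted_path 0 \<omega>) * ennreal (exp (wiener_int \<kappa> u (Bpath \<omega>) - (norm u)\<^sup>2 / 2)) \<partial>M)"
proof -
  define L where "L \<omega> = ennreal (exp (wiener_int \<kappa> u (Bpath \<omega>) - (norm u)\<^sup>2 / 2))" for \<omega>
  have [measurable]: "L \<in> borel_measurable M" unfolding L_def by measurable
  define P where "P = distr M C01 (shifted_path u)"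
  define Q where "Q = distr (density M L) C01 (shifted_path 0)"
  have [measurable]: "shifted_path v \<in> measurable (density M L) C01" for v by simp
  have projlim: "(\<lambda>j. (norm (dyadic_proj (\<kappa> j) u))\<^sup>2) \<longlonglongrightarrow> (norm u)\<^sup>2"
    by (intro tendsto_intros filterlim_compose[OF dyadic_proj_tendsto \<kappa>])
  \<comment> \<open>Stated for an event and for its complement: the choice of c supplies the second
    inequality that is needed for equality.\<close>
  have fatou: "(\<integral>\<^sup>+\<omega>. indicator {\<omega>\<in>space M. c (\<forall>t\<in>S. shifted_path 0 \<omega> t \<in> A t)} \<omega> * L \<omega> \<partial>M)
      \<le> emeasure M {\<omega>\<in>space M. c (\<forall>t\<in>S. shifted_path u \<omega> t \<in> A t)}"
    if S: "finite S" "S \<subseteq> dyadics" and A: "\<And>t. t \<in> S \<Longrightarrow> A t \<in> sets borel" and c: "c \<in> {id, Not}" for S A c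
  proof -
    let ?E = "\<lambda>v. {\<omega>\<in>space M. c (\<forall>t\<in>S. shifted_path v \<omega> t \<in> A t)}"
    have [measurable]: "?E 0 \<in> sets M"
    proof -
      have "Measurable.pred M (\<lambda>\<omega>. \<forall>t\<in>S. shifted_path 0 \<omega> t \<in> A t)"
      proof (rule pred_intros_finite[OF S(1)])
        fix t assume t: "t \<in> S"
        then have t01: "t \<in> {0..1}" using S(2) dyadics_01 by blast
        show "Measurable.pred M (\<lambda>\<omega>. shifted_path 0 \<omega> t \<in> A t)"
          by (rule pred_sets2[OF A[OF t] measurable_compose[OF shifted_path_measurable C01_eval_measurable[OF t01]]])
      qed
      then have "Measurable.pred M (\<lambda>\<omega>. c (\<forall>t\<in>S. shifted_path 0 \<omega> t \<in> A t))" using c by auto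
      then show ?thesis by (simp add: pred_def)
    qed
    obtain k0 where k0: "\<And>k. k \<ge> k0 \<Longrightarrow> S \<subseteq> grid k ` {..2^k}"
      using finite_dyadics_level[OF S] by blast
    define D where "D j \<omega> = ennreal (exp (dyadic_int (\<kappa> j) u (Bpath \<omega>) - (norm (dyadic_proj (\<kappa> j) u))\<^sup>2 / 2))" for j \<omega>
    have [measurable]: "D j \<in> borel_measurable M" for j unfolding D_def by measurable
    have "(\<integral>\<^sup>+\<omega>. indicator (?E 0) \<omega> * L \<omega> \<partial>M) = (\<integral>\<^sup>+\<omega>. liminf (\<lambda>j. indicator (?E 0) \<omega> * D j \<omega>) \<partial>M)"
    proof (rule nn_integral_cong_AE, use wiener_int_tendsto[OF adm] in eventually_elim)
      fix \<omega> assume lim: "(\<lambda>j. dyadic_int (\<kappa> j) u (Bpath \<omega>)) \<longlonglongrightarrow> wiener_int \<kappa> u (Bpath \<omega>)"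
      have "(\<lambda>j. D j \<omega>) \<longlonglongrightarrow> L \<omega>"
        unfolding D_def L_def by (intro tendsto_intros lim projlim) auto
      then have "(\<lambda>j. indicator (?E 0) \<omega> * D j \<omega>) \<longlonglongrightarrow> indicator (?E 0) \<omega> * L \<omega>"
        by (auto simp: indicator_def)
      then show "indicator (?E 0) \<omega> * L \<omega> = liminf (\<lambda>j. indicator (?E 0) \<omega> * D j \<omega>)"
        by (rule lim_imp_Liminf[OF sequentially_bot, symmetric])
    qed
    also have "\<dots> \<le> liminf (\<lambda>j. \<integral>\<^sup>+\<omega>. indicator (?E 0) \<omega> * D j \<omega> \<partial>M)"
      by (rule nn_integral_liminf) measurable
    also have "\<dots> \<le> limsup (\<lambda>j. \<integral>\<^sup>+\<omega>. indicator (?E 0) \<omega> * D j \<omega> \<partial>M)"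
      by (rule Liminf_le_Limsup) simp
    also have "\<dots> \<le> emeasure M (?E u)"
    proof (rule Limsup_bounded)
      have "\<forall>\<^sub>F j in sequentially. \<kappa> j \<ge> k0" using \<kappa> by (simp add: filterlim_at_top)
      then show "\<forall>\<^sub>F j in sequentially. (\<integral>\<^sup>+\<omega>. indicator (?E 0) \<omega> * D j \<omega> \<partial>M) \<le> emeasure M (?E u)"
        by eventually_elim (simp add: D_def grid_shift[OF S(1) k0 A c])
    qed
    finally show ?thesis .
  qed
  have mass: "(\<integral>\<^sup>+\<omega>. L \<omega> \<partial>M) = 1"
    unfolding L_def by (rule nn_integral_exp_wiener_int[OF \<kappa> adm])
  have "P = Q"
  proof (rule C01_measure_eqI)
    show "sets P = sets C01" "sets Q = sets C01" by (auto simp: P_def Q_def)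
    show "finite_measure P" unfolding P_def by (intro finite_measure_distr) measurable
    fix S and A :: "real \<Rightarrow> real set"
    assume S: "finite S" "S \<subseteq> dyadics" and A: "\<And>t. t \<in> S \<Longrightarrow> A t \<in> sets borel"
    let ?E = "\<lambda>c v. {\<omega>\<in>space M. c (\<forall>t\<in>S. shifted_path v \<omega> t \<in> A t)}"
    have D: "{x \<in> space C01. \<forall>t\<in>S. x t \<in> A t} \<in> sets C01"
    proof -
      have "Measurable.pred C01 (\<lambda>x. \<forall>t\<in>S. x t \<in> A t)"
      proof (rule pred_intros_finite[OF S(1)])
        fix t assume t: "t \<in> S"
        then have t01: "t \<in> {0..1}" using S(2) dyadics_01 by blast
        show "Measurable.pred C01 (\<lambda>x. x t \<in> A t)"
          by (rule pred_sets2[OF A[OF t] C01_eval_measurable[OF t01]])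
      qed
      then show ?thesis by (simp add: pred_def)
    qed
    have vim: "shifted_path v -` {x \<in> space C01. \<forall>t\<in>S. x t \<in> A t} \<inter> space M = ?E id v" for v
      using measurable_space[OF shifted_path_measurable] by auto
    have idm: "?E id v \<in> sets M" for v
      using measurable_sets[OF shifted_path_measurable D, of v] unfolding vim .
    have notE: "?E Not v = space M - ?E id v" for v by auto
    have eP: "emeasure P {x \<in> space C01. \<forall>t\<in>S. x t \<in> A t} = emeasure M (?E id u)"
      unfolding P_def emeasure_distr[OF shifted_path_measurable D] vim ..
    have eQ: "emeasure Q {x \<in> space C01. \<forall>t\<in>S. x t \<in> A t} = (\<integral>\<^sup>+\<omega>. indicator (?E id 0) \<omega> * L \<omega> \<partial>M)"
    proof -
      have "emeasure Q {x \<in> space C01. \<forall>t\<in>S. x t \<in> A t}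
          = emeasure (density M L) (shifted_path 0 -` {x \<in> space C01. \<forall>t\<in>S. x t \<in> A t} \<inter> space (density M L))"
        unfolding Q_def by (rule emeasure_distr[OF _ D]) measurable
      also have "\<dots> = emeasure (density M L) (?E id 0)" by (simp only: space_density vim)
      also have "\<dots> = (\<integral>\<^sup>+\<omega>. L \<omega> * indicator (?E id 0) \<omega> \<partial>M)"
        by (rule emeasure_density) (use idm[of 0] in auto)
      finally show ?thesis by (simp only: mult.commute)
    qed
    have le1: "(\<integral>\<^sup>+\<omega>. indicator (?E id 0) \<omega> * L \<omega> \<partial>M) \<le> emeasure M (?E id u)"
      by (rule fatou[OF S A]) auto
    have le2: "(\<integral>\<^sup>+\<omega>. indicator (?E Not 0) \<omega> * L \<omega> \<partial>M) \<le> emeasure M (?E Not u)"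
      by (rule fatou[OF S A]) auto
    have sum1: "(\<integral>\<^sup>+\<omega>. indicator (?E id 0) \<omega> * L \<omega> \<partial>M) + (\<integral>\<^sup>+\<omega>. indicator (?E Not 0) \<omega> * L \<omega> \<partial>M) = 1"
    proof -
      have "(\<integral>\<^sup>+\<omega>. indicator (?E id 0) \<omega> * L \<omega> \<partial>M) + (\<integral>\<^sup>+\<omega>. indicator (?E Not 0) \<omega> * L \<omega> \<partial>M)
          = (\<integral>\<^sup>+\<omega>. indicator (?E id 0) \<omega> * L \<omega> + indicator (?E Not 0) \<omega> * L \<omega> \<partial>M)"
        unfolding notE using idm[of 0] by (subst nn_integral_add) auto
      also have "\<dots> = (\<integral>\<^sup>+\<omega>. L \<omega> \<partial>M)"
        by (intro nn_integral_cong) (auto simp: indicator_def)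
      finally show ?thesis unfolding mass .
    qed
    have sum2: "emeasure M (?E id u) + emeasure M (?E Not u) = 1"
    proof -
      have "emeasure M (?E id u) + emeasure M (?E Not u) = emeasure M (?E id u \<union> ?E Not u)"
        unfolding notE using idm[of u] by (intro plus_emeasure) auto
      also have "?E id u \<union> ?E Not u = space M" by auto
      finally show ?thesis unfolding emeasure_space_1 .
    qed
    have fin: "emeasure M (?E Not u) \<noteq> \<top>" by simp
    \<comment> \<open>Both total masses are 1, so the upper bound for the complement is a lower
      bound for the event; the complement has finite measure and can be cancelled.\<close>
    have "emeasure M (?E id u) + emeasure M (?E Not u)
        \<le> (\<integral>\<^sup>+\<omega>. indicator (?E id 0) \<omega> * L \<omega> \<partial>M) + emeasure M (?E Not u)"
      unfolding sum2 sum1[symmetric] using le2 by (rule add_left_mono)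
    then have "emeasure M (?E id u) \<le> (\<integral>\<^sup>+\<omega>. indicator (?E id 0) \<omega> * L \<omega> \<partial>M)"
      using fin by (simp add: add.commute[of _ "emeasure M (?E Not u)"] ennreal_add_left_cancel_le)
    then show "emeasure P {x \<in> space C01. \<forall>t\<in>S. x t \<in> A t} = emeasure Q {x \<in> space C01. \<forall>t\<in>S. x t \<in> A t}"
      unfolding eP eQ using le1 by (rule antisym)
  qed
  have "(\<integral>\<^sup>+\<omega>. g (shifted_path u \<omega>) \<partial>M) = (\<integral>\<^sup>+x. g x \<partial>P)"
    unfolding P_def by (subst nn_integral_distr) auto
  also have "\<dots> = (\<integral>\<^sup>+\<omega>. g (shifted_path 0 \<omega>) \<partial>density M L)"
    unfolding \<open>P = Q\<close> Q_def by (subst nn_integral_distr) auto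
  also have "\<dots> = (\<integral>\<^sup>+\<omega>. g (shifted_path 0 \<omega>) * L \<omega> \<partial>M)"
    by (subst nn_integral_density) (auto simp: mult.commute)
  finally show ?thesis unfolding L_def .
qed

text \<open>A chi-square bound: the density L has mean 1 and E (L - 1)^2 = exp (|u|^2) - 1, so the
  change of measure costs at most the square root of this when g is at most 1.\<close>

lemma cameron_martin_tv:
  assumes \<kappa>: "filterlim \<kappa> at_top sequentially" and adm: "admissible \<kappa> u"
    and g[measurable]: "g \<in> borel_measurable C01" and g1: "\<And>x. g x \<le> 1"
  shows "(\<integral>\<^sup>+\<omega>. g (shifted_path u \<omega>) \<partial>M)
    \<le> (\<integral>\<^sup>+\<omega>. g (shifted_path 0 \<omega>) \<partial>M) + ennreal (sqrt (exp ((norm u)\<^sup>2) - 1))"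
proof (cases "u = 0")
  case False
  define s where "s = (norm u)\<^sup>2"
  have s: "0 < s" using False by (simp add: s_def)
  define L where "L \<omega> = exp (wiener_int \<kappa> u (Bpath \<omega>) - s / 2)" for \<omega>
  have [measurable]: "L \<in> borel_measurable M" unfolding L_def by measurable
  have L0: "0 \<le> L \<omega>" for \<omega> by (simp add: L_def)
  have EL: "(\<integral>\<^sup>+\<omega>. ennreal (L \<omega>) \<partial>M) = 1"
    unfolding L_def s_def by (rule nn_integral_exp_wiener_int[OF \<kappa> adm])
  have adm2: "admissible \<kappa> (2 *\<^sub>R u)"
    using admissible_sum[of "{0::nat}" \<kappa> "\<lambda>_. u" "\<lambda>_. 2"] adm by simp
  \<comment> \<open>The square of the density at u is exp (|u|^2) times the density at 2u, which
    again has mass one.\<close>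
  have EL2: "(\<integral>\<^sup>+\<omega>. ennreal ((L \<omega>)\<^sup>2) \<partial>M) = ennreal (exp s)"
  proof -
    have "AE \<omega> in M. wiener_int \<kappa> (2 *\<^sub>R u) (Bpath \<omega>) = 2 * wiener_int \<kappa> u (Bpath \<omega>)"
      using wiener_int_sum[of "{0::nat}" \<kappa> "\<lambda>_. u" "\<lambda>_. 2"] adm by simp
    then have "(\<integral>\<^sup>+\<omega>. ennreal ((L \<omega>)\<^sup>2) \<partial>M)
        = (\<integral>\<^sup>+\<omega>. ennreal (exp s) * ennreal (exp (wiener_int \<kappa> (2 *\<^sub>R u) (Bpath \<omega>) - (norm (2 *\<^sub>R u))\<^sup>2 / 2)) \<partial>M)"
      by (intro nn_integral_cong_AE)
        (auto simp: L_def ennreal_mult[symmetric] exp_add[symmetric] power2_eq_square s_def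
          algebra_simps elim!: eventually_mono)
    also have "\<dots> = ennreal (exp s) * 1"
      by (subst nn_integral_cmult) (simp_all only: nn_integral_exp_wiener_int[OF \<kappa> adm2], measurable)
    finally show ?thesis by simp
  qed
  have var: "(\<integral>\<^sup>+\<omega>. ennreal ((L \<omega> - 1)\<^sup>2) \<partial>M) = ennreal (exp s - 1)"
  proof -
    \<comment> \<open>Twice the mean of L is added on both sides, since subtraction is awkward for
      extended nonnegative reals; it is cancelled at the end.\<close>
    have "(\<integral>\<^sup>+\<omega>. ennreal ((L \<omega> - 1)\<^sup>2) \<partial>M) + 2 = (\<integral>\<^sup>+\<omega>. ennreal ((L \<omega> - 1)\<^sup>2) + 2 * ennreal (L \<omega>) \<partial>M)"
      using EL by (subst nn_integral_add) (auto simp: nn_integral_cmult)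
    also have "\<dots> = (\<integral>\<^sup>+\<omega>. ennreal ((L \<omega>)\<^sup>2) + 1 \<partial>M)"
    proof (rule nn_integral_cong)
      fix \<omega>
      have "ennreal ((L \<omega> - 1)\<^sup>2) + 2 * ennreal (L \<omega>) = ennreal ((L \<omega> - 1)\<^sup>2 + 2 * L \<omega>)"
        using L0[of \<omega>] by (simp add: ennreal_mult)
      also have "(L \<omega> - 1)\<^sup>2 + 2 * L \<omega> = (L \<omega>)\<^sup>2 + 1" by (simp add: power2_eq_square algebra_simps)
      also have "ennreal \<dots> = ennreal ((L \<omega>)\<^sup>2) + 1" by simp
      finally show "ennreal ((L \<omega> - 1)\<^sup>2) + 2 * ennreal (L \<omega>) = ennreal ((L \<omega>)\<^sup>2) + 1" .
    qed
    also have "\<dots> = ennreal (exp s) + 1"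
      using EL2 emeasure_space_1 by (subst nn_integral_add) auto
    also have "\<dots> = ennreal (exp s - 1) + 2"
    proof -
      have "ennreal (exp s - 1) + ennreal 2 = ennreal (exp s - 1 + 2)"
        using s by (intro ennreal_plus[symmetric]) auto
      moreover have "ennreal (exp s) + ennreal 1 = ennreal (exp s + 1)"
        by (intro ennreal_plus[symmetric]) auto
      ultimately show ?thesis by (simp add: add.commute)
    qed
    finally show ?thesis by (simp add: add.commute[of _ 2] ennreal_add_left_cancel)
  qed
  define \<delta> where "\<delta> = sqrt (exp s - 1)"
  have \<delta>: "0 < \<delta>" "\<delta>\<^sup>2 = exp s - 1" using s by (auto simp: \<delta>_def)
  \<comment> \<open>Stands in for Cauchy-Schwarz: L - 1 \<le> \<delta>/2 + (L - 1)^2 / (2 \<delta>)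
    pointwise, and with E (L - 1)^2 = \<delta>^2 the right side integrates to \<delta>.\<close>
  define \<epsilon> where "\<epsilon> = 1 / (2 * \<delta>)"
  have \<epsilon>: "0 < \<epsilon>" using \<delta> by (simp add: \<epsilon>_def)
  have "(\<integral>\<^sup>+\<omega>. g (shifted_path u \<omega>) \<partial>M) = (\<integral>\<^sup>+\<omega>. g (shifted_path 0 \<omega>) * ennreal (L \<omega>) \<partial>M)"
    unfolding L_def s_def by (rule cameron_martin[OF \<kappa> adm g])
  also have "\<dots> \<le> (\<integral>\<^sup>+\<omega>. g (shifted_path 0 \<omega>) + (ennreal (\<delta> / 2) + ennreal (\<epsilon>) * ennreal ((L \<omega> - 1)\<^sup>2)) \<partial>M)"
  proof (rule nn_integral_mono)
    fix \<omega>
    have "L \<omega> - 1 \<le> \<delta> / 2 + \<epsilon> * (L \<omega> - 1)\<^sup>2"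
      using zero_le_power2[of "L \<omega> - 1 - \<delta>"] \<delta>(1) by (simp add: \<epsilon>_def field_simps power2_eq_square)
    then have "ennreal (L \<omega>) \<le> ennreal (1 + (\<delta> / 2 + \<epsilon> * (L \<omega> - 1)\<^sup>2))"
      by (intro ennreal_leI) linarith
    also have "\<dots> = 1 + (ennreal (\<delta> / 2) + ennreal (\<epsilon>) * ennreal ((L \<omega> - 1)\<^sup>2))"
      using \<delta>(1) \<epsilon> by (simp add: ennreal_mult)
    finally have "g (shifted_path 0 \<omega>) * ennreal (L \<omega>)
        \<le> g (shifted_path 0 \<omega>) * (1 + (ennreal (\<delta> / 2) + ennreal (\<epsilon>) * ennreal ((L \<omega> - 1)\<^sup>2)))"
      by (rule mult_left_mono) simp
    also have "\<dots> = g (shifted_path 0 \<omega>) + g (shifted_path 0 \<omega>) * (ennreal (\<delta> / 2) + ennreal (\<epsilon>) * ennreal ((L \<omega> - 1)\<^sup>2))"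
      by (simp add: distrib_left)
    also have "\<dots> \<le> g (shifted_path 0 \<omega>) + 1 * (ennreal (\<delta> / 2) + ennreal (\<epsilon>) * ennreal ((L \<omega> - 1)\<^sup>2))"
      by (intro add_left_mono mult_right_mono g1) auto
    finally show "g (shifted_path 0 \<omega>) * ennreal (L \<omega>)
        \<le> g (shifted_path 0 \<omega>) + (ennreal (\<delta> / 2) + ennreal (\<epsilon>) * ennreal ((L \<omega> - 1)\<^sup>2))" by simp
  qed
  also have "\<dots> = (\<integral>\<^sup>+\<omega>. g (shifted_path 0 \<omega>) \<partial>M) + (ennreal (\<delta> / 2) + ennreal (\<epsilon>) * ennreal (\<delta>\<^sup>2))"
    using emeasure_space_1 var \<delta>(2) by (simp add: nn_integral_add nn_integral_cmult)
  also have "ennreal (\<delta> / 2) + ennreal (\<epsilon>) * ennreal (\<delta>\<^sup>2) = ennreal \<delta>"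
  proof -
    have "ennreal (\<delta> / 2) + ennreal (\<epsilon>) * ennreal (\<delta>\<^sup>2) = ennreal (\<delta> / 2 + \<epsilon> * \<delta>\<^sup>2)"
      using \<delta>(1) \<epsilon> by (simp add: ennreal_mult)
    also have "\<delta> / 2 + \<epsilon> * \<delta>\<^sup>2 = \<delta>" using \<delta>(1) by (simp add: \<epsilon>_def power2_eq_square)
    finally show ?thesis .
  qed
  finally show ?thesis by (simp add: \<delta>_def s_def)
qed simp

section \<open>The white noise model\<close>

context
  fixes n :: nat
  assumes n: "1 \<le> n"
begin

abbreviation "law \<equiv> white_noise_law M B n"

lemma sqrt_n: "0 < sqrt (real n)" "sqrt (real n) * sqrt (real n) = real n"
  using n by auto

lemma white_noise_path_measurable_pair:
  "(\<lambda>(w, \<omega>). white_noise_path B n w \<omega>) \<in> measurable (borel \<Otimes>\<^sub>M M) C01"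
proof -
  have "(\<lambda>x. restrict (\<lambda>t. primitive (fst x) t + 1 / sqrt (real n) * B t (snd x)) {0..1})
      \<in> measurable (borel \<Otimes>\<^sub>M M) C01"
  proof (rule measurable_C01I)
    fix t :: real assume t: "t \<in> {0..1}"
    have [measurable]: "B t \<in> borel_measurable M" using t by (rule measurable_B)
    have [measurable]: "(\<lambda>w. primitive w t) \<in> borel_measurable borel"
      unfolding primitive_eq_inner by (intro borel_measurable_continuous_onI continuous_intros)
    show "(\<lambda>x. primitive (fst x) t + 1 / sqrt (real n) * B t (snd x)) \<in> borel_measurable (borel \<Otimes>\<^sub>M M)"
      by measurable
  next
    fix x :: "L2 \<times> 'o" assume "x \<in> space (borel \<Otimes>\<^sub>M M)"
    then show "continuous_on {0..1} (\<lambda>t. primitive (fst x) t + 1 / sqrt (real n) * B t (snd x))"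
      by (intro continuous_intros primitive_continuous continuous_B) (auto simp: space_pair_measure)
  qed
  then show ?thesis by (simp add: white_noise_path_def case_prod_beta)
qed

lemma white_noise_path_measurable [measurable]: "white_noise_path B n w \<in> measurable M C01"
  using measurable_compose[OF measurable_Pair1' white_noise_path_measurable_pair, of w] by simp

lemma prob_space_law: "prob_space (law w)"
  unfolding white_noise_law_def by (rule prob_space_distr) measurable

lemma sets_law [simp, measurable_cong]: "sets (law w) = sets C01"
  by (simp add: white_noise_law_def)

lemma space_law [simp]: "space (law w) = space C01"
  by (simp add: white_noise_law_def)

lemma law_kernel [measurable]: "law \<in> measurable borel (prob_algebra C01)"
proof (rule measurable_prob_algebraI)
  show "prob_space (law w)" for w by (rule prob_space_law)
  have "(\<lambda>w. distr M C01 (white_noise_path B n w)) \<in> measurable borel (subprob_algebra C01)"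
    by (rule measurable_distr2[OF white_noise_path_measurable_pair])
      (auto simp: space_subprob_algebra prob_space_imp_subprob_space prob_space_axioms)
  then show "law \<in> measurable borel (subprob_algebra C01)"
    unfolding white_noise_law_def[abs_def] .
qed

lemma nn_integral_law:
  assumes [measurable]: "g \<in> borel_measurable C01"
  shows "(\<integral>\<^sup>+x. g x \<partial>law w) = (\<integral>\<^sup>+\<omega>. g (white_noise_path B n w \<omega>) \<partial>M)"
  unfolding white_noise_law_def by (rule nn_integral_distr) measurable

lemma wiener_int_white_noise:
  assumes \<kappa>: "filterlim \<kappa> at_top sequentially" and adm: "admissible \<kappa> h"
  shows "AE \<omega> in M. wiener_int \<kappa> h (white_noise_path B n w \<omega>)
    = inner w h + wiener_int \<kappa> h (Bpath \<omega>) / sqrt (real n)"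
  using wiener_int_tendsto[OF adm]
proof eventually_elim
  case (elim \<omega>)
  have "dyadic_int k h (white_noise_path B n w \<omega>)
      = inner (dyadic_proj k h) w + 1 / sqrt (real n) * dyadic_int k h (Bpath \<omega>)" for k
    by (rule dyadic_int_path) (simp add: white_noise_path_def)
  moreover have "(\<lambda>j. inner (dyadic_proj (\<kappa> j) h) w + 1 / sqrt (real n) * dyadic_int (\<kappa> j) h (Bpath \<omega>))
      \<longlonglongrightarrow> inner h w + 1 / sqrt (real n) * wiener_int \<kappa> h (Bpath \<omega>)"
    by (intro tendsto_intros elim filterlim_compose[OF dyadic_proj_tendsto \<kappa>])
  ultimately have "(\<lambda>j. dyadic_int (\<kappa> j) h (white_noise_path B n w \<omega>))
      \<longlonglongrightarrow> inner h w + 1 / sqrt (real n) * wiener_int \<kappa> h (Bpath \<omega>)" by simp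
  then show ?case unfolding wiener_int_def[of \<kappa> h "white_noise_path B n w \<omega>"]
    by (simp add: limI inner_commute)
qed

text \<open>Rescales a path to noise level 1/sqrt n and adds the drift of v. A change u of the
  signal then becomes the Cameron-Martin shift by sqrt n times u of the driving Brownian
  motion.\<close>

definition renoise :: "L2 \<Rightarrow> (real \<Rightarrow> real) \<Rightarrow> real \<Rightarrow> real" where
  "renoise v x = restrict (\<lambda>t. primitive v t + 1 / sqrt (real n) * x t) {0..1}"

lemma renoise_measurable [measurable]: "renoise v \<in> measurable C01 C01"
  unfolding renoise_def[abs_def]
  by (intro measurable_C01I borel_measurable_add borel_measurable_times borel_measurable_const C01_eval_measurable)
    (use n in \<open>auto simp: space_C01 intro!: continuous_intros primitive_continuous\<close>)

lemma white_noise_path_renoise: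
  "white_noise_path B n (v + u) \<omega> = renoise v (shifted_path (sqrt (real n) *\<^sub>R u) \<omega>)"
  using sqrt_n by (auto simp: fun_eq_iff white_noise_path_def renoise_def shifted_path_def
    primitive_eq_inner inner_add_left field_simps)

lemma admissible_scale: "admissible \<kappa> u \<Longrightarrow> admissible \<kappa> (c *\<^sub>R u)"
  using admissible_sum[of "{0::nat}" \<kappa> "\<lambda>_. u" "\<lambda>_. c"] by simp

text \<open>Girsanov's formula with an arbitrary base signal v. Under the law at v the integral of u
  against the path has mean \<open>inner v u\<close>, which is why it is centred in the
  exponent.\<close>

lemma law_shift:
  assumes \<kappa>: "filterlim \<kappa> at_top sequentially" and adm: "admissible \<kappa> u"
    and g[measurable]: "g \<in> borel_measurable C01"
  shows "(\<integral>\<^sup>+x. g x \<partial>law (v + u))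
    = (\<integral>\<^sup>+x. g x * ennreal (exp (real n * (wiener_int \<kappa> u x - inner v u) - real n * (norm u)\<^sup>2 / 2)) \<partial>law v)"
proof -
  let ?u = "sqrt (real n) *\<^sub>R u"
  have sc: "AE \<omega> in M. wiener_int \<kappa> ?u (Bpath \<omega>) = sqrt (real n) * wiener_int \<kappa> u (Bpath \<omega>)"
    using wiener_int_sum[of "{0::nat}" \<kappa> "\<lambda>_. u" "\<lambda>_. sqrt (real n)"] adm by simp
  have "(\<integral>\<^sup>+x. g x \<partial>law (v + u)) = (\<integral>\<^sup>+\<omega>. (g \<circ> renoise v) (shifted_path ?u \<omega>) \<partial>M)"
    unfolding nn_integral_law[OF g] white_noise_path_renoise by simp
  also have "\<dots> = (\<integral>\<^sup>+\<omega>. (g \<circ> renoise v) (shifted_path 0 \<omega>)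
      * ennreal (exp (wiener_int \<kappa> ?u (Bpath \<omega>) - (norm ?u)\<^sup>2 / 2)) \<partial>M)"
    by (rule cameron_martin[OF \<kappa> admissible_scale[OF adm]]) (simp add: o_def)
  also have "\<dots> = (\<integral>\<^sup>+\<omega>. g (white_noise_path B n v \<omega>) * ennreal (exp (real n *
      (wiener_int \<kappa> u (white_noise_path B n v \<omega>) - inner v u) - real n * (norm u)\<^sup>2 / 2)) \<partial>M)"
  proof (rule nn_integral_cong_AE, use sc wiener_int_white_noise[OF \<kappa> adm, of v] in eventually_elim)
    case (elim \<omega>)
    have "real n * (wiener_int \<kappa> u (white_noise_path B n v \<omega>) - inner v u) = sqrt (real n) * wiener_int \<kappa> u (Bpath \<omega>)"
    proof -
      have "wiener_int \<kappa> u (white_noise_path B n v \<omega>) - inner v u = wiener_int \<kappa> u (Bpath \<omega>) / sqrt (real n)"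
        using elim(2) by simp
      moreover have "real n * (wiener_int \<kappa> u (Bpath \<omega>) / sqrt (real n))
          = (real n / sqrt (real n)) * wiener_int \<kappa> u (Bpath \<omega>)" by simp
      ultimately show ?thesis by (simp only: real_div_sqrt[OF of_nat_0_le_iff])
    qed
    moreover have "(norm ?u)\<^sup>2 = real n * (norm u)\<^sup>2" by (simp add: power_mult_distrib)
    ultimately show ?case using elim(1) white_noise_path_renoise[of v 0 \<omega>] by simp
  qed
  also have "\<dots> = (\<integral>\<^sup>+x. g x * ennreal (exp (real n * (wiener_int \<kappa> u x - inner v u) - real n * (norm u)\<^sup>2 / 2)) \<partial>law v)"
    by (subst nn_integral_law) auto
  finally show ?thesis .
qed

text \<open>The cap at 1 is trivial for functions bounded by 1, but it makes the bound integrable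
  over the prior and provides the dominating constant when N tends to infinity in
  \<open>posterior_tail_bound\<close>.\<close>

lemma law_tv:
  assumes [measurable]: "g \<in> borel_measurable C01" and g1: "\<And>x. g x \<le> 1"
  shows "(\<integral>\<^sup>+x. g x \<partial>law v) \<le> (\<integral>\<^sup>+x. g x \<partial>law w) + ennreal (min 1 (sqrt (exp (real n * (norm (v - w))\<^sup>2) - 1)))"
proof -
  let ?u = "sqrt (real n) *\<^sub>R (v - w)"
  obtain \<kappa> where \<kappa>: "filterlim \<kappa> at_top sequentially" "admissible \<kappa> (v - w)"
    using ex_admissible[of "{v - w}"] by auto
  have "(\<integral>\<^sup>+x. g x \<partial>law v) = (\<integral>\<^sup>+\<omega>. (g \<circ> renoise w) (shifted_path ?u \<omega>) \<partial>M)"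
    using white_noise_path_renoise[of w "v - w"] by (subst nn_integral_law) simp_all
  also have "\<dots> \<le> (\<integral>\<^sup>+\<omega>. (g \<circ> renoise w) (shifted_path 0 \<omega>) \<partial>M) + ennreal (sqrt (exp ((norm ?u)\<^sup>2) - 1))"
    by (rule cameron_martin_tv[OF \<kappa>(1) admissible_scale[OF \<kappa>(2)]]) (simp_all add: o_def g1)
  also have "(\<integral>\<^sup>+\<omega>. (g \<circ> renoise w) (shifted_path 0 \<omega>) \<partial>M) = (\<integral>\<^sup>+x. g x \<partial>law w)"
    using white_noise_path_renoise[of w 0] by (subst nn_integral_law) simp_all
  finally have 1: "(\<integral>\<^sup>+x. g x \<partial>law v) \<le> (\<integral>\<^sup>+x. g x \<partial>law w) + ennreal (sqrt (exp (real n * (norm (v - w))\<^sup>2) - 1))"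
    by (simp add: power_mult_distrib)
  have "(\<integral>\<^sup>+x. g x \<partial>law v) \<le> (\<integral>\<^sup>+x. 1 \<partial>law v)" by (intro nn_integral_mono g1)
  also have "\<dots> = 1" using prob_space.emeasure_space_1[OF prob_space_law] by simp
  finally have "(\<integral>\<^sup>+x. g x \<partial>law v) \<le> (\<integral>\<^sup>+x. g x \<partial>law w) + ennreal 1"
    by (simp add: add_increasing)
  then show ?thesis using 1 by (cases "1 \<le> sqrt (exp (real n * (norm (v - w))\<^sup>2) - 1)") (auto simp: min_def)
qed

lemma nn_integral_law_wiener_int:
  fixes \<psi> :: "'i \<Rightarrow> L2"
  assumes \<kappa>: "filterlim \<kappa> at_top sequentially" and J: "finite J"
    and adm: "\<And>j. j \<in> J \<Longrightarrow> admissible \<kappa> (\<psi> j)"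
    and ortho: "\<And>i j. i \<in> J \<Longrightarrow> j \<in> J \<Longrightarrow> inner (\<psi> i) (\<psi> j) = (if i = j then 1 else 0)"
    and F[measurable]: "F \<in> borel_measurable (PiM J (\<lambda>_. borel))"
  shows "(\<integral>\<^sup>+x. F (\<lambda>j\<in>J. sqrt (real n) * wiener_int \<kappa> (\<psi> j) x) \<partial>law v)
    = (\<integral>\<^sup>+z. F (\<lambda>j\<in>J. sqrt (real n) * inner v (\<psi> j) + z j) \<partial>PiM J (\<lambda>_. std_normal_distribution))"
proof -
  let ?W = "\<lambda>\<omega>. \<lambda>j\<in>J. wiener_int \<kappa> (\<psi> j) (Bpath \<omega>)"
  have [measurable]: "?W \<in> measurable M (PiM J (\<lambda>_. borel))"
    by (intro measurable_restrict wiener_int_measurable)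
  have [measurable]: "(\<lambda>x. \<lambda>j\<in>J. sqrt (real n) * wiener_int \<kappa> (\<psi> j) x) \<in> measurable C01 (PiM J (\<lambda>_. borel))"
    by (intro measurable_restrict borel_measurable_times borel_measurable_const wiener_int_measurable_C01)
  have [measurable]: "(\<lambda>z. \<lambda>j\<in>J. sqrt (real n) * inner v (\<psi> j) + z j) \<in> measurable (PiM J (\<lambda>_. borel)) (PiM J (\<lambda>_. borel))"
    by measurable
  have "AE \<omega> in M. \<forall>j\<in>J. wiener_int \<kappa> (\<psi> j) (white_noise_path B n v \<omega>)
      = inner v (\<psi> j) + wiener_int \<kappa> (\<psi> j) (Bpath \<omega>) / sqrt (real n)"
    using J adm wiener_int_white_noise[OF \<kappa>] by (simp add: AE_finite_all)
  then have eq: "AE \<omega> in M. (\<lambda>j\<in>J. sqrt (real n) * wiener_int \<kappa> (\<psi> j) (white_noise_path B n v \<omega>))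
      = (\<lambda>j\<in>J. sqrt (real n) * inner v (\<psi> j) + ?W \<omega> j)"
    by eventually_elim (use sqrt_n in \<open>auto simp: fun_eq_iff distrib_left\<close>)
  have "(\<integral>\<^sup>+x. F (\<lambda>j\<in>J. sqrt (real n) * wiener_int \<kappa> (\<psi> j) x) \<partial>law v)
      = (\<integral>\<^sup>+\<omega>. F (\<lambda>j\<in>J. sqrt (real n) * wiener_int \<kappa> (\<psi> j) (white_noise_path B n v \<omega>)) \<partial>M)"
    by (subst nn_integral_law) measurable
  also have "\<dots> = (\<integral>\<^sup>+\<omega>. F (\<lambda>j\<in>J. sqrt (real n) * inner v (\<psi> j) + ?W \<omega> j) \<partial>M)"
    by (rule nn_integral_cong_AE) (use eq in eventually_elim, simp only:)
  also have "\<dots> = (\<integral>\<^sup>+z. F (\<lambda>j\<in>J. sqrt (real n) * inner v (\<psi> j) + z j) \<partial>distr M (PiM J (\<lambda>_. borel)) ?W)"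
    by (subst nn_integral_distr) auto
  also have "distr M (PiM J (\<lambda>_. borel)) ?W = PiM J (\<lambda>_. std_normal_distribution)"
    by (rule distr_wiener_int_PiM[OF \<kappa> J adm ortho])
  finally show ?thesis .
qed

end

end

section \<open>One-dimensional posteriors\<close>

lemma nn_integral_std_normal_exp_quarter:
  "(\<integral>\<^sup>+x. ennreal (exp (x\<^sup>2 / 4)) \<partial>std_normal_distribution) = ennreal (sqrt 2)"
proof -
  have eq: "std_normal_density x * exp (x\<^sup>2 / 4) = sqrt 2 * normal_density 0 (sqrt 2) x" for x
    by (simp add: normal_density_def real_sqrt_mult exp_add[symmetric] field_simps)
  have "(\<integral>\<^sup>+x. ennreal (exp (x\<^sup>2 / 4)) \<partial>std_normal_distribution)
      = (\<integral>\<^sup>+x. ennreal (sqrt 2) * ennreal (normal_density 0 (sqrt 2) x) \<partial>lborel)"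
    by (subst nn_integral_density) (auto simp: ennreal_mult[symmetric] eq)
  also have "\<dots> = ennreal (sqrt 2) * emeasure (density lborel (normal_density 0 (sqrt 2))) UNIV"
    by (subst nn_integral_cmult) (auto simp: emeasure_density)
  also have "\<dots> = ennreal (sqrt 2)"
    using prob_space.emeasure_space_1[OF prob_space_normal_density[of "sqrt 2" 0]] by simp
  finally show ?thesis .
qed

lemma abs_powr_convex:
  fixes x y p t :: real
  assumes "1 \<le> p" "0 \<le> t" "t \<le> 1"
  shows "\<bar>t * x + (1 - t) * y\<bar> powr p \<le> t * \<bar>x\<bar> powr p + (1 - t) * \<bar>y\<bar> powr p"
proof -
  \<comment> \<open>c^p \<le> c on the unit interval; this covers the case in which one of the two
    points is zero, the other case being convexity of the power on positive reals.\<close>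
  have scale: "(c * z) powr p \<le> c * z powr p" if "0 \<le> c" "c \<le> 1" "0 \<le> z" for c z
  proof (cases "c = 0")
    case False
    then have "c powr p \<le> c powr 1" using that assms by (intro powr_mono') auto
    then show ?thesis using that by (simp add: powr_mult mult_right_mono)
  qed simp
  have "\<bar>t * x + (1 - t) * y\<bar> powr p \<le> (t * \<bar>x\<bar> + (1 - t) * \<bar>y\<bar>) powr p"
    using assms by (intro powr_mono2) (auto simp: abs_mult intro!: order_trans[OF abs_triangle_ineq])
  also have "\<dots> \<le> t * \<bar>x\<bar> powr p + (1 - t) * \<bar>y\<bar> powr p"
  proof (cases "x = 0 \<or> y = 0")
    case True
    then show ?thesis using scale[of t "\<bar>x\<bar>"] scale[of "1 - t" "\<bar>y\<bar>"] assms by auto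
  next
    case False
    then show ?thesis
      using convex_onD[OF powr_convex[OF assms(1)], of "1 - t" "\<bar>x\<bar>" "\<bar>y\<bar>"] assms by auto
  qed
  finally show ?thesis .
qed

text \<open>A linear lower bound uniform in p, which gives the prior at least exponential tails for
  every admissible p.\<close>

lemma abs_powr_ge: "\<bar>x\<bar> - 1 \<le> \<bar>x\<bar> powr p" if "1 \<le> p" for x p :: real
proof (cases "\<bar>x\<bar> \<le> 1")
  case True then show ?thesis by (smt (verit) powr_ge_zero)
next
  case False
  then have "\<bar>x\<bar> powr 1 \<le> \<bar>x\<bar> powr p" using that by (intro powr_mono) auto
  then show ?thesis using False by simp
qed

text \<open>The substitution \<open>x = a + (1 + \<eta>) (y - a)\<close> and convexity of \<open>V\<close> turn an integral against
  \<open>exp (- V)\<close> into a pointwise supremum, without integrating by parts.\<close>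

lemma dilation_bound:
  fixes V :: "real \<Rightarrow> real" and g :: "real \<Rightarrow> ennreal"
  assumes [measurable]: "V \<in> borel_measurable borel" "g \<in> borel_measurable borel"
    and \<eta>: "0 < \<eta>"
    and conv: "\<And>x. (1 + \<eta>) * V x - \<eta> * V a \<le> V (a + (1 + \<eta>) * (x - a))"
    and bound: "\<And>x. g (a + (1 + \<eta>) * (x - a)) * ennreal (exp (\<eta> * (V a - V x))) \<le> C"
  shows "(\<integral>\<^sup>+x. g x * ennreal (exp (- V x)) \<partial>lborel)
    \<le> ennreal (1 + \<eta>) * C * (\<integral>\<^sup>+x. ennreal (exp (- V x)) \<partial>lborel)"
proof -
  define h where "h x = a + (1 + \<eta>) * (x - a)" for x
  have h: "h x = (a - (1 + \<eta>) * a) + (1 + \<eta>) * x" for x by (simp add: h_def algebra_simps)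
  have [measurable]: "h \<in> borel_measurable borel" unfolding h_def by measurable
  have "(\<integral>\<^sup>+x. g x * ennreal (exp (- V x)) \<partial>lborel)
      = ennreal (1 + \<eta>) * (\<integral>\<^sup>+x. g (h x) * ennreal (exp (- V (h x))) \<partial>lborel)"
    unfolding h using \<eta> by (subst nn_integral_real_affine[where c="1 + \<eta>" and t="a - (1 + \<eta>) * a"]) auto
  also have "(\<integral>\<^sup>+x. g (h x) * ennreal (exp (- V (h x))) \<partial>lborel)
      \<le> (\<integral>\<^sup>+x. C * ennreal (exp (- V x)) \<partial>lborel)"
  proof (rule nn_integral_mono)
    fix x
    have "exp (- V (h x)) \<le> exp (\<eta> * (V a - V x)) * exp (- V x)"
      using conv[of x] by (simp add: h_def exp_add[symmetric] algebra_simps)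
    then have "g (h x) * ennreal (exp (- V (h x)))
        \<le> g (h x) * (ennreal (exp (\<eta> * (V a - V x))) * ennreal (exp (- V x)))"
      by (intro mult_left_mono) (auto simp: ennreal_mult[symmetric] intro!: ennreal_leI)
    also have "\<dots> \<le> C * ennreal (exp (- V x))"
      using bound[of x] by (auto simp: h_def mult.assoc[symmetric] intro!: mult_right_mono)
    finally show "g (h x) * ennreal (exp (- V (h x))) \<le> C * ennreal (exp (- V x))" .
  qed
  also have "\<dots> = C * (\<integral>\<^sup>+x. ennreal (exp (- V x)) \<partial>lborel)"
    by (rule nn_integral_cmult) measurable
  finally show ?thesis by (simp add: mult_left_mono mult.assoc)
qed

lemma nn_integral_exp_abs_finite:
  assumes p: "1 \<le> p" "p \<le> 2"
  shows "(\<integral>\<^sup>+x. ennreal (exp (- (\<bar>x\<bar> powr p) / p)) \<partial>lborel) < \<infinity>"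
proof -
  \<comment> \<open>Rate 1/2 because p \<le> 2 gives |x|^p / p \<ge> (|x| - 1) / 2. The two
    reflected exponential densities together dominate the two-sided tail.\<close>
  let ?e = "exponential_density (1/2)"
  have le: "exp (- (\<bar>x\<bar> powr p) / p) \<le> 2 * exp (1/2) * (?e x + ?e (- x))" for x
  proof -
    have "(\<bar>x\<bar> - 1) / 2 \<le> (\<bar>x\<bar> powr p) / p"
    proof (cases "\<bar>x\<bar> \<le> 1")
      case True
      then have "(\<bar>x\<bar> - 1) / 2 \<le> 0" by simp
      also have "0 \<le> (\<bar>x\<bar> powr p) / p" using p by simp
      finally show ?thesis .
    next
      case False
      then have "(\<bar>x\<bar> - 1) / 2 \<le> (\<bar>x\<bar> - 1) / p" using p by (intro divide_left_mono) auto
      also have "\<dots> \<le> (\<bar>x\<bar> powr p) / p" using abs_powr_ge[OF p(1), of x] p by (intro divide_right_mono) auto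
      finally show ?thesis .
    qed
    then have "exp (- (\<bar>x\<bar> powr p) / p) \<le> exp (1/2 - \<bar>x\<bar> / 2)" by (simp add: field_simps)
    also have "\<dots> = exp (1/2) * exp (- \<bar>x\<bar> / 2)" by (simp add: exp_add[symmetric])
    also have "\<dots> \<le> exp (1/2) * (2 * (?e x + ?e (- x)))"
      by (intro mult_left_mono) (auto simp: exponential_density_def abs_if)
    finally show ?thesis by (simp add: algebra_simps)
  qed
  have one: "(\<integral>\<^sup>+x. ennreal (?e x) \<partial>lborel) = 1"
    using prob_space.emeasure_space_1[OF prob_space_exponential_density[of "1/2"]]
    by (simp add: emeasure_density)
  have two: "(\<integral>\<^sup>+x. ennreal (?e (- x)) \<partial>lborel) = 1"
    using one by (subst (asm) nn_integral_real_affine[where c="-1" and t=0]) auto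
  have "(\<integral>\<^sup>+x. ennreal (exp (- (\<bar>x\<bar> powr p) / p)) \<partial>lborel)
      \<le> (\<integral>\<^sup>+x. ennreal (2 * exp (1/2)) * (ennreal (?e x) + ennreal (?e (- x))) \<partial>lborel)"
  proof (rule nn_integral_mono)
    fix x :: real
    have "0 \<le> ?e x" "0 \<le> ?e (- x)" by (auto simp: exponential_density_def)
    then show "ennreal (exp (- (\<bar>x\<bar> powr p) / p)) \<le> ennreal (2 * exp (1/2)) * (ennreal (?e x) + ennreal (?e (- x)))"
      using le[of x] by (simp add: ennreal_plus[symmetric] ennreal_mult[symmetric] ennreal_leI del: ennreal_plus)
  qed
  also have "\<dots> = ennreal (2 * exp (1/2)) * (1 + 1)"
    by (subst nn_integral_cmult, measurable) (subst nn_integral_add, auto simp: one two)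
  also have "\<dots> < \<infinity>" by (simp add: ennreal_mult_less_top)
  finally show ?thesis .
qed

section \<open>Normalisation of the p-exponential law\<close>

definition p_exp_const :: "real \<Rightarrow> real" where
  "p_exp_const p = (LBINT y. exp (- (\<bar>y\<bar> powr p) / p))"

context
  fixes p :: real
  assumes p: "1 \<le> p" "p \<le> 2"
begin

lemma nn_p_exp_const:
  "(\<integral>\<^sup>+x. ennreal (exp (- (\<bar>x\<bar> powr p) / p)) \<partial>lborel) = ennreal (p_exp_const p)"
proof -
  have "integrable lborel (\<lambda>x. exp (- (\<bar>x\<bar> powr p) / p))"
    by (rule integrableI_nonneg) (use nn_integral_exp_abs_finite[OF p] in auto)
  then show ?thesis unfolding p_exp_const_def by (rule nn_integral_eq_integral) auto
qed

lemma p_exp_const_pos: "0 < p_exp_const p"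
proof -
  have "(\<integral>\<^sup>+x. ennreal (exp (- (\<bar>x\<bar> powr p) / p)) \<partial>lborel) \<noteq> 0"
  proof
    assume "(\<integral>\<^sup>+x. ennreal (exp (- (\<bar>x\<bar> powr p) / p)) \<partial>lborel) = 0"
    then have "AE x in (lborel :: real measure). False"
      by (subst (asm) nn_integral_0_iff_AE) (auto simp: ennreal_eq_0_iff not_le)
    then have "emeasure (lborel :: real measure) UNIV = 0"
      using AE_iff_measurable[of UNIV "lborel :: real measure" "\<lambda>_. False"] by simp
    then show False by simp
  qed
  then show ?thesis unfolding nn_p_exp_const by (simp add: ennreal_eq_0_iff)
qed

lemma p_exponential_eq:
  "p_exponential p = density lborel (\<lambda>x. ennreal (exp (- (\<bar>x\<bar> powr p) / p) / p_exp_const p))"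
  by (simp add: p_exponential_def p_exp_const_def)

lemma nn_integral_p_exponential:
  assumes [measurable]: "g \<in> borel_measurable borel"
  shows "(\<integral>\<^sup>+x. g x \<partial>p_exponential p)
    = ennreal (1 / p_exp_const p) * (\<integral>\<^sup>+x. g x * ennreal (exp (- (\<bar>x\<bar> powr p) / p)) \<partial>lborel)"
proof -
  have eq: "ennreal (exp (- (\<bar>x\<bar> powr p) / p) / p_exp_const p)
      = ennreal (1 / p_exp_const p) * ennreal (exp (- (\<bar>x\<bar> powr p) / p))" for x
    using p_exp_const_pos by (simp add: ennreal_mult[symmetric])
  show ?thesis
    unfolding p_exponential_eq
    by (subst nn_integral_density, measurable, subst nn_integral_cmult[symmetric], measurable)
      (simp only: eq ac_simps)
qed

lemma sets_p_exponential [simp, measurable_cong]: "sets (p_exponential p) = sets borel"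
  by (simp add: p_exponential_eq)

lemma space_p_exponential [simp]: "space (p_exponential p) = UNIV"
  by (simp add: p_exponential_eq)

lemma prob_space_p_exponential: "prob_space (p_exponential p)"
proof
  have "emeasure (p_exponential p) (space (p_exponential p)) = (\<integral>\<^sup>+x. 1 \<partial>p_exponential p)"
    by simp
  also have "\<dots> = 1"
    using p_exp_const_pos nn_p_exp_const
    by (subst nn_integral_p_exponential) (auto simp: ennreal_mult[symmetric])
  finally show "emeasure (p_exponential p) (space (p_exponential p)) = 1" .
qed

end

section \<open>Posterior expectations and exponential risk in one coordinate\<close>

context
  fixes p :: real
  assumes p: "1 \<le> p" "p \<le> 2"
begin

text \<open>Density at y of a normal law with mean \<sigma> x and unit variance, relative to the
  standard normal law. The scalar model is y = \<sigma> x + noise with x drawn from the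
  p-exponential law; \<open>evidence\<close> is its relative marginal density and
  \<open>post_int\<close> its posterior expectation.\<close>

definition lik :: "real \<Rightarrow> real \<Rightarrow> real \<Rightarrow> real" where
  "lik \<sigma> y x = exp (\<sigma> * x * y - (\<sigma> * x)\<^sup>2 / 2)"

definition evidence :: "real \<Rightarrow> real \<Rightarrow> ennreal" where
  "evidence \<sigma> y = (\<integral>\<^sup>+x. ennreal (lik \<sigma> y x) \<partial>p_exponential p)"

definition post_int :: "real \<Rightarrow> (real \<Rightarrow> ennreal) \<Rightarrow> real \<Rightarrow> ennreal" where
  "post_int \<sigma> g y = (\<integral>\<^sup>+x. g x * ennreal (lik \<sigma> y x) \<partial>p_exponential p) / evidence \<sigma> y"

declare sets_p_exponential [OF p, simp, measurable_cong] space_p_exponential [OF p, simp]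

lemma lik_measurable [measurable]: "(\<lambda>(y, x). lik \<sigma> y x) \<in> borel_measurable (borel \<Otimes>\<^sub>M borel)"
  unfolding lik_def by measurable

lemma evidence_measurable [measurable]: "evidence \<sigma> \<in> borel_measurable borel"
proof -
  interpret prob_space "p_exponential p" by (rule prob_space_p_exponential[OF p])
  show ?thesis unfolding evidence_def[abs_def] by measurable
qed

lemma evidence_pos: "evidence \<sigma> y \<noteq> 0"
proof
  interpret prob_space "p_exponential p" by (rule prob_space_p_exponential[OF p])
  assume "evidence \<sigma> y = 0"
  then have "AE x in p_exponential p. ennreal (lik \<sigma> y x) = 0"
    unfolding evidence_def by (subst (asm) nn_integral_0_iff_AE) (auto simp: lik_def)
  then have "AE x in p_exponential p. False"
    by eventually_elim (simp add: lik_def ennreal_eq_0_iff not_le)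
  then show False by simp
qed

lemma evidence_finite: "evidence \<sigma> y \<noteq> \<infinity>"
proof -
  interpret prob_space "p_exponential p" by (rule prob_space_p_exponential[OF p])
  have "lik \<sigma> y x \<le> exp (y\<^sup>2 / 2)" for x
    using zero_le_power2[of "\<sigma> * x - y"] by (simp add: lik_def power2_diff algebra_simps)
  then have "evidence \<sigma> y \<le> (\<integral>\<^sup>+x. ennreal (exp (y\<^sup>2 / 2)) \<partial>p_exponential p)"
    unfolding evidence_def by (intro nn_integral_mono ennreal_leI)
  also have "\<dots> = ennreal (exp (y\<^sup>2 / 2))" using emeasure_space_1 by simp
  finally show ?thesis by (auto simp: top_unique)
qed

lemma post_int_measurable:
  assumes [measurable]: "g \<in> borel_measurable borel"
  shows "post_int \<sigma> g \<in> borel_measurable borel"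
proof -
  interpret prob_space "p_exponential p" by (rule prob_space_p_exponential[OF p])
  show ?thesis unfolding post_int_def[abs_def] by measurable
qed

lemma post_int_mono:
  assumes "\<And>x. g x \<le> h x"
  shows "post_int \<sigma> g y \<le> post_int \<sigma> h y"
  unfolding post_int_def by (intro divide_right_mono_ennreal nn_integral_mono mult_right_mono assms) auto

lemma post_int_const: "post_int \<sigma> (\<lambda>_. c) y = c"
  unfolding post_int_def evidence_def[symmetric]
  by (subst nn_integral_cmult, simp add: lik_def, simp add: evidence_def[symmetric])
    (metis ennreal_mult_divide_eq evidence_finite evidence_pos infinity_ennreal_def)

lemma post_int_affine:
  assumes [measurable]: "g \<in> borel_measurable borel"
  shows "post_int \<sigma> (\<lambda>x. c * (1 + d * g x)) y = c * (1 + d * post_int \<sigma> g y)"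
proof -
  have "(\<integral>\<^sup>+x. c * (1 + d * g x) * ennreal (lik \<sigma> y x) \<partial>p_exponential p)
      = (\<integral>\<^sup>+x. c * (ennreal (lik \<sigma> y x) + d * (g x * ennreal (lik \<sigma> y x))) \<partial>p_exponential p)"
    by (intro nn_integral_cong) (simp add: algebra_simps)
  also have "\<dots> = c * (evidence \<sigma> y + d * (\<integral>\<^sup>+x. g x * ennreal (lik \<sigma> y x) \<partial>p_exponential p))"
    unfolding evidence_def
    by (subst nn_integral_cmult, (simp add: lik_def; fail), subst nn_integral_add,
        (simp add: lik_def; fail), (simp add: lik_def; fail), subst nn_integral_cmult)
      (simp_all add: lik_def)
  finally have *: "(\<integral>\<^sup>+x. c * (1 + d * g x) * ennreal (lik \<sigma> y x) \<partial>p_exponential p)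
    = c * (evidence \<sigma> y + d * (\<integral>\<^sup>+x. g x * ennreal (lik \<sigma> y x) \<partial>p_exponential p))" .
  have "evidence \<sigma> y / evidence \<sigma> y = 1"
    using evidence_finite evidence_pos by (intro ennreal_divide_self) (auto simp: less_top[symmetric] infinity_ennreal_def)
  then show ?thesis
    unfolding post_int_def *
    by (simp add: divide_ennreal_def algebra_simps)
qed

text \<open>The negative log posterior V is a convex quadratic plus |x|^p / p, so
  \<open>dilation_bound\<close> applies with \<eta> = 1/8. The normalising constants cancel in the
  quotient, and only a pointwise estimate is left to the user of the bound.\<close>

lemma post_int_dilation:
  assumes [measurable]: "g \<in> borel_measurable borel"
    and bound: "\<And>x. g (a + 9/8 * (x - a)) *
      ennreal (exp (1/8 * (((\<sigma> * a)\<^sup>2 / 2 - \<sigma> * a * y + \<bar>a\<bar> powr p / p)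
        - ((\<sigma> * x)\<^sup>2 / 2 - \<sigma> * x * y + \<bar>x\<bar> powr p / p)))) \<le> C"
  shows "post_int \<sigma> g y \<le> ennreal (9/8) * C"
proof -
  define V where "V x = (\<sigma> * x)\<^sup>2 / 2 - \<sigma> * x * y + \<bar>x\<bar> powr p / p" for x
  have [measurable]: "V \<in> borel_measurable borel" unfolding V_def by measurable
  have V: "lik \<sigma> y x * exp (- (\<bar>x\<bar> powr p) / p) = exp (- V x)" for x
    by (simp add: lik_def V_def exp_add[symmetric] algebra_simps)
  have conv: "(1 + 1/8) * V x - 1/8 * V a \<le> V (a + (1 + 1/8) * (x - a))" for x
  proof -
    define z where "z = a + (1 + 1/8) * (x - a)"
    \<comment> \<open>The original point is a convex combination of the dilated point z and the
      centre a, with weight 8/9 = 1 / (1 + 1/8).\<close>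
    have x: "x = 8/9 * z + (1 - 8/9) * a" by (simp add: z_def field_simps)
    have "\<bar>x\<bar> powr p \<le> 8/9 * \<bar>z\<bar> powr p + (1 - 8/9) * \<bar>a\<bar> powr p"
      unfolding x by (rule abs_powr_convex[OF p(1)]) auto
    then have "9/8 * (\<bar>x\<bar> powr p) - 1/8 * \<bar>a\<bar> powr p \<le> \<bar>z\<bar> powr p" by simp
    then have 1: "(9/8 * (\<bar>x\<bar> powr p) - 1/8 * \<bar>a\<bar> powr p) / p \<le> \<bar>z\<bar> powr p / p"
      using p by (intro divide_right_mono) auto
    \<comment> \<open>For a quadratic the convexity defect is explicit: \<eta> (1 + \<eta>) / 2 =
      9/128.\<close>
    have "(\<sigma> * z)\<^sup>2 / 2 - \<sigma> * z * y - (9/8 * ((\<sigma> * x)\<^sup>2 / 2 - \<sigma> * x * y)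
        - 1/8 * ((\<sigma> * a)\<^sup>2 / 2 - \<sigma> * a * y)) = 9/128 * (\<sigma> * (x - a))\<^sup>2"
      unfolding z_def by (simp add: power2_eq_square field_simps)
    also have "\<dots> \<ge> 0" by simp
    finally have 2: "9/8 * ((\<sigma> * x)\<^sup>2 / 2 - \<sigma> * x * y) - 1/8 * ((\<sigma> * a)\<^sup>2 / 2 - \<sigma> * a * y)
        \<le> (\<sigma> * z)\<^sup>2 / 2 - \<sigma> * z * y"
      by simp
    show ?thesis using 1 2 unfolding V_def z_def[symmetric]
      by (simp add: algebra_simps diff_divide_distrib)
  qed
  have cc: "0 < ennreal (1 / p_exp_const p)" "ennreal (1 / p_exp_const p) \<noteq> \<top>"
    using p_exp_const_pos[OF p] by (auto simp: ennreal_zero_less_divide)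
  have mV: "ennreal (lik \<sigma> y x) * ennreal (exp (- (\<bar>x\<bar> powr p) / p)) = ennreal (exp (- V x))" for x
    unfolding V[symmetric] by (rule ennreal_mult[symmetric]) (auto simp: lik_def)
  have [measurable]: "lik \<sigma> y \<in> borel_measurable borel" unfolding lik_def[abs_def] by measurable
  have num: "(\<integral>\<^sup>+x. g x * ennreal (lik \<sigma> y x) \<partial>p_exponential p)
     = ennreal (1 / p_exp_const p) * (\<integral>\<^sup>+x. g x * ennreal (exp (- V x)) \<partial>lborel)"
    by (subst nn_integral_p_exponential[OF p], measurable) (simp only: mult.assoc mV)
  have den: "evidence \<sigma> y = ennreal (1 / p_exp_const p) * (\<integral>\<^sup>+x. ennreal (exp (- V x)) \<partial>lborel)"
    unfolding evidence_def by (subst nn_integral_p_exponential[OF p], measurable) (simp only: mV)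
  have "(\<integral>\<^sup>+x. g x * ennreal (exp (- V x)) \<partial>lborel)
     \<le> ennreal (1 + 1/8) * C * (\<integral>\<^sup>+x. ennreal (exp (- V x)) \<partial>lborel)"
    by (rule dilation_bound[where \<eta>="1/8" and a=a]) (use conv bound in \<open>auto simp: V_def\<close>)
  then have "(\<integral>\<^sup>+x. g x * ennreal (lik \<sigma> y x) \<partial>p_exponential p) \<le> (ennreal (9/8) * C) * evidence \<sigma> y"
    unfolding num den by (simp add: mult.left_commute mult_left_mono)
  then have "post_int \<sigma> g y \<le> ((ennreal (9/8) * C) * evidence \<sigma> y) / evidence \<sigma> y"
    unfolding post_int_def by (rule divide_right_mono_ennreal)
  also have "\<dots> = ennreal (9/8) * C"
    using evidence_finite evidence_pos by (intro ennreal_mult_divide_eq) auto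
  finally show ?thesis .
qed

text \<open>The constant \<open>81\<close> leaves room for the dilation by \<open>9/8\<close> used in both risk bounds. The bound below
  is used where the prior scale dominates the noise or the signal is large,
  \<open>post_risk_exp_bound_small\<close> where the signal is below the noise level.\<close>

lemma post_risk_exp_bound:
  assumes \<sigma>: "0 < \<sigma>"
  shows "(\<integral>\<^sup>+e. post_int \<sigma> (\<lambda>x. ennreal (exp ((\<sigma> * x - u)\<^sup>2 / 81))) (u + e) \<partial>std_normal_distribution)
    \<le> ennreal (exp (1 + \<bar>u / \<sigma>\<bar> powr p))"
proof -
  define \<phi> where "\<phi> = \<bar>u / \<sigma>\<bar> powr p"
  have \<phi>: "0 \<le> \<phi>" by (simp add: \<phi>_def)
  have ph: "\<phi> / p \<le> \<phi>" using p \<phi> by (simp add: divide_le_eq mult_le_cancel_left1)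
  have le: "post_int \<sigma> (\<lambda>x. ennreal (exp ((\<sigma> * x - u)\<^sup>2 / 81))) (u + e)
      \<le> ennreal (9/8) * ennreal (exp (\<phi> + e\<^sup>2 / 4))" for e
  proof (rule post_int_dilation[where a="u / \<sigma>"])
    fix x
    define \<delta> where "\<delta> = \<sigma> * x - u"
    have x: "\<sigma> * x = u + \<delta>" by (simp add: \<delta>_def)
    have su: "\<sigma> * (u / \<sigma>) = u" using \<sigma> by simp
    have px: "0 \<le> \<bar>x\<bar> powr p / p" using p by simp
    have dil: "\<sigma> * (u / \<sigma> + 9/8 * (x - u / \<sigma>)) - u = 9/8 * \<delta>"
      using \<sigma> by (simp add: \<delta>_def field_simps)
    have "(9/8 * \<delta>)\<^sup>2 / 81 + 1/8 * (((\<sigma> * (u/\<sigma>))\<^sup>2 / 2 - \<sigma> * (u/\<sigma>) * (u + e) + \<bar>u/\<sigma>\<bar> powr p / p)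
        - ((\<sigma> * x)\<^sup>2 / 2 - \<sigma> * x * (u + e) + \<bar>x\<bar> powr p / p))
      \<le> (9/8 * \<delta>)\<^sup>2 / 81 + 1/8 * ((u\<^sup>2 / 2 - u * (u + e) + \<phi>)
        - ((u + \<delta>)\<^sup>2 / 2 - (u + \<delta>) * (u + e)))"
      unfolding x su \<phi>_def[symmetric]
      by (intro add_left_mono mult_left_mono diff_mono) (use ph px in auto)
    \<comment> \<open>Here the 81 cancels: (9/8)^2 / 81 = 1/64, and the likelihood contributes
      -1/16, so -3/64 remains to absorb the cross term with the noise.\<close>
    also have "\<dots> = \<phi> / 8 + \<delta> * e / 8 - 3/64 * \<delta>\<^sup>2"
      by (simp add: power2_eq_square field_simps)
    also have "\<dots> \<le> \<phi> + e\<^sup>2 / 4"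
    proof -
      have "\<delta> * e / 8 \<le> e\<^sup>2 / 4 + \<delta>\<^sup>2 / 64"
        using zero_le_power2[of "\<delta> / 8 - e / 2"] by (simp add: power2_eq_square algebra_simps)
      then show ?thesis using \<phi> zero_le_power2[of \<delta>] by linarith
    qed
    finally show "ennreal (exp ((\<sigma> * (u / \<sigma> + 9/8 * (x - u / \<sigma>)) - u)\<^sup>2 / 81)) *
      ennreal (exp (1/8 * (((\<sigma> * (u/\<sigma>))\<^sup>2 / 2 - \<sigma> * (u/\<sigma>) * (u + e) + \<bar>u/\<sigma>\<bar> powr p / p)
        - ((\<sigma> * x)\<^sup>2 / 2 - \<sigma> * x * (u + e) + \<bar>x\<bar> powr p / p)))) \<le> ennreal (exp (\<phi> + e\<^sup>2 / 4))"
      unfolding dil by (subst ennreal_mult[symmetric]) (auto simp: exp_add[symmetric] intro!: ennreal_leI)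
  qed measurable
  have "(\<integral>\<^sup>+e. post_int \<sigma> (\<lambda>x. ennreal (exp ((\<sigma> * x - u)\<^sup>2 / 81))) (u + e) \<partial>std_normal_distribution)
      \<le> (\<integral>\<^sup>+e. ennreal (9/8 * exp \<phi>) * ennreal (exp (e\<^sup>2 / 4)) \<partial>std_normal_distribution)"
    by (intro nn_integral_mono order_trans[OF le]) (simp add: ennreal_mult[symmetric] exp_add)
  also have "\<dots> = ennreal (9/8 * exp \<phi>) * ennreal (sqrt 2)"
    by (subst nn_integral_cmult) (simp_all add: nn_integral_std_normal_exp_quarter)
  also have "\<dots> = ennreal (9/8 * sqrt 2 * exp \<phi>)"
    by (simp add: ennreal_mult[symmetric] mult.commute mult.left_commute)
  \<comment> \<open>The Jacobian 9/8 of the dilation and the Gaussian integral sqrt 2 together stay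
    below e; this is the summand 1 in the exponent.\<close>
  also have "\<dots> \<le> ennreal (exp 1 * exp \<phi>)"
  proof (intro ennreal_leI mult_right_mono)
    have "sqrt 2 \<le> 3/2" by (rule real_le_lsqrt) (auto simp: power2_eq_square)
    moreover have "2 \<le> exp (1::real)" using exp_ge_add_one_self[of 1] by simp
    ultimately show "9/8 * sqrt 2 \<le> exp (1::real)" by simp
  qed auto
  finally show ?thesis by (simp add: exp_add \<phi>_def)
qed

text \<open>Dilation about the origin: an eighth of the log prior, exp (- |x|^p / (8 p)), controls
  x^2, and an eighth of the log-likelihood controls the exponential factor. The bound does not
  depend on \<sigma>, and exp (y^2 / 8) remains integrable under Gaussian noise.\<close>

lemma post_int_second_moment:
  "post_int \<sigma> (\<lambda>x. ennreal (x\<^sup>2 * exp (2/81 * (\<sigma> * x)\<^sup>2))) y \<le> ennreal (9/8) * ennreal (1000 * exp (y\<^sup>2 / 8))"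
proof -
  define h where "h x = x\<^sup>2 * exp (2/81 * (\<sigma> * x)\<^sup>2)" for x
  have h0: "0 \<le> h x" for x by (simp add: h_def)
  have [measurable]: "h \<in> borel_measurable borel" unfolding h_def[abs_def] by measurable
  have "post_int \<sigma> (\<lambda>x. ennreal (h x)) y \<le> ennreal (9/8) * ennreal (1000 * exp (y\<^sup>2 / 8))"
  proof (rule post_int_dilation[where a=0])
    fix x
    \<comment> \<open>From exp t \<ge> t^2 / 2 at t = |x| / 16 comes 512, and the factor exp (1/16)
      from the linear lower bound on |x|^p brings it to less than 600.\<close>
    have 1: "x\<^sup>2 * exp (- (\<bar>x\<bar> powr p / (8 * p))) \<le> 600"
    proof -
      have "(\<bar>x\<bar> - 1) / 16 \<le> \<bar>x\<bar> powr p / (8 * p)"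
      proof (cases "\<bar>x\<bar> \<le> 1")
        case True
        then have "(\<bar>x\<bar> - 1) / 16 \<le> 0" by simp
        also have "0 \<le> \<bar>x\<bar> powr p / (8 * p)" using p by simp
        finally show ?thesis .
      next
        case False
        then have "(\<bar>x\<bar> - 1) / 16 \<le> (\<bar>x\<bar> - 1) / (8 * p)" using p by (intro divide_left_mono) auto
        also have "\<dots> \<le> (\<bar>x\<bar> powr p) / (8 * p)"
          using abs_powr_ge[OF p(1), of x] p by (intro divide_right_mono) auto
        finally show ?thesis .
      qed
      then have "exp (- (\<bar>x\<bar> powr p / (8 * p))) \<le> exp (1/16) * exp (- \<bar>x\<bar> / 16)"
        by (simp add: exp_add[symmetric] field_simps)
      then have "x\<^sup>2 * exp (- (\<bar>x\<bar> powr p / (8 * p))) \<le> x\<^sup>2 * (exp (1/16) * exp (- \<bar>x\<bar> / 16))"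
        by (intro mult_left_mono) auto
      also have "\<dots> = exp (1/16) * (x\<^sup>2 / exp (\<bar>x\<bar> / 16))" by (simp add: exp_minus field_simps)
      also have "x\<^sup>2 / exp (\<bar>x\<bar> / 16) \<le> 512"
      proof -
        have "(\<bar>x\<bar> / 16)\<^sup>2 / 2 \<le> exp (\<bar>x\<bar> / 16)"
          using exp_lower_Taylor_quadratic[of "\<bar>x\<bar> / 16"] by simp
        then show ?thesis by (simp add: divide_le_eq power_divide)
      qed
      also have "exp (1/16 :: real) \<le> 1 + 1/16 + (1/16)\<^sup>2" by (rule exp_bound) auto
      finally show ?thesis by (simp add: power2_eq_square)
    qed
    \<comment> \<open>After dilation the coefficient of (\<sigma> x)^2 is 2/64 - 1/16 = -1/32, so
      the left side is at most y^2 / 8 by completing the square.\<close>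
    have 2: "2/81 * (\<sigma> * (9/8 * x))\<^sup>2 + 1/8 * (\<sigma> * x * y - (\<sigma> * x)\<^sup>2 / 2) \<le> y\<^sup>2 / 8"
      using zero_le_power2[of "\<sigma> * x / 2 - y"]
      by (simp add: power2_eq_square algebra_simps)
    have "h (9/8 * x) * exp (1/8 * (- ((\<sigma> * x)\<^sup>2 / 2 - \<sigma> * x * y + \<bar>x\<bar> powr p / p)))
        = 81/64 * (x\<^sup>2 * exp (- (\<bar>x\<bar> powr p / (8 * p)))) *
          exp (2/81 * (\<sigma> * (9/8 * x))\<^sup>2 + 1/8 * (\<sigma> * x * y - (\<sigma> * x)\<^sup>2 / 2))"
      by (simp add: h_def power_mult_distrib power_divide exp_add[symmetric] algebra_simps)
    also have "\<dots> \<le> (81/64 * 600) * exp (y\<^sup>2 / 8)"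
      using 1 2 by (intro mult_mono) auto
    also have "\<dots> \<le> 1000 * exp (y\<^sup>2 / 8)" by simp
    finally show "ennreal (h (0 + 9/8 * (x - 0))) *
      ennreal (exp (1/8 * (((\<sigma> * 0)\<^sup>2 / 2 - \<sigma> * 0 * y + \<bar>0\<bar> powr p / p)
        - ((\<sigma> * x)\<^sup>2 / 2 - \<sigma> * x * y + \<bar>x\<bar> powr p / p)))) \<le> ennreal (1000 * exp (y\<^sup>2 / 8))"
      using h0 by (subst ennreal_mult[symmetric]) (auto intro!: ennreal_leI)
  qed measurable
  then show ?thesis by (simp add: h_def)
qed

text \<open>\<open>post_risk_exp_bound\<close> costs at least 1 in the exponent for every
  coordinate, so it cannot be summed over infinitely many. Here e^t \<le> 1 + t e^t isolates the
  excess over 1, which is a second moment times \<sigma>^2; the exponent then vanishes with \<sigma>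
  and u.\<close>

lemma post_risk_exp_bound_small:
  assumes u: "\<bar>u\<bar> \<le> 1"
  shows "(\<integral>\<^sup>+e. post_int \<sigma> (\<lambda>x. ennreal (exp ((\<sigma> * x - u)\<^sup>2 / 81))) (u + e) \<partial>std_normal_distribution)
    \<le> ennreal (exp (72 * (\<sigma>\<^sup>2 + u\<^sup>2)))"
proof -
  define h where "h x = x\<^sup>2 * exp (2/81 * (\<sigma> * x)\<^sup>2)" for x
  have h0: "0 \<le> h x" for x by (simp add: h_def)
  have [measurable]: "h \<in> borel_measurable borel" unfolding h_def[abs_def] by measurable
  have hle: "post_int \<sigma> (\<lambda>x. ennreal (h x)) y \<le> ennreal (9/8) * ennreal (1000 * exp (y\<^sup>2 / 8))" for y
    unfolding h_def by (rule post_int_second_moment)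
  define c where "c = exp (2/81 * u\<^sup>2)"
  define d where "d = 2/81 * \<sigma>\<^sup>2"
  have cd: "0 \<le> c" "0 \<le> d" by (auto simp: c_def d_def)
  have g: "exp ((\<sigma> * x - u)\<^sup>2 / 81) \<le> c * (1 + d * h x)" for x
  proof -
    have "(\<sigma> * x - u)\<^sup>2 \<le> 2 * (\<sigma> * x)\<^sup>2 + 2 * u\<^sup>2"
      using zero_le_power2[of "\<sigma> * x + u"] by (simp add: power2_sum power2_diff)
    then have "exp ((\<sigma> * x - u)\<^sup>2 / 81) \<le> exp (2/81 * u\<^sup>2 + 2/81 * (\<sigma> * x)\<^sup>2)" by simp
    also have "\<dots> = c * exp (2/81 * (\<sigma> * x)\<^sup>2)" by (simp add: c_def exp_add)
    \<comment> \<open>The inequality e^t \<le> 1 + t e^t, with t proportional to \<sigma>^2; the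
      factor t e^t is the integrand of \<open>post_int_second_moment\<close> up to that
      constant.\<close>
    also have "exp (2/81 * (\<sigma> * x)\<^sup>2) \<le> 1 + 2/81 * (\<sigma> * x)\<^sup>2 * exp (2/81 * (\<sigma> * x)\<^sup>2)"
    proof -
      have "1 - t \<le> exp (- t)" for t :: real using exp_ge_add_one_self[of "- t"] by simp
      then have "exp t * (1 - t) \<le> exp t * exp (- t)" for t :: real by (intro mult_left_mono) auto
      then have "exp t \<le> 1 + t * exp t" for t :: real by (simp add: exp_minus algebra_simps)
      then show ?thesis .
    qed
    also have "\<dots> = 1 + d * h x" by (simp add: d_def h_def power_mult_distrib)
    finally show ?thesis using cd by (simp add: mult_left_mono)
  qed
  have post: "post_int \<sigma> (\<lambda>x. ennreal (exp ((\<sigma> * x - u)\<^sup>2 / 81))) (u + e)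
      \<le> ennreal c * (1 + ennreal (d * 2000) * ennreal (exp (e\<^sup>2 / 4)))" for e
  proof -
    have "post_int \<sigma> (\<lambda>x. ennreal (exp ((\<sigma> * x - u)\<^sup>2 / 81))) (u + e)
        \<le> post_int \<sigma> (\<lambda>x. ennreal c * (1 + ennreal d * ennreal (h x))) (u + e)"
    proof (rule post_int_mono)
      fix x
      have "ennreal c * (1 + ennreal d * ennreal (h x)) = ennreal (c * (1 + d * h x))"
        using cd h0[of x] by (simp add: ennreal_mult)
      then show "ennreal (exp ((\<sigma> * x - u)\<^sup>2 / 81)) \<le> ennreal c * (1 + ennreal d * ennreal (h x))"
        using g[of x] by (simp add: ennreal_leI)
    qed
    also have "\<dots> = ennreal c * (1 + ennreal d * post_int \<sigma> (\<lambda>x. ennreal (h x)) (u + e))"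
      by (rule post_int_affine) measurable
    also have "\<dots> \<le> ennreal c * (1 + ennreal d * (ennreal (9/8) * ennreal (1000 * exp ((u + e)\<^sup>2 / 8))))"
      by (intro mult_left_mono add_left_mono hle) auto
    also have "\<dots> = ennreal c * (1 + ennreal (d * (1125 * exp ((u + e)\<^sup>2 / 8))))"
      using cd by (simp add: ennreal_mult[symmetric])
    \<comment> \<open>|u| \<le> 1 gives (u + e)^2 / 8 \<le> 1/4 + e^2 / 4, and 1125 exp (1/4) is
      below 2000.\<close>
    also have "\<dots> \<le> ennreal c * (1 + ennreal (d * 2000 * exp (e\<^sup>2 / 4)))"
    proof (intro mult_left_mono add_left_mono ennreal_leI)
      have "(u + e)\<^sup>2 \<le> 2 * u\<^sup>2 + 2 * e\<^sup>2"
        using zero_le_power2[of "u - e"] by (simp add: power2_sum power2_diff)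
      moreover have "u\<^sup>2 \<le> 1" using u by (simp add: abs_square_le_1)
      ultimately have "exp ((u + e)\<^sup>2 / 8) \<le> exp (1/4 + e\<^sup>2 / 4)" by simp
      also have "\<dots> = exp (1/4) * exp (e\<^sup>2 / 4)" by (simp add: exp_add)
      also have "\<dots> \<le> (1 + 1/4 + (1/4)\<^sup>2) * exp (e\<^sup>2 / 4)"
        by (intro mult_right_mono exp_bound) auto
      also have "1 + 1/4 + (1/4)\<^sup>2 = (21/16 :: real)" by (simp add: power2_eq_square)
      finally have "1125 * exp ((u + e)\<^sup>2 / 8) \<le> 1125 * (21/16 * exp (e\<^sup>2 / 4))" by simp
      also have "\<dots> \<le> 2000 * exp (e\<^sup>2 / 4)" by simp
      finally have "1125 * exp ((u + e)\<^sup>2 / 8) \<le> 2000 * exp (e\<^sup>2 / 4)" .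
      then show "d * (1125 * exp ((u + e)\<^sup>2 / 8)) \<le> d * 2000 * exp (e\<^sup>2 / 4)"
        using cd by (simp add: mult.assoc mult_left_mono)
    qed auto
    finally show ?thesis using cd by (simp add: ennreal_mult)
  qed
  have "(\<integral>\<^sup>+e. post_int \<sigma> (\<lambda>x. ennreal (exp ((\<sigma> * x - u)\<^sup>2 / 81))) (u + e) \<partial>std_normal_distribution)
      \<le> (\<integral>\<^sup>+e. ennreal c * (1 + ennreal (d * 2000) * ennreal (exp (e\<^sup>2 / 4))) \<partial>std_normal_distribution)"
    by (intro nn_integral_mono post)
  also have "\<dots> = ennreal c * (1 + ennreal (d * 2000) * ennreal (sqrt 2))"
  proof -
    interpret prob_space std_normal_distribution by (rule prob_space_normal_density) simp
    have "(\<integral>\<^sup>+e. ennreal c * (1 + ennreal (d * 2000) * ennreal (exp (e\<^sup>2 / 4))) \<partial>std_normal_distribution)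
      = ennreal c * ((\<integral>\<^sup>+e. 1 \<partial>std_normal_distribution) +
          ennreal (d * 2000) * (\<integral>\<^sup>+e. ennreal (exp (e\<^sup>2 / 4)) \<partial>std_normal_distribution))"
      by (subst nn_integral_cmult, simp, subst nn_integral_add, simp, simp, subst nn_integral_cmult) simp_all
    then show ?thesis
      unfolding nn_integral_std_normal_exp_quarter using emeasure_space_1 by simp
  qed
  also have "\<dots> = ennreal (c * (1 + d * 2000 * sqrt 2))"
    using cd by (simp add: ennreal_mult)
  also have "\<dots> \<le> ennreal (exp (72 * (\<sigma>\<^sup>2 + u\<^sup>2)))"
  proof (rule ennreal_leI)
    \<comment> \<open>The constant 72 exceeds (2/81) 2000 sqrt 2, which is about 70.\<close>
    have "sqrt 2 \<le> 142/100" by (rule real_le_lsqrt) (auto simp: power2_eq_square)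
    then have "\<sigma>\<^sup>2 * sqrt 2 \<le> \<sigma>\<^sup>2 * (142/100)" by (intro mult_left_mono) auto
    moreover have "d * 2000 * sqrt 2 = (4000/81) * (\<sigma>\<^sup>2 * sqrt 2)" by (simp add: d_def)
    ultimately have "1 + d * 2000 * sqrt 2 \<le> 1 + 72 * \<sigma>\<^sup>2" using zero_le_power2[of \<sigma>] by linarith
    also have "\<dots> \<le> exp (72 * \<sigma>\<^sup>2)" by (rule exp_ge_add_one_self)
    finally have "c * (1 + d * 2000 * sqrt 2) \<le> exp (72 * u\<^sup>2) * exp (72 * \<sigma>\<^sup>2)"
      using cd by (intro mult_mono) (auto simp: c_def)
    then show "c * (1 + d * 2000 * sqrt 2) \<le> exp (72 * (\<sigma>\<^sup>2 + u\<^sup>2))"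
      by (simp add: exp_add[symmetric] algebra_simps)
  qed
  finally show ?thesis .
qed

lemma second_moment_p_exponential: "(\<integral>\<^sup>+x. ennreal (x\<^sup>2) \<partial>p_exponential p) < \<infinity>"
proof -
  interpret prob_space "p_exponential p" by (rule prob_space_p_exponential[OF p])
  \<comment> \<open>At \<sigma> = 0 the likelihood is constantly 1 and the posterior is the prior,
    so the posterior moment bound contains the moment of the prior.\<close>
  have "evidence 0 0 = 1" using emeasure_space_1 by (simp add: evidence_def lik_def)
  then have "(\<integral>\<^sup>+x. ennreal (x\<^sup>2) \<partial>p_exponential p) = post_int 0 (\<lambda>x. ennreal (x\<^sup>2 * exp (2/81 * (0 * x)\<^sup>2))) 0"
    by (simp add: post_int_def lik_def divide_ennreal_def)
  also have "\<dots> < \<infinity>"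
    by (rule le_less_trans[OF post_int_second_moment]) (simp add: ennreal_mult_less_top)
  finally show ?thesis .
qed

end

section \<open>Resampling of coordinates and posterior kernels\<close>

text \<open>Replacing the coordinates in J by an independent copy leaves a product law unchanged. It
  allows integration over finitely many coordinates with the tail frozen, while the full sequence
  remains the integration variable.\<close>

lemma PiM_resample:
  fixes N :: "'i \<Rightarrow> 'a measure"
  assumes p: "\<And>i. i \<in> I \<Longrightarrow> prob_space (N i)" and J: "J \<subseteq> I"
  shows "distr (PiM J N \<Otimes>\<^sub>M PiM I N) (PiM I N) (\<lambda>(a, x). \<lambda>i\<in>I. if i \<in> J then a i else x i) = PiM I N"
proof (rule measure_eqI_PiM_infinite)
  let ?r = "\<lambda>(a, x). \<lambda>i\<in>I. if i \<in> J then a i else x i"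
  interpret I: prob_space "PiM I N" by (rule prob_space_PiM[OF p])
  interpret J: prob_space "PiM J N" by (rule prob_space_PiM) (use p J in auto)
  interpret P: pair_prob_space "PiM J N" "PiM I N" ..
  have r: "?r \<in> measurable (PiM J N \<Otimes>\<^sub>M PiM I N) (PiM I N)"
    unfolding case_prod_beta
  proof (rule measurable_restrict)
    fix i assume i: "i \<in> I"
    show "(\<lambda>x. if i \<in> J then fst x i else snd x i) \<in> measurable (PiM J N \<Otimes>\<^sub>M PiM I N) (N i)"
      using i by (cases "i \<in> J") (auto intro!: measurable_compose[OF measurable_fst] measurable_compose[OF measurable_snd])
  qed
  show "finite_measure (distr (PiM J N \<Otimes>\<^sub>M PiM I N) (PiM I N) ?r)"
    by (rule P.finite_measure_distr[OF r])
  fix A S assume S: "finite S" "S \<subseteq> I" and A: "\<And>i. i \<in> S \<Longrightarrow> A i \<in> sets (N i)"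
  let ?E = "prod_emb I N S (Pi\<^sub>E S A)"
  let ?E1 = "prod_emb J N (S \<inter> J) (Pi\<^sub>E (S \<inter> J) A)" and ?E2 = "prod_emb I N (S - J) (Pi\<^sub>E (S - J) A)"
  have E: "?E \<in> sets (PiM I N)" using S A by (intro sets_PiM_I) auto
  have E12: "?E1 \<in> sets (PiM J N)" "?E2 \<in> sets (PiM I N)" using S A by (intro sets_PiM_I; auto)+
  \<comment> \<open>Cylinders pull back to products: the constraints inside J fall on the fresh
    copy, the others on the old sequence.\<close>
  have "?r -` ?E \<inter> space (PiM J N \<Otimes>\<^sub>M PiM I N) = ?E1 \<times> ?E2"
  proof (intro set_eqI iffI)
    fix z assume z: "z \<in> ?r -` ?E \<inter> space (PiM J N \<Otimes>\<^sub>M PiM I N)"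
    obtain a x where ax: "z = (a, x)" by (cases z)
    have sp: "a \<in> space (PiM J N)" "x \<in> space (PiM I N)" using z by (auto simp: ax space_pair_measure)
    have in_A: "(if i \<in> J then a i else x i) \<in> A i" if "i \<in> S" for i
      using z that S(2) by (auto simp: ax prod_emb_def PiE_iff subset_iff dest: bspec[of _ _ i] split: if_splits)
    have "a i \<in> A i" if "i \<in> S \<inter> J" for i using in_A[of i] that by simp
    moreover have "x i \<in> A i" if "i \<in> S - J" for i using in_A[of i] that by simp
    ultimately show "z \<in> ?E1 \<times> ?E2"
      using sp S(2) J by (auto simp: ax prod_emb_def PiE_iff space_PiM)
  next
    fix z assume z: "z \<in> ?E1 \<times> ?E2"
    obtain a x where ax: "z = (a, x)" by (cases z)
    have sp: "a \<in> space (PiM J N)" "x \<in> space (PiM I N)" using z by (auto simp: ax prod_emb_def space_PiM)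
    have 1: "a i \<in> A i" if "i \<in> S" "i \<in> J" for i
      using z that by (auto simp: ax prod_emb_def PiE_iff dest: bspec[of _ _ i])
    have 2: "x i \<in> A i" if "i \<in> S" "i \<notin> J" for i
      using z that by (auto simp: ax prod_emb_def PiE_iff dest: bspec[of _ _ i])
    have spz: "z \<in> space (PiM J N \<Otimes>\<^sub>M PiM I N)" using sp by (simp add: ax space_pair_measure)
    then have "?r z \<in> space (PiM I N)" by (rule measurable_space[OF r])
    then show "z \<in> ?r -` ?E \<inter> space (PiM J N \<Otimes>\<^sub>M PiM I N)"
      using 1 2 S(2) spz by (auto simp: ax prod_emb_def PiE_iff space_PiM subset_iff)
  qed
  then have "emeasure (distr (PiM J N \<Otimes>\<^sub>M PiM I N) (PiM I N) ?r) ?E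
      = emeasure (PiM J N \<Otimes>\<^sub>M PiM I N) (?E1 \<times> ?E2)"
    using emeasure_distr[OF r E] by simp
  also have "\<dots> = emeasure (PiM J N) ?E1 * emeasure (PiM I N) ?E2"
    by (rule I.emeasure_pair_measure_Times[OF E12])
  also have "\<dots> = (\<Prod>i\<in>S \<inter> J. emeasure (N i) (A i)) * (\<Prod>i\<in>S - J. emeasure (N i) (A i))"
    using S A J p by (intro arg_cong2[where f="(*)"] emeasure_PiM_emb) auto
  also have "\<dots> = (\<Prod>i\<in>S. emeasure (N i) (A i))"
    using S(1) by (subst prod.union_disjoint[symmetric]) (auto simp: Int_Diff_Un)
  also have "\<dots> = emeasure (PiM I N) ?E"
    using S A p by (intro emeasure_PiM_emb[symmetric]) auto
  finally show "emeasure (distr (PiM J N \<Otimes>\<^sub>M PiM I N) (PiM I N) ?r) ?E = emeasure (PiM I N) ?E" .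
qed auto

lemma nn_integral_PiM_resample:
  fixes N :: "'i \<Rightarrow> 'a measure"
  assumes p: "\<And>i. i \<in> I \<Longrightarrow> prob_space (N i)" and J: "J \<subseteq> I"
    and F[measurable]: "F \<in> borel_measurable (PiM I N)"
  shows "(\<integral>\<^sup>+x. F x \<partial>PiM I N)
    = (\<integral>\<^sup>+x. \<integral>\<^sup>+a. F (\<lambda>i\<in>I. if i \<in> J then a i else x i) \<partial>PiM J N \<partial>PiM I N)"
proof -
  let ?r = "\<lambda>(a, x). \<lambda>i\<in>I. if i \<in> J then a i else x i"
  interpret I: prob_space "PiM I N" by (rule prob_space_PiM[OF p])
  interpret J: prob_space "PiM J N" by (rule prob_space_PiM) (use p J in auto)
  interpret P: pair_prob_space "PiM J N" "PiM I N" ..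
  have r[measurable]: "?r \<in> measurable (PiM J N \<Otimes>\<^sub>M PiM I N) (PiM I N)"
    unfolding case_prod_beta
  proof (rule measurable_restrict)
    fix i assume i: "i \<in> I"
    show "(\<lambda>x. if i \<in> J then fst x i else snd x i) \<in> measurable (PiM J N \<Otimes>\<^sub>M PiM I N) (N i)"
      using i by (cases "i \<in> J") (auto intro!: measurable_compose[OF measurable_fst] measurable_compose[OF measurable_snd])
  qed
  have "(\<integral>\<^sup>+x. F x \<partial>PiM I N) = (\<integral>\<^sup>+x. F x \<partial>distr (PiM J N \<Otimes>\<^sub>M PiM I N) (PiM I N) ?r)"
    by (simp only: PiM_resample[OF p J])
  also have "\<dots> = (\<integral>\<^sup>+z. F (?r z) \<partial>(PiM J N \<Otimes>\<^sub>M PiM I N))"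
    by (rule nn_integral_distr) measurable
  also have "\<dots> = (\<integral>\<^sup>+x. \<integral>\<^sup>+a. F (?r (a, x)) \<partial>PiM J N \<partial>PiM I N)"
    by (rule P.nn_integral_snd[symmetric]) measurable
  finally show ?thesis by simp
qed

text \<open>The defining identity of the posterior concerns events in the data space; a monotone
  class argument extends it to weights f. With the weight \<open>ratio\<close> it exchanges the
  posterior mass of A for the indicator of A under the prior, which is the only property of the
  kernel used beyond its being Markov.\<close>

lemma nn_integral_bind_posterior:
  assumes post: "is_posterior prior S P K" and A[measurable]: "A \<in> sets prior"
    and P[measurable]: "P \<in> measurable prior (prob_algebra S)"
    and pr: "prob_space prior" and f: "f \<in> borel_measurable S"
  shows "(\<integral>\<^sup>+w. indicator A w * (\<integral>\<^sup>+x. f x \<partial>P w) \<partial>prior)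
    = (\<integral>\<^sup>+w. (\<integral>\<^sup>+x. emeasure (K x) A * f x \<partial>P w) \<partial>prior)"
proof -
  have K[measurable]: "K \<in> measurable S (prob_algebra prior)" using post by (simp add: is_posterior_def)
  have K2: "K \<in> measurable S (subprob_algebra prior)" by (rule measurable_prob_algebraD[OF K])
  have P2: "P \<in> measurable prior (subprob_algebra S)" by (rule measurable_prob_algebraD[OF P])
  have kA[measurable]: "(\<lambda>x. emeasure (K x) A) \<in> borel_measurable S"
    by (rule measurable_emeasure_kernel[OF K2 A])
  have ne: "space prior \<noteq> {}" by (rule prob_space.not_empty[OF pr])
  have bs: "sets (bind prior P) = sets S"
    using sets_bind[of prior P S] sets_kernel[OF P2] ne by auto
  have sp: "space (bind prior P) = space S" by (rule sets_eq_imp_space_eq[OF bs])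
  have nb: "(\<integral>\<^sup>+x. g x \<partial>bind prior P) = (\<integral>\<^sup>+w. \<integral>\<^sup>+x. g x \<partial>P w \<partial>prior)" if "g \<in> borel_measurable S" for g
    by (rule nn_integral_bind[OF that P2])
  have Pf: "(\<lambda>w. \<integral>\<^sup>+x. g x \<partial>P w) \<in> borel_measurable prior" if "g \<in> borel_measurable S" for g
    by (rule measurable_compose[OF P2 nn_integral_measurable_subprob_algebra[OF that]])
  have setsP: "sets (P w) = sets S" if "w \<in> space prior" for w
    by (rule sets_kernel[OF P2 that])
  have iA[measurable]: "indicator A \<in> borel_measurable prior" using A by measurable
  have iPf: "(\<lambda>w. indicator A w * (\<integral>\<^sup>+x. g x \<partial>P w)) \<in> borel_measurable prior"
    if "g \<in> borel_measurable S" for g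
    by (intro borel_measurable_times_ennreal iA Pf that)
  have "(\<integral>\<^sup>+w. indicator A w * (\<integral>\<^sup>+x. f x \<partial>P w) \<partial>prior) = (\<integral>\<^sup>+x. emeasure (K x) A * f x \<partial>bind prior P)"
    using f
  proof (induction rule: borel_measurable_induct)
    case (cong f g)
    have "(\<integral>\<^sup>+x. f x \<partial>P w) = (\<integral>\<^sup>+x. g x \<partial>P w)" if "w \<in> space prior" for w
      using cong(3) sets_eq_imp_space_eq[OF setsP[OF that]] by (intro nn_integral_cong) auto
    then have 1: "(\<integral>\<^sup>+w. indicator A w * (\<integral>\<^sup>+x. f x \<partial>P w) \<partial>prior) = (\<integral>\<^sup>+w. indicator A w * (\<integral>\<^sup>+x. g x \<partial>P w) \<partial>prior)"
      by (intro nn_integral_cong) simp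
    have 2: "(\<integral>\<^sup>+x. emeasure (K x) A * f x \<partial>bind prior P) = (\<integral>\<^sup>+x. emeasure (K x) A * g x \<partial>bind prior P)"
      using cong(3) by (intro nn_integral_cong) (simp add: sp)
    show ?case using cong 1 2 by simp
  next
    case (set D)
    have "(\<integral>\<^sup>+w. indicator A w * (\<integral>\<^sup>+x. indicator D x \<partial>P w) \<partial>prior) = (\<integral>\<^sup>+w\<in>A. emeasure (P w) D \<partial>prior)"
      using setsP set by (intro nn_integral_cong) (simp add: mult.commute)
    also have "\<dots> = (\<integral>\<^sup>+x\<in>D. emeasure (K x) A \<partial>bind prior P)"
      using post A set by (simp add: is_posterior_def)
    finally show ?case by simp
  next
    case (mult u c)
    have "(\<integral>\<^sup>+w. indicator A w * (\<integral>\<^sup>+x. c * u x \<partial>P w) \<partial>prior)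
        = (\<integral>\<^sup>+w. c * (indicator A w * (\<integral>\<^sup>+x. u x \<partial>P w)) \<partial>prior)"
      using mult setsP by (intro nn_integral_cong) (simp add: nn_integral_cmult mult.left_commute cong: measurable_cong_sets)
    also have "\<dots> = c * (\<integral>\<^sup>+w. indicator A w * (\<integral>\<^sup>+x. u x \<partial>P w) \<partial>prior)"
      by (rule nn_integral_cmult[OF iPf[OF mult(2)]])
    also have "\<dots> = c * (\<integral>\<^sup>+x. emeasure (K x) A * u x \<partial>bind prior P)" using mult by simp
    also have "\<dots> = (\<integral>\<^sup>+x. c * (emeasure (K x) A * u x) \<partial>bind prior P)"
      using mult by (intro nn_integral_cmult[symmetric]) (simp cong: measurable_cong_sets add: bs)
    finally show ?case by (simp add: mult.left_commute)
  next
    case (add u v)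
    have "(\<integral>\<^sup>+w. indicator A w * (\<integral>\<^sup>+x. v x + u x \<partial>P w) \<partial>prior)
        = (\<integral>\<^sup>+w. indicator A w * (\<integral>\<^sup>+x. v x \<partial>P w) + indicator A w * (\<integral>\<^sup>+x. u x \<partial>P w) \<partial>prior)"
      using add setsP by (intro nn_integral_cong) (simp add: nn_integral_add distrib_left cong: measurable_cong_sets)
    also have "\<dots> = (\<integral>\<^sup>+w. indicator A w * (\<integral>\<^sup>+x. v x \<partial>P w) \<partial>prior) + (\<integral>\<^sup>+w. indicator A w * (\<integral>\<^sup>+x. u x \<partial>P w) \<partial>prior)"
      using add by (intro nn_integral_add iPf)
    also have "\<dots> = (\<integral>\<^sup>+x. emeasure (K x) A * v x + emeasure (K x) A * u x \<partial>bind prior P)"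
      unfolding add using add by (intro nn_integral_add[symmetric]) (simp_all cong: measurable_cong_sets add: bs)
    finally show ?case by (simp add: distrib_left)
  next
    case (seq U)
    have "(\<integral>\<^sup>+w. indicator A w * (\<integral>\<^sup>+x. (SUP i. U i) x \<partial>P w) \<partial>prior)
        = (\<integral>\<^sup>+w. (SUP i. indicator A w * (\<integral>\<^sup>+x. U i x \<partial>P w)) \<partial>prior)"
    proof (rule nn_integral_cong)
      fix w assume w: "w \<in> space prior"
      have "(\<integral>\<^sup>+x. (SUP i. U i) x \<partial>P w) = (SUP i. \<integral>\<^sup>+x. U i x \<partial>P w)"
      proof -
        have "(\<integral>\<^sup>+x. (SUP i. U i) x \<partial>P w) = (\<integral>\<^sup>+x. (SUP i. U i x) \<partial>P w)"
          by (rule nn_integral_cong) (simp only: SUP_apply)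
        also have "\<dots> = (SUP i. \<integral>\<^sup>+x. U i x \<partial>P w)"
          by (rule nn_integral_monotone_convergence_SUP[OF seq(3)])
            (use seq(1) in \<open>simp cong: measurable_cong_sets add: setsP[OF w]\<close>)
        finally show ?thesis .
      qed
      then show "indicator A w * (\<integral>\<^sup>+x. (SUP i. U i) x \<partial>P w) = (SUP i. indicator A w * (\<integral>\<^sup>+x. U i x \<partial>P w))"
        by (simp add: SUP_mult_left_ennreal)
    qed
    also have "\<dots> = (SUP i. \<integral>\<^sup>+w. indicator A w * (\<integral>\<^sup>+x. U i x \<partial>P w) \<partial>prior)"
    proof (rule nn_integral_monotone_convergence_SUP)
      show "incseq (\<lambda>i w. indicator A w * (\<integral>\<^sup>+x. U i x \<partial>P w))"
        using seq(3) by (auto simp: incseq_def le_fun_def intro!: mult_left_mono nn_integral_mono)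
      show "(\<lambda>w. indicator A w * (\<integral>\<^sup>+x. U i x \<partial>P w)) \<in> borel_measurable prior" for i
        by (rule iPf[OF seq(1)])
    qed
    also have "\<dots> = (SUP i. \<integral>\<^sup>+x. emeasure (K x) A * U i x \<partial>bind prior P)"
      using seq by simp
    also have "\<dots> = (\<integral>\<^sup>+x. (SUP i. emeasure (K x) A * U i x) \<partial>bind prior P)"
    proof (rule nn_integral_monotone_convergence_SUP[symmetric])
      show "incseq (\<lambda>i x. emeasure (K x) A * U i x)"
        using seq(3) by (auto simp: incseq_def le_fun_def intro!: mult_left_mono)
      show "(\<lambda>x. emeasure (K x) A * U i x) \<in> borel_measurable (bind prior P)" for i
        using seq(1)[of i] by (simp cong: measurable_cong_sets add: bs)
    qed
    finally show ?case by (simp only: SUP_apply SUP_mult_left_ennreal)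
  qed
  also have "\<dots> = (\<integral>\<^sup>+w. (\<integral>\<^sup>+x. emeasure (K x) A * f x \<partial>P w) \<partial>prior)"
    using f by (intro nb) measurable
  finally show ?thesis .
qed

section \<open>Orthonormal bases and series priors\<close>

context
  fixes \<psi> :: "nat \<Rightarrow> 'a :: real_inner"
  assumes \<psi>: "orthonormal_basis \<psi>"
begin

lemma basis_inner: "1 \<le> i \<Longrightarrow> 1 \<le> j \<Longrightarrow> inner (\<psi> i) (\<psi> j) = (if i = j then 1 else 0)"
  using \<psi> by (auto simp: orthonormal_basis_def)

definition basis_proj :: "nat \<Rightarrow> 'a \<Rightarrow> 'a" where
  "basis_proj N w = (\<Sum>j\<in>{1..N}. inner w (\<psi> j) *\<^sub>R \<psi> j)"

lemma inner_sum_basis: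
  assumes "i \<in> {1..N}"
  shows "inner (\<Sum>j\<in>{1..N}. c j *\<^sub>R \<psi> j) (\<psi> i) = c i"
proof -
  have "inner (\<Sum>j\<in>{1..N}. c j *\<^sub>R \<psi> j) (\<psi> i) = (\<Sum>j\<in>{1..N}. if j = i then c i else 0)"
    unfolding inner_sum_left using assms by (intro sum.cong) (auto simp: basis_inner)
  then show ?thesis using assms by simp
qed

lemma norm_sum_basis: "(norm (\<Sum>j\<in>{1..N}. c j *\<^sub>R \<psi> j))\<^sup>2 = (\<Sum>j\<in>{1..N}. (c j)\<^sup>2)"
proof -
  have "inner (\<Sum>j\<in>{1..N}. c j *\<^sub>R \<psi> j) (\<Sum>j\<in>{1..N}. c j *\<^sub>R \<psi> j) = (\<Sum>j\<in>{1..N}. c j * c j)"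
    unfolding inner_sum_right[of "\<Sum>j\<in>{1..N}. c j *\<^sub>R \<psi> j"]
    by (intro sum.cong refl) (simp only: inner_scaleR_right inner_sum_basis)
  then show ?thesis unfolding power2_norm_eq_inner by (simp only: power2_eq_square)
qed

lemma inner_basis_proj: "i \<in> {1..N} \<Longrightarrow> inner (basis_proj N w) (\<psi> i) = inner w (\<psi> i)"
  unfolding basis_proj_def by (rule inner_sum_basis)

lemma inner_rest_sum: "inner (w - basis_proj N w) (\<Sum>j\<in>{1..N}. c j *\<^sub>R \<psi> j) = 0"
  unfolding inner_sum_right by (intro sum.neutral) (auto simp: inner_diff_left inner_basis_proj)

lemma norm_rest_add:
  "(norm (w - basis_proj N w + (\<Sum>j\<in>{1..N}. c j *\<^sub>R \<psi> j)))\<^sup>2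
    = (norm (w - basis_proj N w))\<^sup>2 + (\<Sum>j\<in>{1..N}. (c j)\<^sup>2)"
proof -
  have "(norm (w - basis_proj N w + (\<Sum>j\<in>{1..N}. c j *\<^sub>R \<psi> j)))\<^sup>2
      = (norm (w - basis_proj N w))\<^sup>2 + (norm (\<Sum>j\<in>{1..N}. c j *\<^sub>R \<psi> j))\<^sup>2"
    unfolding power2_norm_eq_inner inner_add_left inner_add_right
    using inner_rest_sum[of w N c] by (simp add: inner_commute)
  then show ?thesis unfolding norm_sum_basis .
qed

lemma basis_proj_tendsto: "(\<lambda>N. basis_proj N w) \<longlonglongrightarrow> w"
proof (rule metric_LIMSEQ_I)
  fix e :: real assume e: "0 < e"
  have "w \<in> closure (span (\<psi> ` {1..}))" using \<psi> by (simp add: orthonormal_basis_def)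
  then have "\<exists>s\<in>span (\<psi> ` {1..}). dist s w < e" using e unfolding closure_approachable by blast
  then obtain s where s: "s \<in> span (\<psi> ` {1..})" "dist s w < e" by blast
  obtain S r where Sr: "finite S" "S \<subseteq> \<psi> ` {1..}" "s = (\<Sum>v\<in>S. r v *\<^sub>R v)"
    using s(1) unfolding span_explicit by blast
  obtain T where T: "T \<subseteq> {1..}" "finite T" "S = \<psi> ` T" using finite_subset_image[OF Sr(1,2)] by blast
  obtain N0 where N0: "T \<subseteq> {..N0}" using T(2) finite_nat_iff_bounded_le by blast
  have "dist (basis_proj N w) w < e" if N: "N \<ge> N0" for N
  proof -
    have "T \<subseteq> {1..N}"
    proof
      fix x assume "x \<in> T"
      then have "1 \<le> x" "x \<le> N0" using T(1) N0 by auto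
      then show "x \<in> {1..N}" using N by simp
    qed
    then have "s \<in> span (\<psi> ` {1..N})"
      unfolding Sr(3) T(3) by (intro span_sum span_scale span_base) blast
    then have "\<exists>c. s = (\<Sum>j\<in>{1..N}. c j *\<^sub>R \<psi> j)"
    proof (induction rule: span_induct_alt)
      case base
      show ?case by (intro exI[of _ "\<lambda>_. 0"]) simp
    next
      case (step a x y)
      then obtain j c where jc: "j \<in> {1..N}" "x = \<psi> j" "y = (\<Sum>j\<in>{1..N}. c j *\<^sub>R \<psi> j)" by auto
      have "a *\<^sub>R x = (\<Sum>i\<in>{1..N}. (if i = j then a else 0) *\<^sub>R \<psi> i)"
        using jc(1) unfolding jc(2) by (simp add: if_distrib[of "\<lambda>t. t *\<^sub>R _"] sum.delta cong: if_cong)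
      then have "a *\<^sub>R x + y = (\<Sum>i\<in>{1..N}. ((if i = j then a else 0) + c i) *\<^sub>R \<psi> i)"
        unfolding jc(3) by (simp add: scaleR_add_left sum.distrib)
      then show ?case by (rule exI[of _ "\<lambda>i. (if i = j then a else 0) + c i"])
    qed
    then obtain c where c: "s = (\<Sum>j\<in>{1..N}. c j *\<^sub>R \<psi> j)" by blast
    \<comment> \<open>Splits w - s into the residual of the projection and a vector in the span of
      the first N elements; Pythagoras makes the projection the best approximation.\<close>
    have "w - s = w - basis_proj N w + (\<Sum>j\<in>{1..N}. (inner w (\<psi> j) - c j) *\<^sub>R \<psi> j)"
      by (simp add: c basis_proj_def scaleR_diff_left sum_subtractf)
    then have "(norm (w - s))\<^sup>2 \<ge> (norm (w - basis_proj N w))\<^sup>2"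
      by (simp only: norm_rest_add) (simp add: sum_nonneg)
    then have "norm (w - basis_proj N w) \<le> norm (w - s)" by (rule power2_le_imp_le) simp
    then show ?thesis using s(2) by (simp add: dist_norm norm_minus_commute)
  qed
  then show "\<exists>N0. \<forall>N\<ge>N0. dist (basis_proj N w) w < e" by blast
qed

end

text \<open>By Pythagoras the squared norm of a block of the series is the same block of the
  numerical series, so Cauchy blocks correspond and completeness applies.\<close>

lemma orthogonal_series_summable:
  fixes \<psi> :: "nat \<Rightarrow> 'a::{real_inner,banach}"
  assumes \<psi>: "orthonormal_basis \<psi>" and c: "summable (\<lambda>k. (c k)\<^sup>2)"
  shows "summable (\<lambda>k. c k *\<^sub>R \<psi> (Suc k))"
  unfolding summable_Cauchy
proof (intro allI impI)
  fix e :: real assume e: "0 < e"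
  then have "0 < e\<^sup>2" by simp
  then obtain N where N: "\<And>m n. m \<ge> N \<Longrightarrow> norm (\<Sum>k=m..<n. (c k)\<^sup>2) < e\<^sup>2"
    using c unfolding summable_Cauchy by blast
  have "norm (\<Sum>k=m..<n. c k *\<^sub>R \<psi> (Suc k)) < e" if m: "m \<ge> N" for m n
  proof -
    have "(norm (\<Sum>k=m..<n. c k *\<^sub>R \<psi> (Suc k)))\<^sup>2 = (\<Sum>k=m..<n. (c k)\<^sup>2)"
      unfolding power2_norm_eq_inner inner_sum_left
    proof (rule sum.cong[OF refl])
      fix i assume i: "i \<in> {m..<n}"
      have "inner (c i *\<^sub>R \<psi> (Suc i)) (\<Sum>k=m..<n. c k *\<^sub>R \<psi> (Suc k)) = (\<Sum>k=m..<n. if k = i then (c i)\<^sup>2 else 0)"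
        unfolding inner_sum_right using basis_inner[OF \<psi>, of "Suc i"]
        by (intro sum.cong refl) (auto simp: power2_eq_square)
      then show "inner (c i *\<^sub>R \<psi> (Suc i)) (\<Sum>k=m..<n. c k *\<^sub>R \<psi> (Suc k)) = (c i)\<^sup>2"
        using i by simp
    qed
    also have "\<dots> < e\<^sup>2" using N[OF m, of n] by (simp add: sum_nonneg)
    finally show ?thesis using e by (simp add: power2_less_imp_less)
  qed
  then show "\<exists>N. \<forall>m\<ge>N. \<forall>n. norm (\<Sum>k=m..<n. c k *\<^sub>R \<psi> (Suc k)) < e" by blast
qed

section \<open>The series prior and resampling of its first coordinates\<close>

definition prior_sd :: "real \<Rightarrow> real \<Rightarrow> nat \<Rightarrow> real" where
  "prior_sd \<alpha> lam l = lam * real l powr (- 1/2 - \<alpha>)"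

definition prior_map :: "(nat \<Rightarrow> L2) \<Rightarrow> real \<Rightarrow> real \<Rightarrow> (nat \<Rightarrow> real) \<Rightarrow> L2" where
  "prior_map \<psi> \<alpha> lam \<xi> = lam *\<^sub>R (\<Sum>k. (real (Suc k) powr (- 1/2 - \<alpha>) * \<xi> (Suc k)) *\<^sub>R \<psi> (Suc k))"

locale p_exponential_series =
  fixes \<psi> :: "nat \<Rightarrow> L2" and p \<alpha> lam :: real
  assumes \<psi>: "orthonormal_basis \<psi>" and p: "1 \<le> p" "p \<le> 2" and \<alpha>: "0 < \<alpha>" and lam: "0 < lam"
begin

abbreviation "\<mu> \<equiv> p_exponential p"
abbreviation "\<Xi> \<equiv> PiM {1..} (\<lambda>_::nat. p_exponential p)"
abbreviation "S \<equiv> prior_map \<psi> \<alpha> lam"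
abbreviation "\<tau> \<equiv> prior_sd \<alpha> lam"

declare sets_p_exponential [OF p, simp, measurable_cong] space_p_exponential [OF p, simp]

lemma prob_mu: "prob_space \<mu>" by (rule prob_space_p_exponential[OF p])

lemma prob_Xi: "prob_space \<Xi>" by (rule prob_space_PiM) (rule prob_mu)

lemma sd_pos: "1 \<le> l \<Longrightarrow> 0 < \<tau> l" using lam by (simp add: prior_sd_def)

lemma coord_measurable: "1 \<le> l \<Longrightarrow> (\<lambda>\<xi>. \<xi> l) \<in> borel_measurable \<Xi>"
proof -
  assume "1 \<le> l"
  then have "(\<lambda>\<xi>. \<xi> l) \<in> measurable \<Xi> \<mu>" by (intro measurable_component_singleton) simp
  then show ?thesis by (simp cong: measurable_cong_sets)
qed

lemma prior_map_measurable [measurable]: "S \<in> borel_measurable \<Xi>"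
  unfolding prior_map_def[abs_def]
  by (intro borel_measurable_scaleR borel_measurable_const borel_measurable_suminf
      borel_measurable_times coord_measurable) auto

lemma prior_eq: "p_exponential_prior \<psi> p \<alpha> lam = distr \<Xi> borel S"
  by (simp add: p_exponential_prior_def prior_map_def[abs_def])

text \<open>The coordinate sequences for which the random series converges. They have full measure
  because \<alpha> > 0 makes the variances summable; statements about the values of
  \<open>prior_map\<close> are made on them.\<close>

definition admissible_coords :: "(nat \<Rightarrow> real) \<Rightarrow> bool" where
  "admissible_coords \<xi> \<longleftrightarrow> summable (\<lambda>k. (real (Suc k) powr (- 1/2 - \<alpha>) * \<xi> (Suc k))\<^sup>2)"

lemma AE_admissible_coords: "AE \<xi> in \<Xi>. admissible_coords \<xi>"
proof -
  define t where "t k = real (Suc k) powr (- 1/2 - \<alpha>)" for k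
  have ts: "summable (\<lambda>k. (t k)\<^sup>2)"
  proof -
    have "summable (\<lambda>k. real k powr (- 1 - 2 * \<alpha>))"
      using \<alpha> by (subst summable_real_powr_iff) simp
    then have "summable (\<lambda>k. real (Suc k) powr (- 1 - 2 * \<alpha>))"
      by (subst summable_Suc_iff)
    moreover have "(t k)\<^sup>2 = real (Suc k) powr (- 1 - 2 * \<alpha>)" for k
      by (simp add: t_def power2_eq_square powr_add[symmetric])
    ultimately show ?thesis by simp
  qed
  define c where "c = enn2real (\<integral>\<^sup>+x. ennreal (x\<^sup>2) \<partial>\<mu>)"
  have c: "(\<integral>\<^sup>+x. ennreal (x\<^sup>2) \<partial>\<mu>) = ennreal c" "0 \<le> c"
    using second_moment_p_exponential[OF p] by (auto simp: c_def)
  have sq[measurable]: "(\<lambda>x. ennreal (x\<^sup>2)) \<in> borel_measurable \<mu>"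
    unfolding measurable_cong_sets[OF sets_p_exponential[OF p] refl] by measurable
  have cm[measurable]: "(\<lambda>\<xi>. \<xi> (Suc k)) \<in> borel_measurable \<Xi>" for k
    by (rule coord_measurable) simp
  have co: "(\<integral>\<^sup>+\<xi>. ennreal ((\<xi> (Suc k))\<^sup>2) \<partial>\<Xi>) = ennreal c" for k
  proof -
    have d: "distr \<Xi> \<mu> (\<lambda>\<xi>. \<xi> (Suc k)) = \<mu>"
      by (rule distr_PiM_component) (auto simp: prob_mu)
    have "(\<integral>\<^sup>+x. ennreal (x\<^sup>2) \<partial>distr \<Xi> \<mu> (\<lambda>\<xi>. \<xi> (Suc k))) = (\<integral>\<^sup>+\<xi>. ennreal ((\<xi> (Suc k))\<^sup>2) \<partial>\<Xi>)"
    proof (rule nn_integral_distr)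
      show "(\<lambda>\<xi>. \<xi> (Suc k)) \<in> measurable \<Xi> \<mu>" by (rule measurable_component_singleton) simp
      show "(\<lambda>x. ennreal (x\<^sup>2)) \<in> borel_measurable (distr \<Xi> \<mu> (\<lambda>\<xi>. \<xi> (Suc k)))"
        using sq by (simp only: measurable_distr_eq1)
    qed
    then show ?thesis unfolding d c by simp
  qed
  have "(\<integral>\<^sup>+\<xi>. (\<Sum>k. ennreal ((t k * \<xi> (Suc k))\<^sup>2)) \<partial>\<Xi>) = (\<Sum>k. \<integral>\<^sup>+\<xi>. ennreal ((t k * \<xi> (Suc k))\<^sup>2) \<partial>\<Xi>)"
    by (rule nn_integral_suminf) measurable
  also have "\<dots> = (\<Sum>k. ennreal ((t k)\<^sup>2 * c))"
  proof (rule suminf_cong)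
    fix k
    have "(\<integral>\<^sup>+\<xi>. ennreal ((t k * \<xi> (Suc k))\<^sup>2) \<partial>\<Xi>) = (\<integral>\<^sup>+\<xi>. ennreal ((t k)\<^sup>2) * ennreal ((\<xi> (Suc k))\<^sup>2) \<partial>\<Xi>)"
      by (intro nn_integral_cong) (simp add: power_mult_distrib ennreal_mult)
    also have "\<dots> = ennreal ((t k)\<^sup>2) * ennreal c"
      by (subst nn_integral_cmult, measurable) (simp only: co)
    finally show "(\<integral>\<^sup>+\<xi>. ennreal ((t k * \<xi> (Suc k))\<^sup>2) \<partial>\<Xi>) = ennreal ((t k)\<^sup>2 * c)"
      using c by (simp add: ennreal_mult)
  qed
  also have "\<dots> < \<infinity>"
    using ts c by (subst suminf_ennreal2) (auto intro!: summable_mult2)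
  finally have fin: "(\<integral>\<^sup>+\<xi>. (\<Sum>k. ennreal ((t k * \<xi> (Suc k))\<^sup>2)) \<partial>\<Xi>) < \<infinity>" .
  have "AE \<xi> in \<Xi>. (\<Sum>k. ennreal ((t k * \<xi> (Suc k))\<^sup>2)) \<noteq> \<infinity>"
  proof (rule nn_integral_PInf_AE)
    show "(\<integral>\<^sup>+\<xi>. (\<Sum>k. ennreal ((t k * \<xi> (Suc k))\<^sup>2)) \<partial>\<Xi>) \<noteq> \<infinity>" using fin by (simp only: less_top infinity_ennreal_def)
  qed measurable
  then show ?thesis
    unfolding admissible_coords_def t_def[symmetric]
    by eventually_elim (intro summable_suminf_not_top, auto)
qed

lemma prior_map_sums:
  assumes "admissible_coords \<xi>"
  shows "(\<lambda>k. (\<tau> (Suc k) * \<xi> (Suc k)) *\<^sub>R \<psi> (Suc k)) sums S \<xi>"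
proof -
  have "summable (\<lambda>k. (real (Suc k) powr (- 1/2 - \<alpha>) * \<xi> (Suc k)) *\<^sub>R \<psi> (Suc k))"
    using assms unfolding admissible_coords_def by (rule orthogonal_series_summable[OF \<psi>])
  from sums_scaleR_right[OF summable_sums[OF this], of lam]
  show ?thesis by (simp add: prior_map_def prior_sd_def mult.assoc)
qed

lemma inner_prior_map:
  assumes \<xi>: "admissible_coords \<xi>" and l: "1 \<le> l"
  shows "inner (S \<xi>) (\<psi> l) = \<tau> l * \<xi> l"
proof -
  have "(\<lambda>k. inner ((\<tau> (Suc k) * \<xi> (Suc k)) *\<^sub>R \<psi> (Suc k)) (\<psi> l)) sums inner (S \<xi>) (\<psi> l)"
    by (rule bounded_linear.sums[OF bounded_linear_inner_left prior_map_sums[OF \<xi>]])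
  moreover have "(\<lambda>k. inner ((\<tau> (Suc k) * \<xi> (Suc k)) *\<^sub>R \<psi> (Suc k)) (\<psi> l))
      = (\<lambda>k. if k = l - 1 then \<tau> l * \<xi> l else 0)"
    using l basis_inner[OF \<psi>, of _ l] by (auto simp: fun_eq_iff)
  moreover have "(\<lambda>k. if k = l - 1 then \<tau> l * \<xi> l else 0) sums (\<tau> l * \<xi> l)"
    using sums_single[of "l - 1" "\<lambda>_. \<tau> l * \<xi> l"] by simp
  ultimately show ?thesis using sums_unique2 by metis
qed

definition rest :: "nat \<Rightarrow> L2 \<Rightarrow> L2" where "rest N w = w - basis_proj \<psi> N w"

lemma rest_measurable [measurable]: "rest N \<in> borel_measurable borel"
  unfolding rest_def[abs_def] basis_proj_def[OF \<psi>]
  by (intro borel_measurable_continuous_onI continuous_intros)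

lemma inner_rest: "j \<in> {1..N} \<Longrightarrow> inner (rest N w) (\<psi> j) = 0"
  by (simp add: rest_def inner_diff_left inner_basis_proj[OF \<psi>])

text \<open>The form in which \<open>nn_integral_PiM_resample\<close> presents its argument.
  Changing finitely many coordinates preserves convergence of the series and the part of the draw
  beyond N.\<close>

definition splice :: "nat \<Rightarrow> (nat \<Rightarrow> real) \<Rightarrow> (nat \<Rightarrow> real) \<Rightarrow> nat \<Rightarrow> real" where
  "splice N a \<xi> = (\<lambda>i\<in>{1..}. if i \<in> {1..N} then a i else \<xi> i)"

lemma admissible_splice:
  assumes "admissible_coords \<xi>" shows "admissible_coords (splice N a \<xi>)"
proof -
  have "\<forall>\<^sub>F k in sequentially. (real (Suc k) powr (- 1/2 - \<alpha>) * splice N a \<xi> (Suc k))\<^sup>2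
      = (real (Suc k) powr (- 1/2 - \<alpha>) * \<xi> (Suc k))\<^sup>2"
    using eventually_ge_at_top[of N] by eventually_elim (simp add: splice_def)
  then show ?thesis using assms unfolding admissible_coords_def by (simp add: summable_cong)
qed

lemma prior_map_splice:
  assumes \<xi>: "admissible_coords \<xi>"
  shows "S (splice N a \<xi>) = rest N (S \<xi>) + (\<Sum>j\<in>{1..N}. (\<tau> j * a j) *\<^sub>R \<psi> j)"
proof -
  have "(\<lambda>k. (\<tau> (Suc k) * splice N a \<xi> (Suc k)) *\<^sub>R \<psi> (Suc k) - (\<tau> (Suc k) * \<xi> (Suc k)) *\<^sub>R \<psi> (Suc k))
      sums (S (splice N a \<xi>) - S \<xi>)"
    by (intro sums_diff prior_map_sums admissible_splice \<xi>)
  moreover have "(\<lambda>k. (\<tau> (Suc k) * splice N a \<xi> (Suc k)) *\<^sub>R \<psi> (Suc k) - (\<tau> (Suc k) * \<xi> (Suc k)) *\<^sub>R \<psi> (Suc k))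
      sums (\<Sum>k\<in>{..<N}. (\<tau> (Suc k) * splice N a \<xi> (Suc k)) *\<^sub>R \<psi> (Suc k) - (\<tau> (Suc k) * \<xi> (Suc k)) *\<^sub>R \<psi> (Suc k))"
    by (rule sums_finite) (auto simp: splice_def)
  ultimately have "S (splice N a \<xi>) - S \<xi>
      = (\<Sum>k\<in>{..<N}. (\<tau> (Suc k) * splice N a \<xi> (Suc k)) *\<^sub>R \<psi> (Suc k) - (\<tau> (Suc k) * \<xi> (Suc k)) *\<^sub>R \<psi> (Suc k))"
    by (rule sums_unique2)
  also have "\<dots> = (\<Sum>j\<in>{1..N}. (\<tau> j * a j) *\<^sub>R \<psi> j - (\<tau> j * \<xi> j) *\<^sub>R \<psi> j)"
    by (rule sum.reindex_bij_witness[of _ "\<lambda>j. j - 1" Suc]) (auto simp: splice_def)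
  also have "\<dots> = (\<Sum>j\<in>{1..N}. (\<tau> j * a j) *\<^sub>R \<psi> j) - basis_proj \<psi> N (S \<xi>)"
    unfolding basis_proj_def[OF \<psi>] sum_subtractf
    by (intro arg_cong2[where f="(-)"] refl sum.cong) (auto simp: inner_prior_map[OF \<xi>])
  finally show ?thesis by (simp add: rest_def algebra_simps)
qed

lemma rest_rest_add:
  "rest N (rest N w + (\<Sum>j\<in>{1..N}. c j *\<^sub>R \<psi> j)) = rest N w"
proof -
  have "inner (rest N w + (\<Sum>j\<in>{1..N}. c j *\<^sub>R \<psi> j)) (\<psi> i) = c i" if "i \<in> {1..N}" for i
    using that by (simp only: inner_add_left inner_rest inner_sum_basis[OF \<psi>] add_0)
  then have "basis_proj \<psi> N (rest N w + (\<Sum>j\<in>{1..N}. c j *\<^sub>R \<psi> j)) = (\<Sum>j\<in>{1..N}. c j *\<^sub>R \<psi> j)"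
    unfolding basis_proj_def[OF \<psi>] by (intro sum.cong) auto
  then show ?thesis by (simp add: rest_def)
qed

lemma rest_prior_map_splice:
  "admissible_coords \<xi> \<Longrightarrow> rest N (S (splice N a \<xi>)) = rest N (S \<xi>)"
  unfolding prior_map_splice by (rule rest_rest_add)

end

section \<open>The posterior tail bound\<close>

locale white_noise_posterior =
  brownian_motion M B + p_exponential_series \<psi> p \<alpha> lam
  for M :: "'o measure" and B :: "real \<Rightarrow> 'o \<Rightarrow> real" and \<psi> :: "nat \<Rightarrow> L2" and p \<alpha> lam :: real +
  fixes n :: nat and w0 :: L2
  assumes n: "1 \<le> n"
begin

abbreviation "P \<equiv> white_noise_law M B n"

text \<open>Units in which the noise level 1/sqrt n becomes 1. In them the prior scale of coordinate
  l is \<open>noise_sd l\<close>, the \<sigma> of the scalar model, and the true coordinate is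
  \<open>signal l\<close>.\<close>

definition noise_sd :: "nat \<Rightarrow> real" where "noise_sd l = sqrt (real n) * \<tau> l"
definition signal :: "nat \<Rightarrow> real" where "signal l = sqrt (real n) * inner w0 (\<psi> l)"

declare sets_law [OF n, simp, measurable_cong] space_law [OF n, simp]

lemma lik_pos: "0 < lik s y x" by (simp add: lik_def[OF p])

lemma lik_meas [measurable]: "(\<lambda>x. lik s (f x) (g x)) \<in> borel_measurable N"
  if [measurable]: "f \<in> borel_measurable N" "g \<in> borel_measurable N"
  unfolding lik_def[OF p] by measurable

lemma ev_meas [measurable]: "evidence p s \<in> borel_measurable borel"
  by (rule evidence_measurable[OF p])

context
  fixes \<kappa> :: "nat \<Rightarrow> nat" and N :: nat
  assumes \<kappa>: "filterlim \<kappa> at_top sequentially" and adm: "\<And>j. j \<in> {1..N} \<Longrightarrow> admissible \<kappa> (\<psi> j)"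
begin

definition obs :: "nat \<Rightarrow> (real \<Rightarrow> real) \<Rightarrow> real" where
  "obs j x = sqrt (real n) * wiener_int \<kappa> (\<psi> j) x"

lemma obs_measurable [measurable]: "obs j \<in> borel_measurable C01"
  unfolding obs_def[abs_def] by measurable

text \<open>The base signal v is orthogonal to the first N basis elements, so the mixed term in
  Girsanov's exponent vanishes; orthonormality splits what remains into one scalar likelihood per
  coordinate.\<close>

lemma law_shift_coords:
  assumes v: "\<And>j. j \<in> {1..N} \<Longrightarrow> inner v (\<psi> j) = 0" and g[measurable]: "g \<in> borel_measurable C01"
  shows "(\<integral>\<^sup>+x. g x \<partial>P (v + (\<Sum>j\<in>{1..N}. c j *\<^sub>R \<psi> j)))
    = (\<integral>\<^sup>+x. g x * (\<Prod>j\<in>{1..N}. ennreal (lik (sqrt (real n)) (obs j x) (c j))) \<partial>P v)"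
proof -
  let ?u = "\<Sum>j\<in>{1..N}. c j *\<^sub>R \<psi> j"
  have admu: "admissible \<kappa> ?u" by (intro admissible_sum adm) auto
  have vu: "inner v ?u = 0" unfolding inner_sum_right by (intro sum.neutral) (auto simp: v)
  have nu: "(norm ?u)\<^sup>2 = (\<Sum>j\<in>{1..N}. (c j)\<^sup>2)" by (rule norm_sum_basis[OF \<psi>])
  \<comment> \<open>Linearity of the Wiener integral is known on Brownian paths only; it is carried
    over to observed paths, where each integral is the Brownian one divided by sqrt n because v
    contributes nothing.\<close>
  have "AE \<omega> in M. \<forall>h\<in>insert ?u (\<psi> ` {1..N}). wiener_int \<kappa> h (white_noise_path B n v \<omega>)
      = inner v h + wiener_int \<kappa> h (Bpath \<omega>) / sqrt (real n)"
    using admu adm wiener_int_white_noise[OF n \<kappa>, of _ v] by (subst AE_finite_all) auto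
  moreover have "AE \<omega> in M. wiener_int \<kappa> ?u (Bpath \<omega>) = (\<Sum>j\<in>{1..N}. c j * wiener_int \<kappa> (\<psi> j) (Bpath \<omega>))"
    by (intro wiener_int_sum adm) auto
  ultimately have lin: "AE \<omega> in M. wiener_int \<kappa> ?u (white_noise_path B n v \<omega>)
      = (\<Sum>j\<in>{1..N}. c j * wiener_int \<kappa> (\<psi> j) (white_noise_path B n v \<omega>))"
  proof eventually_elim
    case (elim \<omega>)
    have "wiener_int \<kappa> (\<psi> j) (white_noise_path B n v \<omega>) = wiener_int \<kappa> (\<psi> j) (Bpath \<omega>) / sqrt (real n)"
      if "j \<in> {1..N}" for j using elim(1) v[OF that] that by auto
    then have "(\<Sum>j\<in>{1..N}. c j * wiener_int \<kappa> (\<psi> j) (white_noise_path B n v \<omega>))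
        = (\<Sum>j\<in>{1..N}. c j * wiener_int \<kappa> (\<psi> j) (Bpath \<omega>)) / sqrt (real n)"
      unfolding sum_divide_distrib by (intro sum.cong) auto
    then show ?case using elim vu by simp
  qed
  have "(\<integral>\<^sup>+x. g x \<partial>P (v + ?u))
      = (\<integral>\<^sup>+x. g x * ennreal (exp (real n * (wiener_int \<kappa> ?u x - inner v ?u) - real n * (norm ?u)\<^sup>2 / 2)) \<partial>P v)"
    by (rule law_shift[OF n \<kappa> admu g])
  also have "\<dots> = (\<integral>\<^sup>+\<omega>. g (white_noise_path B n v \<omega>) *
      (\<Prod>j\<in>{1..N}. ennreal (lik (sqrt (real n)) (obs j (white_noise_path B n v \<omega>)) (c j))) \<partial>M)"
  proof (subst nn_integral_law[OF n], measurable, rule nn_integral_cong_AE, use lin in eventually_elim)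
    fix \<omega> assume l: "wiener_int \<kappa> ?u (white_noise_path B n v \<omega>)
      = (\<Sum>j\<in>{1..N}. c j * wiener_int \<kappa> (\<psi> j) (white_noise_path B n v \<omega>))"
    let ?x = "white_noise_path B n v \<omega>"
    have "real n * (wiener_int \<kappa> ?u ?x - inner v ?u) - real n * (norm ?u)\<^sup>2 / 2
        = (\<Sum>j\<in>{1..N}. sqrt (real n) * c j * obs j ?x - (sqrt (real n) * c j)\<^sup>2 / 2)"
      unfolding vu nu l obs_def sum_subtractf sum_divide_distrib sum_distrib_left diff_0_right
      by (intro arg_cong2[where f="(-)"] sum.cong refl) (auto simp: power_mult_distrib)
    then have "exp (real n * (wiener_int \<kappa> ?u ?x - inner v ?u) - real n * (norm ?u)\<^sup>2 / 2)
        = (\<Prod>j\<in>{1..N}. lik (sqrt (real n)) (obs j ?x) (c j))"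
      by (simp only: exp_sum[OF finite_atLeastAtMost] lik_def[OF p])
    then show "g ?x * ennreal (exp (real n * (wiener_int \<kappa> ?u ?x - inner v ?u) - real n * (norm ?u)\<^sup>2 / 2))
        = g ?x * (\<Prod>j\<in>{1..N}. ennreal (lik (sqrt (real n)) (obs j ?x) (c j)))"
      by (simp only:) (subst prod_ennreal, auto intro: less_imp_le lik_pos)
  qed
  also have "\<dots> = (\<integral>\<^sup>+x. g x * (\<Prod>j\<in>{1..N}. ennreal (lik (sqrt (real n)) (obs j x) (c j))) \<partial>P v)"
    by (subst nn_integral_law[OF n]) measurable
  finally show ?thesis .
qed

text \<open>\<open>ratio\<close> is the density of the first \<open>N\<close> coordinates of the observation under \<open>w0\<close>
  relative to their marginal law under the prior.\<close>

definition ratio :: "(real \<Rightarrow> real) \<Rightarrow> ennreal" where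
  "ratio x = (\<Prod>j\<in>{1..N}. ennreal (lik (sqrt (real n)) (obs j x) (inner w0 (\<psi> j))) / evidence p (noise_sd j) (obs j x))"

lemma ratio_measurable [measurable]: "ratio \<in> borel_measurable C01"
  unfolding ratio_def[abs_def] by measurable

abbreviation "coords_law \<equiv> PiM {1..N} (\<lambda>_::nat. p_exponential p)"

lemma lik_scale: "lik (sqrt (real n)) y (\<tau> j * a) = lik (noise_sd j) y a"
  by (simp add: lik_def[OF p] noise_sd_def mult.assoc)

lemma kernel_integral_measurable:
  assumes [measurable]: "f \<in> borel_measurable (borel \<Otimes>\<^sub>M C01)"
  shows "(\<lambda>v :: L2. \<integral>\<^sup>+x. f (v, x) \<partial>P v) \<in> borel_measurable borel"
  by (rule nn_integral_measurable_subprob_algebra2[OF _ measurable_prob_algebraD[OF law_kernel[OF n]]])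
    measurable

text \<open>Bayes' rule in the first N coordinates with the tail of the draw frozen. Relative to the
  law at the tail, integrating out a coordinate yields posterior expectation times evidence; the
  evidence cancels the denominator of \<open>ratio\<close>, and the numerator moves the law to the
  coordinates of \<open>w0\<close>. Posterior integrals under the prior mixture thus become products
  of scalar posterior integrals under the true coordinates.\<close>

lemma mixture_identity:
  assumes h[measurable]: "h \<in> borel_measurable (borel \<Otimes>\<^sub>M C01)"
    and G[measurable]: "\<And>j. G j \<in> borel_measurable borel"
  shows "(\<integral>\<^sup>+\<xi>. \<integral>\<^sup>+x. (\<Prod>j\<in>{1..N}. G j (\<xi> j)) * h (rest N (S \<xi>), x) * ratio x \<partial>P (S \<xi>) \<partial>\<Xi>)
    = (\<integral>\<^sup>+\<xi>. \<integral>\<^sup>+x. h (rest N (S \<xi>), x) * (\<Prod>j\<in>{1..N}. post_int p (noise_sd j) (G j) (obs j x))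
        \<partial>P (rest N (S \<xi>) + basis_proj \<psi> N w0) \<partial>\<Xi>)"
proof -
  interpret coords_law: prob_space coords_law by (rule prob_space_PiM) (rule prob_mu)
  interpret Coords: product_prob_space "\<lambda>_::nat. p_exponential p" "{1..N}"
    by (simp add: product_prob_space_def product_prob_space_axioms_def product_sigma_finite_def
      prob_space_imp_sigma_finite prob_mu)
  have coord[measurable]: "(\<lambda>\<xi>. \<xi> j) \<in> borel_measurable \<Xi>" if "j \<in> {1..N}" for j
    using that by (intro coord_measurable) auto
  have coorda[measurable]: "(\<lambda>a. a j) \<in> borel_measurable coords_law" if "j \<in> {1..N}" for j
  proof -
    have "(\<lambda>a. a j) \<in> measurable coords_law \<mu>" using that by (rule measurable_component_singleton)
    then show ?thesis by (simp cong: measurable_cong_sets)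
  qed
  have Gl: "(\<lambda>a. G j a * ennreal (lik s y a)) \<in> borel_measurable \<mu>" for j s y
    unfolding measurable_cong_sets[OF sets_p_exponential[OF p] refl]
    by (intro borel_measurable_times_ennreal G measurable_compose[OF _ measurable_ennreal] lik_meas
      borel_measurable_const measurable_ident_sets refl)
  define F where "F \<xi> = (\<Prod>j\<in>{1..N}. G j (\<xi> j)) * (\<integral>\<^sup>+x. h (rest N (S \<xi>), x) * ratio x \<partial>P (S \<xi>))" for \<xi>
  have km: "(\<lambda>v. \<integral>\<^sup>+x. h (rest N v, x) * ratio x \<partial>P v) \<in> borel_measurable borel"
    using kernel_integral_measurable[of "\<lambda>(v, x). h (rest N v, x) * ratio x"] by simp
  have Fm: "F \<in> borel_measurable \<Xi>"
    unfolding F_def[abs_def]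
    by (intro borel_measurable_times_ennreal borel_measurable_prod_ennreal measurable_compose[OF coord G]
      measurable_compose[OF prior_map_measurable km])
  have "(\<integral>\<^sup>+\<xi>. \<integral>\<^sup>+x. (\<Prod>j\<in>{1..N}. G j (\<xi> j)) * h (rest N (S \<xi>), x) * ratio x \<partial>P (S \<xi>) \<partial>\<Xi>) = (\<integral>\<^sup>+\<xi>. F \<xi> \<partial>\<Xi>)"
    unfolding F_def
    by (intro nn_integral_cong) (simp add: mult.assoc nn_integral_cmult)
  \<comment> \<open>The inner integral runs over fresh first coordinates a, for a fixed tail of
    \<xi>.\<close>
  also have "\<dots> = (\<integral>\<^sup>+\<xi>. \<integral>\<^sup>+a. F (splice N a \<xi>) \<partial>coords_law \<partial>\<Xi>)"
    unfolding splice_def by (rule nn_integral_PiM_resample[OF prob_mu _ Fm]) auto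
  also have "\<dots> = (\<integral>\<^sup>+\<xi>. \<integral>\<^sup>+x. h (rest N (S \<xi>), x) * (\<Prod>j\<in>{1..N}. post_int p (noise_sd j) (G j) (obs j x))
        \<partial>P (rest N (S \<xi>) + basis_proj \<psi> N w0) \<partial>\<Xi>)"
  proof (rule nn_integral_cong_AE, use AE_admissible_coords in eventually_elim)
    fix \<xi> assume \<xi>: "admissible_coords \<xi>"
    define v where "v = rest N (S \<xi>)"
    have v: "inner v (\<psi> j) = 0" if "j \<in> {1..N}" for j
      unfolding v_def using that by (rule inner_rest)
    interpret Pv: prob_space "P v" by (rule prob_space_law[OF n])
    interpret PP: pair_prob_space coords_law "P v" ..
    have hv[measurable]: "(\<lambda>x. h (v, x)) \<in> borel_measurable C01" by measurable
    have spl: "splice N a \<xi> j = a j" if "j \<in> {1..N}" for a j using that by (simp add: splice_def)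
    have r1: "rest N (S (splice N a \<xi>)) = v" for a
      unfolding v_def by (rule rest_prior_map_splice[OF \<xi>])
    have s1: "S (splice N a \<xi>) = v + (\<Sum>j\<in>{1..N}. (\<tau> j * a j) *\<^sub>R \<psi> j)" for a
      unfolding v_def by (rule prior_map_splice[OF \<xi>])
    have "F (splice N a \<xi>) = (\<integral>\<^sup>+x. h (v, x) * ratio x *
        (\<Prod>j\<in>{1..N}. G j (a j) * ennreal (lik (noise_sd j) (obs j x) (a j))) \<partial>P v)" for a
    proof -
      have "F (splice N a \<xi>) = (\<Prod>j\<in>{1..N}. G j (a j)) *
          (\<integral>\<^sup>+x. h (v, x) * ratio x \<partial>P (v + (\<Sum>j\<in>{1..N}. (\<tau> j * a j) *\<^sub>R \<psi> j)))"
        unfolding F_def r1 unfolding s1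
        by (intro arg_cong2[where f="(*)"] prod.cong refl) (simp_all add: spl)
      also have "\<dots> = (\<Prod>j\<in>{1..N}. G j (a j)) * (\<integral>\<^sup>+x. h (v, x) * ratio x *
          (\<Prod>j\<in>{1..N}. ennreal (lik (sqrt (real n)) (obs j x) (\<tau> j * a j))) \<partial>P v)"
        by (subst law_shift_coords[OF v]) measurable
      also have "\<dots> = (\<integral>\<^sup>+x. (\<Prod>j\<in>{1..N}. G j (a j)) * (h (v, x) * ratio x *
          (\<Prod>j\<in>{1..N}. ennreal (lik (noise_sd j) (obs j x) (a j)))) \<partial>P v)"
        unfolding lik_scale by (rule nn_integral_cmult[symmetric]) measurable
      finally show ?thesis by (simp add: prod.distrib ac_simps)
    qed
    then have "(\<integral>\<^sup>+a. F (splice N a \<xi>) \<partial>coords_law) = (\<integral>\<^sup>+a. \<integral>\<^sup>+x. h (v, x) * ratio x *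
        (\<Prod>j\<in>{1..N}. G j (a j) * ennreal (lik (noise_sd j) (obs j x) (a j))) \<partial>P v \<partial>coords_law)" by simp
    \<comment> \<open>After the shift the data law \<open>P v\<close> no longer depends on a, so the
      order of integration can be exchanged.\<close>
    also have "\<dots> = (\<integral>\<^sup>+x. \<integral>\<^sup>+a. h (v, x) * ratio x *
        (\<Prod>j\<in>{1..N}. G j (a j) * ennreal (lik (noise_sd j) (obs j x) (a j))) \<partial>coords_law \<partial>P v)"
    proof (rule PP.Fubini'[symmetric])
      have 1: "(\<lambda>z. fst z j) \<in> borel_measurable (coords_law \<Otimes>\<^sub>M P v)" if "j \<in> {1..N}" for j
        by (rule measurable_compose[OF measurable_fst coorda[OF that]])
      have 2: "snd \<in> measurable (coords_law \<Otimes>\<^sub>M P v) C01"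
        using measurable_snd[of coords_law "P v"] by (simp cong: measurable_cong_sets)
      have "(\<lambda>z. h (v, snd z) * ratio (snd z) *
          (\<Prod>j\<in>{1..N}. G j (fst z j) * ennreal (lik (noise_sd j) (obs j (snd z)) (fst z j)))) \<in> borel_measurable (coords_law \<Otimes>\<^sub>M P v)"
        by (intro borel_measurable_times_ennreal borel_measurable_prod_ennreal measurable_compose[OF 2 hv]
          measurable_compose[OF 2 ratio_measurable] measurable_compose[OF 1 G] measurable_compose[OF _ measurable_ennreal]
          lik_meas measurable_compose[OF 2 obs_measurable] 1)
      then show "(\<lambda>(a, x). h (v, x) * ratio x *
          (\<Prod>j\<in>{1..N}. G j (a j) * ennreal (lik (noise_sd j) (obs j x) (a j)))) \<in> borel_measurable (coords_law \<Otimes>\<^sub>M P v)"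
        by (simp add: case_prod_beta)
    qed
    also have "\<dots> = (\<integral>\<^sup>+x. (h (v, x) * (\<Prod>j\<in>{1..N}. post_int p (noise_sd j) (G j) (obs j x))) *
        (\<Prod>j\<in>{1..N}. ennreal (lik (sqrt (real n)) (obs j x) (inner w0 (\<psi> j)))) \<partial>P v)"
    proof (rule nn_integral_cong)
      fix x
      have "(\<integral>\<^sup>+a. h (v, x) * ratio x * (\<Prod>j\<in>{1..N}. G j (a j) * ennreal (lik (noise_sd j) (obs j x) (a j))) \<partial>coords_law)
          = h (v, x) * ratio x * (\<integral>\<^sup>+a. (\<Prod>j\<in>{1..N}. G j (a j) * ennreal (lik (noise_sd j) (obs j x) (a j))) \<partial>coords_law)"
        by (rule nn_integral_cmult)
          (intro borel_measurable_times_ennreal borel_measurable_prod_ennreal measurable_compose[OF coorda G]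
            measurable_compose[OF _ measurable_ennreal] lik_meas coorda borel_measurable_const)
      also have "(\<integral>\<^sup>+a. (\<Prod>j\<in>{1..N}. G j (a j) * ennreal (lik (noise_sd j) (obs j x) (a j))) \<partial>coords_law)
          = (\<Prod>j\<in>{1..N}. \<integral>\<^sup>+a. G j a * ennreal (lik (noise_sd j) (obs j x) a) \<partial>\<mu>)"
        by (rule Coords.product_nn_integral_prod) (auto intro: Gl)
      also have "\<dots> = (\<Prod>j\<in>{1..N}. post_int p (noise_sd j) (G j) (obs j x) * evidence p (noise_sd j) (obs j x))"
        unfolding post_int_def[OF p]
        using evidence_finite[OF p] evidence_pos[OF p]
        by (intro prod.cong refl) (simp add: ennreal_divide_times ennreal_times_divide ennreal_mult_divide_eq less_top[symmetric])
      finally have "(\<integral>\<^sup>+a. h (v, x) * ratio x * (\<Prod>j\<in>{1..N}. G j (a j) * ennreal (lik (noise_sd j) (obs j x) (a j))) \<partial>coords_law)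
        = h (v, x) * (ratio x * (\<Prod>j\<in>{1..N}. post_int p (noise_sd j) (G j) (obs j x) * evidence p (noise_sd j) (obs j x)))"
        by (simp add: mult.assoc)
      \<comment> \<open>Evidence against evidence: it is neither zero nor infinite, so the quotient
        is 1 also in the extended reals.\<close>
      also have "ratio x * (\<Prod>j\<in>{1..N}. post_int p (noise_sd j) (G j) (obs j x) * evidence p (noise_sd j) (obs j x))
          = (\<Prod>j\<in>{1..N}. post_int p (noise_sd j) (G j) (obs j x) * ennreal (lik (sqrt (real n)) (obs j x) (inner w0 (\<psi> j))))"
        unfolding ratio_def prod.distrib[symmetric]
      proof (intro prod.cong refl)
        fix j
        have "evidence p (noise_sd j) (obs j x) / evidence p (noise_sd j) (obs j x) = 1"
          using evidence_finite[OF p] evidence_pos[OF p]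
          by (intro ennreal_divide_self) (auto simp: less_top[symmetric])
        then have ee: "inverse (evidence p (noise_sd j) (obs j x)) * evidence p (noise_sd j) (obs j x) = 1"
          by (simp add: divide_ennreal_def mult.commute)
        have "ennreal (lik (sqrt (real n)) (obs j x) (inner w0 (\<psi> j))) / evidence p (noise_sd j) (obs j x) *
          (post_int p (noise_sd j) (G j) (obs j x) * evidence p (noise_sd j) (obs j x))
          = post_int p (noise_sd j) (G j) (obs j x) * ennreal (lik (sqrt (real n)) (obs j x) (inner w0 (\<psi> j)))
            * (inverse (evidence p (noise_sd j) (obs j x)) * evidence p (noise_sd j) (obs j x))"
          unfolding divide_ennreal_def by (simp only: ac_simps)
        then show "ennreal (lik (sqrt (real n)) (obs j x) (inner w0 (\<psi> j))) / evidence p (noise_sd j) (obs j x) *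
          (post_int p (noise_sd j) (G j) (obs j x) * evidence p (noise_sd j) (obs j x))
          = post_int p (noise_sd j) (G j) (obs j x) * ennreal (lik (sqrt (real n)) (obs j x) (inner w0 (\<psi> j)))"
          unfolding ee by simp
      qed
      finally show "(\<integral>\<^sup>+a. h (v, x) * ratio x * (\<Prod>j\<in>{1..N}. G j (a j) * ennreal (lik (noise_sd j) (obs j x) (a j))) \<partial>coords_law)
        = (h (v, x) * (\<Prod>j\<in>{1..N}. post_int p (noise_sd j) (G j) (obs j x))) *
          (\<Prod>j\<in>{1..N}. ennreal (lik (sqrt (real n)) (obs j x) (inner w0 (\<psi> j))))"
        by (simp add: prod.distrib mult.assoc)
    qed
    \<comment> \<open>The surviving likelihoods are those of the coordinates of \<open>w0\<close>;
      the shift formula is read backwards.\<close>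
    also have "\<dots> = (\<integral>\<^sup>+x. h (v, x) * (\<Prod>j\<in>{1..N}. post_int p (noise_sd j) (G j) (obs j x))
        \<partial>P (v + (\<Sum>j\<in>{1..N}. inner w0 (\<psi> j) *\<^sub>R \<psi> j)))"
    proof (rule law_shift_coords[symmetric])
      show "inner v (\<psi> j) = 0" if "j \<in> {1..N}" for j using that by (rule v)
      show "(\<lambda>x. h (v, x) * (\<Prod>j\<in>{1..N}. post_int p (noise_sd j) (G j) (obs j x))) \<in> borel_measurable C01"
        by (intro borel_measurable_times_ennreal borel_measurable_prod_ennreal hv
          measurable_compose[OF obs_measurable post_int_measurable[OF p G]])
    qed
    finally show "(\<integral>\<^sup>+a. F (splice N a \<xi>) \<partial>coords_law) = (\<integral>\<^sup>+x. h (rest N (S \<xi>), x) *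
        (\<Prod>j\<in>{1..N}. post_int p (noise_sd j) (G j) (obs j x)) \<partial>P (rest N (S \<xi>) + basis_proj \<psi> N w0))"
      unfolding v_def basis_proj_def[OF \<psi>] .
  qed
  finally show ?thesis .
qed

text \<open>The first N rescaled observations are independent with unit Gaussian noise around
  \<open>signal\<close>, whatever the orthogonal tail v is, so the expected product is a product of
  scalar risks.\<close>

lemma law_obs_prod:
  assumes v: "\<And>j. j \<in> {1..N} \<Longrightarrow> inner v (\<psi> j) = 0" and G[measurable]: "\<And>j. G j \<in> borel_measurable borel"
  shows "(\<integral>\<^sup>+x. (\<Prod>j\<in>{1..N}. G j (obs j x)) \<partial>P (v + basis_proj \<psi> N w0))
    = (\<Prod>j\<in>{1..N}. \<integral>\<^sup>+e. G j (signal j + e) \<partial>std_normal_distribution)"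
proof -
  interpret product_prob_space "\<lambda>_::nat. std_normal_distribution" "{1..N}"
    by (simp add: product_prob_space_def product_prob_space_axioms_def product_sigma_finite_def
      prob_space_imp_sigma_finite prob_space_normal_density)
  let ?F = "\<lambda>y. \<Prod>j\<in>{1..N}. G j (y j)" and ?w = "v + basis_proj \<psi> N w0"
  have iw: "sqrt (real n) * inner ?w (\<psi> j) = signal j" if "j \<in> {1..N}" for j
    using that by (simp only: inner_add_left v inner_basis_proj[OF \<psi>] add_0 signal_def)
  have "(\<integral>\<^sup>+x. (\<Prod>j\<in>{1..N}. G j (obs j x)) \<partial>P ?w)
      = (\<integral>\<^sup>+x. ?F (\<lambda>j\<in>{1..N}. sqrt (real n) * wiener_int \<kappa> (\<psi> j) x) \<partial>P ?w)"
    by (intro nn_integral_cong prod.cong) (auto simp: obs_def)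
  also have "\<dots> = (\<integral>\<^sup>+z. ?F (\<lambda>j\<in>{1..N}. sqrt (real n) * inner ?w (\<psi> j) + z j) \<partial>PiM {1..N} (\<lambda>_. std_normal_distribution))"
    by (rule nn_integral_law_wiener_int[OF n \<kappa>]) (auto intro: adm simp: basis_inner[OF \<psi>])
  also have "\<dots> = (\<integral>\<^sup>+z. (\<Prod>j\<in>{1..N}. G j (signal j + z j)) \<partial>PiM {1..N} (\<lambda>_. std_normal_distribution))"
    by (intro nn_integral_cong prod.cong) (auto simp: iw simp del: One_nat_def)
  also have "\<dots> = (\<Prod>j\<in>{1..N}. \<integral>\<^sup>+e. G j (signal j + e) \<partial>std_normal_distribution)"
    by (rule product_nn_integral_prod[of _ "\<lambda>j e. G j (signal j + e)"]) auto
  finally show ?thesis .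
qed

end

end

lemma prod_mono_ennreal:
  fixes f g :: "'i \<Rightarrow> ennreal"
  shows "(\<And>j. j \<in> A \<Longrightarrow> f j \<le> g j) \<Longrightarrow> prod f A \<le> prod g A"
  by (induction A rule: infinite_finite_induct) (auto intro: mult_mono)

section \<open>From finitely many coordinates to the full tail bound\<close>

context white_noise_posterior
begin

lemma rest_diff: "rest N (u - v) = rest N u - rest N v"
  by (simp add: rest_def basis_proj_def[OF \<psi>] inner_diff_left scaleR_diff_left sum_subtractf)

lemma rest_tendsto: "(\<lambda>N. rest N w) \<longlonglongrightarrow> 0"
  unfolding rest_def using tendsto_diff[OF tendsto_const[of w] basis_proj_tendsto[OF \<psi>, of w]] by simp

lemma norm_sq_split:
  "(norm w)\<^sup>2 = (norm (rest N w))\<^sup>2 + (\<Sum>j\<in>{1..N}. (inner w (\<psi> j))\<^sup>2)"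
  using norm_rest_add[OF \<psi>, of w N "\<lambda>j. inner w (\<psi> j)"]
  unfolding rest_def[symmetric] basis_proj_def[OF \<psi>, symmetric] by (simp add: rest_def)

lemma nn_integral_prior:
  assumes [measurable]: "f \<in> borel_measurable borel"
  shows "(\<integral>\<^sup>+w. f w \<partial>p_exponential_prior \<psi> p \<alpha> lam) = (\<integral>\<^sup>+\<xi>. f (S \<xi>) \<partial>\<Xi>)"
  unfolding prior_eq by (rule nn_integral_distr) measurable

text \<open>Under the prior mixture the weight \<open>ratio\<close> replaces the first \<open>N\<close> coordinates of the signal by
  those of \<open>w0\<close>. The last integral pays for the remaining coordinates, where the prior draw has to be
  compared with \<open>w0\<close> in total variation; it vanishes as \<open>N\<close> grows.\<close>

lemma posterior_tail_bound_finite: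
  assumes post: "is_posterior (p_exponential_prior \<psi> p \<alpha> lam) C01 P K"
    and \<rho>: "0 < \<rho>"
    and b: "\<And>j. j \<in> {1..N} \<Longrightarrow> (\<integral>\<^sup>+e. post_int p (noise_sd j) (\<lambda>x. ennreal (exp ((noise_sd j * x - signal j)\<^sup>2 / 81)))
      (signal j + e) \<partial>std_normal_distribution) \<le> ennreal (exp (b j))"
    and Bd: "(\<Sum>j\<in>{1..N}. b j) \<le> Bd"
  shows "(\<integral>\<^sup>+x. emeasure (K x) {w. \<rho> < norm (w - w0)} \<partial>P w0)
    \<le> ennreal (exp (Bd - real n * \<rho>\<^sup>2 / 162))
      + (\<integral>\<^sup>+\<xi>. indicator {w. \<rho>\<^sup>2 / 2 < (norm (rest N (w - w0)))\<^sup>2} (S \<xi>)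
          + ennreal (min 1 (sqrt (exp (real n * (norm (rest N (S \<xi> - w0)))\<^sup>2) - 1))) \<partial>\<Xi>)"
proof -
  let ?prior = "p_exponential_prior \<psi> p \<alpha> lam"
  interpret Xi: prob_space \<Xi> by (rule prob_Xi)
  define A where "A = {w. \<rho> < norm (w - w0)}"
  have A[measurable]: "A \<in> sets borel" unfolding A_def by measurable
  have sp: "sets ?prior = sets borel" by (simp add: prior_eq)
  have prp: "prob_space ?prior" unfolding prior_eq by (rule Xi.prob_space_distr) measurable
  have K: "K \<in> measurable C01 (prob_algebra ?prior)" using post by (simp add: is_posterior_def)
  have [measurable]: "(\<lambda>x. emeasure (K x) A) \<in> borel_measurable C01"
    by (rule measurable_emeasure_kernel[OF measurable_prob_algebraD[OF K]]) (simp add: sp)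
  \<comment> \<open>Truncation at 1 makes the bound hold off the path space too, where K need not be
    a probability measure; \<open>law_tv\<close> asks for it everywhere.\<close>
  define g where "g x = min 1 (emeasure (K x) A)" for x
  have g[measurable]: "g \<in> borel_measurable C01" unfolding g_def by measurable
  have gK: "g x = emeasure (K x) A" if "x \<in> space C01" for x
  proof -
    have "prob_space (K x)" using measurable_space[OF K that] by (simp add: space_prob_algebra)
    then show ?thesis unfolding g_def by (simp add: min_absorb2 prob_space.emeasure_le_1)
  qed
  obtain \<kappa> where \<kappa>: "filterlim \<kappa> at_top sequentially" and adm0: "\<forall>h\<in>\<psi> ` {1..N}. admissible \<kappa> h"
    using ex_admissible[of "\<psi> ` {1..N}"] by blast
  have adm: "admissible \<kappa> (\<psi> j)" if "j \<in> {1..N}" for j using adm0 that by blast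
  define v where "v \<xi> = rest N (S \<xi>) + basis_proj \<psi> N w0" for \<xi>
  have v_meas[measurable]: "v \<in> borel_measurable \<Xi>"
    unfolding v_def[abs_def] by measurable
  have Pint: "(\<lambda>\<xi>. \<integral>\<^sup>+x. f x \<partial>P (v \<xi>)) \<in> borel_measurable \<Xi>" if f: "f \<in> borel_measurable C01" for f
    by (rule measurable_compose[OF v_meas measurable_compose[OF measurable_prob_algebraD[OF law_kernel[OF n]]
        nn_integral_measurable_subprob_algebra[OF f]]])
  have PintS: "(\<lambda>w. \<integral>\<^sup>+x. f x \<partial>P w) \<in> borel_measurable borel" if f: "f \<in> borel_measurable C01" for f
    by (rule measurable_compose[OF measurable_prob_algebraD[OF law_kernel[OF n]]
        nn_integral_measurable_subprob_algebra[OF f]])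
  note ratio_m = ratio_measurable[OF \<kappa> adm]
  note obs_m = obs_measurable[OF \<kappa> adm]
  define R where "R x = ratio \<kappa> N x" for x
  have R_meas[measurable]: "R \<in> borel_measurable C01" unfolding R_def[abs_def] by (rule ratio_m)
  define G where "G j a = ennreal (exp ((noise_sd j * a - signal j)\<^sup>2 / 81))" for j a
  have G_meas[measurable]: "G j \<in> borel_measurable borel" for j unfolding G_def[abs_def] by measurable
  define tv where "tv \<xi> = ennreal (min 1 (sqrt (exp (real n * (norm (rest N (S \<xi> - w0)))\<^sup>2) - 1)))" for \<xi>
  have tv_meas[measurable]: "tv \<in> borel_measurable \<Xi>" unfolding tv_def[abs_def] by measurable
  define T where "T = {w. \<rho>\<^sup>2 / 2 < (norm (rest N (w - w0)))\<^sup>2}"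
  have T_meas[measurable]: "T \<in> sets borel" unfolding T_def by measurable
  have 1: "(\<integral>\<^sup>+x. emeasure (K x) A \<partial>P w0) \<le> (\<integral>\<^sup>+\<xi>. \<integral>\<^sup>+x. g x \<partial>P (v \<xi>) \<partial>\<Xi>) + (\<integral>\<^sup>+\<xi>. tv \<xi> \<partial>\<Xi>)"
  proof -
    have "(\<integral>\<^sup>+x. emeasure (K x) A \<partial>P w0) = (\<integral>\<^sup>+x. g x \<partial>P w0)"
      by (intro nn_integral_cong) (simp add: gK)
    also have "\<dots> = (\<integral>\<^sup>+\<xi>. \<integral>\<^sup>+x. g x \<partial>P w0 \<partial>\<Xi>)" using Xi.emeasure_space_1 by simp
    also have "\<dots> \<le> (\<integral>\<^sup>+\<xi>. (\<integral>\<^sup>+x. g x \<partial>P (v \<xi>)) + tv \<xi> \<partial>\<Xi>)"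
    proof (rule nn_integral_mono)
      fix \<xi>
      \<comment> \<open>\<open>v \<xi>\<close> agrees with \<open>w0\<close> in the first N
        coordinates, so the total variation cost involves only the remainders.\<close>
      have "w0 - v \<xi> = - rest N (S \<xi> - w0)" unfolding rest_diff by (simp add: v_def rest_def)
      then have "norm (w0 - v \<xi>) = norm (rest N (S \<xi> - w0))" by simp
      moreover have "(\<integral>\<^sup>+x. g x \<partial>P w0) \<le> (\<integral>\<^sup>+x. g x \<partial>P (v \<xi>))
          + ennreal (min 1 (sqrt (exp (real n * (norm (w0 - v \<xi>))\<^sup>2) - 1)))"
        by (rule law_tv[OF n g]) (simp add: g_def)
      ultimately show "(\<integral>\<^sup>+x. g x \<partial>P w0) \<le> (\<integral>\<^sup>+x. g x \<partial>P (v \<xi>)) + tv \<xi>"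
        by (simp only: tv_def)
    qed
    also have "\<dots> = (\<integral>\<^sup>+\<xi>. \<integral>\<^sup>+x. g x \<partial>P (v \<xi>) \<partial>\<Xi>) + (\<integral>\<^sup>+\<xi>. tv \<xi> \<partial>\<Xi>)"
      by (rule nn_integral_add[OF Pint[OF g] tv_meas])
    finally show ?thesis .
  qed
  \<comment> \<open>\<open>mixture_identity\<close> with all G equal to 1 writes the modified law as
    a reweighted mixture, and \<open>nn_integral_bind_posterior\<close> then replaces the posterior
    mass of A by its indicator at the prior draw.\<close>
  have 2: "(\<integral>\<^sup>+\<xi>. \<integral>\<^sup>+x. g x \<partial>P (v \<xi>) \<partial>\<Xi>) = (\<integral>\<^sup>+\<xi>. indicator A (S \<xi>) * (\<integral>\<^sup>+x. R x \<partial>P (S \<xi>)) \<partial>\<Xi>)"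
  proof -
    have "(\<integral>\<^sup>+\<xi>. \<integral>\<^sup>+x. g x \<partial>P (v \<xi>) \<partial>\<Xi>) = (\<integral>\<^sup>+\<xi>. \<integral>\<^sup>+x. g x * R x \<partial>P (S \<xi>) \<partial>\<Xi>)"
      using mixture_identity[OF \<kappa> adm, where N=N and h="\<lambda>(w, x). g x" and G="\<lambda>_ _. 1"]
      by (simp add: post_int_const[OF p] v_def R_def)
    also have "\<dots> = (\<integral>\<^sup>+w. \<integral>\<^sup>+x. g x * R x \<partial>P w \<partial>?prior)"
      by (rule nn_integral_prior[symmetric], rule PintS) measurable
    also have "\<dots> = (\<integral>\<^sup>+w. \<integral>\<^sup>+x. emeasure (K x) A * R x \<partial>P w \<partial>?prior)"
      by (intro nn_integral_cong) (simp add: gK)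
    also have "\<dots> = (\<integral>\<^sup>+w. indicator A w * (\<integral>\<^sup>+x. R x \<partial>P w) \<partial>?prior)"
    proof (rule nn_integral_bind_posterior[OF post _ _ prp R_meas, symmetric])
      show "P \<in> measurable ?prior (prob_algebra C01)"
        using law_kernel[OF n] by (simp only: measurable_cong_sets[OF sp refl])
    qed (simp add: sp)
    also have "\<dots> = (\<integral>\<^sup>+\<xi>. indicator A (S \<xi>) * (\<integral>\<^sup>+x. R x \<partial>P (S \<xi>)) \<partial>\<Xi>)"
      by (rule nn_integral_prior) (intro borel_measurable_times_ennreal borel_measurable_indicator A PintS R_meas)
    finally show ?thesis .
  qed
  define c where "c = ennreal (exp (- (real n * \<rho>\<^sup>2 / 162)))"
  \<comment> \<open>Either the coordinates beyond N carry more than half of \<rho>^2, or the first N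
    carry at least half, and Chernoff's bound with exponent 1/81 gives the factor c. This is the
    origin of 162 = 2 * 81.\<close>
  have split: "AE \<xi> in \<Xi>. indicator A (S \<xi>) \<le> c * (\<Prod>j\<in>{1..N}. G j (\<xi> j)) + indicator T (S \<xi>)"
    using AE_admissible_coords
  proof eventually_elim
    case (elim \<xi>)
    show ?case
    proof (cases "S \<xi> \<in> A \<and> S \<xi> \<notin> T")
      case True
      have "\<rho>\<^sup>2 \<le> (norm (S \<xi> - w0))\<^sup>2"
        using True \<rho> by (intro power_mono) (auto simp: A_def)
      then have "\<rho>\<^sup>2 / 2 \<le> (\<Sum>j\<in>{1..N}. (inner (S \<xi> - w0) (\<psi> j))\<^sup>2)"
        using norm_sq_split[of "S \<xi> - w0" N] True by (simp add: T_def)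
      also have "\<dots> = (\<Sum>j\<in>{1..N}. (\<tau> j * \<xi> j - inner w0 (\<psi> j))\<^sup>2)"
        by (intro sum.cong refl) (simp add: inner_diff_left inner_prior_map[OF elim])
      finally have "real n * (\<rho>\<^sup>2 / 2) \<le> real n * (\<Sum>j\<in>{1..N}. (\<tau> j * \<xi> j - inner w0 (\<psi> j))\<^sup>2)"
        by (rule mult_left_mono) simp
      also have "\<dots> = (\<Sum>j\<in>{1..N}. (noise_sd j * \<xi> j - signal j)\<^sup>2)"
        unfolding sum_distrib_left
      proof (intro sum.cong refl)
        fix j
        have "noise_sd j * \<xi> j - signal j = sqrt (real n) * (\<tau> j * \<xi> j - inner w0 (\<psi> j))"
          by (simp add: noise_sd_def signal_def algebra_simps)
        then show "real n * (\<tau> j * \<xi> j - inner w0 (\<psi> j))\<^sup>2 = (noise_sd j * \<xi> j - signal j)\<^sup>2"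
          by (simp add: power_mult_distrib)
      qed
      finally have "1 \<le> exp (- (real n * \<rho>\<^sup>2 / 162)) * exp (\<Sum>j\<in>{1..N}. (noise_sd j * \<xi> j - signal j)\<^sup>2 / 81)"
        by (simp add: exp_add[symmetric] sum_divide_distrib[symmetric])
      also have "\<dots> = exp (- (real n * \<rho>\<^sup>2 / 162)) * (\<Prod>j\<in>{1..N}. exp ((noise_sd j * \<xi> j - signal j)\<^sup>2 / 81))"
        by (simp add: exp_sum)
      finally have "ennreal 1 \<le> ennreal \<dots>" by (rule ennreal_leI)
      also have "\<dots> = c * (\<Prod>j\<in>{1..N}. G j (\<xi> j))"
        unfolding c_def G_def by (subst prod_ennreal) (auto simp: ennreal_mult prod_nonneg)
      finally show ?thesis using True by (simp add: indicator_def)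
    qed (auto simp: indicator_def)
  qed
  have coord: "(\<lambda>\<xi>. \<xi> j) \<in> borel_measurable \<Xi>" if "j \<in> {1..N}" for j
    using that by (intro coord_measurable) auto
  have RS: "(\<lambda>\<xi>. \<integral>\<^sup>+x. R x \<partial>P (S \<xi>)) \<in> borel_measurable \<Xi>"
    by (rule measurable_compose[OF prior_map_measurable PintS[OF R_meas]])
  have Gm: "(\<lambda>\<xi>. \<Prod>j\<in>{1..N}. G j (\<xi> j)) \<in> borel_measurable \<Xi>"
    by (intro borel_measurable_prod_ennreal measurable_compose[OF coord G_meas])
  have "(\<integral>\<^sup>+\<xi>. indicator A (S \<xi>) * (\<integral>\<^sup>+x. R x \<partial>P (S \<xi>)) \<partial>\<Xi>)
      \<le> (\<integral>\<^sup>+\<xi>. c * ((\<Prod>j\<in>{1..N}. G j (\<xi> j)) * (\<integral>\<^sup>+x. R x \<partial>P (S \<xi>))) + indicator T (S \<xi>) * (\<integral>\<^sup>+x. R x \<partial>P (S \<xi>)) \<partial>\<Xi>)"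
  proof (rule nn_integral_mono_AE, use split in eventually_elim)
    fix \<xi> assume elim: "indicator A (S \<xi>) \<le> c * (\<Prod>j\<in>{1..N}. G j (\<xi> j)) + indicator T (S \<xi>)"
    have "indicator A (S \<xi>) * (\<integral>\<^sup>+x. R x \<partial>P (S \<xi>))
        \<le> (c * (\<Prod>j\<in>{1..N}. G j (\<xi> j)) + indicator T (S \<xi>)) * (\<integral>\<^sup>+x. R x \<partial>P (S \<xi>))"
      by (rule mult_right_mono[OF elim]) simp
    then show "indicator A (S \<xi>) * (\<integral>\<^sup>+x. R x \<partial>P (S \<xi>))
        \<le> c * ((\<Prod>j\<in>{1..N}. G j (\<xi> j)) * (\<integral>\<^sup>+x. R x \<partial>P (S \<xi>))) + indicator T (S \<xi>) * (\<integral>\<^sup>+x. R x \<partial>P (S \<xi>))"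
      by (simp only: distrib_right mult.assoc)
  qed
  also have "\<dots> = c * (\<integral>\<^sup>+\<xi>. (\<Prod>j\<in>{1..N}. G j (\<xi> j)) * (\<integral>\<^sup>+x. R x \<partial>P (S \<xi>)) \<partial>\<Xi>)
      + (\<integral>\<^sup>+\<xi>. indicator T (S \<xi>) * (\<integral>\<^sup>+x. R x \<partial>P (S \<xi>)) \<partial>\<Xi>)"
  proof (subst nn_integral_add)
    show "(\<lambda>\<xi>. c * ((\<Prod>j\<in>{1..N}. G j (\<xi> j)) * (\<integral>\<^sup>+x. R x \<partial>P (S \<xi>)))) \<in> borel_measurable \<Xi>"
      by (intro borel_measurable_times_ennreal borel_measurable_const Gm RS)
    show "(\<lambda>\<xi>. indicator T (S \<xi>) * (\<integral>\<^sup>+x. R x \<partial>P (S \<xi>))) \<in> borel_measurable \<Xi>"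
      by (intro borel_measurable_times_ennreal RS measurable_compose[OF prior_map_measurable borel_measurable_indicator[OF T_meas]])
    show "(\<integral>\<^sup>+\<xi>. c * ((\<Prod>j\<in>{1..N}. G j (\<xi> j)) * (\<integral>\<^sup>+x. R x \<partial>P (S \<xi>))) \<partial>\<Xi>) + (\<integral>\<^sup>+\<xi>. indicator T (S \<xi>) * (\<integral>\<^sup>+x. R x \<partial>P (S \<xi>)) \<partial>\<Xi>)
      = c * (\<integral>\<^sup>+\<xi>. (\<Prod>j\<in>{1..N}. G j (\<xi> j)) * (\<integral>\<^sup>+x. R x \<partial>P (S \<xi>)) \<partial>\<Xi>)
      + (\<integral>\<^sup>+\<xi>. indicator T (S \<xi>) * (\<integral>\<^sup>+x. R x \<partial>P (S \<xi>)) \<partial>\<Xi>)"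
      by (subst nn_integral_cmult) (intro borel_measurable_times_ennreal Gm RS, rule refl)
  qed
  also have "(\<integral>\<^sup>+\<xi>. (\<Prod>j\<in>{1..N}. G j (\<xi> j)) * (\<integral>\<^sup>+x. R x \<partial>P (S \<xi>)) \<partial>\<Xi>) \<le> ennreal (exp Bd)"
  proof -
    have "(\<integral>\<^sup>+\<xi>. (\<Prod>j\<in>{1..N}. G j (\<xi> j)) * (\<integral>\<^sup>+x. R x \<partial>P (S \<xi>)) \<partial>\<Xi>)
        = (\<integral>\<^sup>+\<xi>. \<integral>\<^sup>+x. (\<Prod>j\<in>{1..N}. G j (\<xi> j)) * R x \<partial>P (S \<xi>) \<partial>\<Xi>)"
      by (intro nn_integral_cong, subst nn_integral_cmult) simp_all
    also have "\<dots> = (\<integral>\<^sup>+\<xi>. \<integral>\<^sup>+x. (\<Prod>j\<in>{1..N}. post_int p (noise_sd j) (G j) (obs \<kappa> j x)) \<partial>P (v \<xi>) \<partial>\<Xi>)"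
      using mixture_identity[OF \<kappa> adm, where N=N and h="\<lambda>_. 1" and G=G] by (simp only: R_def v_def mult_1 mult_1_right G_meas borel_measurable_const)
    also have "\<dots> = (\<integral>\<^sup>+\<xi>. (\<Prod>j\<in>{1..N}. \<integral>\<^sup>+e. post_int p (noise_sd j) (G j) (signal j + e) \<partial>std_normal_distribution) \<partial>\<Xi>)"
      unfolding v_def
      by (intro nn_integral_cong law_obs_prod[OF \<kappa> adm] inner_rest post_int_measurable[OF p G_meas])
    also have "\<dots> = (\<Prod>j\<in>{1..N}. \<integral>\<^sup>+e. post_int p (noise_sd j) (G j) (signal j + e) \<partial>std_normal_distribution)"
      using Xi.emeasure_space_1 by simp
    also have "\<dots> \<le> (\<Prod>j\<in>{1..N}. ennreal (exp (b j)))"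
      unfolding G_def by (intro prod_mono_ennreal b)
    also have "\<dots> = ennreal (exp (\<Sum>j\<in>{1..N}. b j))" by (simp add: prod_ennreal exp_sum)
    also have "\<dots> \<le> ennreal (exp Bd)" using Bd by (intro ennreal_leI) simp
    finally show ?thesis .
  qed
  \<comment> \<open>The event T sees only the remainder of the draw, so the weight
    \<open>ratio\<close> integrates to one and leaves the prior probability of T.\<close>
  also have "(\<integral>\<^sup>+\<xi>. indicator T (S \<xi>) * (\<integral>\<^sup>+x. R x \<partial>P (S \<xi>)) \<partial>\<Xi>) = (\<integral>\<^sup>+\<xi>. indicator T (S \<xi>) \<partial>\<Xi>)"
  proof -
    have iT: "indicator T (S \<xi>) = (indicator {w. \<rho>\<^sup>2 / 2 < (norm (w - rest N w0))\<^sup>2} (rest N (S \<xi>)) :: ennreal)" for \<xi>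
      by (simp add: T_def indicator_def rest_diff)
    have hm: "(\<lambda>(w, x). indicator {w. \<rho>\<^sup>2 / 2 < (norm (w - rest N w0))\<^sup>2} w :: ennreal) \<in> borel_measurable (borel \<Otimes>\<^sub>M C01)"
      by measurable
    have "(\<integral>\<^sup>+\<xi>. indicator T (S \<xi>) * (\<integral>\<^sup>+x. R x \<partial>P (S \<xi>)) \<partial>\<Xi>)
        = (\<integral>\<^sup>+\<xi>. \<integral>\<^sup>+x. indicator T (S \<xi>) * R x \<partial>P (S \<xi>) \<partial>\<Xi>)"
      by (intro nn_integral_cong, subst nn_integral_cmult) simp_all
    also have "\<dots> = (\<integral>\<^sup>+\<xi>. \<integral>\<^sup>+x. indicator T (S \<xi>) \<partial>P (v \<xi>) \<partial>\<Xi>)"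
      using mixture_identity[OF \<kappa> adm hm, where G="\<lambda>_ _. 1"]
      by (simp add: iT R_def v_def post_int_const[OF p])
    also have "\<dots> = (\<integral>\<^sup>+\<xi>. indicator T (S \<xi>) \<partial>\<Xi>)"
      using prob_space.emeasure_space_1[OF prob_space_law[OF n]] by (intro nn_integral_cong) simp
    finally show ?thesis .
  qed
  finally have 3: "(\<integral>\<^sup>+\<xi>. indicator A (S \<xi>) * (\<integral>\<^sup>+x. R x \<partial>P (S \<xi>)) \<partial>\<Xi>) \<le> c * ennreal (exp Bd) + (\<integral>\<^sup>+\<xi>. indicator T (S \<xi>) \<partial>\<Xi>)"
    by (simp add: mult_left_mono add_right_mono)
  have cB: "c * ennreal (exp Bd) = ennreal (exp (Bd - real n * \<rho>\<^sup>2 / 162))"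
    by (simp add: c_def ennreal_mult[symmetric] exp_add[symmetric])
  have "(\<integral>\<^sup>+x. emeasure (K x) A \<partial>P w0) \<le> (ennreal (exp (Bd - real n * \<rho>\<^sup>2 / 162)) + (\<integral>\<^sup>+\<xi>. indicator T (S \<xi>) \<partial>\<Xi>)) + (\<integral>\<^sup>+\<xi>. tv \<xi> \<partial>\<Xi>)"
    using 1 3 unfolding 2 cB by (meson add_right_mono order_trans)
  also have "\<dots> = ennreal (exp (Bd - real n * \<rho>\<^sup>2 / 162)) + (\<integral>\<^sup>+\<xi>. indicator T (S \<xi>) + tv \<xi> \<partial>\<Xi>)"
  proof -
    have "(\<integral>\<^sup>+\<xi>. indicator T (S \<xi>) + tv \<xi> \<partial>\<Xi>) = (\<integral>\<^sup>+\<xi>. indicator T (S \<xi>) \<partial>\<Xi>) + (\<integral>\<^sup>+\<xi>. tv \<xi> \<partial>\<Xi>)"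
      by (rule nn_integral_add[OF measurable_compose[OF prior_map_measurable borel_measurable_indicator[OF T_meas]] tv_meas])
    then show ?thesis by (simp add: add.assoc)
  qed
  finally show ?thesis unfolding A_def T_def tv_def .
qed

text \<open>The left side does not depend on N. The correction terms of the finite bound tend to 0
  for each prior draw and are at most 2, so dominated convergence removes them.\<close>

lemma posterior_tail_bound:
  assumes post: "is_posterior (p_exponential_prior \<psi> p \<alpha> lam) C01 P K"
    and \<rho>: "0 < \<rho>"
    and b: "\<And>j. 1 \<le> j \<Longrightarrow> (\<integral>\<^sup>+e. post_int p (noise_sd j) (\<lambda>x. ennreal (exp ((noise_sd j * x - signal j)\<^sup>2 / 81)))
      (signal j + e) \<partial>std_normal_distribution) \<le> ennreal (exp (b j))"
    and Bd: "\<And>N. (\<Sum>j\<in>{1..N}. b j) \<le> Bd"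
  shows "(\<integral>\<^sup>+x. emeasure (K x) {w. \<rho> < norm (w - w0)} \<partial>P w0) \<le> ennreal (exp (Bd - real n * \<rho>\<^sup>2 / 162))"
proof -
  interpret Xi: prob_space \<Xi> by (rule prob_Xi)
  define t where "t N \<xi> = (indicator {w. \<rho>\<^sup>2 / 2 < (norm (rest N (w - w0)))\<^sup>2} (S \<xi>)
          + ennreal (min 1 (sqrt (exp (real n * (norm (rest N (S \<xi> - w0)))\<^sup>2) - 1))))" for N \<xi>
  have t_meas[measurable]: "t N \<in> borel_measurable \<Xi>" for N
    unfolding t_def[abs_def] by measurable
  have lim: "(\<lambda>N. t N \<xi>) \<longlonglongrightarrow> 0" for \<xi>
  proof -
    have "(\<lambda>N. (norm (rest N (S \<xi> - w0)))\<^sup>2) \<longlonglongrightarrow> (norm (0::L2))\<^sup>2"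
      by (intro tendsto_intros rest_tendsto)
    then have n0: "(\<lambda>N. (norm (rest N (S \<xi> - w0)))\<^sup>2) \<longlonglongrightarrow> 0" by simp
    have "\<forall>\<^sub>F N in sequentially. (norm (rest N (S \<xi> - w0)))\<^sup>2 < \<rho>\<^sup>2 / 2"
      by (rule order_tendstoD(2)[OF n0]) (use \<rho> in simp)
    then have "\<forall>\<^sub>F N in sequentially. (indicator {w. \<rho>\<^sup>2 / 2 < (norm (rest N (w - w0)))\<^sup>2} (S \<xi>) :: ennreal) = 0"
      by eventually_elim (simp add: indicator_def)
    then have 1: "(\<lambda>N. indicator {w. \<rho>\<^sup>2 / 2 < (norm (rest N (w - w0)))\<^sup>2} (S \<xi>) :: ennreal) \<longlonglongrightarrow> 0"
      by (rule tendsto_eventually)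
    have "(\<lambda>N. min 1 (sqrt (exp (real n * (norm (rest N (S \<xi> - w0)))\<^sup>2) - 1))) \<longlonglongrightarrow> min 1 (sqrt (exp (real n * 0) - 1))"
      by (intro tendsto_intros n0)
    then have 2: "(\<lambda>N. ennreal (min 1 (sqrt (exp (real n * (norm (rest N (S \<xi> - w0)))\<^sup>2) - 1)))) \<longlonglongrightarrow> ennreal 0"
      by (intro tendsto_ennrealI) simp
    show ?thesis using tendsto_add[OF 1 2] unfolding t_def by simp
  qed
  have "(\<lambda>N. \<integral>\<^sup>+\<xi>. t N \<xi> \<partial>\<Xi>) \<longlonglongrightarrow> (\<integral>\<^sup>+\<xi>. 0 \<partial>\<Xi>)"
  proof (rule nn_integral_dominated_convergence[where w="\<lambda>_. 2"])
    show "(\<integral>\<^sup>+\<xi>. 2 \<partial>\<Xi>) < \<infinity>" using Xi.emeasure_space_1 by simp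
    show "AE \<xi> in \<Xi>. t N \<xi> \<le> 2" for N
    proof (rule AE_I2)
      fix \<xi>
      have "ennreal (min 1 (sqrt (exp (real n * (norm (rest N (S \<xi> - w0)))\<^sup>2) - 1))) \<le> ennreal 1"
        by (intro ennreal_leI) simp
      moreover have "indicator {w. \<rho>\<^sup>2 / 2 < (norm (rest N (w - w0)))\<^sup>2} (S \<xi>) \<le> (1::ennreal)"
        by (simp add: indicator_def)
      ultimately have "t N \<xi> \<le> 1 + ennreal 1" unfolding t_def by (intro add_mono)
      then show "t N \<xi> \<le> 2" by simp
    qed
  qed (auto simp: lim simp del: One_nat_def intro: t_meas)
  then have "(\<lambda>N. ennreal (exp (Bd - real n * \<rho>\<^sup>2 / 162)) + (\<integral>\<^sup>+\<xi>. t N \<xi> \<partial>\<Xi>))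
      \<longlonglongrightarrow> ennreal (exp (Bd - real n * \<rho>\<^sup>2 / 162)) + 0"
    by (intro tendsto_add tendsto_const) simp
  moreover have "(\<integral>\<^sup>+x. emeasure (K x) {w. \<rho> < norm (w - w0)} \<partial>P w0)
      \<le> ennreal (exp (Bd - real n * \<rho>\<^sup>2 / 162)) + (\<integral>\<^sup>+\<xi>. t N \<xi> \<partial>\<Xi>)" for N
    unfolding t_def by (rule posterior_tail_bound_finite[OF post \<rho> b Bd]) simp
  ultimately have "(\<integral>\<^sup>+x. emeasure (K x) {w. \<rho> < norm (w - w0)} \<partial>P w0) \<le> ennreal (exp (Bd - real n * \<rho>\<^sup>2 / 162)) + 0"
    by (intro LIMSEQ_le_const) auto
  then show ?thesis by simp
qed

end

section \<open>Contraction rates\<close>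

text \<open>With y = 1/x this is the Bernoulli-type inequality (1 - y)^(-a) \<ge> 1 + a y, a
  consequence of ln (1 - y) \<le> -y. It is the telescoping step of the integral comparison.\<close>

lemma powr_minus_step:
  fixes a x :: real
  assumes a: "0 < a" and x: "1 < x"
  shows "a * x powr (- 1 - a) \<le> (x - 1) powr (- a) - x powr (- a)"
proof -
  define y where "y = 1 / x"
  have y: "0 < y" "y < 1" using x by (auto simp: y_def)
  have "x - 1 = x * (1 - y)" using x by (simp add: y_def field_simps)
  then have 1: "(x - 1) powr (- a) = x powr (- a) * (1 - y) powr (- a)"
    using x y by (simp add: powr_mult)
  have "ln (1 - y) \<le> - y" using ln_le_minus_one[of "1 - y"] y by simp
  then have "a * y \<le> - a * ln (1 - y)" using a mult_left_mono[of "ln (1 - y)" "- y" a] by simp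
  then have "1 + a * y \<le> (1 - y) powr (- a)"
    using y exp_ge_add_one_self[of "- a * ln (1 - y)"] by (simp add: powr_def)
  then have "x powr (- a) * (1 + a * y) \<le> (x - 1) powr (- a)"
    unfolding 1 by (intro mult_left_mono) auto
  moreover have "x powr (- a) * y = x powr (- 1 - a)"
  proof -
    have "x powr (- 1) = y" using x by (simp add: powr_minus_divide y_def)
    then have "x powr (- a) * y = x powr (- a + - 1)" unfolding powr_add by simp
    also have "- a + - 1 = - 1 - a" by simp
    finally show ?thesis .
  qed
  ultimately show ?thesis by (simp add: algebra_simps)
qed

text \<open>Comparison with the integral beyond the integer part m of L. It bounds the total squared
  prior scale, in noise units, of the coordinates beyond the effective dimension.\<close>

lemma sum_powr_tail:
  fixes a L :: real
  assumes a: "0 < a" and L: "1 \<le> L" and F: "finite F" "\<And>j. j \<in> F \<Longrightarrow> L < real j"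
  shows "(\<Sum>j\<in>F. (L / real j) powr (1 + a)) \<le> 2 powr a / a * L"
proof -
  define m where "m = nat \<lfloor>L\<rfloor>"
  have m: "1 \<le> m" "real m \<le> L" "L < real m + 1" using L by (auto simp: m_def) linarith+
  obtain N where N: "F \<subseteq> {..N}" using F(1) finite_nat_iff_bounded_le by blast
  have FN: "F \<subseteq> {Suc m..max m N}"
  proof
    fix j assume j: "j \<in> F"
    have "m < j" using F(2)[OF j] m(2) by simp
    then show "j \<in> {Suc m..max m N}" using j N by auto
  qed
  have tele: "(\<Sum>j\<in>{Suc m..K}. real j powr (- 1 - a)) \<le> (real m powr (- a) - real K powr (- a)) / a" if "m \<le> K" for K
    using that
  proof (induction K rule: dec_induct)
    case (step K)
    have "a * real (Suc K) powr (- 1 - a) \<le> real K powr (- a) - real (Suc K) powr (- a)"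
      using powr_minus_step[OF a, of "real (Suc K)"] step.hyps m by simp
    then have "real (Suc K) powr (- 1 - a) \<le> (real K powr (- a) - real (Suc K) powr (- a)) / a"
      using a by (simp add: field_simps)
    moreover have "(\<Sum>j\<in>{Suc m..Suc K}. real j powr (- 1 - a))
        = (\<Sum>j\<in>{Suc m..K}. real j powr (- 1 - a)) + real (Suc K) powr (- 1 - a)"
      using step.hyps by simp
    ultimately show ?case using step.IH by (simp add: diff_divide_distrib)
  qed simp
  have "(\<Sum>j\<in>F. (L / real j) powr (1 + a)) \<le> (\<Sum>j\<in>{Suc m..max m N}. (L / real j) powr (1 + a))"
    using FN by (intro sum_mono2) auto
  also have "\<dots> = L powr (1 + a) * (\<Sum>j\<in>{Suc m..max m N}. real j powr (- 1 - a))"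
    unfolding sum_distrib_left
  proof (intro sum.cong refl)
    fix j assume "j \<in> {Suc m..max m N}"
    have "(L / real j) powr (1 + a) = L powr (1 + a) / real j powr (1 + a)" using L by (simp add: powr_divide)
    also have "\<dots> = L powr (1 + a) * real j powr (- (1 + a))" by (simp only: powr_minus divide_inverse)
    finally show "(L / real j) powr (1 + a) = L powr (1 + a) * real j powr (- 1 - a)" by simp
  qed
  also have "\<dots> \<le> L powr (1 + a) * (real m powr (- a) / a)"
  proof (intro mult_left_mono)
    have "(real m powr (- a) - real (max m N) powr (- a)) / a \<le> real m powr (- a) / a"
      using a by (intro divide_right_mono) auto
    then show "(\<Sum>j\<in>{Suc m..max m N}. real j powr (- 1 - a)) \<le> real m powr (- a) / a"
      using tele[of "max m N"] by simp
  qed simp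
  \<comment> \<open>Since L \<ge> 1, its integer part is at least L/2; rounding costs the factor
    2^a.\<close>
  also have "\<dots> \<le> L powr (1 + a) * ((L / 2) powr (- a) / a)"
  proof (intro mult_left_mono divide_right_mono)
    have "L / 2 \<le> real m" using m by linarith
    then show "real m powr (- a) \<le> (L / 2) powr (- a)" using a L by (intro powr_mono2') auto
  qed (use a in auto)
  also have "\<dots> = 2 powr a / a * L"
  proof -
    have "(L / 2) powr (- a) = L powr (- a) * 2 powr a"
      using L by (simp add: powr_divide powr_minus field_simps)
    moreover have "L powr (1 + a) * L powr (- a) = L" using L by (simp add: powr_add[symmetric])
    ultimately show ?thesis by simp
  qed
  finally show ?thesis .
qed

definition tail_const :: "real \<Rightarrow> real" where "tail_const \<alpha> = 2 powr (2 * \<alpha>) / (2 * \<alpha>)"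

lemma (in white_noise_posterior) signal_sq: "(signal j)\<^sup>2 = real n * (inner w0 (\<psi> j))\<^sup>2"
  by (simp add: signal_def power_mult_distrib)

lemma (in white_noise_posterior) noise_sd_sq:
  assumes L: "1 \<le> L" and nl: "real n * lam\<^sup>2 = L powr (1 + 2 * \<alpha>)" and j: "1 \<le> j"
  shows "(noise_sd j)\<^sup>2 = (L / real j) powr (1 + 2 * \<alpha>)"
proof -
  have "(noise_sd j)\<^sup>2 = (real n * lam\<^sup>2) * (real j powr (- 1/2 - \<alpha>))\<^sup>2"
    by (simp add: noise_sd_def prior_sd_def power_mult_distrib)
  also have "(real j powr (- 1/2 - \<alpha>))\<^sup>2 = real j powr (- (1 + 2 * \<alpha>))"
    by (simp add: power2_eq_square powr_add[symmetric])
  also have "(real n * lam\<^sup>2) * real j powr (- (1 + 2 * \<alpha>)) = (L / real j) powr (1 + 2 * \<alpha>)"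
  proof -
    have "(L / real j) powr (1 + 2 * \<alpha>) = L powr (1 + 2 * \<alpha>) / real j powr (1 + 2 * \<alpha>)"
      using L by (simp add: powr_divide)
    then show ?thesis unfolding nl powr_minus divide_inverse by simp
  qed
  finally show ?thesis .
qed

text \<open>Each coordinate is charged by one of the two scalar risk bounds. The set G holds the
  coordinates where a signal above the prior scale is paid for through |w0_j / \<tau>_j|^p; outside
  G the signal is below the noise level and is paid for through its energy.\<close>

lemma (in white_noise_posterior) posterior_tail_bound_explicit:
  assumes post: "is_posterior (p_exponential_prior \<psi> p \<alpha> lam) C01 P K" and \<rho>: "0 < \<rho>"
    and L: "1 \<le> L" and nl: "real n * lam\<^sup>2 = L powr (1 + 2 * \<alpha>)"
    and G1: "\<And>F. finite F \<Longrightarrow> F \<subseteq> {1..} \<inter> G \<Longrightarrow> (\<Sum>j\<in>F. \<bar>inner w0 (\<psi> j) / prior_sd \<alpha> lam j\<bar> powr p) \<le> C * L"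
    and G2: "\<And>F. finite F \<Longrightarrow> F \<subseteq> {1..} - G \<Longrightarrow> (\<Sum>j\<in>F. real n * (inner w0 (\<psi> j))\<^sup>2) \<le> C * L"
    and G3: "\<And>j. 1 \<le> j \<Longrightarrow> j \<notin> G \<Longrightarrow> real n * (inner w0 (\<psi> j))\<^sup>2 \<le> 1"
  shows "(\<integral>\<^sup>+x. emeasure (K x) {w. \<rho> < norm (w - w0)} \<partial>P w0)
    \<le> ennreal (exp ((2 + 144 * tail_const \<alpha> + 146 * C) * L - real n * \<rho>\<^sup>2 / 162))"
proof (rule posterior_tail_bound[OF post \<rho>])
  define \<phi> where "\<phi> j = \<bar>inner w0 (\<psi> j) / prior_sd \<alpha> lam j\<bar> powr p" for j
  \<comment> \<open>Signal below the prior scale: the prior cost is at most 1, so 2 suffices up to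
    L; beyond L the noise dominates both terms of the small-signal bound, hence 144 = 2 * 72. Signal
    above the prior scale: in G the cost is at least 1 and absorbs the summand 1; outside G the
    signal dominates the prior scale, again with 144.\<close>
  define b where "b j = (if \<bar>inner w0 (\<psi> j)\<bar> \<le> \<tau> j
     then (if real j \<le> L then 2 else 144 * (noise_sd j)\<^sup>2)
     else (if j \<in> G then 2 * \<phi> j else 144 * (signal j)\<^sup>2))" for j
  note sig = signal_sq and sd = noise_sd_sq[OF L nl]
  have nsd: "0 < noise_sd j" if "1 \<le> j" for j
    using sd_pos[OF that] n by (simp add: noise_sd_def)
  have ratio: "signal j / noise_sd j = inner w0 (\<psi> j) / \<tau> j" for j
    using n by (simp add: signal_def noise_sd_def)
  fix j :: nat assume j: "1 \<le> j"
  let ?I = "\<integral>\<^sup>+e. post_int p (noise_sd j) (\<lambda>x. ennreal (exp ((noise_sd j * x - signal j)\<^sup>2 / 81)))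
      (signal j + e) \<partial>std_normal_distribution"
  have bA: "?I \<le> ennreal (exp (1 + \<phi> j))"
    using post_risk_exp_bound[OF p nsd[OF j], of "signal j"] by (simp only: ratio \<phi>_def)
  have bB: "?I \<le> ennreal (exp (72 * ((noise_sd j)\<^sup>2 + (signal j)\<^sup>2)))" if "(signal j)\<^sup>2 \<le> 1"
    by (rule post_risk_exp_bound_small[OF p]) (use that in \<open>simp add: abs_square_le_1\<close>)
  have bex: "?I \<le> ennreal (exp t) \<Longrightarrow> t \<le> s \<Longrightarrow> ?I \<le> ennreal (exp s)" for s t
    by (rule order_trans) (auto intro: ennreal_leI)
  show "?I \<le> ennreal (exp (b j))"
  proof (cases "\<bar>inner w0 (\<psi> j)\<bar> \<le> \<tau> j")
    case True
    have sq: "(signal j)\<^sup>2 \<le> (noise_sd j)\<^sup>2"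
    proof -
      have "(inner w0 (\<psi> j))\<^sup>2 \<le> (\<tau> j)\<^sup>2" using True sd_pos[OF j] by (simp add: abs_le_square_iff[symmetric])
      then show ?thesis by (simp add: sig noise_sd_def power_mult_distrib mult_left_mono)
    qed
    show ?thesis
    proof (cases "real j \<le> L")
      case jL: True
      have "\<bar>inner w0 (\<psi> j) / \<tau> j\<bar> \<le> 1" using True sd_pos[OF j] by (simp add: abs_divide divide_le_eq)
      then have "\<phi> j \<le> 1" using p by (simp add: \<phi>_def powr_le1)
      then show ?thesis using True jL by (intro bex[OF bA]) (simp add: b_def)
    next
      case False
      have "(noise_sd j)\<^sup>2 \<le> 1" unfolding sd[OF j] using False \<alpha> L by (intro powr_le1) auto
      then show ?thesis using True False sq by (intro bex[OF bB]) (auto simp: b_def)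
    qed
  next
    case False
    then have gt: "\<tau> j < \<bar>inner w0 (\<psi> j)\<bar>" by simp
    show ?thesis
    proof (cases "j \<in> G")
      case True
      have "1 \<le> \<bar>inner w0 (\<psi> j) / \<tau> j\<bar>" using gt sd_pos[OF j] by (simp add: abs_divide le_divide_eq)
      then have "1 \<le> \<phi> j" using p by (simp add: \<phi>_def ge_one_powr_ge_zero)
      then show ?thesis using True False by (intro bex[OF bA]) (simp add: b_def)
    next
      case nG: False
      have "(signal j)\<^sup>2 \<le> 1" unfolding sig by (rule G3[OF j nG])
      moreover have "(noise_sd j)\<^sup>2 \<le> (signal j)\<^sup>2"
      proof -
        have "(\<tau> j)\<^sup>2 \<le> (inner w0 (\<psi> j))\<^sup>2" using gt sd_pos[OF j] by (simp add: abs_le_square_iff[symmetric])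
        then show ?thesis by (simp add: sig noise_sd_def power_mult_distrib mult_left_mono)
      qed
      ultimately show ?thesis using False nG by (intro bex[OF bB]) (auto simp: b_def)
    qed
  qed
next
  define \<phi> where "\<phi> j = \<bar>inner w0 (\<psi> j) / prior_sd \<alpha> lam j\<bar> powr p" for j
  fix N :: nat
  note sig = signal_sq and sd = noise_sd_sq[OF L nl]
  let ?b = "\<lambda>j. if \<bar>inner w0 (\<psi> j)\<bar> \<le> \<tau> j
     then (if real j \<le> L then 2 else 144 * (noise_sd j)\<^sup>2)
     else (if j \<in> G then 2 * \<phi> j else 144 * (signal j)\<^sup>2)"
  let ?J = "{1..N}"
  have \<phi>0: "0 \<le> \<phi> j" for j by (simp add: \<phi>_def)
  \<comment> \<open>The nested cases are relaxed to a sum of four independent ones, each summed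
    separately; about L coordinates lie below L.\<close>
  have "(\<Sum>j\<in>?J. ?b j) \<le> (\<Sum>j\<in>?J. (if real j \<le> L then 2 else 0) + (if L < real j then 144 * (noise_sd j)\<^sup>2 else 0)
      + (if j \<in> G then 2 * \<phi> j else 0) + (if j \<notin> G then 144 * (signal j)\<^sup>2 else 0))"
    using \<phi>0 by (intro sum_mono) auto
  also have "\<dots> = 2 * (\<Sum>j\<in>{j\<in>?J. real j \<le> L}. 1) + 144 * (\<Sum>j\<in>{j\<in>?J. L < real j}. (noise_sd j)\<^sup>2)
      + 2 * (\<Sum>j\<in>{j\<in>?J. j \<in> G}. \<phi> j) + 144 * (\<Sum>j\<in>{j\<in>?J. j \<notin> G}. (signal j)\<^sup>2)"
    unfolding sum.distrib sum_distrib_left by (simp only: sum.inter_filter[OF finite_atLeastAtMost] mult_1_right)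
  also have "\<dots> \<le> 2 * L + 144 * (tail_const \<alpha> * L) + 2 * (C * L) + 144 * (C * L)"
  proof (intro add_mono mult_left_mono)
    have "{j\<in>?J. real j \<le> L} \<subseteq> {1..nat \<lfloor>L\<rfloor>}" by (auto simp: le_nat_floor)
    then have "card {j\<in>?J. real j \<le> L} \<le> card {1..nat \<lfloor>L\<rfloor>}" by (intro card_mono) auto
    also have "\<dots> = nat \<lfloor>L\<rfloor>" by simp
    finally have "real (card {j\<in>?J. real j \<le> L}) \<le> real (nat \<lfloor>L\<rfloor>)" by simp
    also have "\<dots> \<le> L" using L by simp
    finally show "(\<Sum>j\<in>{j\<in>?J. real j \<le> L}. 1) \<le> L" by simp
    have "(\<Sum>j\<in>{j\<in>?J. L < real j}. (noise_sd j)\<^sup>2) = (\<Sum>j\<in>{j\<in>?J. L < real j}. (L / real j) powr (1 + 2 * \<alpha>))"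
      by (intro sum.cong refl) (auto simp: sd)
    also have "\<dots> \<le> tail_const \<alpha> * L"
      unfolding tail_const_def using \<alpha> L by (intro sum_powr_tail) auto
    finally show "(\<Sum>j\<in>{j\<in>?J. L < real j}. (noise_sd j)\<^sup>2) \<le> tail_const \<alpha> * L" .
    show "(\<Sum>j\<in>{j\<in>?J. j \<in> G}. \<phi> j) \<le> C * L" unfolding \<phi>_def by (rule G1) auto
    show "(\<Sum>j\<in>{j\<in>?J. j \<notin> G}. (signal j)\<^sup>2) \<le> C * L" unfolding sig by (rule G2) auto
  qed auto
  also have "\<dots> = (2 + 144 * tail_const \<alpha> + 146 * C) * L" by (simp add: algebra_simps)
  finally show "(\<Sum>j\<in>?J. ?b j) \<le> (2 + 144 * tail_const \<alpha> + 146 * C) * L" .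
qed

lemma emeasure_ge_le_nn_integral:
  assumes f: "f \<in> borel_measurable M" and e: "0 < e"
  shows "emeasure M {x \<in> space M. ennreal e \<le> f x} \<le> ennreal (1 / e) * (\<integral>\<^sup>+x. f x \<partial>M)"
proof -
  have c: "ennreal (1 / e) * ennreal e = 1" using e by (simp add: ennreal_mult[symmetric])
  have "ennreal e \<le> t \<Longrightarrow> 1 \<le> ennreal (1 / e) * t" for t
    using mult_left_mono[of "ennreal e" t "ennreal (1 / e)"] c by simp
  then have "{x \<in> space M. ennreal e \<le> f x} \<subseteq> {x \<in> space M. 1 \<le> ennreal (1 / e) * f x}" by auto
  moreover have "{x \<in> space M. 1 \<le> ennreal (1 / e) * f x} \<in> sets M" using f by measurable
  ultimately have "emeasure M {x \<in> space M. ennreal e \<le> f x} \<le> emeasure M {x \<in> space M. 1 \<le> ennreal (1 / e) * f x}"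
    by (rule emeasure_mono)
  also have "\<dots> \<le> ennreal (1 / e) * (\<integral>\<^sup>+x. f x * indicator (space M) x \<partial>M)"
    using nn_integral_Markov_inequality[where u=f and M=M and A="space M" and c="ennreal (1 / e)"] f
    by simp
  also have "(\<integral>\<^sup>+x. f x * indicator (space M) x \<partial>M) = (\<integral>\<^sup>+x. f x \<partial>M)"
    by (intro nn_integral_cong) simp
  finally show ?thesis .
qed

text \<open>In all three regimes \<open>L = n r^2\<close> is the effective dimension: \<open>n \<lambda>^2 = L^(1 + 2 \<alpha>)\<close>, so the prior
  scale of coordinate \<open>j\<close> falls below the noise level exactly when \<open>j > L\<close>.\<close>

lemma posterior_contraction:
  fixes M :: "'o measure" and B :: "real \<Rightarrow> 'o \<Rightarrow> real" and \<psi> :: "nat \<Rightarrow> L2" and w0 :: L2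
    and p \<alpha> C \<gamma> :: real and lam r :: "nat \<Rightarrow> real" and G :: "nat \<Rightarrow> nat set"
  assumes B: "brownian_motion M B" and \<psi>: "orthonormal_basis \<psi>" and p: "1 \<le> p" "p \<le> 2" and \<alpha>: "0 < \<alpha>"
    and post: "\<And>n. n \<ge> 1 \<Longrightarrow>
      is_posterior (p_exponential_prior \<psi> p \<alpha> (lam n)) C01 (white_noise_law M B n) (post n)"
    and \<gamma>: "0 < \<gamma>"
    and ev: "\<And>n. n \<ge> n0 \<Longrightarrow> 0 < lam n \<and> 0 < r n \<and> real n powr \<gamma> \<le> real n * (r n)\<^sup>2
      \<and> real n * (lam n)\<^sup>2 = (real n * (r n)\<^sup>2) powr (1 + 2 * \<alpha>)"
    and G1: "\<And>n F. n \<ge> n0 \<Longrightarrow> finite F \<Longrightarrow> F \<subseteq> {1..} \<inter> G n \<Longrightarrow>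
      (\<Sum>j\<in>F. \<bar>inner w0 (\<psi> j) / prior_sd \<alpha> (lam n) j\<bar> powr p) \<le> C * (real n * (r n)\<^sup>2)"
    and G2: "\<And>n F. n \<ge> n0 \<Longrightarrow> finite F \<Longrightarrow> F \<subseteq> {1..} - G n \<Longrightarrow>
      (\<Sum>j\<in>F. real n * (inner w0 (\<psi> j))\<^sup>2) \<le> C * (real n * (r n)\<^sup>2)"
    and G3: "\<And>n j. n \<ge> n0 \<Longrightarrow> 1 \<le> j \<Longrightarrow> j \<notin> G n \<Longrightarrow> real n * (inner w0 (\<psi> j))\<^sup>2 \<le> 1"
  shows "\<exists>K0. \<forall>K\<ge>K0. tendsto_in_probability (\<lambda>n. white_noise_law M B n w0)
           (\<lambda>n x. measure (post n x) {w. norm (w - w0) \<le> K * r n}) 1"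
proof -
  define D where "D = 2 + 144 * tail_const \<alpha> + 146 * C"
  \<comment> \<open>13^2 = 169 exceeds 162. Hence K \<ge> 13 (|D| + 1) leaves one L to spare: the
    exponent D L - n \<rho>^2 / 162 is at most -L.\<close>
  have D: "D + 1 \<le> K\<^sup>2 / 162" if K: "13 * (\<bar>D\<bar> + 1) \<le> K" for K
  proof -
    have "(13 * (\<bar>D\<bar> + 1))\<^sup>2 \<le> K\<^sup>2" using K by (intro power_mono) auto
    moreover have "(13 * (\<bar>D\<bar> + 1))\<^sup>2 = 169 * (\<bar>D\<bar> + 1)\<^sup>2" by (simp only: power_mult_distrib) simp
    moreover have "(\<bar>D\<bar> + 1) * 1 \<le> (\<bar>D\<bar> + 1) * (\<bar>D\<bar> + 1)" by (rule mult_left_mono) auto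
    ultimately show ?thesis by (simp add: power2_eq_square)
  qed
  show ?thesis
  proof (intro exI[of _ "13 * (\<bar>D\<bar> + 1)"] allI impI)
    fix K :: real assume K: "13 * (\<bar>D\<bar> + 1) \<le> K"
    have "0 < 13 * (\<bar>D\<bar> + 1)" by (simp add: add_nonneg_pos)
    then have K0: "0 < K" using K by (rule less_le_trans)
    show "tendsto_in_probability (\<lambda>n. white_noise_law M B n w0)
           (\<lambda>n x. measure (post n x) {w. norm (w - w0) \<le> K * r n}) 1"
      unfolding tendsto_in_probability_def
    proof (intro allI impI)
      fix e :: real assume e: "0 < e"
      let ?P = "\<lambda>n. white_noise_law M B n w0"
      let ?E = "\<lambda>n. {x \<in> space (?P n). \<bar>measure (post n x) {w. norm (w - w0) \<le> K * r n} - 1\<bar> > e}"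
      have bound: "measure (?P n) (?E n) \<le> exp (- (real n powr \<gamma>)) / e" if n: "n \<ge> max n0 1" for n
      proof -
        interpret W: white_noise_posterior M B \<psi> p \<alpha> "lam n" n w0
          using ev[of n] n by (intro white_noise_posterior.intro B p_exponential_series.intro
            white_noise_posterior_axioms.intro \<psi> p \<alpha>) auto
        define L where "L = real n * (r n)\<^sup>2"
        have n1: "1 \<le> n" "n0 \<le> n" using n by auto
        have Lg: "real n powr \<gamma> \<le> L" using ev[OF n1(2)] by (simp add: L_def)
        moreover have "1 \<le> real n powr \<gamma>" using n1 \<gamma> by (intro ge_one_powr_ge_zero) auto
        ultimately have L: "1 \<le> L" by simp
        define \<rho> where "\<rho> = K * r n"
        have \<rho>: "0 < \<rho>" using K0 ev[OF n1(2)] by (simp add: \<rho>_def)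
        have "(\<integral>\<^sup>+x. emeasure (post n x) {w. \<rho> < norm (w - w0)} \<partial>?P n) \<le> ennreal (exp (D * L - real n * \<rho>\<^sup>2 / 162))"
          unfolding D_def
          by (rule W.posterior_tail_bound_explicit[OF post[OF n1(1)] \<rho> L, where G="G n"])
            (use ev[OF n1(2)] G1[OF n1(2)] G2[OF n1(2)] G3[OF n1(2)] in \<open>auto simp: L_def\<close>)
        also have "\<dots> \<le> ennreal (exp (- (real n powr \<gamma>)))"
        proof (intro ennreal_leI)
          have "real n * \<rho>\<^sup>2 / 162 = K\<^sup>2 / 162 * L" by (simp add: \<rho>_def L_def power_mult_distrib)
          moreover have "(D + 1) * L \<le> K\<^sup>2 / 162 * L" using D[OF K] L by (intro mult_right_mono) auto
          ultimately have "D * L - real n * \<rho>\<^sup>2 / 162 \<le> - L" by (simp add: algebra_simps)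
          then show "exp (D * L - real n * \<rho>\<^sup>2 / 162) \<le> exp (- (real n powr \<gamma>))" using Lg by simp
        qed
        finally have I: "(\<integral>\<^sup>+x. emeasure (post n x) {w. \<rho> < norm (w - w0)} \<partial>?P n) \<le> ennreal (exp (- (real n powr \<gamma>)))" .
        let ?prior = "p_exponential_prior \<psi> p \<alpha> (lam n)"
        have sp: "sets ?prior = sets borel" by (simp add: W.prior_eq)
        have Kn: "post n \<in> measurable C01 (prob_algebra ?prior)"
          using post[OF n1(1)] by (simp add: is_posterior_def)
        have meas: "(\<lambda>x. emeasure (post n x) {w. \<rho> < norm (w - w0)}) \<in> borel_measurable (?P n)"
        proof -
          have "{w. \<rho> < norm (w - w0)} \<in> sets borel" by measurable
          then have "(\<lambda>x. emeasure (post n x) {w. \<rho> < norm (w - w0)}) \<in> borel_measurable C01"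
            by (intro measurable_emeasure_kernel[OF measurable_prob_algebraD[OF Kn]]) (simp add: sp)
          then show ?thesis using W.sets_law[OF n1(1)] by (simp cong: measurable_cong_sets)
        qed
        have sub: "?E n \<subseteq> {x \<in> space (?P n). ennreal e \<le> emeasure (post n x) {w. \<rho> < norm (w - w0)}}"
        proof
          fix x assume x: "x \<in> ?E n"
          then have xs: "x \<in> space C01" using W.space_law[OF n1(1)] by simp
          have "post n x \<in> space (prob_algebra ?prior)" by (rule measurable_space[OF Kn xs])
          then have pp: "prob_space (post n x)" and ss: "sets (post n x) = sets borel"
            using sp by (auto simp: space_prob_algebra)
          interpret Q: prob_space "post n x" by (rule pp)
          have spc: "space (post n x) = UNIV" using sets_eq_imp_space_eq[OF ss] by simp
          have "{w. norm (w - w0) \<le> \<rho>} \<in> sets (post n x)" unfolding ss by measurable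
          then have "Q.prob (space (post n x) - {w. norm (w - w0) \<le> \<rho>}) = 1 - Q.prob {w. norm (w - w0) \<le> \<rho>}"
            by (rule Q.prob_compl)
          moreover have "space (post n x) - {w. norm (w - w0) \<le> \<rho>} = {w. \<rho> < norm (w - w0)}"
            using spc by auto
          ultimately have "Q.prob {w. \<rho> < norm (w - w0)} = 1 - Q.prob {w. norm (w - w0) \<le> \<rho>}"
            by simp
          moreover have "e < \<bar>Q.prob {w. norm (w - w0) \<le> \<rho>} - 1\<bar>" using x by (simp add: \<rho>_def)
          moreover have "Q.prob {w. norm (w - w0) \<le> \<rho>} \<le> 1" by simp
          ultimately have "e \<le> Q.prob {w. \<rho> < norm (w - w0)}" by linarith
          then show "x \<in> {x \<in> space (?P n). ennreal e \<le> emeasure (post n x) {w. \<rho> < norm (w - w0)}}"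
            using x by (simp add: Q.emeasure_eq_measure ennreal_leI)
        qed
        interpret Pn: prob_space "?P n" by (rule W.prob_space_law[OF n1(1)])
        let ?f = "\<lambda>x. emeasure (post n x) {w. \<rho> < norm (w - w0)}"
        have "{x \<in> space (?P n). ennreal e \<le> ?f x} \<in> sets (?P n)"
          by (rule borel_measurable_le[OF borel_measurable_const meas])
        then have "emeasure (?P n) (?E n) \<le> emeasure (?P n) {x \<in> space (?P n). ennreal e \<le> ?f x}"
          by (rule emeasure_mono[OF sub])
        also have "\<dots> \<le> ennreal (1 / e) * (\<integral>\<^sup>+x. ?f x \<partial>?P n)"
          by (rule emeasure_ge_le_nn_integral[OF meas e])
        also have "\<dots> \<le> ennreal (1 / e) * ennreal (exp (- (real n powr \<gamma>)))" by (rule mult_left_mono[OF I]) simp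
        also have "\<dots> = ennreal (exp (- (real n powr \<gamma>)) / e)" using e by (simp add: ennreal_mult[symmetric])
        finally have "ennreal (measure (?P n) (?E n)) \<le> ennreal (exp (- (real n powr \<gamma>)) / e)"
          by (simp add: Pn.emeasure_eq_measure)
        then show ?thesis using e by (subst (asm) ennreal_le_iff) auto
      qed
      have "filterlim (\<lambda>n. real n powr \<gamma>) at_top sequentially"
        by (rule filterlim_compose[OF real_powr_at_top[OF \<gamma>] filterlim_real_sequentially])
      then have "(\<lambda>n. exp (- (real n powr \<gamma>))) \<longlonglongrightarrow> 0"
        by (intro filterlim_compose[OF exp_at_bot] filterlim_compose[OF filterlim_uminus_at_bot_at_top])
      then have "(\<lambda>n. exp (- (real n powr \<gamma>)) / e) \<longlonglongrightarrow> 0 / e" by (intro tendsto_intros) (use e in auto)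
      then have lim: "(\<lambda>n. exp (- (real n powr \<gamma>)) / e) \<longlonglongrightarrow> 0" by simp
      show "(\<lambda>n. measure (?P n) (?E n)) \<longlonglongrightarrow> 0"
      proof (rule tendsto_sandwich[OF _ _ tendsto_const lim])
        show "\<forall>\<^sub>F n in sequentially. measure (?P n) (?E n) \<le> exp (- (real n powr \<gamma>)) / e"
          using eventually_ge_at_top[of "max n0 1"] by eventually_elim (rule bound)
      qed simp
    qed
  qed
qed

section \<open>Prior cost of a Besov signal\<close>

lemma besov_sum_bound:
  assumes "w0 \<in> besov \<psi> \<beta> q"
  obtains Sb where "1 \<le> Sb" and "\<And>F. finite F \<Longrightarrow> F \<subseteq> {1..} \<Longrightarrow>
    (\<Sum>j\<in>F. real j powr (q * (\<beta> + 1/2) - 1) * \<bar>inner w0 (\<psi> j)\<bar> powr q) \<le> Sb"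
proof -
  let ?f = "\<lambda>l. real l powr (q * (\<beta> + 1/2) - 1) * \<bar>inner w0 (\<psi> l)\<bar> powr q"
  have s: "?f summable_on {1..}" using assms by (simp add: besov_def)
  have "sum ?f F \<le> infsum ?f {1..}" if "finite F" "F \<subseteq> {1..}" for F
    using that by (intro finite_sum_le_infsum s) auto
  then show ?thesis
    by (intro that[of "max 1 (infsum ?f {1..})"]) (auto simp: le_max_iff_disj)
qed

lemma prior_ratio_powr:
  assumes "0 < lam" "1 \<le> j"
  shows "\<bar>a / prior_sd \<alpha> lam j\<bar> powr p = lam powr (- p) * (real j powr (1/2 + \<alpha>) * \<bar>a\<bar>) powr p"
proof -
  have "prior_sd \<alpha> lam j = lam / real j powr (1/2 + \<alpha>)"
  proof -
    have "- 1/2 - \<alpha> = - (1/2 + \<alpha>)" by simp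
    then show ?thesis unfolding prior_sd_def by (simp only: powr_minus divide_inverse)
  qed
  then have eq: "\<bar>a / prior_sd \<alpha> lam j\<bar> = (1 / lam) * (real j powr (1/2 + \<alpha>) * \<bar>a\<bar>)"
    using assms by (simp add: abs_mult)
  have "\<bar>a / prior_sd \<alpha> lam j\<bar> powr p = (1 / lam) powr p * (real j powr (1/2 + \<alpha>) * \<bar>a\<bar>) powr p"
    unfolding eq by (rule powr_mult; use assms in simp)
  also have "(1 / lam) powr p = lam powr (- p)"
    using assms by (simp add: powr_divide powr_minus_divide)
  finally show ?thesis .
qed

text \<open>With \<alpha> = \<beta> - 1/q the weighted coefficients t_j satisfy that t_j^q is
  exactly the Besov summand. The claim is then the inclusion of l^q in l^p.\<close>

lemma ratio_sum_bound_le: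
  assumes q: "0 < q" "q \<le> p" and lam: "0 < lam" and \<alpha>: "\<alpha> = \<beta> - 1 / q" and Sb: "1 \<le> Sb"
    and S: "(\<Sum>j\<in>F. real j powr (q * (\<beta> + 1/2) - 1) * \<bar>a j\<bar> powr q) \<le> Sb"
    and F: "finite F" "F \<subseteq> {1..}"
  shows "(\<Sum>j\<in>F. \<bar>a j / prior_sd \<alpha> lam j\<bar> powr p) \<le> Sb powr (p / q) * lam powr (- p)"
proof -
  define t where "t j = real j powr (1/2 + \<alpha>) * \<bar>a j\<bar>" for j
  have t0: "0 \<le> t j" for j by (simp add: t_def)
  have tq: "t j powr q = real j powr (q * (\<beta> + 1/2) - 1) * \<bar>a j\<bar> powr q" for j
  proof -
    have "(1/2 + \<alpha>) * q = q * (\<beta> + 1/2) - 1" using q by (simp add: \<alpha> field_simps)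
    then show ?thesis unfolding t_def by (simp add: powr_mult powr_powr)
  qed
  have tqS: "t j powr q \<le> Sb" if "j \<in> F" for j
    using member_le_sum[OF that, of "\<lambda>j. t j powr q"] F(1) S unfolding tq[symmetric] by simp
  \<comment> \<open>Each t_j^q is bounded by the whole sum Sb, so p/q - 1 of the power can be traded
    for a constant.\<close>
  have tp: "t j powr p \<le> t j powr q * Sb powr (p / q - 1)" if j: "j \<in> F" for j
  proof -
    have "t j powr p = (t j powr q) powr (p / q)" using q by (simp add: powr_powr)
    also have "\<dots> = t j powr q * (t j powr q) powr (p / q - 1)"
    proof (cases "t j = 0")
      case False
      then show ?thesis by (simp add: powr_mult_base)
    qed simp
    also have "\<dots> \<le> t j powr q * Sb powr (p / q - 1)"
      using q tqS[OF j] by (intro mult_left_mono powr_mono2) (auto simp: field_simps)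
    finally show ?thesis .
  qed
  have "(\<Sum>j\<in>F. \<bar>a j / prior_sd \<alpha> lam j\<bar> powr p) = (\<Sum>j\<in>F. lam powr (- p) * t j powr p)"
    unfolding t_def using F(2) by (intro sum.cong refl prior_ratio_powr lam) auto
  also have "\<dots> \<le> (\<Sum>j\<in>F. lam powr (- p) * (t j powr q * Sb powr (p / q - 1)))"
    by (intro sum_mono mult_left_mono tp) auto
  also have "\<dots> = lam powr (- p) * Sb powr (p / q - 1) * (\<Sum>j\<in>F. t j powr q)"
    unfolding sum_distrib_left by (intro sum.cong refl) (simp only: ac_simps)
  also have "\<dots> \<le> lam powr (- p) * Sb powr (p / q - 1) * Sb"
    using S unfolding tq[symmetric] by (intro mult_left_mono) auto
  also have "\<dots> = Sb powr (p / q) * lam powr (- p)"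
  proof -
    have "Sb * Sb powr (p / q - 1) = Sb powr (p / q)" using Sb by (simp add: powr_mult_base)
    then show ?thesis by (simp add: mult.assoc mult.commute[of _ Sb])
  qed
  finally show ?thesis .
qed

lemma harm_le: "1 \<le> N \<Longrightarrow> (\<Sum>j\<in>{1..N}. 1 / real j) \<le> 1 + ln (real N)"
proof (induction N rule: dec_induct)
  case (step N)
  have "1 / real (Suc N) \<le> ln (real (Suc N)) - ln (real N)"
  proof -
    have N: "0 < real N" using step.hyps by simp
    have "ln (real N / real (Suc N)) \<le> real N / real (Suc N) - 1"
      using N by (intro ln_le_minus_one) auto
    moreover have "ln (real N / real (Suc N)) = ln (real N) - ln (real (Suc N))"
      using N by (simp add: ln_div)
    moreover have "real N / real (Suc N) - 1 = - (1 / real (Suc N))" by (simp add: field_simps)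
    ultimately show ?thesis by linarith
  qed
  then show ?case using step by simp
qed simp

text \<open>Young's inequality \<open>v^p \<le> k^(p-q) v^q + k^p\<close> with \<open>k = (ln n)^(-1/q)\<close> takes the place of
  Hoelder's inequality; cutting the sum at \<open>n^3\<close> makes the harmonic sum of order \<open>ln n\<close>.\<close>

lemma ratio_sum_bound_gt:
  assumes p: "0 < p" "p < q" and lam: "0 < lam" and \<alpha>: "\<alpha> = \<beta> - 1 / p" and Sb: "1 \<le> Sb"
    and S: "(\<Sum>j\<in>F. real j powr (q * (\<beta> + 1/2) - 1) * \<bar>a j\<bar> powr q) \<le> Sb"
    and F: "F \<subseteq> {1..n^3}" and n: "3 \<le> (n::nat)"
  shows "(\<Sum>j\<in>F. \<bar>a j / prior_sd \<alpha> lam j\<bar> powr p) \<le> (Sb + 4) * (lam powr (- p) * ln (real n) powr ((q - p) / q))"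
proof -
  define H where "H = ln (real n)"
  have H: "1 \<le> H"
  proof -
    have "exp 1 \<le> real n" using exp_le n by linarith
    then show ?thesis unfolding H_def using n by (subst ln_ge_iff) auto
  qed
  define v where "v j = real j powr (\<beta> + 1/2) * \<bar>a j\<bar>" for j
  have finF: "finite F" using F finite_subset by blast
  \<comment> \<open>With \<alpha> = \<beta> - 1/p the prior cost is v_j^p / j while the Besov
    summand is v_j^q / j. The common weight 1/j produces the harmonic sum when q > p.\<close>
  have vp: "lam powr (- p) * (real j powr (1/2 + \<alpha>) * \<bar>a j\<bar>) powr p = lam powr (- p) * (v j powr p / real j)" if j: "1 \<le> j" for j
  proof -
    have "(1/2 + \<alpha>) * p = (\<beta> + 1/2) * p + - 1" using p by (simp add: \<alpha> field_simps)
    then have "real j powr ((1/2 + \<alpha>) * p) = real j powr ((\<beta> + 1/2) * p) * real j powr (- 1)"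
      by (simp only: powr_add)
    then show ?thesis using j by (simp add: v_def powr_mult powr_powr powr_minus_divide)
  qed
  have vq: "v j powr q / real j = real j powr (q * (\<beta> + 1/2) - 1) * \<bar>a j\<bar> powr q" if j: "1 \<le> j" for j
  proof -
    have "q * (\<beta> + 1/2) - 1 = (\<beta> + 1/2) * q + - 1" by (simp add: algebra_simps)
    then have "real j powr (q * (\<beta> + 1/2) - 1) = real j powr ((\<beta> + 1/2) * q) * real j powr (- 1)"
      by (simp only: powr_add)
    then show ?thesis using j by (simp add: v_def powr_mult powr_powr powr_minus_divide)
  qed
  define k where "k = H powr (- 1 / q)"
  have k: "0 < k" using H by (simp add: k_def)
  have young: "v j powr p \<le> k powr (p - q) * v j powr q + k powr p" for j
  proof (cases "v j \<le> k")
    case True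
    then have "v j powr p \<le> k powr p" using p by (intro powr_mono2) (auto simp: v_def)
    then show ?thesis by (simp add: add_increasing)
  next
    case False
    then have vk: "k \<le> v j" "0 < v j" using k by auto
    have "v j powr p = v j powr (p - q) * v j powr q" using vk by (simp add: powr_add[symmetric])
    also have "\<dots> \<le> k powr (p - q) * v j powr q"
      using vk k p by (intro mult_right_mono powr_mono2') auto
    finally show ?thesis by (simp add: add_increasing2)
  qed
  have k1: "k powr (p - q) = H powr ((q - p) / q)" "k powr p = H powr (- p / q)"
  proof -
    have "- 1 / q * (p - q) = (q - p) / q" "- 1 / q * p = - p / q" using p by (simp_all add: field_simps)
    then show "k powr (p - q) = H powr ((q - p) / q)" "k powr p = H powr (- p / q)"
      unfolding k_def powr_powr by (simp_all only:)
  qed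
  have j1: "1 \<le> j" if "j \<in> F" for j using that F by auto
  have "(\<Sum>j\<in>F. \<bar>a j / prior_sd \<alpha> lam j\<bar> powr p) = (\<Sum>j\<in>F. lam powr (- p) * (v j powr p / real j))"
    by (intro sum.cong refl) (simp only: prior_ratio_powr[OF lam j1] vp[OF j1])
  also have "\<dots> \<le> (\<Sum>j\<in>F. lam powr (- p) * (k powr (p - q) * (v j powr q / real j) + k powr p * (1 / real j)))"
  proof (intro sum_mono mult_left_mono)
    fix j assume "j \<in> F"
    have "v j powr p / real j \<le> (k powr (p - q) * v j powr q + k powr p) / real j"
      by (intro divide_right_mono young) simp
    then show "v j powr p / real j \<le> k powr (p - q) * (v j powr q / real j) + k powr p * (1 / real j)"
      by (simp add: add_divide_distrib)
  qed simp
  also have "\<dots> = lam powr (- p) * (k powr (p - q) * (\<Sum>j\<in>F. v j powr q / real j) + k powr p * (\<Sum>j\<in>F. 1 / real j))"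
    by (simp only: sum_distrib_left[symmetric] sum.distrib)
  also have "\<dots> \<le> lam powr (- p) * (k powr (p - q) * Sb + k powr p * (4 * H))"
  proof (intro mult_left_mono add_mono)
    have "(\<Sum>j\<in>F. v j powr q / real j) = (\<Sum>j\<in>F. real j powr (q * (\<beta> + 1/2) - 1) * \<bar>a j\<bar> powr q)"
      by (intro sum.cong refl vq j1)
    then show "(\<Sum>j\<in>F. v j powr q / real j) \<le> Sb" using S by simp
    have "(\<Sum>j\<in>F. 1 / real j) \<le> (\<Sum>j\<in>{1..n^3}. 1 / real j)" using F by (intro sum_mono2) auto
    also have "\<dots> \<le> 1 + ln (real (n^3))" using n by (intro harm_le) simp
    also have "ln (real (n^3)) = 3 * H" using n by (simp add: H_def ln_realpow)
    finally show "(\<Sum>j\<in>F. 1 / real j) \<le> 4 * H" using H by simp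
  qed auto
  \<comment> \<open>The choice of k balances Young's inequality: k^(p - q) and k^p H are the same
    power of H.\<close>
  also have "k powr p * (4 * H) = 4 * H powr ((q - p) / q)"
  proof -
    have "H powr (- p / q) * H powr 1 = H powr (- p / q + 1)" by (simp only: powr_add)
    also have "- p / q + 1 = (q - p) / q" using p by (simp add: field_simps)
    finally show ?thesis unfolding k1 using H by simp
  qed
  also have "lam powr (- p) * (k powr (p - q) * Sb + 4 * H powr ((q - p) / q)) = (Sb + 4) * (lam powr (- p) * H powr ((q - p) / q))"
    unfolding k1 by (simp add: algebra_simps)
  finally show ?thesis unfolding H_def .
qed

text \<open>Beyond n^3 the Besov weight exceeds n^(3/2), because q \<beta> > 1 makes its exponent
  larger than q/2 \<ge> 1/2. As Sb \<le> sqrt n, the q-th powers sum to at most 1/n there, and q < 2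
  lets them dominate the squares.\<close>

lemma besov_tail:
  assumes q: "1 \<le> q" "q < 2" "1 < q * \<beta>" and Sb: "1 \<le> Sb" and n: "Sb\<^sup>2 \<le> real n" "1 \<le> n"
    and S: "(\<Sum>j\<in>F. real j powr (q * (\<beta> + 1/2) - 1) * \<bar>a j\<bar> powr q) \<le> Sb"
    and F: "finite F" "\<And>j. j \<in> F \<Longrightarrow> n^3 < j"
  shows "(\<Sum>j\<in>F. real n * (a j)\<^sup>2) \<le> 1"
proof -
  have n0: "0 < real n" using n by simp
  have aq: "\<bar>a j\<bar> powr q \<le> real n powr (- 3/2) * (real j powr (q * (\<beta> + 1/2) - 1) * \<bar>a j\<bar> powr q)" if j: "j \<in> F" for j
  proof -
    have "real n powr 3 = real (n^3)" using n0 by (simp add: powr_numeral)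
    also have "\<dots> \<le> real j" using F(2)[OF j] by linarith
    finally have nj: "real n powr 3 \<le> real j" .
    have j1: "1 \<le> real j" using F(2)[OF j] by simp
    have "real n powr (3/2) = (real n powr 3) powr (1/2)" by (subst powr_powr) simp
    also have "\<dots> \<le> real j powr (1/2)" using nj by (intro powr_mono2) auto
    also have "\<dots> \<le> real j powr (q * (\<beta> + 1/2) - 1)"
      using q j1 by (intro powr_mono) (auto simp: algebra_simps)
    finally have "1 \<le> real n powr (- 3/2) * real j powr (q * (\<beta> + 1/2) - 1)"
      using n0 by (simp add: powr_minus_divide le_divide_eq)
    then have "1 * \<bar>a j\<bar> powr q \<le> (real n powr (- 3/2) * real j powr (q * (\<beta> + 1/2) - 1)) * \<bar>a j\<bar> powr q"
      by (rule mult_right_mono) simp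
    then show ?thesis by (simp add: mult.assoc)
  qed
  have "(\<Sum>j\<in>F. \<bar>a j\<bar> powr q) \<le> (\<Sum>j\<in>F. real n powr (- 3/2) * (real j powr (q * (\<beta> + 1/2) - 1) * \<bar>a j\<bar> powr q))"
    by (intro sum_mono aq)
  also have "\<dots> \<le> real n powr (- 3/2) * Sb"
    unfolding sum_distrib_left[symmetric] using S by (rule mult_left_mono) simp
  also have "\<dots> \<le> real n powr (- 3/2) * real n powr (1/2)"
  proof (rule mult_left_mono)
    have "Sb \<le> sqrt (real n)" using n Sb by (simp add: real_le_rsqrt)
    then show "Sb \<le> real n powr (1/2)" by (simp add: powr_half_sqrt)
  qed simp
  also have "\<dots> = real n powr (- 1)" by (simp add: powr_add[symmetric])
  also have "\<dots> = 1 / real n" using n0 by (simp add: powr_minus_divide)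
  finally have sum: "(\<Sum>j\<in>F. \<bar>a j\<bar> powr q) \<le> 1 / real n" .
  have sq: "(a j)\<^sup>2 \<le> \<bar>a j\<bar> powr q" if j: "j \<in> F" for j
  proof -
    have "\<bar>a j\<bar> powr q \<le> 1 / real n"
      using member_le_sum[OF j, of "\<lambda>j. \<bar>a j\<bar> powr q"] F(1) sum by simp
    also have "\<dots> \<le> 1" using n by simp
    finally have "\<bar>a j\<bar> powr q \<le> 1 powr q" by simp
    moreover have "1 powr q < \<bar>a j\<bar> powr q" if "1 < \<bar>a j\<bar>"
      using q that by (intro powr_less_mono2) auto
    ultimately have "\<bar>a j\<bar> \<le> 1" by (meson not_less)
    then have "\<bar>a j\<bar> powr 2 \<le> \<bar>a j\<bar> powr q" using q by (intro powr_mono') auto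
    then show ?thesis by (cases "a j = 0") (auto simp: powr_numeral)
  qed
  have "(\<Sum>j\<in>F. real n * (a j)\<^sup>2) \<le> real n * (\<Sum>j\<in>F. \<bar>a j\<bar> powr q)"
    unfolding sum_distrib_left by (intro sum_mono mult_left_mono sq) auto
  also have "\<dots> \<le> real n * (1 / real n)" by (rule mult_left_mono[OF sum]) simp
  also have "\<dots> = 1" using n0 by simp
  finally show ?thesis .
qed

theorem theorem5p9:
  fixes M :: "'o measure" and B :: "real \<Rightarrow> 'o \<Rightarrow> real"
    and \<psi> :: "nat \<Rightarrow> L2" and w0 :: L2
    and p q \<alpha> \<beta> :: real
    and lam r m :: "nat \<Rightarrow> real"
    and post :: "nat \<Rightarrow> (real \<Rightarrow> real) \<Rightarrow> L2 measure"
  assumes "brownian_motion M B"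
    and "orthonormal_basis \<psi>"
    and "1 \<le> p" "p \<le> 2" "1 \<le> q" "q < 2"
    and "\<beta> > max (1 / p) (1 / q)"
    and "w0 \<in> besov \<psi> \<beta> q"
    and "\<alpha> > 0"
    and "m = (\<lambda>n. real n powr (- \<beta> / (1 + 2 * \<beta>)))"
    and "(q = p \<and> \<alpha> = \<beta> - 1 / p
            \<and> lam = (\<lambda>n. real n powr (- 1 / (p * (1 + 2 * \<beta>))))
            \<and> r = m)
       \<or> (q > p \<and> \<alpha> = \<beta> - 1 / p
            \<and> lam = (\<lambda>n. real n powr (- 1 / (p * (1 + 2 * \<beta>)))
                          * ln (real n) powr ((p - 2 / (1 + 2 * \<beta>)) * ((q - p) / (p\<^sup>2 * q))))
            \<and> r = (\<lambda>n. m n * ln (real n) powr ((q - p) / (p * q * (1 + 2 * \<beta>)))))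
       \<or> (q < p \<and> \<alpha> = \<beta> - 1 / q
            \<and> lam = (\<lambda>n. real n powr (- q / (2 * q + 2 * \<beta> * p * q - 2 * p + p * q)))
            \<and> r = (\<lambda>n. real n powr
                     (((p - q) - \<beta> * p * q) / (2 * (q - p) + 2 * \<beta> * p * q + p * q))))"
    and "\<And>n. n \<ge> 1 \<Longrightarrow>
      is_posterior (p_exponential_prior \<psi> p \<alpha> (lam n)) C01 (white_noise_law M B n) (post n)"
  shows "\<exists>K0. \<forall>K\<ge>K0. tendsto_in_probability (\<lambda>n. white_noise_law M B n w0)
           (\<lambda>n x. measure (post n x) {w. norm (w - w0) \<le> K * r n}) 1"
proof -
  note BM = assms(1) and \<psi> = assms(2) and p = assms(3,4) and q = assms(5,6)
    and \<alpha> = assms(9) and m = assms(10) and cases = assms(11) and post = assms(12)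
  have \<beta>: "1 / p < \<beta>" "1 / q < \<beta>" using assms(7) by auto
  have \<beta>0: "0 < \<beta>" using \<beta>(1) p by (smt (verit) divide_nonneg_pos)
  have b1: "0 < 1 + 2 * \<beta>" using \<beta>0 by simp
  obtain Sb where Sb: "1 \<le> Sb" "\<And>F. finite F \<Longrightarrow> F \<subseteq> {1..} \<Longrightarrow>
    (\<Sum>j\<in>F. real j powr (q * (\<beta> + 1/2) - 1) * \<bar>inner w0 (\<psi> j)\<bar> powr q) \<le> Sb"
    by (rule besov_sum_bound[OF assms(8)]) blast
  \<comment> \<open>The cases q = p and q < p share one shape: n r^2 = n^g is also the prior cost
    \<lambda>^(-p), and \<open>gg\<close> is the condition n \<lambda>^2 = (n r^2)^(1 + 2 \<alpha>)
    on exponents. All coordinates belong to G.\<close>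
  have contraction_le: ?thesis
    if qp: "q \<le> p" and al: "\<alpha> = \<beta> - 1 / q" and g: "0 < g" and lam: "lam = (\<lambda>n. real n powr (- g / p))"
      and r: "r = (\<lambda>n. real n powr ((g - 1) / 2))" and gg: "1 - 2 * g / p = g * (1 + 2 * \<alpha>)" for g
  proof -
    have nr: "real n * (r n)\<^sup>2 = real n powr g" if "1 \<le> n" for n
    proof -
      have "real n * (r n)\<^sup>2 = real n powr 1 * (real n powr ((g - 1) / 2) * real n powr ((g - 1) / 2))"
        using that by (simp add: r power2_eq_square)
      also have "\<dots> = real n powr g" by (simp only: powr_add[symmetric]) simp
      finally show ?thesis .
    qed
    have nl: "real n * (lam n)\<^sup>2 = (real n powr g) powr (1 + 2 * \<alpha>)" if "1 \<le> n" for n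
    proof -
      have "real n * (lam n)\<^sup>2 = real n powr 1 * (real n powr (- g / p) * real n powr (- g / p))"
        using that by (simp add: lam power2_eq_square)
      also have "\<dots> = real n powr (1 - 2 * g / p)" by (simp only: powr_add[symmetric]) simp
      finally show ?thesis unfolding gg powr_powr .
    qed
    have lp: "lam n powr (- p) = real n powr g" for n using p by (simp add: lam powr_powr)
    show ?thesis
    proof (rule posterior_contraction[OF BM \<psi> p \<alpha> post g, where ?n0.0=1 and G="\<lambda>_. UNIV" and C="Sb powr (p / q)"])
      fix n :: nat assume n: "1 \<le> n"
      show "0 < lam n \<and> 0 < r n \<and> real n powr g \<le> real n * (r n)\<^sup>2
          \<and> real n * (lam n)\<^sup>2 = (real n * (r n)\<^sup>2) powr (1 + 2 * \<alpha>)"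
        unfolding nr[OF n] nl[OF n] using n by (simp add: lam r)
      fix F :: "nat set" assume F: "finite F" "F \<subseteq> {1..} \<inter> UNIV"
      have "(\<Sum>j\<in>F. \<bar>inner w0 (\<psi> j) / prior_sd \<alpha> (lam n) j\<bar> powr p) \<le> Sb powr (p / q) * lam n powr (- p)"
        using q qp F n by (intro ratio_sum_bound_le[OF _ _ _ al Sb(1) Sb(2)]) (auto simp: lam)
      then show "(\<Sum>j\<in>F. \<bar>inner w0 (\<psi> j) / prior_sd \<alpha> (lam n) j\<bar> powr p) \<le> Sb powr (p / q) * (real n * (r n)\<^sup>2)"
        unfolding lp nr[OF n] .
    next
      fix n :: nat and F :: "nat set" assume "finite F" "F \<subseteq> {1..} - UNIV"
      then show "(\<Sum>j\<in>F. real n * (inner w0 (\<psi> j))\<^sup>2) \<le> Sb powr (p / q) * (real n * (r n)\<^sup>2)"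
        by (simp add: subset_empty)
    qed auto
  qed
  show ?thesis
    using cases
  proof (elim disjE conjE)
    assume c: "q = p" "\<alpha> = \<beta> - 1 / p" "lam = (\<lambda>n. real n powr (- 1 / (p * (1 + 2 * \<beta>))))" "r = m"
    show ?thesis
    \<comment> \<open>Solving \<open>gg\<close> gives 1/g = 1 + 2 \<alpha> + 2/p, which is 1 + 2
      \<beta> when q = p.\<close>
    proof (rule contraction_le[of "1 / (1 + 2 * \<beta>)"])
      show "lam = (\<lambda>n. real n powr (- (1 / (1 + 2 * \<beta>)) / p))" unfolding c(3) by (simp add: mult.commute)
      have "(1 / (1 + 2 * \<beta>) - 1) / 2 = - \<beta> / (1 + 2 * \<beta>)" using b1 by (simp add: field_simps)
      then show "r = (\<lambda>n. real n powr ((1 / (1 + 2 * \<beta>) - 1) / 2))" unfolding c(4) m by (simp only:)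
      show "1 - 2 * (1 / (1 + 2 * \<beta>)) / p = 1 / (1 + 2 * \<beta>) * (1 + 2 * \<alpha>)"
      proof -
        have \<alpha>2: "1 + 2 * \<alpha> = (1 + 2 * \<beta>) - 2 / p" unfolding c(2) by simp
        have "1 / (1 + 2 * \<beta>) * ((1 + 2 * \<beta>) - 2 / p) = 1 - 2 * (1 / (1 + 2 * \<beta>)) / p"
          unfolding right_diff_distrib using b1 by simp
        then show ?thesis unfolding \<alpha>2 by (rule sym)
      qed
    qed (use c b1 in auto)
  next
    assume c: "q < p" "\<alpha> = \<beta> - 1 / q"
      "lam = (\<lambda>n. real n powr (- q / (2 * q + 2 * \<beta> * p * q - 2 * p + p * q)))"
      "r = (\<lambda>n. real n powr (((p - q) - \<beta> * p * q) / (2 * (q - p) + 2 * \<beta> * p * q + p * q)))"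
    define D where "D = 2 * q + 2 * \<beta> * p * q - 2 * p + p * q"
    \<comment> \<open>Positivity of the denominator: \<beta> q > 1 makes 2 \<beta> p q - 2 p
      positive.\<close>
    have "1 < \<beta> * q" using \<beta>(2) q by (simp add: divide_less_eq)
    then have "1 * p < (\<beta> * q) * p" using p by (intro mult_strict_right_mono) auto
    then have "0 < p * q + 2 * q + 2 * ((\<beta> * q) * p - 1 * p)"
      using p q by (intro add_pos_pos mult_pos_pos) auto
    also have "\<dots> = D" by (simp add: D_def algebra_simps)
    finally have D: "0 < D" .
    have D2: "2 * (q - p) + 2 * \<beta> * p * q + p * q = D" by (simp add: D_def algebra_simps)
    show ?thesis
    \<comment> \<open>The same equation for g with \<alpha> = \<beta> - 1/q: 1/g = 1 + 2 \<beta> -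
      2/q + 2/p = D / (p q).\<close>
    proof (rule contraction_le[of "p * q / D"])
      show "lam = (\<lambda>n. real n powr (- (p * q / D) / p))"
        unfolding c(3) D_def[symmetric] using p by simp
      have "(p * q / D - 1) / 2 = ((p - q) - \<beta> * p * q) / D"
        using D by (simp add: divide_simps) (simp add: D_def algebra_simps)
      then show "r = (\<lambda>n. real n powr ((p * q / D - 1) / 2))" unfolding c(4) D2 by (simp only:)
      have "1 - 2 * (p * q / D) / p = (D - 2 * q) / D" using D p by (simp add: field_simps)
      also have "D - 2 * q = p * q * (1 + 2 * \<alpha>)"
        unfolding c(2) D_def using q by (simp add: field_simps)
      finally show "1 - 2 * (p * q / D) / p = p * q / D * (1 + 2 * \<alpha>)" by simp
    qed (use c D p q in auto)
  next
    assume c: "q > p" "\<alpha> = \<beta> - 1 / p"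
      "lam = (\<lambda>n. real n powr (- 1 / (p * (1 + 2 * \<beta>)))
                          * ln (real n) powr ((p - 2 / (1 + 2 * \<beta>)) * ((q - p) / (p\<^sup>2 * q))))"
      "r = (\<lambda>n. m n * ln (real n) powr ((q - p) / (p * q * (1 + 2 * \<beta>))))"
    define d where "d = 1 + 2 * \<beta>"
    have d: "0 < d" "\<beta> = (d - 1) / 2" using b1 by (auto simp: d_def)
    define \<nu> where "\<nu> = (q - p) / (p * q * d)"
    define \<omega> where "\<omega> = (p - 2 / d) * ((q - p) / (p\<^sup>2 * q))"
    have \<nu>0: "0 < \<nu>" using c(1) p q d by (simp add: \<nu>_def)
    \<comment> \<open>From 3 on ln n \<ge> 1, so powers of the logarithm are monotone; Sb^2 \<le> n
      is what \<open>besov_tail\<close> asks for.\<close>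
    define n0 where "n0 = max 3 (nat \<lceil>Sb\<^sup>2\<rceil>)"
    have n3: "3 \<le> n" "1 \<le> n" "Sb\<^sup>2 \<le> real n" if "n0 \<le> n" for n
      using that unfolding n0_def by (auto simp: nat_le_iff ceiling_le_iff)
    have H1: "1 \<le> ln (real n)" if "n0 \<le> n" for n
    proof -
      have "exp 1 \<le> real n" using exp_le n3(1)[OF that] by linarith
      then show ?thesis using n3[OF that] by (subst ln_ge_iff) auto
    qed
    have rep: "real n = exp (ln (real n))" "ln (real n) = exp (ln (ln (real n)))" if "n0 \<le> n" for n
      using H1[OF that] n3[OF that] by auto
    \<comment> \<open>Written as exponentials in ln n and ln (ln n), the scaling relations become
      linear identities between exponents.\<close>
    have powr_exp: "real n powr a * ln (real n) powr b = exp (a * ln (real n) + b * ln (ln (real n)))"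
      if "n0 \<le> n" for n a b
      using H1[OF that] n3[OF that] by (simp add: powr_def exp_add)
    have lam_exp: "lam n = exp (- 1 / (p * d) * ln (real n) + \<omega> * ln (ln (real n)))" if "n0 \<le> n" for n
      unfolding c(3) d_def[symmetric] \<omega>_def[symmetric] by (rule powr_exp[OF that])
    have r_exp: "r n = exp (- \<beta> / d * ln (real n) + \<nu> * ln (ln (real n)))" if "n0 \<le> n" for n
      unfolding c(4) m d_def[symmetric] \<nu>_def[symmetric] by (rule powr_exp[OF that])
    have nr: "real n * (r n)\<^sup>2 = exp (1 / d * ln (real n) + 2 * \<nu> * ln (ln (real n)))" if n: "n0 \<le> n" for n
    proof -
      have "real n * (r n)\<^sup>2 = exp (ln (real n)) * (r n)\<^sup>2" using rep(1)[OF n] by simp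
      also have "\<dots> = exp (ln (real n) + 2 * (- \<beta> / d * ln (real n) + \<nu> * ln (ln (real n))))"
        unfolding r_exp[OF n] by (simp add: power2_eq_square exp_add[symmetric] algebra_simps)
      also have "ln (real n) + 2 * (- \<beta> / d * ln (real n) + \<nu> * ln (ln (real n)))
          = (1 - 2 * \<beta> / d) * ln (real n) + 2 * \<nu> * ln (ln (real n))"
        by (simp add: algebra_simps)
      also have "1 - 2 * \<beta> / d = 1 / d" using d by (simp add: field_simps)
      finally show ?thesis .
    qed
    have nl: "real n * (lam n)\<^sup>2 = (real n * (r n)\<^sup>2) powr (1 + 2 * \<alpha>)" if n: "n0 \<le> n" for n
    proof -
      have "real n * (lam n)\<^sup>2 = exp (ln (real n)) * (lam n)\<^sup>2" using rep(1)[OF n] by simp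
      also have "\<dots> = exp ((1 - 2 / (p * d)) * ln (real n) + 2 * \<omega> * ln (ln (real n)))"
        unfolding lam_exp[OF n] by (simp add: power2_eq_square exp_add[symmetric] algebra_simps)
      also have "1 - 2 / (p * d) = (1 + 2 * \<alpha>) * (1 / d)"
        unfolding c(2) d(2) using d p by (simp add: field_simps)
      also have "2 * \<omega> = (1 + 2 * \<alpha>) * (2 * \<nu>)"
        unfolding c(2) d(2) \<omega>_def \<nu>_def using d(1) p q by (simp add: field_simps power2_eq_square)
      also have "exp ((1 + 2 * \<alpha>) * (1 / d) * ln (real n) + (1 + 2 * \<alpha>) * (2 * \<nu>) * ln (ln (real n)))
          = (real n * (r n)\<^sup>2) powr (1 + 2 * \<alpha>)"
        unfolding nr[OF n] by (simp add: powr_def algebra_simps)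
      finally show ?thesis .
    qed
    \<comment> \<open>The balance behind the logarithmic factors: the prior cost, inflated by the
      harmonic sum, equals n r^2. Together with n \<lambda>^2 = (n r^2)^(1 + 2 \<alpha>) it
      determines \<omega> and \<nu>.\<close>
    have lpH: "lam n powr (- p) * ln (real n) powr ((q - p) / q) = real n * (r n)\<^sup>2" if n: "n0 \<le> n" for n
    proof -
      have "lam n powr (- p) = exp (- p * (- 1 / (p * d) * ln (real n) + \<omega> * ln (ln (real n))))"
        unfolding lam_exp[OF n] by (simp add: powr_def)
      moreover have "ln (real n) powr ((q - p) / q) = exp ((q - p) / q * ln (ln (real n)))"
        using H1[OF n] by (simp add: powr_def)
      ultimately have "lam n powr (- p) * ln (real n) powr ((q - p) / q)
          = exp (- p * (- 1 / (p * d) * ln (real n) + \<omega> * ln (ln (real n))) + (q - p) / q * ln (ln (real n)))"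
        by (simp only: exp_add)
      also have "- p * (- 1 / (p * d) * ln (real n) + \<omega> * ln (ln (real n))) + (q - p) / q * ln (ln (real n))
          = (p * (1 / (p * d))) * ln (real n) + ((q - p) / q - p * \<omega>) * ln (ln (real n))"
        by (simp add: algebra_simps)
      also have "p * (1 / (p * d)) = 1 / d" using p by simp
      also have "(q - p) / q - p * \<omega> = 2 * \<nu>"
        unfolding \<omega>_def \<nu>_def using d(1) p q by (simp add: field_simps power2_eq_square)
      finally show ?thesis unfolding nr[OF n] .
    qed
    have nrge: "real n powr (1 / d) \<le> real n * (r n)\<^sup>2" if n: "n0 \<le> n" for n
    proof -
      have "0 \<le> ln (ln (real n))" using H1[OF n] by simp
      then show ?thesis unfolding nr[OF n] using n3[OF n] \<nu>0 by (simp add: powr_def)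
    qed
    have nr1: "1 \<le> real n * (r n)\<^sup>2" if n: "n0 \<le> n" for n
    proof -
      have "1 \<le> real n powr (1 / d)" using n3[OF n] d by (intro ge_one_powr_ge_zero) auto
      then show ?thesis using nrge[OF n] by linarith
    qed
    have qb: "1 < q * \<beta>" using \<beta>(2) q by (simp add: divide_less_eq mult.commute)
    show ?thesis
    \<comment> \<open>Up to n^3 the prior cost is controlled by \<open>ratio_sum_bound_gt\<close>;
      beyond n^3 the signal energy in noise units is at most 1 by \<open>besov_tail\<close>, in
      total and hence for each coordinate.\<close>
    proof (rule posterior_contraction[OF BM \<psi> p \<alpha> post, where ?n0.0=n0 and \<gamma>="1 / d" and G="\<lambda>n. {..n^3}" and C="Sb + 4"])
      show "0 < 1 / d" using d by simp
      fix n :: nat assume n: "n0 \<le> n"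
      show "0 < lam n \<and> 0 < r n \<and> real n powr (1 / d) \<le> real n * (r n)\<^sup>2
          \<and> real n * (lam n)\<^sup>2 = (real n * (r n)\<^sup>2) powr (1 + 2 * \<alpha>)"
        using nl[OF n] nrge[OF n] by (simp add: lam_exp[OF n] r_exp[OF n])
      show "(\<Sum>j\<in>F. \<bar>inner w0 (\<psi> j) / prior_sd \<alpha> (lam n) j\<bar> powr p) \<le> (Sb + 4) * (real n * (r n)\<^sup>2)"
        if F: "finite F" "F \<subseteq> {1..} \<inter> {..n^3}" for F
        unfolding lpH[OF n, symmetric]
        by (rule ratio_sum_bound_gt[OF _ c(1) _ c(2) Sb(1) Sb(2) _ n3(1)[OF n]])
          (use F p lam_exp[OF n] in auto)
      show "(\<Sum>j\<in>F. real n * (inner w0 (\<psi> j))\<^sup>2) \<le> (Sb + 4) * (real n * (r n)\<^sup>2)"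
        if F: "finite F" "F \<subseteq> {1..} - {..n^3}" for F
      proof -
        have "(\<Sum>j\<in>F. real n * (inner w0 (\<psi> j))\<^sup>2) \<le> 1"
          by (rule besov_tail[OF q qb Sb(1) n3(3)[OF n] n3(2)[OF n] Sb(2)]) (use F in auto)
        also have "\<dots> \<le> (Sb + 4) * (real n * (r n)\<^sup>2)"
          using Sb(1) nr1[OF n] mult_mono[of 1 "Sb + 4" 1 "real n * (r n)\<^sup>2"] by simp
        finally show ?thesis .
      qed
      show "real n * (inner w0 (\<psi> j))\<^sup>2 \<le> 1" if j: "1 \<le> j" "j \<notin> {..n^3}" for j
      proof -
        have "(\<Sum>j\<in>{j}. real n * (inner w0 (\<psi> j))\<^sup>2) \<le> 1"
          by (rule besov_tail[OF q qb Sb(1) n3(3)[OF n] n3(2)[OF n] Sb(2)]) (use j in auto)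
        then show ?thesis by simp
      qed
    qed
  qed
qed

end
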